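(* (Scaling formula) For any $s>0$ and all $n,m\in\mathbb{Z}$, $$W_{n,m}[B^s,\sigma^s,\mu^s,\omega]=W_{n,m}[B,\sigma,\mu,s\omega],$$ where $B^s=sB$, $\sigma^s=\sigma(s^{-1}\,\cdot)$, $\mu^s=\mu(s^{-1}\,\cdot)$.
   Context: $\omega>0$ is a frequency; $(|x|,\theta_x)$ are polar coordinates of $x\in\mathbb{R}^2$. $\sigma,\mu$ are positive functions on $\mathbb{R}^2$ such that $\frac1\sigma$ and $\mu$ are bounded and measurable, $0<\lambda_1\le\frac1\sigma\le\lambda_2$ and $0<\lambda_3\le\mu\le\lambda_4$ for constants $\lambda_j$, and $\frac1\sigma-1$, $\mu-1$ are compactly supported. $B\subset\mathbb{R}^2$ is a bounded domain with Lipschitz boundary, containing the origin, with $\operatorname{supp}(\frac1\sigma-1)\subset B$ and $\operatorname{supp}(\mu-1)\subset B$; $\nu$ is the outward unit normal on $\partial B$. Definition of the scattering coefficients of $(B,\sigma,\mu)$ at a frequency $k>0$ such that $k^2$ is not a Neumann eigenvalue of $-\frac1\mu\nabla\cdot\frac1\sigma\nabla$ on $B$ and not a Dirichlet eigenvalue of $-\Delta$ on $B$: put $\Gamma_k(x)=-\frac i4H_0^{(1)}(k|x|)$; $S^k_B[\phi](x)=\int_{\partial B}\Gamma_k(x-y)\phi(y)\,dS_y$; $(K^k_B)^*[\phi](x)=\int_{\partial B}\frac{\partial\Gamma_k}{\partial\nu_x}(x-y)\phi(y)\,dS_y$ for $x\in\partial B$ (principal value). $\Lambda_{\sigma,\mu,k}[g]=w|_{\partial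 B}$, where $w$ solves $\nabla\cdot\frac1\sigma\nabla w+k^2\mu w=0$ in $B$, $\frac1\sigma\frac{\partial w}{\partial\nu}=g$ on $\partial B$. The operator $$\mathcal{A}=\begin{bmatrix}-S^k_B & \Lambda_{\sigma,\mu,k}\\ -\left(\frac12I+(K^k_B)^*\right) & I\end{bmatrix}:L^2(\partial B)\times L^2(\partial B)\to H^1(\partial B)\times L^2(\partial B)$$ is invertible. With $\mathcal{C}_{m,k}(x)=J_m(k|x|)e^{im\theta_x}$ ($J_m$ Bessel functions), let $(\phi_{m,k},\psi_{m,k})$ be the solution of $\mathcal{A}(\phi_{m,k},\psi_{m,k})^T=(\mathcal{C}_{m,k},\frac{\partial\mathcal{C}_{m,k}}{\partial\nu})^T$ on $\partial B$. Then $W_{n,m}[B,\sigma,\mu,k]=\int_{\partial B}\overline{\mathcal{C}_{n,k}(y)}\,\phi_{m,k}(y)\,dS_y$, $n,m\in\mathbb{Z}$. The coefficients of $(B^s,\sigma^s,\mu^s)$ are defined by the same formulas with $B,\sigma,\mu$ replaced by $B^s,\sigma^s,\mu^s$. Standing assumption: the non-eigenvalue conditions hold for $(B^s,\sigma^s,\mu^s)$ at frequency $\omega$ (equivalently for $(B,\sigma,\mu)$ at frequency $s\omega$). *)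

theory Defs
  imports "HOL-Analysis.Analysis"
begin

section \<open>Special functions\<close>

text \<open>Power series of \<open>J\<^sub>n\<close>; for negative integers \<open>J\<^sub>-\<^sub>n = (-1)\<^sup>n J\<^sub>n\<close>.\<close>

definition bessel_J :: "int \<Rightarrow> real \<Rightarrow> real" where
  "bessel_J m t =
     (if m < 0 then (-1) ^ nat \<bar>m\<bar> else 1) *
     (\<Sum>j. (-1) ^ j / (fact j * fact (j + nat \<bar>m\<bar>)) * (t / 2) ^ (2 * j + nat \<bar>m\<bar>))"

definition bessel_Y0 :: "real \<Rightarrow> real" where
  "bessel_Y0 t =
     2 / pi * ((ln (t / 2) + euler_mascheroni) * bessel_J 0 t
       + (\<Sum>j. (-1) ^ j * harm (Suc j) * (t / 2) ^ (2 * Suc j) / (fact (Suc j))\<^sup>2))"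

definition hankel1_0 :: "real \<Rightarrow> complex" where
  "hankel1_0 t = Complex (bessel_J 0 t) (bessel_Y0 t)"

definition fund_sol :: "real \<Rightarrow> real^2 \<Rightarrow> complex" where
  "fund_sol k x = - (\<i> / 4) * hankel1_0 (k * norm x)"

definition polar_angle :: "real^2 \<Rightarrow> real" where
  "polar_angle x = Arg (Complex (x $ 1) (x $ 2))"

definition cyl_wave :: "int \<Rightarrow> real \<Rightarrow> real^2 \<Rightarrow> complex" where
  "cyl_wave m k x = of_real (bessel_J m (k * norm x)) * cis (of_int m * polar_angle x)"


section \<open>Boundary geometry\<close>

text \<open>One-dimensional Hausdorff measure, normalised so that it is arc length on rectifiable
  curves; it serves as the surface measure. The outer measure is a metric outer measure, hence
  countably additive on the Borel sets, so \<^const>\<open>measure_of\<close> does not degenerate.\<close>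

definition hausdorff1_outer :: "(real^2) set \<Rightarrow> ennreal" where
  "hausdorff1_outer A =
     (SUP \<delta>\<in>{0<..}. INF U\<in>{U :: nat \<Rightarrow> (real^2) set.
          A \<subseteq> (\<Union>i. U i) \<and> (\<forall>i. bounded (U i) \<and> diameter (U i) \<le> \<delta>)}.
        (\<Sum>i. ennreal (diameter (U i))))"

definition hausdorff1 :: "(real^2) measure" where
  "hausdorff1 = measure_of UNIV (sets borel) hausdorff1_outer"

definition boundary_measure :: "(real^2) set \<Rightarrow> (real^2) measure" where
  "boundary_measure B = restrict_space hausdorff1 (frontier B)"

text \<open>Every boundary point \<open>p\<close> has a cylinder, in suitable orthonormal coordinates
  \<open>(e, f)\<close> centred at \<open>p\<close>, in which \<open>B\<close> is the set above the graph of a Lipschitz function.\<close>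

definition lipschitz_boundary :: "(real^2) set \<Rightarrow> bool" where
  "lipschitz_boundary B \<longleftrightarrow>
     (\<forall>p\<in>frontier B. \<exists>e f. \<exists>r>0. \<exists>h>0. \<exists>L \<gamma>.
        norm e = 1 \<and> norm f = 1 \<and> e \<bullet> f = 0 \<and> L-lipschitz_on (UNIV :: real set) \<gamma> \<and>
        (\<forall>a b. \<bar>a\<bar> < r \<and> \<bar>b\<bar> < h \<longrightarrow>
           (p + a *\<^sub>R e + b *\<^sub>R f \<in> B \<longleftrightarrow> b > (\<gamma> a :: real))))"

text \<open>\<open>n\<close> is the outward unit normal at \<open>x\<close> if \<open>B\<close> is tangent at \<open>x\<close> to the half plane
  \<open>(y - x) \<bullet> n < 0\<close>. Such an \<open>n\<close> is unique; on a Lipschitz boundary it exists exactly where the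
  local graph function is differentiable, thus almost everywhere.\<close>

definition is_outward_normal :: "(real^2) set \<Rightarrow> real^2 \<Rightarrow> real^2 \<Rightarrow> bool" where
  "is_outward_normal B x n \<longleftrightarrow> norm n = 1 \<and>
     (\<forall>\<epsilon>>0. \<exists>\<delta>>0. \<forall>y. norm (y - x) < \<delta> \<longrightarrow>
        ((y - x) \<bullet> n < - \<epsilon> * norm (y - x) \<longrightarrow> y \<in> B) \<and>
        ((y - x) \<bullet> n > \<epsilon> * norm (y - x) \<longrightarrow> y \<notin> B))"

definition outward_normal :: "(real^2) set \<Rightarrow> real^2 \<Rightarrow> real^2" where
  "outward_normal B x = (if \<exists>n. is_outward_normal B x n then THE n. is_outward_normal B x n else 0)"

definition normal_deriv :: "(real^2) set \<Rightarrow> (real^2 \<Rightarrow> complex) \<Rightarrow> real^2 \<Rightarrow> complex" where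
  "normal_deriv B u x = frechet_derivative u (at x) (outward_normal B x)"


section \<open>Function spaces\<close>

definition L2 :: "'a measure \<Rightarrow> ('a \<Rightarrow> 'b::{real_normed_vector,second_countable_topology}) \<Rightarrow> bool"
  where "L2 M f \<longleftrightarrow> f \<in> borel_measurable M \<and> integrable M (\<lambda>x. (norm (f x))\<^sup>2)"

definition L2_norm :: "'a measure \<Rightarrow> ('a \<Rightarrow> 'b::real_normed_vector) \<Rightarrow> real" where
  "L2_norm M f = sqrt (LINT x|M. (norm (f x))\<^sup>2)"

fun C_n :: "nat \<Rightarrow> (real^2 \<Rightarrow> complex) \<Rightarrow> bool" where
  "C_n 0 f \<longleftrightarrow> continuous_on UNIV f"
| "C_n (Suc n) f \<longleftrightarrow> (\<forall>x. f differentiable at x) \<and>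
     (\<forall>v. C_n n (\<lambda>x. frechet_derivative f (at x) v))"

definition C_infinity :: "(real^2 \<Rightarrow> complex) \<Rightarrow> bool" where
  "C_infinity f \<longleftrightarrow> (\<forall>n. C_n n f)"

definition supp :: "(real^2 \<Rightarrow> 'b::zero) \<Rightarrow> (real^2) set" where
  "supp f = closure {x. f x \<noteq> 0}"

definition test_function :: "(real^2) set \<Rightarrow> (real^2 \<Rightarrow> complex) \<Rightarrow> bool" where
  "test_function B v \<longleftrightarrow> C_infinity v \<and> compact (supp v) \<and> supp v \<subseteq> B"

definition grad :: "(real^2 \<Rightarrow> complex) \<Rightarrow> real^2 \<Rightarrow> complex^2" where
  "grad v x = (\<chi> j. frechet_derivative v (at x) (axis j 1))"

definition weak_gradient ::
  "(real^2) set \<Rightarrow> (real^2 \<Rightarrow> complex) \<Rightarrow> (real^2 \<Rightarrow> complex^2) \<Rightarrow> bool" where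
  "weak_gradient B w G \<longleftrightarrow>
     (\<forall>v j. test_function B v \<longrightarrow>
        (LINT x|lebesgue_on B. w x * grad v x $ j) = - (LINT x|lebesgue_on B. G x $ j * v x))"

text \<open>\<open>H1 B w G\<close>: \<open>w\<close> lies in \<open>H\<^sup>1(B)\<close> and \<open>G\<close> is (a representative of) its weak gradient.\<close>

definition H1 :: "(real^2) set \<Rightarrow> (real^2 \<Rightarrow> complex) \<Rightarrow> (real^2 \<Rightarrow> complex^2) \<Rightarrow> bool" where
  "H1 B w G \<longleftrightarrow> L2 (lebesgue_on B) w \<and> L2 (lebesgue_on B) G \<and> weak_gradient B w G"

definition H1_limit ::
  "(real^2) set \<Rightarrow> (nat \<Rightarrow> real^2 \<Rightarrow> complex) \<Rightarrow> (real^2 \<Rightarrow> complex) \<Rightarrow> (real^2 \<Rightarrow> complex^2) \<Rightarrow> bool"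
  where
  "H1_limit B v w G \<longleftrightarrow>
     (\<lambda>j. L2_norm (lebesgue_on B) (\<lambda>x. v j x - w x)) \<longlonglongrightarrow> 0 \<and>
     (\<lambda>j. L2_norm (lebesgue_on B) (\<lambda>x. grad (v j) x - G x)) \<longlonglongrightarrow> 0"

definition H1_zero :: "(real^2) set \<Rightarrow> (real^2 \<Rightarrow> complex) \<Rightarrow> (real^2 \<Rightarrow> complex^2) \<Rightarrow> bool" where
  "H1_zero B w G \<longleftrightarrow> H1 B w G \<and> (\<exists>v. (\<forall>j. test_function B (v j)) \<and> H1_limit B v w G)"

text \<open>Graph of the trace operator \<open>H\<^sup>1(B) \<rightarrow> L\<^sup>2(\<partial>B)\<close>, the continuous extension of the restriction
  of smooth functions. It is a graph, and not a function, because elements of \<open>L\<^sup>2(\<partial>B)\<close>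
  are determined only up to null sets; the same applies to \<open>NtD\<close> below.\<close>

definition sobolev_trace :: "(real^2) set \<Rightarrow> (real^2 \<Rightarrow> complex) \<Rightarrow> (real^2 \<Rightarrow> complex^2) \<Rightarrow>
    (real^2 \<Rightarrow> complex) \<Rightarrow> bool" where
  "sobolev_trace B w G u \<longleftrightarrow> H1 B w G \<and> L2 (boundary_measure B) u \<and>
     (\<exists>v. (\<forall>j. C_infinity (v j)) \<and> H1_limit B v w G \<and>
        (\<lambda>j. L2_norm (boundary_measure B) (\<lambda>x. v j x - u x)) \<longlonglongrightarrow> 0)"


section \<open>Boundary value problems\<close>

text \<open>\<open>\<integral>\<^sub>B a \<nabla>w \<cdot> \<nabla>v\<^sup>* - \<lambda> b w v\<^sup>*\<close>, with \<open>\<^sup>*\<close> denoting complex conjugation.\<close>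

definition energy_form ::
  "(real^2) set \<Rightarrow> (real^2 \<Rightarrow> real) \<Rightarrow> (real^2 \<Rightarrow> real) \<Rightarrow> real \<Rightarrow>
   (real^2 \<Rightarrow> complex) \<Rightarrow> (real^2 \<Rightarrow> complex^2) \<Rightarrow>
   (real^2 \<Rightarrow> complex) \<Rightarrow> (real^2 \<Rightarrow> complex^2) \<Rightarrow> complex" where
  "energy_form B a b lam w G v H =
     (LINT x|lebesgue_on B.
        a x *\<^sub>R (\<Sum>j\<in>UNIV. G x $ j * cnj (H x $ j)) - (lam * b x) *\<^sub>R (w x * cnj (v x)))"

text \<open>Weak formulation of \<open>\<nabla>\<cdot>(1/\<sigma>)\<nabla>w + \<lambda> \<mu> w = 0\<close> in \<open>B\<close>, \<open>(1/\<sigma>) \<partial>w/\<partial>\<nu> = g\<close> on \<open>\<partial>B\<close>.\<close>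

definition neumann_solution ::
  "(real^2) set \<Rightarrow> (real^2 \<Rightarrow> real) \<Rightarrow> (real^2 \<Rightarrow> real) \<Rightarrow> real \<Rightarrow> (real^2 \<Rightarrow> complex) \<Rightarrow>
   (real^2 \<Rightarrow> complex) \<Rightarrow> (real^2 \<Rightarrow> complex^2) \<Rightarrow> bool" where
  "neumann_solution B \<sigma> \<mu> lam g w G \<longleftrightarrow> H1 B w G \<and>
     (\<forall>v H u. sobolev_trace B v H u \<longrightarrow>
        energy_form B (\<lambda>x. 1 / \<sigma> x) \<mu> lam w G v H
          = (LINT x|boundary_measure B. g x * cnj (u x)))"

definition neumann_eigenvalue ::
  "(real^2) set \<Rightarrow> (real^2 \<Rightarrow> real) \<Rightarrow> (real^2 \<Rightarrow> real) \<Rightarrow> real \<Rightarrow> bool" where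
  "neumann_eigenvalue B \<sigma> \<mu> lam \<longleftrightarrow>
     (\<exists>w G. neumann_solution B \<sigma> \<mu> lam (\<lambda>x. 0) w G \<and> \<not> (AE x in lebesgue_on B. w x = 0))"

definition dirichlet_eigenvalue :: "(real^2) set \<Rightarrow> real \<Rightarrow> bool" where
  "dirichlet_eigenvalue B lam \<longleftrightarrow>
     (\<exists>w G. H1_zero B w G \<and> \<not> (AE x in lebesgue_on B. w x = 0) \<and>
        (\<forall>v H. H1_zero B v H \<longrightarrow> energy_form B (\<lambda>x. 1) (\<lambda>x. 1) lam w G v H = 0))"

text \<open>Graph of the Neumann-to-Dirichlet operator \<open>\<Lambda>\<^bsub>\<sigma>,\<mu>,k\<^esub>\<close>.\<close>

definition NtD :: "(real^2) set \<Rightarrow> (real^2 \<Rightarrow> real) \<Rightarrow> (real^2 \<Rightarrow> real) \<Rightarrow> real \<Rightarrow>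
    (real^2 \<Rightarrow> complex) \<Rightarrow> (real^2 \<Rightarrow> complex) \<Rightarrow> bool" where
  "NtD B \<sigma> \<mu> k g u \<longleftrightarrow> L2 (boundary_measure B) g \<and>
     (\<exists>w G. neumann_solution B \<sigma> \<mu> (k\<^sup>2) g w G \<and> sobolev_trace B w G u)"


section \<open>Layer potentials and scattering coefficients\<close>

definition single_layer :: "(real^2) set \<Rightarrow> real \<Rightarrow> (real^2 \<Rightarrow> complex) \<Rightarrow> real^2 \<Rightarrow> complex" where
  "single_layer B k \<phi> x = (LINT y|boundary_measure B. fund_sol k (x - y) * \<phi> y)"

definition neumann_poincare_adj ::
  "(real^2) set \<Rightarrow> real \<Rightarrow> (real^2 \<Rightarrow> complex) \<Rightarrow> real^2 \<Rightarrow> complex" where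
  "neumann_poincare_adj B k \<phi> x =
     Lim (at_right 0) (\<lambda>\<epsilon>. LINT y|boundary_measure B.
        indicator {y. norm (x - y) > \<epsilon>} y *\<^sub>R (normal_deriv B (\<lambda>z. fund_sol k (z - y)) x * \<phi> y))"

text \<open>Graph of the operator \<open>\<A>\<close> on \<open>L\<^sup>2(\<partial>B) \<times> L\<^sup>2(\<partial>B)\<close>.\<close>

definition transmission_op ::
  "(real^2) set \<Rightarrow> (real^2 \<Rightarrow> real) \<Rightarrow> (real^2 \<Rightarrow> real) \<Rightarrow> real \<Rightarrow>
   (real^2 \<Rightarrow> complex) \<Rightarrow> (real^2 \<Rightarrow> complex) \<Rightarrow> (real^2 \<Rightarrow> complex) \<Rightarrow> (real^2 \<Rightarrow> complex) \<Rightarrow> bool"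
  where
  "transmission_op B \<sigma> \<mu> k \<phi> \<psi> f g \<longleftrightarrow>
     L2 (boundary_measure B) \<phi> \<and> L2 (boundary_measure B) \<psi> \<and>
     (\<exists>u. NtD B \<sigma> \<mu> k \<psi> u \<and>
        (AE x in boundary_measure B. f x = - single_layer B k \<phi> x + u x)) \<and>
     (AE x in boundary_measure B. g x = - (\<phi> x / 2 + neumann_poincare_adj B k \<phi> x) + \<psi> x)"

definition scattering_densities ::
  "(real^2) set \<Rightarrow> (real^2 \<Rightarrow> real) \<Rightarrow> (real^2 \<Rightarrow> real) \<Rightarrow> real \<Rightarrow> int \<Rightarrow>
   (real^2 \<Rightarrow> complex) \<Rightarrow> (real^2 \<Rightarrow> complex) \<Rightarrow> bool" where
  "scattering_densities B \<sigma> \<mu> k m \<phi> \<psi> \<longleftrightarrow>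
     transmission_op B \<sigma> \<mu> k \<phi> \<psi> (cyl_wave m k) (normal_deriv B (cyl_wave m k))"

text \<open>The densities are determined up to null sets when \<open>\<A>\<close> is invertible, so the integral
  does not depend on the representative.\<close>

definition scattering_coeff ::
  "int \<Rightarrow> int \<Rightarrow> (real^2) set \<Rightarrow> (real^2 \<Rightarrow> real) \<Rightarrow> (real^2 \<Rightarrow> real) \<Rightarrow> real \<Rightarrow> complex" where
  "scattering_coeff n m B \<sigma> \<mu> k =
     (THE c. \<exists>\<phi> \<psi>. scattering_densities B \<sigma> \<mu> k m \<phi> \<psi> \<and>
        c = (LINT y|boundary_measure B. cnj (cyl_wave n k y) * \<phi> y))"

end

theory Submission
  imports Defs
begin

text \<open>The substitution \<open>x = s y\<close> carries every object on \<open>s B\<close> to the corresponding object on \<open>B\<close>. Arc length is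
multiplied by \<open>s\<close>, area by \<open>s\<^sup>2\<close>, gradients and normal derivatives by \<open>1 / s\<close>, and the fundamental solution and
the cylindrical waves depend on frequency and position only through their product. A pair \<open>(\<phi>, \<psi>)\<close> of
densities for \<open>s B\<close> at frequency \<open>k\<close> therefore corresponds to the pair \<open>(s \<phi>(s y), s \<psi>(s y))\<close> for \<open>B\<close> at frequency
\<open>s k\<close>, and both pairs give the same number. Applying this to \<open>s\<close> and to \<open>1 / s\<close> shows that the two coefficients are
definite descriptions of the same property (\<open>scattering_pairing_dilate\<close>).

One step is not a change of variables. The principal value in the adjoint Neumann-Poincare operator is a limit
operator that returns an unspecified value where no limit exists, and the factor \<open>1 / s\<close> can be moved
through it only where the limit does exist. The limit has to be shown to exist almost everywhere on the boundary,
for every square integrable density (\<open>neumann_poincare_limit_exists\<close>). For a Lipschitz boundary this is the theorem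
of Coifman, McIntosh and Meyer on the Cauchy integral. It occupies most of the text, and the argument goes as follows.

\<^item> The Cauchy integral \<open>F\<close> at height \<open>eta\<close> above a Lipschitz graph is bounded on \<open>L\<^sup>2\<close> uniformly in \<open>eta\<close>
 (\<open>F_L2\<close>). Following Coifman, Jones and Semmes, a step function is expanded in a Haar system adapted to the
 measure \<open>dz\<close> on the curve. Each element of the system annihilates affine functions of \<open>z\<close>, so that
 the matrix of the Cauchy kernel is almost diagonal and Schur's test applies (\<open>discrete_bound\<close>). The coefficients
 are controlled by a square function estimate with a Bellman function (\<open>bellman_step\<close>, \<open>square_function\<close>).

\<^item> The Cauchy integral at height \<open>eta + delta\<close> is an average of the one at height \<open>eta\<close> against a kernel of Poisson
 type (\<open>F_reproduce\<close>). The maximal theorem of Hardy and Littlewood then bounds the supremum over all heights, and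
 by comparison the supremum over all truncations (\<open>PV_maximal\<close>).

\<^item> For step functions times \<open>dz/dt\<close> the truncated integrals are differences of logarithms, which converge wherever
 the graph has a tangent. The maximal estimate extends this to \<open>L\<^sup>2\<close> (\<open>PV_exists_ae\<close>).

\<^item> In a boundary chart, one-dimensional Hausdorff measure has a bounded density with respect to the parameter
 (\<open>bounded_density\<close>, \<open>patch_density\<close>), and a point with an outward normal is a point where the graph is differentiable
 (\<open>normal_differentiable\<close>). A finite cover by charts gives \<open>frontier_principal_value\<close>. The normal derivative of the
 fundamental solution differs from \<open>(x - y) \<bullet> \<nu> / (2 \<pi> |x - y|\<^sup>2)\<close> by a bounded kernel.\<close>

text \<open>Short names for facts on the Lebesgue integral whose base names also denote facts on the gauge integral.\<close>
lemmas lint_add = Bochner_Integration.integral_add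
 and lint_diff = Bochner_Integration.integral_diff
 and lint_sum = Bochner_Integration.integral_sum
 and lint_cong = Bochner_Integration.integral_cong
 and lint_norm_bound = Bochner_Integration.integral_norm_bound_integral
 and integrable_dominated = Bochner_Integration.integrable_bound
 and lint_cnj = Bochner_Integration.integral_cnj

section \<open>Second differences on a Lipschitz graph\<close>

text \<open>Row and column sums of the interaction matrix reduce to these sums; the exponent only has to exceed 1.\<close>
lemma lattice_sum_bound:
 "\<exists>C>0. \<forall>(y::real) n. (\<Sum>i<n. (1 + \<bar>y - real i\<bar>) powr (-3/2)) <= C"
proof -
 define f :: "nat => real" where "f = (%n. (1 + real n) powr (-3/2))"
 have fs: "summable f"
 proof -
  have "summable (%n. real n powr (-3/2))"
   by (simp add: summable_real_powr_iff)
  hence "summable (%n. real (Suc n) powr (-3/2))"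
   by (rule summable_ignore_initial_segment[of _ 1, simplified])
  thus ?thesis unfolding f_def by (simp add: add.commute)
 qed
 have f0: "f n >= 0" for n unfolding f_def by simp
 define S where "S = suminf f"
 have fin: "sum f T <= S" if "finite T" for T
  unfolding S_def by (rule sum_le_suminf[OF fs that]) (simp add: f0)
 have S0: "S >= 0" using fin[of "{}"] by simp
 have main: "(\<Sum>i<n. (1 + \<bar>y - real i\<bar>) powr (-3/2)) <= 2 powr (3/2) * (2 * S)" for y :: real and n
 proof -
  define m where "m = nat \<lfloor>y\<rfloor>"
  have 1: "(1 + \<bar>y - real i\<bar>) powr (-3/2) <= 2 powr (3/2) * f (nat \<bar>int m - int i\<bar>)" for i
  proof -
   have bd: "\<bar>real m - real i\<bar> <= 1 + \<bar>y - real i\<bar>"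
   proof (cases "y >= 0")
    case True
    hence "real m <= y" "y < real m + 1" unfolding m_def by linarith+
    thus ?thesis by linarith
   next
    case False
    hence "m = 0" unfolding m_def by simp
    thus ?thesis using False by simp
   qed
   hence *: "(1 + \<bar>real m - real i\<bar>) / 2 <= 1 + \<bar>y - real i\<bar>" proof -
    have "(1 + p) / 2 <= 1 + q" if "p <= 1 + q" "0 <= q" for p q :: real using that by simp
    from this[OF bd] show ?thesis by simp
   qed
   have "(1 + \<bar>y - real i\<bar>) powr (-3/2) <= ((1 + \<bar>real m - real i\<bar>) / 2) powr (-3/2)"
    by (rule powr_mono2') (use * in auto)
   also have "... = 2 powr (3/2) * (1 + \<bar>real m - real i\<bar>) powr (-3/2)"
    by (simp add: powr_divide powr_minus divide_simps)
   also have "\<bar>real m - real i\<bar> = real (nat \<bar>int m - int i\<bar>)" by simp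
   finally show ?thesis unfolding f_def by simp
  qed
  have "(\<Sum>i<n. f (nat \<bar>int m - int i\<bar>)) <= (\<Sum>i\<in>{..<n} \<inter> {..m}. f (nat \<bar>int m - int i\<bar>)) + (\<Sum>i\<in>{..<n} - {..m}. f (nat \<bar>int m - int i\<bar>))"
   by (subst sum.Int_Diff[of _ _ "{..m}"]) auto
  also have "(\<Sum>i\<in>{..<n} \<inter> {..m}. f (nat \<bar>int m - int i\<bar>)) = sum f ((%i. nat \<bar>int m - int i\<bar>) ` ({..<n} \<inter> {..m}))"
   by (subst sum.reindex) (auto simp: inj_on_def)
  also have "... <= S" by (rule fin) auto
  also have "(\<Sum>i\<in>{..<n} - {..m}. f (nat \<bar>int m - int i\<bar>)) = sum f ((%i. nat \<bar>int m - int i\<bar>) ` ({..<n} - {..m}))"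
   by (subst sum.reindex) (auto simp: inj_on_def)
  also have "... <= S" by (rule fin) auto
  finally have 2: "(\<Sum>i<n. f (nat \<bar>int m - int i\<bar>)) <= 2 * S" by simp
  have "(\<Sum>i<n. (1 + \<bar>y - real i\<bar>) powr (-3/2)) <= (\<Sum>i<n. 2 powr (3/2) * f (nat \<bar>int m - int i\<bar>))"
   by (rule sum_mono) (rule 1)
  also have "... <= 2 powr (3/2) * (2 * S)"
   unfolding sum_distrib_left[symmetric] by (rule mult_left_mono[OF 2]) simp
  finally show ?thesis .
 qed
 show ?thesis
 proof (intro exI[of _ "2 powr (3/2) * (2 * S) + 1"] conjI allI)
  show "(\<Sum>i<n. (1 + \<bar>y - real i\<bar>) powr (-3/2)) <= 2 powr (3/2) * (2 * S) + 1" for y :: real and n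
   using main[where y = y and n = n] by linarith
  have "0 <= 2 powr (3/2) * (2 * S)" using S0 by (intro mult_nonneg_nonneg) auto
  thus "0 < 2 powr (3/2) * (2 * S) + 1" by linarith
 qed
qed

text \<open>Expand at \<open>u1\<close>, which is the affine combination of \<open>u0\<close> and \<open>u2\<close> with the complex weight \<open>rho\<close>; the first
order terms cancel.\<close>
lemma complex_taylor_second_difference:
 fixes phi phi' phi'' :: "complex => complex"
 assumes S: "convex S"
  and d1: "!!u. u \<in> S ==> (phi has_field_derivative phi' u) (at u)"
  and d2: "!!u. u \<in> S ==> (phi' has_field_derivative phi'' u) (at u)"
  and M: "!!u. u \<in> S ==> norm (phi'' u) <= M"
  and u: "u0 \<in> S" "u1 \<in> S" "u2 \<in> S" and u1: "u1 = rho * u0 + (1 - rho) * u2"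
 shows "norm (phi u1 - rho * phi u0 - (1 - rho) * phi u2)
  <= M * (norm rho * norm (u0 - u1)^2 + norm (1 - rho) * norm (u2 - u1)^2)"
proof -
 have T: "norm (phi u - (phi u1 + phi' u1 * (u - u1))) <= M * norm (u - u1)^2" if "u \<in> S" for u
 proof -
  let ?f = "%i::nat. if i = 0 then phi else if i = 1 then phi' else phi''"
  have "norm (?f 0 u - (\<Sum>i\<le>1. ?f i u1 * (u - u1)^i / fact i)) <= M * norm (u - u1)^(Suc 1) / fact 1"
  proof (rule field_Taylor[OF S])
   fix i :: nat and x assume "x \<in> S" "i <= 1"
   thus "(?f i has_field_derivative ?f (Suc i) x) (at x within S)"
    using d1[of x] d2[of x] by (cases "i = 0") (auto intro: has_field_derivative_at_within)
  qed (use M u that in auto)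
  thus ?thesis by (simp add: power2_eq_square)
 qed
 let ?R = "%u. phi u - (phi u1 + phi' u1 * (u - u1))"
 have "phi u1 - rho * phi u0 - (1 - rho) * phi u2 = - (rho * ?R u0) - (1 - rho) * ?R u2 - phi' u1 * (rho * u0 + (1 - rho) * u2 - u1)"
  by (simp add: algebra_simps)
 also have "... = - (rho * ?R u0) - (1 - rho) * ?R u2" using u1 by simp
 also have "norm ... <= norm rho * norm (?R u0) + norm (1 - rho) * norm (?R u2)"
  using norm_triangle_ineq4[of "- (rho * ?R u0)" "(1 - rho) * ?R u2"] by (simp add: norm_mult)
 also have "... <= norm rho * (M * norm (u0 - u1)^2) + norm (1 - rho) * (M * norm (u2 - u1)^2)"
  by (intro add_mono mult_left_mono T u) auto
 finally show ?thesis by (simp add: algebra_simps)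
qed

text \<open>A second primitive of the inverse function: its first derivative is the branch \<open>Ln (- \<i> u)\<close>, which is holomorphic
off the negative imaginary axis. Mixed differences of \<open>cl\<close> are double integrals of the Cauchy kernel.\<close>
definition cl :: "complex => complex" where "cl u = u * Ln (- \<i> * u) - u"

lemma cl_deriv:
 assumes "- \<i> * u \<notin> \<real>\<^sub>\<le>\<^sub>0"
 shows "(cl has_field_derivative Ln (- \<i> * u)) (at u)"
  "((%u. Ln (- \<i> * u)) has_field_derivative inverse u) (at u)"
  "((%u. inverse u) has_field_derivative - inverse (u^2)) (at u)"
  "((%u. - inverse (u^2)) has_field_derivative 2 * inverse (u^3)) (at u)"
proof -
 have u0: "u ~= 0" using assms by auto
 have u1: "\<i> * u \<notin> \<real>\<^sub>\<ge>\<^sub>0" using assms by simp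
 show 1: "((%u. Ln (- \<i> * u)) has_field_derivative inverse u) (at u)"
 proof -
  have "((%u. Ln (- \<i> * u)) has_field_derivative inverse (- \<i> * u) * (- \<i>)) (at u)"
   by (rule DERIV_chain2[where f = Ln and g = "%u. - \<i> * u", OF has_field_derivative_Ln[OF assms]]) (auto intro!: derivative_eq_intros)
  moreover have "inverse (- \<i> * u) * (- \<i>) = inverse u" using u0 by (simp add: field_simps)
  ultimately show ?thesis by simp
 qed
 show "(cl has_field_derivative Ln (- \<i> * u)) (at u)"
 proof -
  have "((%u. u * Ln (- \<i> * u) - u) has_field_derivative (1 * Ln (- \<i> * u) + inverse u * u - 1)) (at u)"
   by (intro DERIV_diff DERIV_mult DERIV_ident 1)
  thus ?thesis unfolding cl_def[abs_def] using u0 by simp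
 qed
 show "((%u. inverse u) has_field_derivative - inverse (u^2)) (at u)"
  using u0 by (auto intro!: derivative_eq_intros simp: field_simps power2_eq_square)
 show "((%u. - inverse (u^2)) has_field_derivative 2 * inverse (u^3)) (at u)"
  using u0 by (auto intro!: derivative_eq_intros simp: field_simps power2_eq_square power3_eq_cube)
qed

text \<open>Three half planes, to the right, to the left and above, avoid the branch cut and stay at distance \<open>rho\<close> from the
singularity. In each of them Taylor's formula can be applied to \<open>cl\<close>.\<close>
lemma half_plane_cl:
 assumes "\<omega> \<in> {1, -1, -\<i>}" "rho > 0"
 shows "convex {u. rho <= Re (\<omega> * u)}"
  and "u \<in> {u. rho <= Re (\<omega> * u)} ==> - \<i> * u \<notin> \<real>\<^sub>\<le>\<^sub>0"
  and "u \<in> {u. rho <= Re (\<omega> * u)} ==> norm u >= rho"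
proof -
 have "{u. rho <= Re (\<omega> * u)} = {u. inner (cnj \<omega>) u >= rho}"
  by (auto simp: inner_complex_def)
 thus "convex {u. rho <= Re (\<omega> * u)}" by (simp add: convex_halfspace_ge)
 show "u \<in> {u. rho <= Re (\<omega> * u)} ==> - \<i> * u \<notin> \<real>\<^sub>\<le>\<^sub>0"
  using assms by (auto simp: complex_nonpos_Reals_iff)
 show "norm u >= rho" if "u \<in> {u. rho <= Re (\<omega> * u)}"
 proof -
  have "rho <= norm (\<omega> * u)" using that complex_Re_le_cmod[of "\<omega> * u"] by simp
  also have "... = norm u" using assms by (auto simp: norm_mult)
  finally show ?thesis .
 qed
qed

lemma norm_times_Ln_bound:
 assumes "v ~= 0" "norm v <= R"
 shows "norm (v * Ln v) <= R^2 + 1 + pi * R"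
proof -
 have R0: "R >= 0" "norm v > 0" using assms order_trans[OF norm_ge_zero assms(2)] by auto
 have "norm (Ln v) <= \<bar>ln (norm v)\<bar> + pi"
  using cmod_le[of "Ln v"] assms mpi_less_Im_Ln[of v] Im_Ln_le_pi[of v] by simp
 hence "norm v * norm (Ln v) <= norm v * \<bar>ln (norm v)\<bar> + norm v * pi"
  using R0 by (simp add: ring_distribs(1)[symmetric])
 moreover have "norm v * \<bar>ln (norm v)\<bar> <= (norm v)^2 + 1"
 proof (cases "norm v >= 1")
  case True
  hence "\<bar>ln (norm v)\<bar> <= norm v" using ln_bound[of "norm v"] R0 by simp
  hence "norm v * \<bar>ln (norm v)\<bar> <= norm v * norm v" by (rule mult_left_mono) simp
  thus ?thesis by (simp add: power2_eq_square)
 next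
  case False
  have "ln (1 / norm v) <= 1 / norm v" using R0 by (intro ln_bound) auto
  hence "\<bar>ln (norm v)\<bar> <= 1 / norm v" using False R0 by (simp add: ln_div)
  hence "norm v * \<bar>ln (norm v)\<bar> <= norm v * (1 / norm v)" by (rule mult_left_mono) simp
  hence "norm v * \<bar>ln (norm v)\<bar> <= 1" using R0 by simp
  thus ?thesis using zero_le_power2[of "norm v"] by linarith
 qed
 moreover have "(norm v)^2 <= R^2" using assms by (simp add: power_mono)
 moreover have "norm v * pi <= pi * R" using mult_right_mono[OF assms(2), of pi] by (simp add: mult.commute)
 ultimately show ?thesis unfolding norm_mult by linarith
qed

locale lip_graph =
 fixes A :: "real => real" and L :: real
 assumes lip: "!!s t. \<bar>A s - A t\<bar> <= L * \<bar>s - t\<bar>"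
begin

definition z :: "real => complex" where "z t = Complex t (A t)"

lemma L_nonneg: "L >= 0"
 using lip[of 0 1] by simp

lemma Re_z [simp]: "Re (z t) = t" and Im_z [simp]: "Im (z t) = A t"
 by (simp_all add: z_def)

lemma z_lip: "norm (z s - z t) <= (1 + L) * \<bar>s - t\<bar>"
 using cmod_le[of "z s - z t"] lip[of s t] by (simp add: algebra_simps)

lemma z_lower: "\<bar>s - t\<bar> <= norm (z s - z t)"
 using abs_Re_le_cmod[of "z s - z t"] by simp

text \<open>The weight, relative to the complex measure \<open>dz\<close>, of the right half of the interval \<open>[a, a + h]\<close>. It is also the
barycentric coordinate of the midpoint of the curve with respect to the two end points.\<close>
definition wt :: "real => real => complex" where
 "wt a h = (z (a + h) - z (a + h/2)) / (z (a + h) - z a)"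

text \<open>The pairing of \<open>d\<Phi>\<close> with the Haar function adapted to \<open>dz\<close> on \<open>[a, a + h]\<close>. For the weight 1/2 this is a multiple of
the ordinary second difference.\<close>
definition Th :: "real => real => (real => complex) => complex" where
 "Th a h \<Phi> = \<Phi> (a + h/2) - wt a h * \<Phi> a - (1 - wt a h) * \<Phi> (a + h)"

lemma z_diff_nz: "s ~= t ==> z s - z t ~= 0"
 using z_lower[of s t] by auto

lemma wt_bound:
 assumes "h > 0"
 shows "norm (wt a h) <= 1 + L" "norm (1 - wt a h) <= 1 + L"
  "z (a + h/2) = wt a h * z a + (1 - wt a h) * z (a + h)"
proof -
 have nz: "z (a + h) - z a ~= 0" using assms z_diff_nz[of "a + h" a] by simp
 have 1: "1 - wt a h = (z (a + h/2) - z a) / (z (a + h) - z a)"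
  unfolding wt_def using nz by (simp add: field_simps)
 have n: "norm (z (a + h) - z a) >= h" using z_lower[of "a + h" a] assms by simp
 have X: "norm (x / (z (a + h) - z a)) <= 1 + L" if "norm x <= (1 + L) * (h/2)" for x
 proof -
  note that
  also have "(1 + L) * (h/2) <= (1 + L) * h" using L_nonneg assms by (intro mult_left_mono) auto
  also have "... <= (1 + L) * norm (z (a + h) - z a)" using n L_nonneg by (intro mult_left_mono) auto
  finally show ?thesis using nz by (simp add: norm_divide field_simps)
 qed
 have "norm (z (a + h) - z (a + h/2)) <= (1 + L) * (h/2)"
  using z_lip[of "a+h" "a+h/2"] assms by simp
 thus "norm (wt a h) <= 1 + L" unfolding wt_def by (rule X)
 have "norm (z (a + h/2) - z a) <= (1 + L) * (h/2)"
  using z_lip[of "a+h/2" a] assms by simp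
 thus "norm (1 - wt a h) <= 1 + L" unfolding 1 by (rule X)
 have "wt a h * (z (a + h) - z a) = z (a + h) - z (a + h/2)" unfolding wt_def using nz by simp
 thus "z (a + h/2) = wt a h * z a + (1 - wt a h) * z (a + h)" by (simp add: algebra_simps)
qed

text \<open>The cancellation of the adapted Haar functions: they have integral 0 against \<open>dz\<close>.\<close>
lemma Th_affine:
 assumes "h > 0"
 shows "Th a h (%f. alpha * z f + beta) = 0"
proof -
 have "Th a h (%f. alpha * z f + beta) = alpha * (z (a + h/2) - (wt a h * z a + (1 - wt a h) * z (a + h)))"
  unfolding Th_def by (simp add: algebra_simps)
 thus ?thesis using wt_bound(3)[OF assms, of a] by simp
qed

lemma Th_add: "Th a h (%f. \<Phi> f + \<Psi> f) = Th a h \<Phi> + Th a h \<Psi>"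
 and Th_diff: "Th a h (%f. \<Phi> f - \<Psi> f) = Th a h \<Phi> - Th a h \<Psi>"
 and Th_mult: "Th a h (%f. c * \<Phi> f) = c * Th a h \<Phi>"
 unfolding Th_def by (simp_all add: algebra_simps)

lemma Th_sum: "Th a h (%f. \<Sum>i\<in>I. \<Phi> i f) = (\<Sum>i\<in>I. Th a h (\<Phi> i))"
 by (induction I rule: infinite_finite_induct) (simp_all add: Th_add, simp_all add: Th_def)

lemma Th_swap: "Th a h (%e. Th a' h' (%f. \<Phi> e f)) = Th a' h' (%f. Th a h (%e. \<Phi> e f))"
 unfolding Th_def by (simp add: algebra_simps)

lemma Th_taylor:
 fixes phi phi' phi'' :: "complex => complex"
 assumes h: "h > 0" and S: "convex S" and M: "M >= 0"
  and d1: "!!u. u \<in> S ==> (phi has_field_derivative phi' u) (at u)"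
  and d2: "!!u. u \<in> S ==> (phi' has_field_derivative phi'' u) (at u)"
  and M: "!!u. u \<in> S ==> norm (phi'' u) <= M"
  and \<sigma>: "\<sigma> \<in> {1, -1}"
  and u: "!!t. t \<in> {a, a + h/2, a + h} ==> \<sigma> * z t + v \<in> S"
 shows "norm (Th a h (%t. phi (\<sigma> * z t + v))) <= (1 + L)^3 * M * h^2"
proof -
 let ?u = "%t. \<sigma> * z t + v"
 have M0: "M >= 0" by (rule assms)
 have d: "norm (?u s - ?u t) <= (1 + L) * \<bar>s - t\<bar>" for s t
 proof -
  have "?u s - ?u t = \<sigma> * (z s - z t)" by (simp add: algebra_simps)
  hence "norm (?u s - ?u t) = norm (z s - z t)" using \<sigma> by (auto simp: norm_mult)
  thus ?thesis using z_lip by simp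
 qed
 have "norm (Th a h (%t. phi (?u t))) <= M * (norm (wt a h) * norm (?u a - ?u (a + h/2))^2 + norm (1 - wt a h) * norm (?u (a + h) - ?u (a + h/2))^2)"
  unfolding Th_def
 proof (rule complex_taylor_second_difference[OF S d1 d2 M])
  show "?u (a + h/2) = wt a h * ?u a + (1 - wt a h) * ?u (a + h)"
   unfolding wt_bound(3)[OF h, of a] by (simp add: algebra_simps)
 qed (use u in auto)
 also have "... <= M * ((1 + L) * ((1 + L) * (h/2))^2 + (1 + L) * ((1 + L) * (h/2))^2)"
 proof (intro mult_left_mono add_mono mult_mono power_mono wt_bound h M0)
  show "norm (?u a - ?u (a + h/2)) <= (1 + L) * (h/2)" using d[of a "a+h/2"] h by simp
  show "norm (?u (a+h) - ?u (a + h/2)) <= (1 + L) * (h/2)" using d[of "a+h" "a+h/2"] h by simp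
 qed (use L_nonneg in auto)
 also have "... = (1 + L)^3 * M * h^2 / 2" by (simp add: power2_eq_square power3_eq_cube field_simps)
 also have "... <= (1 + L)^3 * M * h^2" using L_nonneg M0 by simp
 finally show ?thesis .
qed

text \<open>Bounds the argument of \<open>cl\<close>, in units of \<open>h\<close>, when the pole lies at distance comparable to \<open>h\<close>.\<close>
definition N0 :: real where "N0 = 6 * (1 + L)"
definition C1 :: real where "C1 = 3 * (1 + L)^3 + 3 * (3 + 2 * L) * (N0^2 + 1 + pi * N0)"

lemma C1_pos: "C1 > 0"
proof -
 have L1: "1 + L > 0" using L_nonneg by simp
 hence "N0 > 0" unfolding N0_def by simp
 note L1 this
 have "N0^2 + 1 + pi * N0 > 0" using \<open>N0 > 0\<close> by (intro add_pos_pos) auto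
 moreover have "3 * (1 + L)^3 > 0" using L1 by simp
 ultimately have "3 * (1 + L)^3 > 0" "3 * (3 + 2 * L) * (N0^2 + 1 + pi * N0) > 0"
  using L_nonneg by auto
 thus ?thesis unfolding C1_def by linarith
qed

lemma slit:
 assumes "eta > 0" "\<sigma> \<in> {1, -1 :: real}"
 shows "- \<i> * (of_real \<sigma> * (z f - z e) + \<i> * of_real eta) \<notin> \<real>\<^sub>\<le>\<^sub>0"
 using assms by (auto simp: complex_nonpos_Reals_iff)

text \<open>If the pole is far from the interval, horizontally or vertically, the second derivative of \<open>cl\<close> is
bounded by the inverse distance. If it is near, rescaling \<open>cl\<close> by \<open>h\<close> changes it by an affine function, which is
annihilated, and the rescaled function is bounded because \<open>u Ln u\<close> is.\<close>
lemma atom_bound: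
 assumes h: "h > 0" and eta: "eta > 0" and \<sigma>: "\<sigma> \<in> {1, -1 :: real}"
 shows "norm (Th a h (%f. cl (of_real \<sigma> * (z f - z e) + \<i> * of_real eta))) <= C1 * h^2 / (h + \<bar>e - a\<bar>)"
proof -
 define v where "v = \<i> * of_real eta - of_real \<sigma> * z e"
 have uv: "of_real \<sigma> * (z f - z e) + \<i> * of_real eta = of_real \<sigma> * z f + v" for f
  unfolding v_def by (simp add: algebra_simps)
 have \<sigma>': "complex_of_real \<sigma> \<in> {1, -1}" using \<sigma> by auto
 let ?P = "3 * (3 + 2 * L) * (N0^2 + 1 + pi * N0)"
 have Pn: "N0^2 + 1 + pi * N0 >= 0" using L_nonneg unfolding N0_def by auto
 hence Pp: "?P >= 0" using L_nonneg by auto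
 have taylor: ?thesis if \<omega>: "\<omega> \<in> {1, -1, -\<i>}" and rho: "rho > 0" "3 * rho >= h + \<bar>e - a\<bar>"
  and inn: "!!t. t \<in> {a, a + h/2, a + h} ==> Re (\<omega> * (of_real \<sigma> * (z t - z e) + \<i> * of_real eta)) >= rho" for \<omega> rho
 proof -
  note hp = half_plane_cl[OF \<omega> rho(1)]
  have "norm (Th a h (%f. cl (of_real \<sigma> * z f + v))) <= (1 + L)^3 * (1/rho) * h^2"
  proof (rule Th_taylor[OF h hp(1) _ cl_deriv(1) cl_deriv(2)])
   fix u assume "u \<in> {u. rho <= Re (\<omega> * u)}"
   from hp(2)[OF this] hp(3)[OF this]
   show "- \<i> * u \<notin> \<real>\<^sub>\<le>\<^sub>0" "- \<i> * u \<notin> \<real>\<^sub>\<le>\<^sub>0" "norm (inverse u) <= 1 / rho"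
    using rho by (auto simp: norm_inverse divide_inverse intro!: le_imp_inverse_le)
  qed (use inn uv rho \<sigma>' in auto)
  also have "... <= (1 + L)^3 * (3 / (h + \<bar>e - a\<bar>)) * h^2"
  proof (intro mult_right_mono mult_left_mono)
   show "1 / rho <= 3 / (h + \<bar>e - a\<bar>)" using rho h by (auto simp: divide_simps)
  qed (use L_nonneg in auto)
  also have "... <= C1 * h^2 / (h + \<bar>e - a\<bar>)"
  proof -
   have "3 * (1 + L)^3 <= C1" unfolding C1_def using Pp by simp
   hence "3 * (1 + L)^3 * (h^2 / (h + \<bar>e - a\<bar>)) <= C1 * (h^2 / (h + \<bar>e - a\<bar>))"
    using h by (intro mult_right_mono) auto
   thus ?thesis by (simp add: mult.commute)
  qed
  finally show ?thesis by (simp add: uv)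
 qed
 have Reu: "Re (of_real \<sigma> * (z t - z e) + \<i> * of_real eta) = \<sigma> * (t - e)"
  and Imu: "Im (of_real \<sigma> * (z t - z e) + \<i> * of_real eta) = \<sigma> * (A t - A e) + eta" for t
  by simp_all
 have tin: "a <= t \<and> t <= a + h" if "t \<in> {a, a + h/2, a + h}" for t using that h by auto
 consider (far) "\<bar>e - a\<bar> >= 2 * h" | (high) "\<bar>e - a\<bar> < 2 * h" "eta >= 3 * (1 + L) * h" | (near) "\<bar>e - a\<bar> < 2 * h" "eta < 3 * (1 + L) * h"
  by linarith
 thus ?thesis
 proof cases
  case far
  have rho: "\<bar>e - a\<bar> - h > 0" "3 * (\<bar>e - a\<bar> - h) >= h + \<bar>e - a\<bar>" using far h by auto
  show ?thesis
  proof (cases "e <= a")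
   case True
   show ?thesis
   proof (rule taylor[where \<omega> = "of_real \<sigma>", OF _ rho])
    fix t assume t: "t \<in> {a, a + h/2, a + h}"
    have "Re (of_real \<sigma> * (of_real \<sigma> * (z t - z e) + \<i> * of_real eta)) = t - e" using \<sigma> by auto
    with True tin[OF t] h show "\<bar>e - a\<bar> - h <= Re (of_real \<sigma> * (of_real \<sigma> * (z t - z e) + \<i> * of_real eta))"
    by linarith
   qed (use \<sigma> in auto)
  next
   case False
   show ?thesis
   proof (rule taylor[where \<omega> = "- of_real \<sigma>", OF _ rho])
    fix t assume t: "t \<in> {a, a + h/2, a + h}"
    have "Re (- of_real \<sigma> * (of_real \<sigma> * (z t - z e) + \<i> * of_real eta)) = e - t" using \<sigma> by auto
    with False tin[OF t] h show "\<bar>e - a\<bar> - h <= Re (- of_real \<sigma> * (of_real \<sigma> * (z t - z e) + \<i> * of_real eta))"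
    by linarith
   qed (use \<sigma> in auto)
  qed
 next
  case high
  show ?thesis
  proof (rule taylor[where \<omega> = "-\<i>" and rho = h])
   fix t assume t: "t \<in> {a, a + h/2, a + h}"
   have "\<bar>t - e\<bar> <= 3 * h" using tin[OF t] high h by linarith
   hence "L * \<bar>t - e\<bar> <= L * (3 * h)" using L_nonneg by (intro mult_left_mono) auto
   hence "\<bar>A t - A e\<bar> <= 3 * L * h" using lip[of t e] by simp
   moreover have "\<sigma> * (A t - A e) >= - \<bar>A t - A e\<bar>" using \<sigma> by auto
   ultimately have "\<sigma> * (A t - A e) + eta >= h" using high h by (simp add: algebra_simps)
   thus "h <= Re (- \<i> * (of_real \<sigma> * (z t - z e) + \<i> * of_real eta))" by simp
  qed (use h high in auto)
 next
  case near
  let ?u = "%f. of_real \<sigma> * (z f - z e) + \<i> * of_real eta"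
  have e1: "cl (?u f) = ?u f * Ln (- \<i> * ?u f / of_real h) + ((of_real (ln h) - 1) * (of_real \<sigma> * z f) + (of_real (ln h) - 1) * v)" for f
  proof -
   have nz: "- \<i> * ?u f ~= 0" using slit[OF eta \<sigma>, of f e] nonpos_Reals_zero_I by metis
   have "Ln (- \<i> * ?u f / of_real h) = Ln (- \<i> * ?u f) - of_real (ln h)"
    by (rule Ln_divide_of_real[OF h nz])
   thus ?thesis unfolding cl_def uv by (simp only:) (simp add: algebra_simps)
  qed
  have "Th a h (%f. cl (?u f)) = Th a h (%f. ?u f * Ln (- \<i> * ?u f / of_real h)) + Th a h (%f. ((of_real (ln h) - 1) * of_real \<sigma>) * z f + (of_real (ln h) - 1) * v)"
   unfolding e1 Th_add[symmetric] by (simp add: mult.assoc)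
  also have "Th a h (%f. ((of_real (ln h) - 1) * of_real \<sigma>) * z f + (of_real (ln h) - 1) * v) = 0"
   by (rule Th_affine[OF h])
  finally have e2: "Th a h (%f. cl (?u f)) = Th a h (%f. ?u f * Ln (- \<i> * ?u f / of_real h))" by simp
  have b: "norm (?u t * Ln (- \<i> * ?u t / of_real h)) <= h * (N0^2 + 1 + pi * N0)" if t: "t \<in> {a, a + h/2, a + h}" for t
  proof -
   let ?w = "- \<i> * ?u t / of_real h"
   have "norm (?u t) <= norm (z t - z e) + eta"
   proof -
    have "norm (?u t) <= norm (of_real \<sigma> * (z t - z e)) + norm (\<i> * complex_of_real eta)" by (rule norm_triangle_ineq)
    thus ?thesis using \<sigma> eta by (auto simp: norm_mult)
   qed
   also have "norm (z t - z e) <= (1 + L) * (3 * h)"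
   proof -
    have "\<bar>t - e\<bar> <= 3 * h" using tin[OF t] near h by linarith
    hence "(1 + L) * \<bar>t - e\<bar> <= (1 + L) * (3 * h)" using L_nonneg by (intro mult_left_mono) auto
    thus ?thesis using z_lip[of t e] by simp
   qed
   finally have "norm (?u t) <= N0 * h" using near unfolding N0_def by (simp add: algebra_simps)
   moreover have nw: "norm ?w = norm (?u t) / h"
    using h by (simp only: norm_divide norm_mult norm_minus_cancel norm_ii norm_of_real mult_1 abs_of_pos)
   ultimately have w: "norm ?w <= N0" using h by (simp only:) (simp add: pos_divide_le_eq)
   have "- \<i> * ?u t ~= 0" using slit[OF eta \<sigma>, of t e] nonpos_Reals_zero_I by metis
   hence "?w ~= 0" using h by simp
   from norm_times_Ln_bound[OF this w]
   have "norm (?w * Ln ?w) <= N0^2 + 1 + pi * N0" .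
   moreover have "norm (?u t * Ln ?w) = h * norm (?w * Ln ?w)"
    unfolding norm_mult[of ?w] norm_mult[of "?u t"] nw using h by simp
   ultimately show ?thesis using h by (simp only:) (intro mult_left_mono, auto)
  qed
  let ?B = "h * (N0^2 + 1 + pi * N0)"
  let ?F = "%f. ?u f * Ln (- \<i> * ?u f / of_real h)"
  have "norm (Th a h ?F) <= norm (?F (a + h/2)) + norm (wt a h) * norm (?F a) + norm (1 - wt a h) * norm (?F (a + h))"
   unfolding Th_def by (intro order_trans[OF norm_triangle_ineq4] add_mono) (auto simp: norm_mult)
  also have "... <= ?B + (1 + L) * ?B + (1 + L) * ?B"
   by (intro add_mono mult_mono b wt_bound h) (use L_nonneg in auto)
  also have "... = ?P * h^2 / (3 * h)" using h by (simp add: field_simps power2_eq_square)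
  also have "... <= ?P * h^2 / (h + \<bar>e - a\<bar>)"
   using near h by (intro divide_left_mono mult_nonneg_nonneg[OF Pp] mult_pos_pos) auto
  also have "... <= C1 * h^2 / (h + \<bar>e - a\<bar>)"
   using h L_nonneg Pn unfolding C1_def by (intro divide_right_mono mult_right_mono) auto
  finally show ?thesis unfolding e2 .
 qed
qed

text \<open>The cancellation is used in both variables, so four derivatives fall on \<open>cl\<close>.\<close>
lemma atoms_far:
 assumes h: "h1 > 0" "h2 > 0" and eta: "eta > 0"
  and far: "\<bar>a1 - a2\<bar> >= 3 * h1" "\<bar>a1 - a2\<bar> >= 3 * h2"
 shows "norm (Th a1 h1 (%e. Th a2 h2 (%f. cl (z f - z e + \<i> * of_real eta))))
  <= 16 * (1 + L)^6 * h1^2 * h2^2 / \<bar>a1 - a2\<bar>^3"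
proof -
 define r where "r = \<bar>a1 - a2\<bar>"
 define rho where "rho = r / 2"
 have r: "r > 0" and \<rho>0: "rho > 0" using far h unfolding r_def rho_def by auto
 define \<omega> :: complex where "\<omega> = (if a1 < a2 then 1 else -1)"
 have \<omega>: "\<omega> \<in> {1, -1, -\<i>}" unfolding \<omega>_def by auto
 note hp = half_plane_cl[OF \<omega> \<rho>0]
 let ?H = "{u. rho <= Re (\<omega> * u)}"
 let ?S = "{w. \<forall>f\<in>{a2, a2 + h2/2, a2 + h2}. z f - w + \<i> * of_real eta \<in> ?H}"
 have convS: "convex ?S"
 proof -
  have "?S = (\<Inter>f\<in>{a2, a2 + h2/2, a2 + h2}. {w. inner (cnj \<omega>) w <= Re (\<omega> * (z f + \<i> * of_real eta)) - rho})"
   by (auto simp: inner_complex_def algebra_simps)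
  thus ?thesis by (simp only:) (intro convex_INT convex_halfspace_le)
 qed
 have inS: "z e \<in> ?S" if "e \<in> {a1, a1 + h1/2, a1 + h1}" for e
 proof (intro CollectI ballI)
  fix f assume f: "f \<in> {a2, a2 + h2/2, a2 + h2}"
  have b: "a1 <= e" "e <= a1 + h1" "a2 <= f" "f <= a2 + h2" using that f h by auto
  have "Re (\<omega> * (z f - z e + \<i> * of_real eta)) = (if a1 < a2 then f - e else e - f)"
   unfolding \<omega>_def by simp
  thus "rho <= Re (\<omega> * (z f - z e + \<i> * of_real eta))"
   using far h b unfolding rho_def r_def by (simp split: if_splits)
 qed
 let ?Q = "%phi w. Th a2 h2 (%f. phi (z f - w + \<i> * of_real eta))"
 have b0: "[|!!u. u \<in> ?H ==> (phi has_field_derivative phi' u) (at u); w \<in> ?S|] ==> (?Q phi has_field_derivative ?Q (%u. - phi' u) w) (at w)" for phi phi' :: "complex => complex" and w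
 proof -
  assume d: "!!u. u \<in> ?H ==> (phi has_field_derivative phi' u) (at u)" and w: "w \<in> ?S"
  have "((%w. phi (z f - w + \<i> * of_real eta)) has_field_derivative - phi' (z f - w + \<i> * of_real eta)) (at w)"
   if "f \<in> {a2, a2 + h2/2, a2 + h2}" for f
  proof -
   have "((%w. phi (z f - w + \<i> * of_real eta)) has_field_derivative phi' (z f - w + \<i> * of_real eta) * (-1)) (at w)"
    by (rule DERIV_chain2[OF d]) (use w that in "auto intro!: derivative_eq_intros")
   thus ?thesis by simp
  qed
  thus ?thesis unfolding Th_def
   by (intro derivative_eq_intros) auto
 qed
 have "norm (Th a1 h1 (%e. ?Q cl (1 * z e + 0))) <= (1 + L)^3 * ((1 + L)^3 * (2 / rho^3) * h2^2) * h1^2"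
 proof (rule Th_taylor[OF h(1) convS])
  show "0 <= (1 + L)^3 * (2 / rho^3) * h2^2" using \<rho>0 L_nonneg by simp
  fix w assume w: "w \<in> ?S"
  show "(?Q cl has_field_derivative ?Q (%u. - Ln (- \<i> * u)) w) (at w)"
   by (rule b0[OF _ w]) (use hp cl_deriv in blast)
  show "(?Q (%u. - Ln (- \<i> * u)) has_field_derivative ?Q (%u. - (- inverse u)) w) (at w)"
   by (rule b0[OF _ w]) (rule DERIV_minus, use hp cl_deriv in blast)
  show "norm (?Q (%u. - (- inverse u)) w) <= (1 + L)^3 * (2 / rho^3) * h2^2"
  proof -
   have "norm (Th a2 h2 (%f. inverse (1 * z f + (- w + \<i> * of_real eta)))) <= (1 + L)^3 * (2 / rho^3) * h2^2"
   proof (rule Th_taylor[OF h(2) hp(1) _ cl_deriv(3) cl_deriv(4)])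
    fix u assume u: "u \<in> ?H"
    from hp(2)[OF this] show "- \<i> * u \<notin> \<real>\<^sub>\<le>\<^sub>0" "- \<i> * u \<notin> \<real>\<^sub>\<le>\<^sub>0" by auto
    have "rho^3 <= norm u^3" using hp(3)[OF u] \<rho>0 by (intro power_mono) auto
    thus "norm (2 * inverse (u^3)) <= 2 / rho^3"
    using \<rho>0 by (auto simp: norm_mult norm_inverse norm_power divide_inverse intro!: le_imp_inverse_le)
   qed (use w \<rho>0 in "auto simp: algebra_simps")
   thus ?thesis by (simp add: algebra_simps)
  qed
 qed (use inS in auto)
 also have "... = 16 * (1 + L)^6 * h1^2 * h2^2 / r^3"
  unfolding rho_def using r by (simp add: field_simps power_numeral_reduce)
 finally show ?thesis unfolding r_def by simp
qed

end

section \<open>Schur sums and a Bellman inequality\<close>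

text \<open>The decay of the interaction of two adapted Haar functions of lengths \<open>h1\<close> and \<open>h2\<close> at distance \<open>r\<close>.\<close>
definition kap :: "real => real => real => real" where
 "kap h1 h2 r = h1^2 * h2^2 / ((h2 + r) * (h1 + r)^2)"

lemma powr_m32: "x > 0 ==> x powr (-3/2) = 1 / (x * sqrt x)" for x :: real
proof -
 assume x: "x > 0"
 have "x powr (3/2) = x powr (1 + 1/2)" by simp
 also have "... = x * sqrt x" using x by (subst powr_add) (simp add: powr_half_sqrt)
 finally show ?thesis using x powr_minus_divide[of x "3/2"] by simp
qed

lemma kap_nonneg: "h1 > 0 ==> h2 > 0 ==> r >= 0 ==> kap h1 h2 r >= 0"
 unfolding kap_def by simp

lemma kap_row:
 assumes h: "0 < h2" "h2 <= h1" "r >= 0"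
 shows "kap h1 h2 r <= sqrt (h1 * h2) * (1 + r / h2) powr (-3/2)"
proof -
 have p: "0 < h1" "0 < h2 + r" "0 < h1 + r" using h by auto
 have e: "1 + r / h2 = (h2 + r) / h2" using h by (simp add: field_simps)
 have s: "h2 = sqrt h2 * sqrt h2" using h by simp
 have rhs: "sqrt (h1 * h2) * (1 + r / h2) powr (-3/2) = sqrt h1 * h2^2 / ((h2 + r) * sqrt (h2 + r))"
 proof -
  have "sqrt (h1 * h2) * (1 + r / h2) powr (-3/2) = sqrt h1 * sqrt h2 * (1 / ((h2 + r) / h2 * (sqrt (h2 + r) / sqrt h2)))"
   unfolding e using p h by (subst powr_m32) (simp_all add: real_sqrt_mult real_sqrt_divide)
  also have "... = sqrt h1 * (sqrt h2 * sqrt h2) * h2 / ((h2 + r) * sqrt (h2 + r))"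
   using p h by (simp add: field_simps)
  finally show ?thesis using h by (simp add: power2_eq_square)
 qed
 have s1: "sqrt h1 * sqrt h1 = h1" "sqrt (h1 + r) * sqrt (h1 + r) = h1 + r" using p by simp_all
 have "h1^2 * sqrt (h2 + r) = sqrt h1 * ((h1 * sqrt h1) * sqrt (h2 + r))"
  unfolding power2_eq_square using s1(1) by (metis mult.assoc mult.commute)
 also have "... <= sqrt h1 * (((h1 + r) * sqrt (h1 + r)) * sqrt (h1 + r))"
  using h p by (intro mult_left_mono mult_mono) auto
 also have "... = sqrt h1 * (h1 + r)^2" using s1(2) by (simp add: power2_eq_square mult.assoc)
 finally have k: "h1^2 * sqrt (h2 + r) <= sqrt h1 * (h1 + r)^2" .
 have "h1^2 / (h1 + r)^2 <= sqrt h1 / sqrt (h2 + r)"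
  using k p by (simp add: pos_divide_le_eq pos_le_divide_eq mult.commute)
 hence "h2^2 / (h2 + r) * (h1^2 / (h1 + r)^2) <= h2^2 / (h2 + r) * (sqrt h1 / sqrt (h2 + r))"
  using p by (intro mult_left_mono) auto
 hence "kap h1 h2 r <= sqrt h1 * h2^2 / ((h2 + r) * sqrt (h2 + r))"
  unfolding kap_def by (simp add: mult.commute)
 thus ?thesis using rhs by simp
qed

lemma kap_col:
 assumes h: "0 < h2" "0 < h1" "r >= 0"
 shows "kap h1 h2 r <= h2 * (1 + r / h1) powr (-3/2)"
proof -
 have p: "0 < h2 + r" "0 < h1 + r" using h by auto
 have e: "h1^2 / (h1 + r)^2 = 1 / (1 + r / h1)^2" using h p by (simp add: field_simps)
 have "kap h1 h2 r = h2 * (h2 / (h2 + r)) * (h1^2 / (h1 + r)^2)"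
  unfolding kap_def by (simp add: power2_eq_square)
 also have "... <= h2 * 1 * (h1^2 / (h1 + r)^2)"
  using h p by (intro mult_right_mono mult_left_mono) auto
 also have "... = h2 * (1 / (1 + r / h1)^2)" using e by simp
 also have "... <= h2 * (1 + r / h1) powr (-3/2)"
 proof (intro mult_left_mono)
  have u: "1 + r / h1 >= 1" using h by simp
  have "1 / (1 + r / h1)^2 = (1 + r / h1) powr (-2)" using u by (simp add: powr_minus_divide)
  also have "... <= (1 + r / h1) powr (-3/2)" using u by (intro powr_mono) auto
  finally show "1 / (1 + r / h1)^2 <= (1 + r / h1) powr (-3/2)" .
 qed (use h in auto)
 finally show ?thesis .
qed

text \<open>Schur's test with a free parameter \<open>s\<close>, which balances the unequal row and column sums of two different scales.\<close>
lemma schur_pair: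
 fixes u v :: "nat => real"
 assumes K: "!!i j. i < n ==> j < m ==> 0 <= K i j"
  and R: "!!i. i < n ==> (\<Sum>j<m. K i j) <= R" and C: "!!j. j < m ==> (\<Sum>i<n. K i j) <= C"
  and s: "s > 0"
 shows "(\<Sum>i<n. \<Sum>j<m. u i * v j * K i j) <= (R / s * (\<Sum>i<n. (u i)^2) + C * s * (\<Sum>j<m. (v j)^2)) / 2"
proof -
 have am: "a * b <= (a^2 / s + b^2 * s) / 2" for a b :: real
 proof -
  have "0 <= (a - b * s)^2 / s" using s by simp
  also have "... = a^2 / s - 2 * a * b + b^2 * s" using s by (simp add: field_simps power2_eq_square)
  finally show ?thesis by simp
 qed
 have "(\<Sum>i<n. \<Sum>j<m. u i * v j * K i j) <= (\<Sum>i<n. \<Sum>j<m. (((u i)^2 / s + (v j)^2 * s) / 2) * K i j)"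
  by (intro sum_mono mult_right_mono am K) auto
 also have "... = (\<Sum>i<n. \<Sum>j<m. (u i)^2 / s / 2 * K i j) + (\<Sum>i<n. \<Sum>j<m. (v j)^2 * s / 2 * K i j)"
  by (simp add: sum.distrib[symmetric] algebra_simps add_divide_distrib)
 also have "(\<Sum>i<n. \<Sum>j<m. (v j)^2 * s / 2 * K i j) = (\<Sum>j<m. \<Sum>i<n. (v j)^2 * s / 2 * K i j)"
  by (rule sum.swap)
 also have "(\<Sum>j<m. \<Sum>i<n. (v j)^2 * s / 2 * K i j) <= (\<Sum>j<m. (v j)^2 * s / 2 * C)"
  unfolding sum_distrib_left[symmetric] using s by (intro sum_mono mult_left_mono C) auto
 also have "(\<Sum>i<n. \<Sum>j<m. (u i)^2 / s / 2 * K i j) <= (\<Sum>i<n. (u i)^2 / s / 2 * R)"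
  unfolding sum_distrib_left[symmetric] using s by (intro sum_mono mult_left_mono R) auto
 also have "(\<Sum>i<n. (u i)^2 / s / 2 * R) + (\<Sum>j<m. (v j)^2 * s / 2 * C) = (R / s * (\<Sum>i<n. (u i)^2) + C * s * (\<Sum>j<m. (v j)^2)) / 2"
  by (simp add: sum_distrib_left sum_divide_distrib add_divide_distrib mult.commute mult.left_commute mult.assoc)
 finally show ?thesis by simp
qed

lemma geometric_double_sum:
 fixes U V :: "nat => real"
 assumes t: "0 <= t" "t < 1" and U: "!!k. U k >= 0" and V: "!!k. V k >= 0"
 shows "(\<Sum>k<N. \<Sum>l<N. t ^ (if k <= l then l - k else k - l) * (U k + V l)) <= 2 / (1 - t) * ((\<Sum>k<N. U k) + (\<Sum>l<N. V l))"
proof -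
 let ?d = "%k l::nat. if k <= l then l - k else k - l"
 have g: "(\<Sum>i\<in>T. t ^ i) <= 1 / (1 - t)" if "finite T" for T
  using sum_le_suminf[OF summable_geometric[of t] that] t suminf_geometric[of t] by simp
 have row: "(\<Sum>l<N. t ^ ?d k l) <= 2 / (1 - t)" for k
 proof -
  have "(\<Sum>l<N. t ^ ?d k l) = (\<Sum>l\<in>{..<N} \<inter> {..k}. t ^ ?d k l) + (\<Sum>l\<in>{..<N} - {..k}. t ^ ?d k l)"
   by (subst sum.Int_Diff[of _ _ "{..k}"]) auto
  also have "(\<Sum>l\<in>{..<N} \<inter> {..k}. t ^ ?d k l) = (\<Sum>i\<in>?d k ` ({..<N} \<inter> {..k}). t ^ i)"
   by (subst sum.reindex) (auto simp: inj_on_def split: if_splits)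
  also have "... <= 1 / (1 - t)" by (rule g) auto
  also have "(\<Sum>l\<in>{..<N} - {..k}. t ^ ?d k l) = (\<Sum>i\<in>?d k ` ({..<N} - {..k}). t ^ i)"
   by (subst sum.reindex) (auto simp: inj_on_def split: if_splits)
  also have "... <= 1 / (1 - t)" by (rule g) auto
  finally show ?thesis by simp
 qed
 have sym: "?d k l = ?d l k" for k l by auto
 have "(\<Sum>k<N. \<Sum>l<N. t ^ ?d k l * (U k + V l)) = (\<Sum>k<N. \<Sum>l<N. U k * t ^ ?d k l) + (\<Sum>k<N. \<Sum>l<N. V l * t ^ ?d k l)"
  unfolding sum.distrib[symmetric] by (intro sum.cong refl) (simp add: algebra_simps)
 also have "(\<Sum>k<N. \<Sum>l<N. V l * t ^ ?d k l) = (\<Sum>l<N. \<Sum>k<N. V l * t ^ ?d l k)"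
  by (subst sum.swap) (simp only: sym)
 also have "(\<Sum>k<N. \<Sum>l<N. U k * t ^ ?d k l) <= (\<Sum>k<N. U k * (2 / (1 - t)))"
  unfolding sum_distrib_left[symmetric] by (intro sum_mono mult_left_mono row U)
 also have "(\<Sum>l<N. \<Sum>k<N. V l * t ^ ?d l k) <= (\<Sum>l<N. V l * (2 / (1 - t)))"
  unfolding sum_distrib_left[symmetric] by (intro sum_mono mult_left_mono row V)
 also have "(\<Sum>k<N. U k * (2 / (1 - t))) + (\<Sum>l<N. V l * (2 / (1 - t))) = 2 / (1 - t) * ((\<Sum>k<N. U k) + (\<Sum>l<N. V l))"
  unfolding sum_distrib_right[symmetric] by (simp add: algebra_simps)
 finally show ?thesis by simp
qed

lemma sum_pairs: "(\<Sum>i<2 * n. f i) = (\<Sum>i<n. f (2 * i) + f (2 * i + 1))" for f :: "nat => 'a::comm_monoid_add"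
 by (induction n) (simp_all add: add.assoc)

text \<open>Quantitative convexity of \<open>x\<^sup>2 / w\<close> in both variables.\<close>
lemma bellman_real:
 fixes x1 x2 w1 w2 :: real
 assumes "w1 > 0" "w2 > 0"
 shows "x1^2 / w1 + x2^2 / w2 = (x1 + x2)^2 / (w1 + w2) + w1 * w2 / (w1 + w2) * (x1 / w1 - x2 / w2)^2"
proof -
 have "w1 + w2 ~= 0" "w1 ~= 0" "w2 ~= 0" using assms by auto
 thus ?thesis by (simp add: divide_simps power2_eq_square) (simp add: algebra_simps)
qed

lemma bellman_complex:
 fixes x1 x2 :: complex and w1 w2 :: real
 assumes "w1 > 0" "w2 > 0"
 shows "(norm x1)^2 / w1 + (norm x2)^2 / w2 = (norm (x1 + x2))^2 / (w1 + w2) + w1 * w2 / (w1 + w2) * (norm (x1 / of_real w1 - x2 / of_real w2))^2"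
 unfolding cmod_power2
 using bellman_real[OF assms, of "Re x1" "Re x2"] bellman_real[OF assms, of "Im x1" "Im x2"]
 by (simp add: add_divide_distrib ring_distribs Re_divide_of_real Im_divide_of_real)

text \<open>The function \<open>|P|\<^sup>2 / (K - a\<^sup>2)\<close> is strictly convex on the strip \<open>|a| \<le> L\<close>. Its gain of convexity controls both the
oscillation of \<open>P\<close> and the product of \<open>P\<close> with the oscillation of \<open>a\<close>, which together bound the oscillation of
the quotient \<open>P / (1 + \<i> a)\<close>. Here \<open>a\<close> is the mean slope of the curve over an interval and the quotient is an average with
respect to \<open>dz\<close>.\<close>
lemma bellman_step:
 fixes P1 P2 :: complex and a1 a2 L :: real
 assumes L: "L >= 0" and a: "\<bar>a1\<bar> <= L" "\<bar>a2\<bar> <= L"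
 defines "K \<equiv> L^2 + 1"
 defines "CB \<equiv> 4 * (K + (4 * L + 2 * K) * (K * L / 2))^2 + ((4 * L + 2 * K) * K)^2"
 shows "(norm (P1 / Complex 1 a1 - P2 / Complex 1 a2))^2 <=
  CB * ((norm P1)^2 / (K - a1^2) + (norm P2)^2 / (K - a2^2) - 2 * (norm ((P1 + P2) / 2))^2 / (K - ((a1 + a2)/2)^2))"
proof -
 define w1 w2 w where "w1 = K - a1^2" and "w2 = K - a2^2" and "w = K - ((a1 + a2)/2)^2"
 define delta where "delta = (a1 - a2) / 2"
 define P where "P = (P1 + P2) / 2"
 define Y1 Y2 where "Y1 = P1 / of_real w1" and "Y2 = P2 / of_real w2"
 define G where "G = (norm P1)^2 / w1 + (norm P2)^2 / w2 - 2 * (norm P)^2 / w"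
 have sq: "a1^2 <= L^2" "a2^2 <= L^2" "((a1 + a2)/2)^2 <= L^2"
  using a by (auto simp: abs_le_square_iff[symmetric])
 have w: "1 <= w1" "1 <= w2" "1 <= w" "w1 <= K" "w2 <= K" "w <= K"
  using sq unfolding w1_def w2_def w_def K_def by auto
 have K1: "K >= 1" unfolding K_def by simp
 have ws: "w1 + w2 = 2 * (w - delta^2)"
  unfolding w1_def w2_def w_def delta_def by (simp add: field_simps power2_eq_square)
 have wd: "w - delta^2 >= 1" using ws w by argo
 have "(norm P1)^2 / w1 + (norm P2)^2 / w2 = (norm (P1 + P2))^2 / (w1 + w2) + w1 * w2 / (w1 + w2) * (norm (Y1 - Y2))^2"
  unfolding Y1_def Y2_def by (rule bellman_complex) (use w in auto)
 moreover have "norm (P1 + P2) = 2 * norm P" unfolding P_def by simp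
 moreover have "w1 * w2 / (w1 + w2) >= 1/2"
 proof -
  have "w1 * 1 <= w1 * w2" "1 * w2 <= w1 * w2" using w by (auto intro!: mult_mono)
  hence "w1 + w2 <= 2 * (w1 * w2)" by linarith
  thus ?thesis using w by (simp add: pos_le_divide_eq)
 qed
 ultimately have "(norm P1)^2 / w1 + (norm P2)^2 / w2 >= (2 * norm P)^2 / (2 * (w - delta^2)) + 1/2 * (norm (Y1 - Y2))^2"
  unfolding ws by (metis add_left_mono mult_right_mono zero_le_power2)
 moreover have "(2 * norm P)^2 / (2 * (w - delta^2)) >= 2 * (norm P)^2 / w + 2 * (norm P)^2 * delta^2 / K^2"
 proof -
  have "1 / w + delta^2 / K^2 <= 1 / w + delta^2 / (w * (w - delta^2))"
  proof -
   have "w * (w - delta^2) <= K * K" using w wd zero_le_power2[of delta] by (intro mult_mono) (linarith | simp)+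
   thus ?thesis using w wd by (intro add_left_mono divide_left_mono) (auto simp: power2_eq_square)
  qed
  also have "... = 1 / (w - delta^2)" using w wd by (simp add: field_simps)
  finally have "2 * (norm P)^2 * (1 / w + delta^2 / K^2) <= 2 * (norm P)^2 * (1 / (w - delta^2))"
   by (rule mult_left_mono) simp
  from this have f: "2 * (norm P)^2 * (1 / w) + 2 * (norm P)^2 * (delta^2 / K^2) <= 2 * (norm P)^2 * (1 / (w - delta^2))"
   by (simp only: distrib_left)
  have e: "(2 * norm P)^2 / (2 * X) = 2 * (norm P)^2 * (1 / X)" for X :: real
   by (simp add: power2_eq_square)
  show ?thesis using f unfolding e by simp
 qed
 ultimately have G: "G >= 2 * ((norm P)^2 * delta^2) / K^2 + (norm (Y1 - Y2))^2 / 2"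
  unfolding G_def by (simp add: mult.assoc)
 define k1 k2 where "k1 = of_real w1 / Complex 1 a1" and "k2 = of_real w2 / Complex 1 a2"
 have c1: "norm (Complex 1 x) >= 1" for x using complex_Re_le_cmod[of "Complex 1 x"] by simp
 have nz: "Complex 1 x ~= 0" for x using c1[of x] by auto
 have q1: "P1 / Complex 1 a1 = Y1 * k1" "P2 / Complex 1 a2 = Y2 * k2"
  unfolding Y1_def Y2_def k1_def k2_def using w by auto
 have nk1: "norm k1 <= K"
 proof -
  have "w1 / norm (Complex 1 a1) <= w1 / 1" using c1[of a1] w by (intro divide_left_mono) auto
  thus ?thesis unfolding k1_def using w by (simp add: norm_divide)
 qed
 have nk: "norm (k1 - k2) <= (4 * L + 2 * K) * \<bar>delta\<bar>"
 proof -
  have "k1 - k2 = of_real (w1 - w2) / Complex 1 a1 + of_real w2 * ((Complex 1 a2 - Complex 1 a1) / (Complex 1 a1 * Complex 1 a2))"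
   unfolding k1_def k2_def using nz[of a1] nz[of a2] by (simp add: field_simps)
  also have "norm ... <= norm (of_real (w1 - w2) / Complex 1 a1) + norm (of_real w2 * ((Complex 1 a2 - Complex 1 a1) / (Complex 1 a1 * Complex 1 a2)))"
   by (rule norm_triangle_ineq)
  also have "norm (of_real (w1 - w2) / Complex 1 a1) <= 4 * L * \<bar>delta\<bar>"
  proof -
   have "w1 - w2 = - ((a1 + a2) * (2 * delta))" unfolding w1_def w2_def delta_def by (simp add: field_simps power2_eq_square)
   hence "\<bar>w1 - w2\<bar> = \<bar>a1 + a2\<bar> * (2 * \<bar>delta\<bar>)" by (simp add: abs_mult)
   also have "... <= (2 * L) * (2 * \<bar>delta\<bar>)" using a by (intro mult_right_mono) auto
   finally have 1: "\<bar>w1 - w2\<bar> <= 4 * L * \<bar>delta\<bar>" by simp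
   have "norm (of_real (w1 - w2) / Complex 1 a1) = \<bar>w1 - w2\<bar> / norm (Complex 1 a1)"
    by (simp only: norm_divide norm_of_real)
   also have "... <= \<bar>w1 - w2\<bar> / 1" using c1[of a1] by (intro divide_left_mono) auto
   finally show ?thesis using 1 by simp
  qed
  also have "norm (of_real w2 * ((Complex 1 a2 - Complex 1 a1) / (Complex 1 a1 * Complex 1 a2))) <= K * (2 * \<bar>delta\<bar>)"
  proof -
   have "Complex 1 a2 - Complex 1 a1 = \<i> * of_real (a2 - a1)" by (simp add: complex_eq_iff)
   hence 1: "norm (Complex 1 a2 - Complex 1 a1) = 2 * \<bar>delta\<bar>" unfolding delta_def by (simp only: norm_mult norm_ii norm_of_real) auto
   have "1 * 1 <= norm (Complex 1 a1) * norm (Complex 1 a2)" by (intro mult_mono c1) (auto intro: order_trans[OF _ c1])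
   hence 2: "2 * \<bar>delta\<bar> / (norm (Complex 1 a1) * norm (Complex 1 a2)) <= 2 * \<bar>delta\<bar> / 1" by (intro divide_left_mono) auto
   have "norm (of_real w2 * ((Complex 1 a2 - Complex 1 a1) / (Complex 1 a1 * Complex 1 a2))) = \<bar>w2\<bar> * (2 * \<bar>delta\<bar> / (norm (Complex 1 a1) * norm (Complex 1 a2)))"
    by (simp only: norm_mult norm_divide norm_of_real 1)
   also have "... <= K * (2 * \<bar>delta\<bar>)" using 2 w K1 by (intro mult_mono) auto
   finally show ?thesis .
  qed
  finally show ?thesis by (simp add: algebra_simps)
 qed
 have Y2: "norm Y2 <= norm P + K * norm (Y1 - Y2) / 2"
 proof -
  have "Y2 * of_real (w1 + w2) = 2 * P - of_real w1 * (Y1 - Y2)"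
   unfolding Y1_def Y2_def P_def using w by (simp add: field_simps)
  hence "norm Y2 * \<bar>w1 + w2\<bar> = norm (2 * P - of_real w1 * (Y1 - Y2))"
   by (metis norm_mult norm_of_real)
  also have "... <= norm (2 * P) + norm (of_real w1 * (Y1 - Y2))" by (rule norm_triangle_ineq4)
  also have "... = 2 * norm P + w1 * norm (Y1 - Y2)" using w by (simp add: norm_mult)
  also have "... <= 2 * norm P + K * norm (Y1 - Y2)" using w by (intro add_left_mono mult_right_mono) auto
  finally have "norm Y2 * (w1 + w2) <= 2 * norm P + K * norm (Y1 - Y2)" using w by simp
  moreover have "norm Y2 * 2 <= norm Y2 * (w1 + w2)" using w by (intro mult_left_mono) auto
  ultimately show ?thesis by simp
 qed
 define D where "D = norm (Y1 - Y2)"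
 define e where "e = norm P * \<bar>delta\<bar>"
 have d: "\<bar>delta\<bar> <= L" using a unfolding delta_def by auto
 have D0: "D >= 0" "e >= 0" unfolding D_def e_def by auto
 have "P1 / Complex 1 a1 - P2 / Complex 1 a2 = (Y1 - Y2) * k1 + Y2 * (k1 - k2)"
  unfolding q1 by (simp add: algebra_simps)
 hence "norm (P1 / Complex 1 a1 - P2 / Complex 1 a2) <= D * norm k1 + norm Y2 * norm (k1 - k2)"
  unfolding D_def by (metis norm_mult norm_triangle_ineq)
 also have "... <= D * K + (norm P + K * D / 2) * ((4 * L + 2 * K) * \<bar>delta\<bar>)"
  using nk1 nk Y2 D0 K1 L unfolding D_def by (intro add_mono mult_left_mono mult_mono) auto
 also have "... = D * K + (4 * L + 2 * K) * e + (4 * L + 2 * K) * (K * \<bar>delta\<bar> / 2) * D"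
  unfolding e_def by (simp add: algebra_simps)
 also have "... <= D * K + (4 * L + 2 * K) * e + (4 * L + 2 * K) * (K * L / 2) * D"
  using d K1 L D0 by (intro add_left_mono mult_right_mono mult_left_mono divide_right_mono) auto
 also have "... = (K + (4 * L + 2 * K) * (K * L / 2)) * D + (4 * L + 2 * K) * e" by (simp add: algebra_simps)
 finally have "norm (P1 / Complex 1 a1 - P2 / Complex 1 a2) <= (K + (4 * L + 2 * K) * (K * L / 2)) * D + (4 * L + 2 * K) * e" (is "?n <= ?x * D + ?y * e") .
 hence "?n^2 <= (?x * D + ?y * e)^2" by (intro power_mono) auto
 also have "... <= 2 * (?x * D)^2 + 2 * (?y * e)^2"
  using sum_squares_ge_zero[of "?x * D - ?y * e" 0] by (simp add: power2_eq_square algebra_simps)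
 also have "... = 4 * ?x^2 * (D^2 / 2) + (?y * K)^2 * (2 * e^2 / K^2)"
 proof -
  have "2 * (x * D)^2 + 2 * (y * e)^2 = 4 * x^2 * (D^2 / 2) + (y * K)^2 * (2 * e^2 / K^2)" for x y :: real
   using K1 by (simp add: power_mult_distrib)
  thus ?thesis .
 qed
 also have "... <= CB * (D^2 / 2) + CB * (2 * e^2 / K^2)"
  unfolding CB_def by (intro add_mono mult_right_mono) auto
 also have "... <= CB * G"
 proof -
  have "D^2 / 2 + 2 * e^2 / K^2 <= G" using G unfolding D_def e_def by (simp add: power_mult_distrib)
  moreover have "CB >= 0" unfolding CB_def by simp
  ultimately show ?thesis unfolding ring_distribs(1)[symmetric] by (intro mult_left_mono)
 qed
 finally show ?thesis unfolding G_def P_def w1_def w2_def w_def .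
qed

section \<open>Dyadic grids, adapted averages and the square function\<close>

context lip_graph begin

definition ker :: "real => real => real => real => complex" where
 "ker eta \<sigma> e f = cl (of_real \<sigma> * (z f - z e) + \<i> * of_real eta)"

text \<open>The sign \<open>\<sigma>\<close> exchanges the roles of the two variables, so that bounds in one variable give bounds in the other.\<close>
lemma ker_flip: "ker eta \<sigma> e f = ker eta (-\<sigma>) f e"
 unfolding ker_def by (simp add: algebra_simps)

definition C2 :: real where "C2 = 128 * (1 + L)^6 + 75 * C1 * (1 + L)"

lemma C2_pos: "C2 > 0"
 unfolding C2_def using C1_pos L_nonneg by (intro add_nonneg_pos) auto

text \<open>One term for each of the three nodes at which the longer Haar functional samples the kernel.\<close>
definition kap3 :: "real => real => real => real => real" where
 "kap3 h1 h2 a1 a2 = kap h1 h2 \<bar>a1 - a2\<bar> + kap h1 h2 \<bar>a1 + h1/2 - a2\<bar> + kap h1 h2 \<bar>a1 + h1 - a2\<bar>"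

text \<open>For intervals close to each other only the cancellation of the shorter one is used; in this range the bound so
obtained is already of the size of \<open>kap\<close>.\<close>
lemma near_atom_kap:
 assumes "0 < h2" "h2 <= h1" "r <= 4 * h1" "0 <= r"
 shows "h2^2 / (h2 + r) <= 25 * kap h1 h2 r"
proof -
 have "(h1 + r)^2 <= (5 * h1)^2" using assms by (intro power_mono) auto
 hence "(h1 + r)^2 <= 25 * h1^2" by (simp add: power_mult_distrib)
 hence "1 <= 25 * h1^2 / (h1 + r)^2" using assms by simp
 hence "h2^2 / (h2 + r) * 1 <= h2^2 / (h2 + r) * (25 * h1^2 / (h1 + r)^2)"
  using assms by (intro mult_left_mono) auto
 moreover have "h2^2 / (h2 + r) * (25 * h1^2 / (h1 + r)^2) = 25 * kap h1 h2 r" unfolding kap_def by simp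
 ultimately show ?thesis by simp
qed

lemma Th_ker_bound:
 assumes "h > 0" "eta > 0" "\<sigma> \<in> {1, -1}"
 shows "norm (Th a h (%f. ker eta \<sigma> e f)) <= C1 * h^2 / (h + \<bar>e - a\<bar>)"
 unfolding ker_def by (rule atom_bound[OF assms])

lemma Th_Th_ker_bound:
 assumes h: "0 < h2" "h2 <= h1" and eta: "eta > 0" and \<sigma>: "\<sigma> \<in> {1, -1}"
 shows "norm (Th a1 h1 (%e. Th a2 h2 (%f. ker eta \<sigma> e f))) <= C2 * kap3 h1 h2 a1 a2"
proof (cases "\<bar>a1 - a2\<bar> >= 3 * h1")
 case True
 define r where "r = \<bar>a1 - a2\<bar>"
 have r: "r >= 3 * h1" "r > 0" "h1 > 0" using True h unfolding r_def by auto
 have "norm (Th a1 h1 (%e. Th a2 h2 (%f. ker eta \<sigma> e f))) <= 16 * (1 + L)^6 * h1^2 * h2^2 / r^3"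
 proof (cases "\<sigma> = 1")
  case True
  thus ?thesis unfolding r_def ker_def
   using atoms_far[OF r(3) h(1) eta, of a1 a2] r h unfolding r_def by simp
 next
  case False
  hence "\<sigma> = -1" using \<sigma> by simp
  thus ?thesis using atoms_far[OF h(1) r(3) eta, of a2 a1] r h
   unfolding ker_def r_def by (subst Th_swap) (simp add: abs_minus_commute mult.commute mult.left_commute)
 qed
 also have "... <= 128 * (1 + L)^6 * kap h1 h2 r"
 proof -
  have "(h2 + r) * (h1 + r)^2 <= (2 * r) * (2 * r)^2"
   using r h by (intro mult_mono power_mono) auto
  also have "... = 8 * r^3" by (simp add: power2_eq_square power3_eq_cube)
  finally have "h1^2 * h2^2 / (8 * r^3) <= kap h1 h2 r"
   unfolding kap_def using r h by (intro divide_left_mono mult_pos_pos) auto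
  hence "128 * (1 + L)^6 * (h1^2 * h2^2 / (8 * r^3)) <= 128 * (1 + L)^6 * kap h1 h2 r"
   using L_nonneg by (intro mult_left_mono) auto
  moreover have "128 * (1 + L)^6 * (h1^2 * h2^2 / (8 * r^3)) = 16 * (1 + L)^6 * h1^2 * h2^2 / r^3" by simp
  ultimately show ?thesis by (simp only:)
 qed
 also have "... <= C2 * kap3 h1 h2 a1 a2"
 proof (intro mult_mono)
  show "128 * (1 + L)^6 <= C2" unfolding C2_def using C1_pos L_nonneg by simp
  show "kap h1 h2 r <= kap3 h1 h2 a1 a2" unfolding kap3_def r_def using r h kap_nonneg[of h1 h2] by simp
 qed (use C2_pos kap_nonneg[of h1 h2 r] r h in auto)
 finally show ?thesis .
next
 case False
 have h1: "h1 > 0" using h by simp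
 have b: "norm (Th a2 h2 (%f. ker eta \<sigma> e f)) <= C1 * (25 * kap h1 h2 \<bar>e - a2\<bar>)" if "a1 <= e" "e <= a1 + h1" for e
 proof -
  have "norm (Th a2 h2 (%f. ker eta \<sigma> e f)) <= C1 * (h2^2 / (h2 + \<bar>e - a2\<bar>))"
   using Th_ker_bound[OF h(1) eta \<sigma>] by simp
  also have "... <= C1 * (25 * kap h1 h2 \<bar>e - a2\<bar>)"
   using C1_pos False that h by (intro mult_left_mono near_atom_kap) auto
  finally show ?thesis .
 qed
 let ?F = "%e. Th a2 h2 (%f. ker eta \<sigma> e f)"
 have "norm (Th a1 h1 ?F) <= norm (?F (a1 + h1/2)) + norm (wt a1 h1) * norm (?F a1) + norm (1 - wt a1 h1) * norm (?F (a1 + h1))"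
  unfolding Th_def[of a1] by (intro order_trans[OF norm_triangle_ineq4] add_mono) (auto simp: norm_mult)
 also have "... <= (1 + L) * (C1 * (25 * kap h1 h2 \<bar>a1 + h1/2 - a2\<bar>)) + (1 + L) * (C1 * (25 * kap h1 h2 \<bar>a1 - a2\<bar>)) + (1 + L) * (C1 * (25 * kap h1 h2 \<bar>a1 + h1 - a2\<bar>))"
 proof (intro add_mono mult_mono b wt_bound h1)
  have "norm (?F (a1 + h1/2)) <= 1 * (C1 * (25 * kap h1 h2 \<bar>a1 + h1/2 - a2\<bar>))" using b[of "a1 + h1/2"] h1 by simp
  also have "... <= (1 + L) * (C1 * (25 * kap h1 h2 \<bar>a1 + h1/2 - a2\<bar>))"
   using L_nonneg C1_pos h1 h by (intro mult_right_mono) (auto intro!: mult_nonneg_nonneg kap_nonneg)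
  finally show "norm (?F (a1 + h1/2)) <= (1 + L) * (C1 * (25 * kap h1 h2 \<bar>a1 + h1/2 - a2\<bar>))" .
 qed (use h1 L_nonneg in auto)
 also have "... = 25 * C1 * (1 + L) * kap3 h1 h2 a1 a2" unfolding kap3_def by (simp add: algebra_simps)
 also have "... <= C2 * kap3 h1 h2 a1 a2"
 proof (intro mult_right_mono)
  show "25 * C1 * (1 + L) <= C2" unfolding C2_def using C1_pos L_nonneg by (simp add: algebra_simps add_increasing)
  show "0 <= kap3 h1 h2 a1 a2" unfolding kap3_def using h h1 by (intro add_nonneg_nonneg kap_nonneg) auto
 qed
 finally show ?thesis .
qed

end

text \<open>The dyadic grid of generation \<open>k\<close> on \<open>[X, X + l]\<close>, with mesh \<open>gh l k\<close>.\<close>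
definition gp :: "real => real => nat => nat => real" where "gp X l k i = X + l * real i / 2 ^ k"
definition gh :: "real => nat => real" where "gh l k = l / 2 ^ k"

lemma gp_simps:
 "gp X l k i + gh l k = gp X l k (Suc i)"
 "gp X l k i + gh l k / 2 = gp X l (Suc k) (Suc (2 * i))"
 "gp X l (Suc k) (2 * i) = gp X l k i"
 "gp X l (Suc k) (Suc (Suc (2 * i))) = gp X l k (Suc i)"
 "gp X l 0 0 = X" "gp X l 0 (Suc 0) = X + l"
 "gp X l k (Suc i) - gp X l k i = gh l k"
 "gh l (Suc k) = gh l k / 2"
 by (simp_all add: gp_def gh_def field_simps)

text \<open>The row sums gain the square root \<open>t\<^sup>2\<close> of the ratio of the two scales. After balancing in Schur's
test a factor \<open>t\<close> is left, and the sum over all pairs of scales is a geometric series.\<close>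
lemma kap_sums:
 assumes C0: "!!(y::real) n. (\<Sum>i<n. (1 + \<bar>y - real i\<bar>) powr (-3/2)) <= C0" and l: "l > 0" and kl: "k <= m"
  and t: "t = (2 powr (-1/4)) ^ (m - k)"
 shows "(\<Sum>j<n. kap (gh l k) (gh l m) \<bar>e - gp X l m j\<bar>) <= C0 * gh l k * t^2"
  and "(\<Sum>i<n. kap (gh l k) (gh l m) \<bar>gp X l k i + c - a\<bar>) <= C0 * gh l m"
  and "gh l m = gh l k * t^4"
proof -
 have h: "gh l k > 0" "gh l m > 0" using l by (auto simp: gh_def)
 have le: "gh l m <= gh l k" unfolding gh_def using l kl by (intro divide_left_mono power_increasing) auto
 have C0p: "C0 >= 0" using C0[of 0 0] by simp
 show t4: "gh l m = gh l k * t^4"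
 proof -
  have "(2 powr (-1/4) :: real)^4 = 2 powr (-1)" by (simp add: powr_power)
  also have "... = 1/2" by (simp add: powr_minus_divide)
  finally have e: "(2 powr (-1/4) :: real)^4 = 1/2" .
  have "t^4 = ((2 powr (-1/4))^4)^(m - k)" unfolding t
   by (simp only: power_mult[symmetric] mult.commute)
  hence "t^4 = (1/2)^(m - k)" by (simp only: e)
  thus ?thesis using kl unfolding gh_def by (simp add: power_diff power_one_over)
 qed
 have t0: "t > 0" unfolding t by simp
 have sq: "sqrt (gh l k * gh l m) = gh l k * t^2"
 proof -
  have "gh l k * gh l m = (gh l k * t^2)^2" unfolding t4 by (simp add: power2_eq_square power4_eq_xxxx)
  thus ?thesis using h t0 by simp
 qed
 have "(\<Sum>j<n. kap (gh l k) (gh l m) \<bar>e - gp X l m j\<bar>) <= (\<Sum>j<n. gh l k * t^2 * (1 + \<bar>(e - X) / gh l m - real j\<bar>) powr (-3/2))"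
 proof (intro sum_mono)
  fix j
  have "\<bar>e - gp X l m j\<bar> / gh l m = \<bar>(e - gp X l m j) / gh l m\<bar>" using h by simp
  also have "(e - gp X l m j) / gh l m = (e - X) / gh l m - real j"
   using l by (simp add: gp_def gh_def field_simps)
  finally show "kap (gh l k) (gh l m) \<bar>e - gp X l m j\<bar> <= gh l k * t^2 * (1 + \<bar>(e - X) / gh l m - real j\<bar>) powr (-3/2)"
   using kap_row[OF h(2) le, of "\<bar>e - gp X l m j\<bar>"] sq by simp
 qed
 also have "... <= gh l k * t^2 * C0"
  unfolding sum_distrib_left[symmetric] using h t0 by (intro mult_left_mono C0) auto
 finally show "(\<Sum>j<n. kap (gh l k) (gh l m) \<bar>e - gp X l m j\<bar>) <= C0 * gh l k * t^2" by (simp add: mult.commute mult.left_commute)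
 have "(\<Sum>i<n. kap (gh l k) (gh l m) \<bar>gp X l k i + c - a\<bar>) <= (\<Sum>i<n. gh l m * (1 + \<bar>(a - c - X) / gh l k - real i\<bar>) powr (-3/2))"
 proof (intro sum_mono)
  fix i
  have "\<bar>gp X l k i + c - a\<bar> / gh l k = \<bar>(gp X l k i + c - a) / gh l k\<bar>" using h by simp
  also have "(gp X l k i + c - a) / gh l k = - ((a - c - X) / gh l k - real i)"
   using l by (simp add: gp_def gh_def field_simps)
  finally show "kap (gh l k) (gh l m) \<bar>gp X l k i + c - a\<bar> <= gh l m * (1 + \<bar>(a - c - X) / gh l k - real i\<bar>) powr (-3/2)"
   using kap_col[OF h(2) h(1), of "\<bar>gp X l k i + c - a\<bar>"] by (simp add: abs_minus_commute)
 qed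
 also have "... <= gh l m * C0"
  unfolding sum_distrib_left[symmetric] using h by (intro mult_left_mono C0) auto
 finally show "(\<Sum>i<n. kap (gh l k) (gh l m) \<bar>gp X l k i + c - a\<bar>) <= C0 * gh l m" by (simp add: mult.commute)
qed

context lip_graph begin

lemma kap3_schur:
 fixes u v :: "nat => real"
 assumes C0: "!!(y::real) n. (\<Sum>i<n. (1 + \<bar>y - real i\<bar>) powr (-3/2)) <= C0" and l: "l > 0" and kl: "k <= m"
  and t: "t = (2 powr (-1/4)) ^ (m - k)"
 shows "(\<Sum>i<n1. \<Sum>j<n2. u i * v j * kap3 (gh l k) (gh l m) (gp X l k i) (gp X l m j))
  <= 3 * C0 / 2 * t * (gh l k * (\<Sum>i<n1. (u i)^2) + gh l m * (\<Sum>j<n2. (v j)^2))"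
proof -
 note ks = kap_sums[OF C0 l kl t]
 have h: "gh l k > 0" "gh l m > 0" using l by (auto simp: gh_def)
 have t0: "t > 0" unfolding t by simp
 let ?K = "%i j. kap3 (gh l k) (gh l m) (gp X l k i) (gp X l m j)"
 have "(\<Sum>i<n1. \<Sum>j<n2. u i * v j * ?K i j) <= (3 * C0 * gh l k * t^2 / t * (\<Sum>i<n1. (u i)^2) + 3 * C0 * gh l m * t * (\<Sum>j<n2. (v j)^2)) / 2"
 proof (rule schur_pair)
  show "0 <= ?K i j" for i j unfolding kap3_def using h by (intro add_nonneg_nonneg kap_nonneg) auto
  show "(\<Sum>j<n2. ?K i j) <= 3 * C0 * gh l k * t^2" for i
   unfolding kap3_def sum.distrib using ks(1)[where n = n2 and X = X and e = "gp X l k i"] ks(1)[where n = n2 and X = X and e = "gp X l k i + gh l k / 2"] ks(1)[where n = n2 and X = X and e = "gp X l k i + gh l k"]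
   by linarith
  show "(\<Sum>i<n1. ?K i j) <= 3 * C0 * gh l m" for j
   unfolding kap3_def sum.distrib using ks(2)[where n = n1 and X = X and c = 0 and a = "gp X l m j"] ks(2)[where n = n1 and X = X and c = "gh l k / 2" and a = "gp X l m j"] ks(2)[where n = n1 and X = X and c = "gh l k" and a = "gp X l m j"]
   by simp
  show "t > 0" by (rule t0)
 qed
 also have "3 * C0 * gh l k * t^2 / t = 3 * C0 * gh l k * t" using t0 by (simp add: power2_eq_square)
 also have "(3 * C0 * gh l k * t * (\<Sum>i<n1. (u i)^2) + 3 * C0 * gh l m * t * (\<Sum>j<n2. (v j)^2)) / 2 = 3 * C0 / 2 * t * (gh l k * (\<Sum>i<n1. (u i)^2) + gh l m * (\<Sum>j<n2. (v j)^2))"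
  by (simp add: field_simps)
 finally show ?thesis .
qed

text \<open>The value on a dyadic interval is the average, with respect to \<open>dz\<close>, of the values on its two halves.\<close>
definition averages :: "real => real => nat => (nat => nat => complex) => bool" where
 "averages X l N q \<longleftrightarrow> (\<forall>k<N. \<forall>i<2^k. (z (gp X l k (Suc i)) - z (gp X l k i)) * q k i =
   (z (gp X l (Suc k) (Suc (2*i))) - z (gp X l (Suc k) (2*i))) * q (Suc k) (2*i) +
   (z (gp X l (Suc k) (Suc (Suc (2*i)))) - z (gp X l (Suc k) (Suc (2*i)))) * q (Suc k) (Suc (2*i)))"

definition jump :: "(nat => nat => complex) => nat => nat => complex" where
 "jump q k i = q (Suc k) (2*i) - q (Suc k) (Suc (2*i))"

text \<open>The integral of \<open>d\<Phi>\<close> against the step function with values \<open>q k\<close>.\<close>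
definition stp :: "real => real => nat => (nat => nat => complex) => (real => complex) => complex" where
 "stp X l k q \<Phi> = (\<Sum>i<2^k. q k i * (\<Phi> (gp X l k (Suc i)) - \<Phi> (gp X l k i)))"

text \<open>A step function minus its average on the next coarser grid is a combination of adapted Haar functions.\<close>
lemma stp_Suc:
 assumes "averages X l N q" "k < N" "l > 0"
 shows "stp X l (Suc k) q \<Phi> - stp X l k q \<Phi> = (\<Sum>i<2^k. jump q k i * Th (gp X l k i) (gh l k) \<Phi>)"
proof -
 have "stp X l (Suc k) q \<Phi> = (\<Sum>i<2^k. q (Suc k) (2*i) * (\<Phi> (gp X l (Suc k) (Suc (2*i))) - \<Phi> (gp X l (Suc k) (2*i))) +
   q (Suc k) (Suc (2*i)) * (\<Phi> (gp X l (Suc k) (Suc (Suc (2*i)))) - \<Phi> (gp X l (Suc k) (Suc (2*i)))))"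
  unfolding stp_def power_Suc sum_pairs by simp
 hence "stp X l (Suc k) q \<Phi> - stp X l k q \<Phi> = (\<Sum>i<2^k. q (Suc k) (2*i) * (\<Phi> (gp X l (Suc k) (Suc (2*i))) - \<Phi> (gp X l (Suc k) (2*i))) +
   q (Suc k) (Suc (2*i)) * (\<Phi> (gp X l (Suc k) (Suc (Suc (2*i)))) - \<Phi> (gp X l (Suc k) (Suc (2*i)))) - q k i * (\<Phi> (gp X l k (Suc i)) - \<Phi> (gp X l k i)))"
  unfolding stp_def by (simp add: sum_subtractf)
 also have "... = (\<Sum>i<2^k. jump q k i * Th (gp X l k i) (gh l k) \<Phi>)"
 proof (rule sum.cong[OF refl])
  fix i assume "i \<in> {..<(2::nat)^k}"
  hence i: "i < 2^k" by simp
  let ?a = "gp X l k i" and ?c = "gp X l (Suc k) (Suc (2*i))" and ?b = "gp X l k (Suc i)"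
  let ?w = "wt ?a (gh l k)"
  have nz: "z ?b - z ?a ~= 0" using z_diff_nz[of ?b ?a] assms(3) by (simp add: gp_def field_simps)
  have w: "?w * (z ?b - z ?a) = z ?b - z ?c" unfolding wt_def gp_simps using nz by simp
  have "(z ?b - z ?a) * q k i = (z ?c - z ?a) * q (Suc k) (2*i) + (z ?b - z ?c) * q (Suc k) (Suc (2*i))"
   using assms(1,2) i unfolding averages_def by (simp add: gp_simps)
  also have "... = (z ?b - z ?a) * ((1 - ?w) * q (Suc k) (2*i) + ?w * q (Suc k) (Suc (2*i)))"
  proof -
   have gen: "((1 - w') * D) * p + (w' * D) * r = D * ((1 - w') * p + w' * r)" for w' D p r :: complex
    by (simp add: algebra_simps)
   have e: "z ?c - z ?a = (1 - ?w) * (z ?b - z ?a)" using w by (simp add: algebra_simps)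
   show ?thesis unfolding w[symmetric] e by (rule gen)
  qed
  finally have q: "q k i = (1 - ?w) * q (Suc k) (2*i) + ?w * q (Suc k) (Suc (2*i))" using nz by simp
  show "q (Suc k) (2*i) * (\<Phi> ?c - \<Phi> (gp X l (Suc k) (2*i))) +
   q (Suc k) (Suc (2*i)) * (\<Phi> (gp X l (Suc k) (Suc (Suc (2*i)))) - \<Phi> ?c) - q k i * (\<Phi> ?b - \<Phi> ?a) = jump q k i * Th ?a (gh l k) \<Phi>"
   unfolding jump_def Th_def q gp_simps by (simp add: algebra_simps)
 qed
 finally show ?thesis .
qed

lemma stp_expand:
 assumes "averages X l N q" "l > 0"
 shows "stp X l N q \<Phi> = q 0 0 * (\<Phi> (X + l) - \<Phi> X) + (\<Sum>k<N. \<Sum>i<2^k. jump q k i * Th (gp X l k i) (gh l k) \<Phi>)"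
proof -
 have "stp X l N q \<Phi> - stp X l 0 q \<Phi> = (\<Sum>k<N. stp X l (Suc k) q \<Phi> - stp X l k q \<Phi>)"
  by (subst sum_lessThan_telescope) (rule refl)
 also have "... = (\<Sum>k<N. \<Sum>i<2^k. jump q k i * Th (gp X l k i) (gh l k) \<Phi>)"
  by (intro sum.cong refl stp_Suc[OF assms(1) _ assms(2)]) auto
 finally show ?thesis by (simp add: stp_def gp_simps algebra_simps)
qed

text \<open>The constant of \<open>bellman_step\<close> for \<open>K = L\<^sup>2 + 1\<close>.\<close>
definition CB :: real where
 "CB = 4 * ((L^2 + 1) + (4 * L + 2 * (L^2 + 1)) * ((L^2 + 1) * L / 2))^2 + ((4 * L + 2 * (L^2 + 1)) * (L^2 + 1))^2"

definition nrm2 :: "real => nat => (nat => nat => complex) => real" where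
 "nrm2 l N q = (\<Sum>i<2^N. gh l N * (norm (q N i))^2)"

definition CS :: real where "CS = (2 * CB + (L^2 + 1)) * (1 + L)^2"

text \<open>The mean over the grid of the Bellman function increases with the generation, and by \<open>bellman_step\<close> each increment
dominates the squared jumps of that generation; the sum telescopes.\<close>
lemma square_function:
 assumes av: "averages X l N q" and l: "l > 0"
 shows "l * (norm (q 0 0))^2 + (\<Sum>k<N. \<Sum>i<2^k. gh l k * (norm (jump q k i))^2) <= CS * nrm2 l N q"
proof -
 let ?K = "L^2 + 1"
 define m where "m = (%k i. z (gp X l k (Suc i)) - z (gp X l k i))"
 define al where "al = (%k i. Im (m k i) / gh l k)"
 define P where "P = (%k i. m k i * q k i / of_real (gh l k))"
 define B where "B = (%k i. (norm (P k i))^2 / (?K - (al k i)^2))"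
 define T where "T = (%k. \<Sum>i<2^k. gh l k * B k i)"
 have h: "gh l k > 0" for k using l by (simp add: gh_def)
 have al: "\<bar>al k i\<bar> <= L" for k i
 proof -
  have "\<bar>Im (m k i)\<bar> <= L * gh l k" unfolding m_def
   using lip[of "gp X l k (Suc i)" "gp X l k i"] h[of k] by (simp add: gp_simps)
  thus ?thesis unfolding al_def using h[of k] by (simp add: abs_divide pos_divide_le_eq)
 qed
 have w: "1 <= ?K - (al k i)^2" "?K - (al k i)^2 <= ?K" for k i
  using al[of k i] L_nonneg abs_le_square_iff[of "al k i" L] by auto
 have m: "m k i = of_real (gh l k) * Complex 1 (al k i)" for k i
  unfolding al_def using h[of k] by (simp add: complex_eq_iff m_def gp_simps)
 have PC: "P k i = Complex 1 (al k i) * q k i" for k i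
  unfolding P_def m using h[of k] by simp
 have c1: "norm (Complex 1 x) >= 1" for x using complex_Re_le_cmod[of "Complex 1 x"] by simp
 have nz: "Complex 1 x ~= 0" for x using c1[of x] by auto
 have q: "q k i = P k i / Complex 1 (al k i)" for k i unfolding PC using nz by simp
 have B0: "B k i >= 0" for k i unfolding B_def using w[of k i] by simp
 have CB0: "CB >= 0" unfolding CB_def by simp
 have step: "(\<Sum>i<2^k. gh l k * (norm (jump q k i))^2) <= 2 * CB * (T (Suc k) - T k)" if "k < N" for k
 proof -
  have one: "gh l k * (norm (jump q k i))^2 <= 2 * CB * (gh l (Suc k) * B (Suc k) (2*i) + gh l (Suc k) * B (Suc k) (Suc (2*i)) - gh l k * B k i)"
   if i: "i < 2^k" for i
  proof -
   have mm: "m k i = m (Suc k) (2*i) + m (Suc k) (Suc (2*i))" unfolding m_def by (simp add: gp_simps)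
   have "m k i * q k i = m (Suc k) (2*i) * q (Suc k) (2*i) + m (Suc k) (Suc (2*i)) * q (Suc k) (Suc (2*i))"
    using av i \<open>k < N\<close> unfolding averages_def m_def by simp
   hence PP: "P k i = (P (Suc k) (2*i) + P (Suc k) (Suc (2*i))) / 2"
    unfolding P_def gp_simps(8) using h[of k] by (simp add: add_divide_distrib)
   have aa: "al k i = (al (Suc k) (2*i) + al (Suc k) (Suc (2*i))) / 2"
    unfolding al_def mm gp_simps(8) using h[of k] by (simp add: add_divide_distrib)
   have "(norm (jump q k i))^2 <= CB * (B (Suc k) (2*i) + B (Suc k) (Suc (2*i)) - 2 * (norm (P k i))^2 / (?K - (al k i)^2))"
    unfolding jump_def q[of "Suc k"] CB_def B_def PP aa
    by (rule bellman_step[OF L_nonneg al al])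
   hence "(norm (jump q k i))^2 <= CB * (B (Suc k) (2*i) + B (Suc k) (Suc (2*i)) - 2 * B k i)"
    unfolding B_def[of ] by simp
   hence "gh l k * (norm (jump q k i))^2 <= gh l k * (CB * (B (Suc k) (2*i) + B (Suc k) (Suc (2*i)) - 2 * B k i))"
    using h[of k] by (intro mult_left_mono) auto
   thus ?thesis unfolding gp_simps(8) by (simp add: algebra_simps)
  qed
  have "(\<Sum>i<2^k. gh l k * (norm (jump q k i))^2) <= (\<Sum>i<2^k. 2 * CB * (gh l (Suc k) * B (Suc k) (2*i) + gh l (Suc k) * B (Suc k) (Suc (2*i)) - gh l k * B k i))"
   by (intro sum_mono one) auto
  also have "... = 2 * CB * (T (Suc k) - T k)"
   unfolding T_def power_Suc sum_pairs sum_distrib_left[symmetric] sum_subtractf by (simp add: sum_distrib_left distrib_left)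
  finally show ?thesis .
 qed
 have T0: "T k >= 0" for k unfolding T_def using h[of k] B0 by (intro sum_nonneg mult_nonneg_nonneg) auto
 have mono: "T 0 <= T n" if "n <= N" for n using that
 proof (induction n)
  case (Suc n)
  have "0 <= 2 * CB * (T (Suc n) - T n)"
   using order_trans[OF sum_nonneg step[of n]] Suc.prems h[of n] by (simp add: sum_nonneg)
  moreover have "CB > 0" unfolding CB_def using L_nonneg by (intro add_pos_nonneg mult_pos_pos zero_less_power add_nonneg_pos) (auto intro: add_nonneg_pos)
  ultimately have "T n <= T (Suc n)" by (simp add: zero_le_mult_iff)
  thus ?case using Suc by simp
 qed simp
 have "(\<Sum>k<N. \<Sum>i<2^k. gh l k * (norm (jump q k i))^2) <= (\<Sum>k<N. 2 * CB * (T (Suc k) - T k))"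
  by (intro sum_mono step) auto
 also have "... = 2 * CB * (T N - T 0)" unfolding sum_distrib_left[symmetric] by (simp add: sum_lessThan_telescope)
 also have "... <= 2 * CB * T N" using CB0 T0[of 0] by (intro mult_left_mono) auto
 finally have 1: "(\<Sum>k<N. \<Sum>i<2^k. gh l k * (norm (jump q k i))^2) <= 2 * CB * T N" .
 have "l * (norm (q 0 0))^2 <= ?K * T 0"
 proof -
  have "norm (q 0 0) <= norm (P 0 0)"
  proof -
   have "1 * norm (q 0 0) <= norm (Complex 1 (al 0 0)) * norm (q 0 0)" by (intro mult_right_mono c1) auto
   thus ?thesis unfolding PC norm_mult by simp
  qed
  hence "(norm (q 0 0))^2 <= (norm (P 0 0))^2" by (intro power_mono) auto
  also have "... <= ?K * B 0 0"
  proof -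
   have "1 <= ?K / (?K - (al 0 0)^2)" using w[of 0 0] by simp
   hence "(norm (P 0 0))^2 * 1 <= (norm (P 0 0))^2 * (?K / (?K - (al 0 0)^2))" by (intro mult_left_mono) auto
   thus ?thesis unfolding B_def by (simp add: mult.commute)
  qed
  finally have "l * (norm (q 0 0))^2 <= l * (?K * B 0 0)" using l by (intro mult_left_mono) auto
  thus ?thesis unfolding T_def by (simp add: gh_def algebra_simps)
 qed
 also have "... <= ?K * T N" using mono[of N] by (intro mult_left_mono) auto
 finally have 2: "l * (norm (q 0 0))^2 <= ?K * T N" .
 have "T N <= (1 + L)^2 * nrm2 l N q"
 proof -
  have "T N <= (\<Sum>i<2^N. gh l N * ((1 + L)^2 * (norm (q N i))^2))"
   unfolding T_def
  proof (intro sum_mono mult_left_mono)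
   fix i
   have "B N i <= (norm (P N i))^2 / 1" unfolding B_def using w[of N i] by (intro divide_left_mono) auto
   also have "... = (norm (P N i))^2" by simp
   also have "norm (P N i) <= (1 + L) * norm (q N i)"
   proof -
    have "norm (Complex 1 (al N i)) <= 1 + L" using cmod_le[of "Complex 1 (al N i)"] al[of N i] by simp
    thus ?thesis unfolding PC norm_mult by (intro mult_right_mono) auto
   qed
   hence "(norm (P N i))^2 <= ((1 + L) * norm (q N i))^2" by (intro power_mono) auto
   finally show "B N i <= (1 + L)^2 * (norm (q N i))^2" by (simp add: power_mult_distrib)
  qed (use h[of N] in auto)
  also have "... = (1 + L)^2 * nrm2 l N q" unfolding nrm2_def sum_distrib_left by (simp add: algebra_simps)
  finally show ?thesis .
 qed
 hence "(2 * CB + ?K) * T N <= (2 * CB + ?K) * ((1 + L)^2 * nrm2 l N q)"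
  using CB0 by (intro mult_left_mono) auto
 thus ?thesis using 1 2 unfolding CS_def by (simp add: algebra_simps)
qed

end

section \<open>The discrete bilinear estimate\<close>

lemma const_arith: "a * (3 * b / 2) * (2 / x * Y) = 3 * a * b / x * Y" for a b x Y :: real
 by (cases "x = 0") (simp_all add: field_simps)

context lip_graph begin

text \<open>Sums over one pair of generations are bounded by \<open>kap3_schur\<close> with geometric decay in the difference of the generations.\<close>
lemma jumps_bound:
 assumes C0: "!!(y::real) n. (\<Sum>i<n. (1 + \<bar>y - real i\<bar>) powr (-3/2)) <= C0" and l: "l > 0" and eta: "eta > 0"
 defines "tau \<equiv> 2 powr (-1/4) :: real"
 shows "norm (\<Sum>k<N. \<Sum>i<2^k. jump q k i * Th (gp X l k i) (gh l k) (%e. \<Sum>m<N. \<Sum>j<2^m. jump q' m j * Th (gp X l m j) (gh l m) (%f. ker eta 1 e f)))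
  <= 3 * C2 * C0 / (1 - tau) * ((\<Sum>k<N. \<Sum>i<2^k. gh l k * (norm (jump q k i))^2) + (\<Sum>k<N. \<Sum>i<2^k. gh l k * (norm (jump q' k i))^2))"
proof -
 have tau: "0 <= tau" "tau < 1" unfolding tau_def by (auto intro: powr_less_one)
 have C0p: "C0 >= 0" using C0[of 0 0] by simp
 have h: "gh l k > 0" for k using l by (simp add: gh_def)
 define U where "U = (%k. \<Sum>i<2^k. gh l k * (norm (jump q k i))^2)"
 define V where "V = (%k. \<Sum>i<2^k. gh l k * (norm (jump q' k i))^2)"
 define E where "E = (%k i m j. Th (gp X l k i) (gh l k) (%e. Th (gp X l m j) (gh l m) (%f. ker eta 1 e f)))"
 have UV: "U k >= 0" "V k >= 0" for k unfolding U_def V_def using h[of k] by (auto intro!: sum_nonneg)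
 have ex: "(\<Sum>k<N. \<Sum>i<2^k. jump q k i * Th (gp X l k i) (gh l k) (%e. \<Sum>m<N. \<Sum>j<2^m. jump q' m j * Th (gp X l m j) (gh l m) (%f. ker eta 1 e f)))
  = (\<Sum>k<N. \<Sum>i<2^k. \<Sum>m<N. \<Sum>j<2^m. jump q k i * (jump q' m j * E k i m j))"
  unfolding E_def Th_sum Th_mult sum_distrib_left ..
 have sw: "(\<Sum>k<N. \<Sum>i<2^k. \<Sum>m<N. \<Sum>j<2^m. g k i m j) = (\<Sum>k<N. \<Sum>m<N. \<Sum>i<2^k. \<Sum>j<2^m. g k i m j)" for g :: "nat => nat => nat => nat => complex"
  by (rule sum.cong[OF refl]) (rule sum.swap)
 let ?d = "%k m::nat. if k <= m then m - k else k - m"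
 have blk: "norm (\<Sum>i<2^k. \<Sum>j<2^m. jump q k i * (jump q' m j * E k i m j)) <= C2 * (3 * C0 / 2) * (tau ^ ?d k m * (U k + V m))" for k m
 proof -
  let ?u = "%i. norm (jump q k i)" and ?v = "%j. norm (jump q' m j)"
  have n1: "norm (\<Sum>i<2^k. \<Sum>j<2^m. jump q k i * (jump q' m j * E k i m j)) <= (\<Sum>i<2^k. \<Sum>j<2^m. ?u i * ?v j * norm (E k i m j))"
   by (intro order_trans[OF norm_sum] sum_mono) (simp add: norm_mult mult.assoc)
  have UVe: "gh l k * (\<Sum>i<2^k. (?u i)^2) = U k" "gh l m * (\<Sum>j<2^m. (?v j)^2) = V m"
   unfolding U_def V_def sum_distrib_left by simp_all
  show ?thesis
  proof (cases "k <= m")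
   case True
   have "(\<Sum>i<2^k. \<Sum>j<2^m. ?u i * ?v j * norm (E k i m j)) <= (\<Sum>i<2^k. \<Sum>j<2^m. C2 * (?u i * ?v j * kap3 (gh l k) (gh l m) (gp X l k i) (gp X l m j)))"
   proof (intro sum_mono)
    fix i j
    have "gh l m <= gh l k" unfolding gh_def using l True by (intro divide_left_mono power_increasing) auto
    hence "norm (E k i m j) <= C2 * kap3 (gh l k) (gh l m) (gp X l k i) (gp X l m j)"
    unfolding E_def by (intro Th_Th_ker_bound[OF h[of m] _ eta]) auto
    hence "?u i * ?v j * norm (E k i m j) <= ?u i * ?v j * (C2 * kap3 (gh l k) (gh l m) (gp X l k i) (gp X l m j))"
    by (intro mult_left_mono) auto
    thus "?u i * ?v j * norm (E k i m j) <= C2 * (?u i * ?v j * kap3 (gh l k) (gh l m) (gp X l k i) (gp X l m j))"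
    by (simp only: mult.left_commute mult.assoc)
   qed
   also have "... = C2 * (\<Sum>i<2^k. \<Sum>j<2^m. ?u i * ?v j * kap3 (gh l k) (gh l m) (gp X l k i) (gp X l m j))"
    unfolding sum_distrib_left ..
   also have "... <= C2 * (3 * C0 / 2 * tau ^ (m - k) * (U k + V m))"
    unfolding UVe[symmetric] tau_def using C2_pos
    by (intro mult_left_mono kap3_schur[OF C0 l True refl]) auto
   finally show ?thesis using n1 True by (simp add: mult.assoc)
  next
   case False
   hence mk: "m <= k" by simp
   have "(\<Sum>i<2^k. \<Sum>j<2^m. ?u i * ?v j * norm (E k i m j)) = (\<Sum>j<2^m. \<Sum>i<2^k. ?v j * ?u i * norm (E k i m j))"
    by (subst sum.swap) (simp add: mult.commute)
   also have "... <= (\<Sum>j<2^m. \<Sum>i<2^k. C2 * (?v j * ?u i * kap3 (gh l m) (gh l k) (gp X l m j) (gp X l k i)))"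
   proof (intro sum_mono)
    fix i j
    have "gh l k <= gh l m" unfolding gh_def using l mk by (intro divide_left_mono power_increasing) auto
    hence "norm (Th (gp X l m j) (gh l m) (%f. Th (gp X l k i) (gh l k) (%e. ker eta (-1) f e))) <= C2 * kap3 (gh l m) (gh l k) (gp X l m j) (gp X l k i)"
    by (intro Th_Th_ker_bound[OF h[of k] _ eta]) auto
    moreover have "E k i m j = Th (gp X l m j) (gh l m) (%f. Th (gp X l k i) (gh l k) (%e. ker eta (-1) f e))"
    unfolding E_def by (subst Th_swap) (subst ker_flip, rule refl)
    ultimately have "norm (E k i m j) <= C2 * kap3 (gh l m) (gh l k) (gp X l m j) (gp X l k i)" by simp
    hence "?v j * ?u i * norm (E k i m j) <= ?v j * ?u i * (C2 * kap3 (gh l m) (gh l k) (gp X l m j) (gp X l k i))"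
    by (intro mult_left_mono) auto
    thus "?v j * ?u i * norm (E k i m j) <= C2 * (?v j * ?u i * kap3 (gh l m) (gh l k) (gp X l m j) (gp X l k i))"
    by (simp only: mult.left_commute mult.assoc)
   qed
   also have "... = C2 * (\<Sum>j<2^m. \<Sum>i<2^k. ?v j * ?u i * kap3 (gh l m) (gh l k) (gp X l m j) (gp X l k i))"
    unfolding sum_distrib_left ..
   also have "... <= C2 * (3 * C0 / 2 * tau ^ (k - m) * (V m + U k))"
    unfolding UVe[symmetric] tau_def using C2_pos
    by (intro mult_left_mono kap3_schur[OF C0 l mk refl]) auto
   finally show ?thesis using n1 False by (simp add: mult.assoc add.commute)
  qed
 qed
 have "norm (\<Sum>k<N. \<Sum>m<N. \<Sum>i<2^k. \<Sum>j<2^m. jump q k i * (jump q' m j * E k i m j)) <= (\<Sum>k<N. \<Sum>m<N. C2 * (3 * C0 / 2) * (tau ^ ?d k m * (U k + V m)))"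
  by (rule order_trans[OF norm_sum], rule sum_mono, rule order_trans[OF norm_sum], rule sum_mono, rule blk)
 also have "... = C2 * (3 * C0 / 2) * (\<Sum>k<N. \<Sum>m<N. tau ^ ?d k m * (U k + V m))"
  unfolding sum_distrib_left ..
 also have "... <= C2 * (3 * C0 / 2) * (2 / (1 - tau) * ((\<Sum>k<N. U k) + (\<Sum>l<N. V l)))"
  using C2_pos C0p by (intro mult_left_mono geometric_double_sum tau UV) auto
 finally show ?thesis unfolding ex sw U_def V_def const_arith .
qed

text \<open>An end point of the whole interval acts as a point mass, for which only the cancellation of the Haar functions is
available; the sum over each generation is estimated by Schur's test.\<close>
lemma root_jumps_bound:
 assumes C0: "!!(y::real) n. (\<Sum>i<n. (1 + \<bar>y - real i\<bar>) powr (-3/2)) <= C0" and l: "l > 0" and eta: "eta > 0" and \<sigma>: "\<sigma> \<in> {1, -1}"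
 defines "tau \<equiv> 2 powr (-1/4) :: real"
 shows "norm (c * (\<Sum>m<N. \<Sum>j<2^m. jump q m j * (Th (gp X l m j) (gh l m) (%f. ker eta \<sigma> (X + l) f) - Th (gp X l m j) (gh l m) (%f. ker eta \<sigma> X f))))
  <= 75 * C1 * C0 / (1 - tau) * (l * (norm c)^2 + (\<Sum>k<N. \<Sum>i<2^k. gh l k * (norm (jump q k i))^2))"
proof -
 have tau: "0 <= tau" "tau < 1" unfolding tau_def by (auto intro: powr_less_one)
 have C0p: "C0 >= 0" using C0[of 0 0] by simp
 have h: "gh l k > 0" for k using l by (simp add: gh_def)
 define V where "V = (%k. \<Sum>i<2^k. gh l k * (norm (jump q k i))^2)"
 have V0: "V k >= 0" for k unfolding V_def using h[of k] by (auto intro!: sum_nonneg)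
 define D where "D = (%m j. Th (gp X l m j) (gh l m) (%f. ker eta \<sigma> (X + l) f) - Th (gp X l m j) (gh l m) (%f. ker eta \<sigma> X f))"
 have Db: "norm (D m j) <= 25 * C1 * kap3 l (gh l m) X (gp X l m j)" if j: "j < 2^m" for m j
 proof -
  let ?a = "gp X l m j"
  have j': "real j <= 2^m" using j by (metis less_imp_le of_nat_le_iff of_nat_numeral of_nat_power)
  have a: "X <= ?a" "?a <= X + l"
   unfolding gp_def using l j' by (auto simp: divide_le_eq mult_left_mono)
  have hm: "gh l m <= l" unfolding gh_def using l by (simp add: divide_le_eq)
  have one: "norm (Th ?a (gh l m) (%f. ker eta \<sigma> e f)) <= C1 * (25 * kap l (gh l m) \<bar>e - ?a\<bar>)" if "e \<in> {X, X + l}" for e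
  proof -
   have "norm (Th ?a (gh l m) (%f. ker eta \<sigma> e f)) <= C1 * ((gh l m)^2 / (gh l m + \<bar>e - ?a\<bar>))"
    using Th_ker_bound[OF h eta \<sigma>] by simp
   also have "... <= C1 * (25 * kap l (gh l m) \<bar>e - ?a\<bar>)"
    using C1_pos a that l by (intro mult_left_mono near_atom_kap h hm) auto
   finally show ?thesis .
  qed
  have "norm (D m j) <= C1 * (25 * kap l (gh l m) \<bar>X + l - ?a\<bar>) + C1 * (25 * kap l (gh l m) \<bar>X - ?a\<bar>)"
   unfolding D_def by (intro order_trans[OF norm_triangle_ineq4] add_mono one) auto
  also have "... <= 25 * C1 * kap3 l (gh l m) X ?a"
   using kap_nonneg[OF l h, of "\<bar>X + l/2 - ?a\<bar>" m] C1_pos unfolding kap3_def by (simp add: algebra_simps)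
  finally show ?thesis .
 qed
 have blk: "norm (\<Sum>j<2^m. c * (jump q m j * D m j)) <= 25 * C1 * (3 * C0 / 2) * (tau ^ m * (l * (norm c)^2 + V m))" for m
 proof -
  let ?v = "%j. norm (jump q m j)"
  have "norm (\<Sum>j<2^m. c * (jump q m j * D m j)) <= (\<Sum>j<2^m. 25 * C1 * (norm c * ?v j * kap3 l (gh l m) X (gp X l m j)))"
  proof (intro order_trans[OF norm_sum] sum_mono)
   fix j assume "j \<in> {..<(2::nat)^m}"
   hence "norm (D m j) <= 25 * C1 * kap3 l (gh l m) X (gp X l m j)" by (intro Db) simp
   hence "norm c * ?v j * norm (D m j) <= norm c * ?v j * (25 * C1 * kap3 l (gh l m) X (gp X l m j))"
    by (intro mult_left_mono) auto
   thus "norm (c * (jump q m j * D m j)) <= 25 * C1 * (norm c * ?v j * kap3 l (gh l m) X (gp X l m j))"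
    by (simp add: norm_mult mult.assoc mult.left_commute)
  qed
  also have "... = 25 * C1 * (\<Sum>i<(1::nat). \<Sum>j<2^m. norm c * ?v j * kap3 (gh l 0) (gh l m) (gp X l 0 i) (gp X l m j))"
   by (simp add: sum_distrib_left gp_simps gh_def)
  also have "... <= 25 * C1 * (3 * C0 / 2 * tau ^ (m - 0) * (gh l 0 * (\<Sum>i<(1::nat). (norm c)^2) + gh l m * (\<Sum>j<2^m. (?v j)^2)))"
   unfolding tau_def using C1_pos by (intro mult_left_mono kap3_schur[OF C0 l _ refl]) auto
  also have "gh l m * (\<Sum>j<2^m. (?v j)^2) = V m" unfolding V_def sum_distrib_left ..
  finally show ?thesis by (simp add: mult.assoc gh_def)
 qed
 have "norm (c * (\<Sum>m<N. \<Sum>j<2^m. jump q m j * D m j)) = norm (\<Sum>m<N. \<Sum>j<2^m. c * (jump q m j * D m j))"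
  unfolding sum_distrib_left ..
 also have "... <= (\<Sum>m<N. 25 * C1 * (3 * C0 / 2) * (tau ^ m * (l * (norm c)^2 + V m)))"
  by (intro order_trans[OF norm_sum] sum_mono blk)
 also have "... = 25 * C1 * (3 * C0 / 2) * (\<Sum>m<N. tau ^ m * (l * (norm c)^2 + V m))"
  unfolding sum_distrib_left ..
 also have "... <= 25 * C1 * (3 * C0 / 2) * (2 / (1 - tau) * (l * (norm c)^2 + (\<Sum>m<N. V m)))"
 proof (intro mult_left_mono)
  have g: "(\<Sum>m<N. tau ^ m) <= 1 / (1 - tau)"
   using sum_le_suminf[OF summable_geometric[of tau], of "{..<N}"] tau suminf_geometric[of tau] by simp
  have "(\<Sum>m<N. tau ^ m * (l * (norm c)^2 + V m)) = (\<Sum>m<N. tau ^ m) * (l * (norm c)^2) + (\<Sum>m<N. tau ^ m * V m)"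
   by (simp add: distrib_left sum.distrib sum_distrib_right)
  also have "(\<Sum>m<N. tau ^ m) * (l * (norm c)^2) <= 1 / (1 - tau) * (l * (norm c)^2)"
   using g l by (intro mult_right_mono) auto
  also have "(\<Sum>m<N. tau ^ m * V m) <= (\<Sum>m<N. 1 / (1 - tau) * V m)"
  proof (intro sum_mono mult_right_mono V0)
   fix m
   have "tau ^ m <= 1" using tau by (intro power_le_one) auto
   also have "1 <= 1 / (1 - tau)" using tau by simp
   finally show "tau ^ m <= 1 / (1 - tau)" .
  qed
  also have "(\<Sum>m<N. 1 / (1 - tau) * V m) = 1 / (1 - tau) * (\<Sum>m<N. V m)" unfolding sum_distrib_left ..
  finally have "(\<Sum>m<N. tau ^ m * (l * (norm c)^2 + V m)) <= 1 / (1 - tau) * (l * (norm c)^2 + (\<Sum>m<N. V m))"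
   by (simp add: distrib_left)
  also have "... <= 2 / (1 - tau) * (l * (norm c)^2 + (\<Sum>m<N. V m))"
   using tau l V0 by (intro mult_right_mono divide_right_mono add_nonneg_nonneg sum_nonneg) auto
  finally show "(\<Sum>m<N. tau ^ m * (l * (norm c)^2 + V m)) <= 2 / (1 - tau) * (l * (norm c)^2 + (\<Sum>m<N. V m))" .
 qed (use C1_pos C0p in auto)
 also have "... = 75 * C1 * C0 / (1 - tau) * (l * (norm c)^2 + (\<Sum>m<N. V m))" unfolding const_arith by simp
 finally show ?thesis unfolding D_def V_def .
qed

definition CR :: real where "CR = 4 * ((1 + (1 + L)) ^ 2 + 1 + pi * (1 + (1 + L)))"

text \<open>The four values are bounded after rescaling by \<open>l\<close>, which changes \<open>cl\<close> by an affine function, and affine functions have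
mixed difference 0.\<close>
lemma root_root_bound:
 assumes l: "l > 0" and eta: "eta > 0" "eta <= l"
 shows "norm (ker eta 1 (X + l) (X + l) - ker eta 1 (X + l) X - (ker eta 1 X (X + l) - ker eta 1 X X)) <= CR * l"
proof -
 let ?u = "%e f. of_real 1 * (z f - z e) + \<i> * of_real eta"
 let ?F = "%e f. ?u e f * Ln (- \<i> * ?u e f / of_real l)"
 let ?R = "1 + (1 + L)"
 have k: "ker eta 1 e f = ?F e f + (of_real (ln l) - 1) * ?u e f" for e f
 proof -
  have nz: "- \<i> * ?u e f ~= 0" using slit[OF eta(1), of 1 f e] nonpos_Reals_zero_I by (metis insertI1)
  have "Ln (- \<i> * ?u e f / of_real l) = Ln (- \<i> * ?u e f) - of_real (ln l)"
   by (rule Ln_divide_of_real[OF l nz])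
  thus ?thesis unfolding ker_def cl_def by (simp only:) (simp add: algebra_simps)
 qed
 have b: "norm (?F e f) <= l * (?R^2 + 1 + pi * ?R)" if "e \<in> {X, X + l}" "f \<in> {X, X + l}" for e f
 proof -
  let ?w = "- \<i> * ?u e f / of_real l"
  have nw: "norm ?w = norm (?u e f) / l"
   using l by (simp only: norm_divide norm_mult norm_minus_cancel norm_ii norm_of_real mult_1 abs_of_pos)
  have "norm (?u e f) <= norm (z f - z e) + eta"
   using norm_triangle_ineq[of "z f - z e" "\<i> * of_real eta"] eta by (simp add: norm_mult)
  also have "norm (z f - z e) <= (1 + L) * l"
   by (rule order_trans[OF z_lip]) (use that l L_nonneg in "auto intro!: mult_left_mono")
  finally have "norm (?u e f) <= ?R * l" using eta by (simp add: algebra_simps)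
  hence w: "norm ?w <= ?R" unfolding nw using l by (simp only: pos_divide_le_eq)
  have "- \<i> * ?u e f ~= 0" using slit[OF eta(1), of 1 f e] nonpos_Reals_zero_I by (metis insertI1)
  hence "?w ~= 0" using l by simp
  from norm_times_Ln_bound[OF this w] have "norm (?w * Ln ?w) <= ?R^2 + 1 + pi * ?R" .
  moreover have "norm (?F e f) = l * norm (?w * Ln ?w)"
   unfolding norm_mult[of ?w] norm_mult[of "?u e f"] nw using l by simp
  ultimately show ?thesis using l by (simp only:) (intro mult_left_mono, auto)
 qed
 define M where "M = l * (?R^2 + 1 + pi * ?R)"
 define F where "F = ?F"
 have bF: "norm (F e f) <= M" if "e \<in> {X, X + l}" "f \<in> {X, X + l}" for e f
  unfolding F_def M_def by (rule b[OF that])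
 have "ker eta 1 (X + l) (X + l) - ker eta 1 (X + l) X - (ker eta 1 X (X + l) - ker eta 1 X X) =
  F (X + l) (X + l) - F (X + l) X - (F X (X + l) - F X X)"
  unfolding k F_def by (simp add: algebra_simps)
 also have "norm ... <= (norm (F (X + l) (X + l)) + norm (F (X + l) X)) + (norm (F X (X + l)) + norm (F X X))"
  by (intro order_trans[OF norm_triangle_ineq4] add_mono norm_triangle_ineq4)
 also have "... <= (M + M) + (M + M)"
  by (intro add_mono bF) simp_all
 also have "... = CR * l" unfolding CR_def M_def by simp
 finally show ?thesis .
qed

text \<open>Both step functions are expanded in their mean value and their adapted Haar functions. The interactions of Haar
functions, of a mean with Haar functions and of the two means are estimated separately, and the coefficients are
summed by \<open>square_function\<close>. The condition \<open>eta \<le> l\<close> serves the interaction of the two means.\<close>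
theorem discrete_bound:
 "\<exists>C>0. \<forall>X l N eta q q'. l > 0 --> 0 < eta --> eta <= l --> averages X l N q --> averages X l N q' -->
   norm (stp X l N q (%e. stp X l N q' (%f. ker eta 1 e f))) <= C * (nrm2 l N q + nrm2 l N q')"
proof -
 obtain C0 where C0p: "C0 > 0" and C0: "!!(y::real) n. (\<Sum>i<n. (1 + \<bar>y - real i\<bar>) powr (-3/2)) <= C0"
  using lattice_sum_bound by blast
 define tau :: real where "tau = 2 powr (-1/4)"
 have tau: "0 <= tau" "tau < 1" unfolding tau_def by (auto intro: powr_less_one)
 define Ka where "Ka = 3 * C2 * C0 / (1 - tau)"
 define Kb where "Kb = 75 * C1 * C0 / (1 - tau)"
 have CR0: "CR >= 0" unfolding CR_def using L_nonneg by auto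
 have K0: "Ka > 0" "Kb > 0" unfolding Ka_def Kb_def using C2_pos C1_pos C0p tau by auto
 have CS0: "CS > 0"
 proof -
  have "2 * CB + (L^2 + 1) > 0" unfolding CB_def by (intro add_nonneg_pos add_nonneg_nonneg mult_nonneg_nonneg) auto
  thus ?thesis unfolding CS_def using L_nonneg by (intro mult_pos_pos) auto
 qed
 show ?thesis
 proof (intro exI[of _ "(Ka + 2 * Kb + CR) * CS"] conjI allI impI)
  show "(Ka + 2 * Kb + CR) * CS > 0" using K0 CR0 CS0 by (intro mult_pos_pos add_pos_nonneg) auto
  fix X l N eta and q q' :: "nat => nat => complex"
  assume l: "l > 0" and eta: "0 < eta" "eta <= l" and av: "averages X l N q" "averages X l N q'"
  let ?G = "\<Sum>k<N. \<Sum>i<2^k. gh l k * (norm (jump q k i))^2" and ?H = "\<Sum>k<N. \<Sum>i<2^k. gh l k * (norm (jump q' k i))^2"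
  let ?g = "q 0 0" and ?h = "q' 0 0"
  have sf: "l * (norm ?g)^2 + ?G <= CS * nrm2 l N q" "l * (norm ?h)^2 + ?H <= CS * nrm2 l N q'"
   using square_function[OF av(1) l] square_function[OF av(2) l] by auto
  have nn: "0 <= ?G" "0 <= ?H" "0 <= l * (norm ?g)^2" "0 <= l * (norm ?h)^2" using l by (auto intro!: sum_nonneg simp: gh_def)
  let ?T = "%k i. Th (gp X l k i) (gh l k)"
  define R where "R = (%e. ker eta 1 e (X + l) - ker eta 1 e X)"
  define S where "S = (%e. \<Sum>m<N. \<Sum>j<2^m. jump q' m j * ?T m j (%f. ker eta 1 e f))"
  have in': "stp X l N q' (%f. ker eta 1 e f) = ?h * R e + S e" for e
   unfolding R_def S_def by (rule stp_expand[OF av(2) l])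
  have "stp X l N q (%e. stp X l N q' (%f. ker eta 1 e f)) =
   ?g * ((?h * R (X + l) + S (X + l)) - (?h * R X + S X)) + (\<Sum>k<N. \<Sum>i<2^k. jump q k i * ?T k i (%e. ?h * R e + S e))"
   unfolding in' by (rule stp_expand[OF av(1) l])
  also have "... = ?g * ?h * (R (X + l) - R X) + ?g * (S (X + l) - S X)
   + ?h * (\<Sum>k<N. \<Sum>i<2^k. jump q k i * ?T k i R) + (\<Sum>k<N. \<Sum>i<2^k. jump q k i * ?T k i S)"
  proof -
   have "(\<Sum>k<N. \<Sum>i<2^k. jump q k i * ?T k i (%e. ?h * R e + S e)) = ?h * (\<Sum>k<N. \<Sum>i<2^k. jump q k i * ?T k i R) + (\<Sum>k<N. \<Sum>i<2^k. jump q k i * ?T k i S)"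
    unfolding Th_add Th_mult by (simp add: distrib_left sum.distrib sum_distrib_left mult.left_commute)
   thus ?thesis by (simp add: algebra_simps)
  qed
  finally have e: "stp X l N q (%e. stp X l N q' (%f. ker eta 1 e f)) = ..." .
  have 1: "norm (?g * ?h * (R (X + l) - R X)) <= CR * (l * (norm ?g)^2 + l * (norm ?h)^2)"
  proof -
   have gh: "norm ?g * norm ?h <= (norm ?g)^2 + (norm ?h)^2"
    using sum_squares_bound[of "norm ?g" "norm ?h"] zero_le_power2[of "norm ?g"] zero_le_power2[of "norm ?h"]
    mult_nonneg_nonneg[OF norm_ge_zero[of ?g] norm_ge_zero[of ?h]] by linarith
   have "norm (?g * ?h * (R (X + l) - R X)) = norm ?g * norm ?h * norm (R (X + l) - R X)" by (simp add: norm_mult)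
   also have "... <= ((norm ?g)^2 + (norm ?h)^2) * (CR * l)"
    using root_root_bound[OF l eta, of X] gh unfolding R_def by (intro mult_mono) auto
   finally show ?thesis by (simp add: algebra_simps)
  qed
  have 2: "norm (?g * (S (X + l) - S X)) <= Kb * (l * (norm ?g)^2 + ?H)"
  proof -
   have "S (X + l) - S X = (\<Sum>m<N. \<Sum>j<2^m. jump q' m j * (?T m j (%f. ker eta 1 (X + l) f) - ?T m j (%f. ker eta 1 X f)))"
    unfolding S_def by (simp add: sum_subtractf right_diff_distrib)
   thus ?thesis using root_jumps_bound[OF C0 l eta(1), where \<sigma> = 1 and c = ?g and N = N and q = q' and X = X] unfolding Kb_def tau_def by simp
  qed
  have 3: "norm (?h * (\<Sum>k<N. \<Sum>i<2^k. jump q k i * ?T k i R)) <= Kb * (l * (norm ?h)^2 + ?G)"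
  proof -
   have "?T k i R = ?T k i (%f. ker eta (-1) (X + l) f) - ?T k i (%f. ker eta (-1) X f)" for k i
    unfolding R_def Th_diff by (subst (1 2) ker_flip) (rule refl)
   thus ?thesis using root_jumps_bound[OF C0 l eta(1), where \<sigma> = "-1" and c = ?h and N = N and q = q and X = X] unfolding Kb_def tau_def by simp
  qed
  have 4: "norm (\<Sum>k<N. \<Sum>i<2^k. jump q k i * ?T k i S) <= Ka * (?G + ?H)"
   unfolding S_def Ka_def tau_def by (rule jumps_bound[OF C0 l eta(1)])
  have w: "l * (norm ?g)^2 + l * (norm ?h)^2 <= l * (norm ?g)^2 + ?G + (l * (norm ?h)^2 + ?H)"
   "l * (norm ?g)^2 + ?H <= l * (norm ?g)^2 + ?G + (l * (norm ?h)^2 + ?H)"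
   "l * (norm ?h)^2 + ?G <= l * (norm ?g)^2 + ?G + (l * (norm ?h)^2 + ?H)"
   "?G + ?H <= l * (norm ?g)^2 + ?G + (l * (norm ?h)^2 + ?H)"
   using nn by linarith+
  have "norm (stp X l N q (%e. stp X l N q' (%f. ker eta 1 e f))) <=
   CR * (l * (norm ?g)^2 + l * (norm ?h)^2) + Kb * (l * (norm ?g)^2 + ?H) + Kb * (l * (norm ?h)^2 + ?G) + Ka * (?G + ?H)"
   unfolding e by (intro order_trans[OF norm_triangle_ineq] add_mono 1 2 3 4)
  also have "... <= CR * (l * (norm ?g)^2 + ?G + (l * (norm ?h)^2 + ?H)) + Kb * (l * (norm ?g)^2 + ?G + (l * (norm ?h)^2 + ?H)) + Kb * (l * (norm ?g)^2 + ?G + (l * (norm ?h)^2 + ?H)) + Ka * (l * (norm ?g)^2 + ?G + (l * (norm ?h)^2 + ?H))"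
   using CR0 K0 by (intro add_mono mult_left_mono[OF w(1)] mult_left_mono[OF w(2)] mult_left_mono[OF w(3)] mult_left_mono[OF w(4)]) simp_all
  also have "... = (Ka + 2 * Kb + CR) * (l * (norm ?g)^2 + ?G + (l * (norm ?h)^2 + ?H))" by (simp add: algebra_simps)
  also have "... <= (Ka + 2 * Kb + CR) * (CS * nrm2 l N q + CS * nrm2 l N q')"
   using sf K0 CR0 by (intro mult_left_mono add_mono) auto
  finally show "norm (stp X l N q (%e. stp X l N q' (%f. ker eta 1 e f))) <= (Ka + 2 * Kb + CR) * CS * (nrm2 l N q + nrm2 l N q')"
   by (simp add: algebra_simps)
 qed
qed

end

section \<open>Cauchy integrals of step functions\<close>

lemma set_integrable_continuous_bounded:
 fixes g b :: "real => complex"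
 assumes g: "continuous_on {s..t} g" and b: "b \<in> borel_measurable borel" "!!x. norm (b x) <= B"
 shows "set_integrable lborel {s..t} (%tau. g tau * b tau)"
proof -
 obtain M where M0: "M > 0" "\<forall>y\<in>g ` {s..t}. norm y <= M"
  using compact_imp_bounded[OF compact_continuous_image[OF g compact_Icc]]
  unfolding bounded_pos by blast
 hence M: "!!x. x \<in> {s..t} ==> norm (g x) <= M" "M > 0" by auto
 have gm: "(%x. indicator {s..t} x *\<^sub>R g x) \<in> borel_measurable borel"
  using g by (intro borel_measurable_continuous_on_indicator) auto
 have gm2: "(%x. (indicator {s..t} x *\<^sub>R g x) * b x) \<in> borel_measurable lborel"
  using borel_measurable_times[OF gm b(1)] by simp
 have "integrable lborel (%x. (indicator {s..t} x *\<^sub>R g x) * b x)"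
 proof (rule integrable_dominated[of lborel "%x. indicator {s..t} x *\<^sub>R (M * B)"])
  show "integrable lborel (%x. indicator {s..t} x *\<^sub>R (M * B))"
   by (intro integrable_scaleR_left integrable_real_indicator) (auto simp: emeasure_lborel_Icc_eq)
  show "AE x in lborel. norm (indicator {s..t} x *\<^sub>R g x * b x) <= norm (indicator {s..t} x *\<^sub>R (M * B))"
  proof (rule AE_I2)
   fix x
   show "norm (indicator {s..t} x *\<^sub>R g x * b x) <= norm (indicator {s..t} x *\<^sub>R (M * B))"
   proof (cases "x \<in> {s..t}")
    case True
    have "norm (g x) * norm (b x) <= M * B" using M(1)[OF True] M(2) b(2)[of x] by (intro mult_mono) auto
    thus ?thesis using True by (simp add: norm_mult)
   qed simp
  qed
 qed (rule gm2)
 thus ?thesis unfolding set_integrable_def by (simp add: scaleR_conv_of_real mult.assoc)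
qed

text \<open>Rademacher's theorem is replaced by a density: \<open>a\<close> is bounded and \<open>A\<close> is its integral. Such an \<open>a\<close> always exists
(\<open>lipschitz_derivative_density\<close>).\<close>
locale lip_graph_deriv = lip_graph +
 fixes a :: "real => real"
 assumes a_meas: "a \<in> borel_measurable borel" and a_bd: "!!t. \<bar>a t\<bar> <= L"
  and A_int: "!!s t. s <= t ==> (LBINT x:{s..t}. a x) = A t - A s"
begin

text \<open>The derivative of the parametrisation \<open>z\<close>. Its real part is 1, so division by \<open>b\<close> is harmless.\<close>
definition b :: "real => complex" where "b t = Complex 1 (a t)"

lemma b_meas [measurable]: "b \<in> borel_measurable borel"
proof -
 have "b = (%t. 1 + \<i> * of_real (a t))" by (auto simp: b_def complex_eq_iff fun_eq_iff)
 thus ?thesis using a_meas by simp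
qed

lemma b_upper: "norm (b t) <= 1 + L"
 using cmod_le[of "b t"] a_bd[of t] by (simp add: b_def)

lemma b_lower: "1 <= norm (b t)"
 using complex_Re_le_cmod[of "b t"] by (simp add: b_def)

lemma b_nz: "b t ~= 0"
 using b_lower[of t] by auto

lemma z_continuous: "continuous_on S z"
proof -
 have "(1 + L)-lipschitz_on S z"
  by (rule lipschitz_onI) (use z_lip L_nonneg in "auto simp: dist_norm")
 thus ?thesis by (rule lipschitz_on_continuous_on)
qed

lemma set_integrable_mult_b:
 assumes "continuous_on {s..t} g"
 shows "set_integrable lborel {s..t} (%tau. g tau * b tau)"
 by (rule set_integrable_continuous_bounded[OF assms b_meas b_upper])

lemma b_has_integral:
 assumes "s <= t"
 shows "(b has_integral (z t - z s)) {s..t}"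
proof -
 have ai: "set_integrable lborel {s..t} a"
 proof -
  have "set_integrable lborel {s..t} (%tau. 1 * complex_of_real (a tau))"
   by (rule set_integrable_continuous_bounded[where B = L]) (use a_meas a_bd in auto)
  thus ?thesis unfolding set_integrable_def by (simp add: scaleR_conv_of_real complex_of_real_integrable_eq flip: of_real_mult)
 qed
 hence "(a has_integral (A t - A s)) {s..t}"
  using set_borel_integral_eq_integral[OF ai] A_int[OF assms] by (simp add: has_integral_integral)
 from has_integral_linear[OF this bounded_linear_of_real[where 'a = complex]]
 have "((%x. complex_of_real (a x)) has_integral of_real (A t - A s)) {s..t}" by (simp add: o_def)
 from has_integral_mult_right[OF this, of \<i>]
 have "((%x. \<i> * complex_of_real (a x)) has_integral \<i> * of_real (A t - A s)) {s..t}" .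
 moreover have "((%x. 1 :: complex) has_integral of_real (t - s)) {s..t}"
  using has_integral_const_real[of "1::complex" s t] assms by (simp add: scaleR_conv_of_real)
 ultimately have "((%x. 1 + \<i> * complex_of_real (a x)) has_integral (of_real (t - s) + \<i> * of_real (A t - A s))) {s..t}"
  by (intro has_integral_add)
 moreover have "(%x. 1 + \<i> * complex_of_real (a x)) = b" by (auto simp: b_def complex_eq_iff fun_eq_iff)
 moreover have "of_real (t - s) + \<i> * of_real (A t - A s) = z t - z s" by (simp add: complex_eq_iff)
 ultimately show ?thesis by simp
qed

text \<open>Since \<open>a\<close> is only a density, \<open>phi \<circ> z\<close> need not be differentiable at every point. But the difference of the two sides, as a
function of the upper limit, has derivative 0 at every point, because \<open>g\<close> is continuous and
the integral of \<open>b\<close> is exactly the increment of \<open>z\<close>.\<close>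
lemma z_ftc:
 assumes st: "s <= t" and d: "!!tau. tau \<in> {s..t} ==> (phi has_field_derivative g tau) (at (z tau))"
  and g: "continuous_on {s..t} g"
 shows "(LBINT tau:{s..t}. g tau * b tau) = phi (z t) - phi (z s)"
proof -
 let ?f = "%tau. g tau * b tau"
 have io: "?f integrable_on {u..v}" if "{u..v} \<subseteq> {s..t}" for u v
  using set_borel_integral_eq_integral(1)[OF set_integrable_mult_b[OF continuous_on_subset[OF g that]]] .
 define G where "G = (%u. phi (z u) - integral {s..u} ?f)"
 have inc: "norm (integral {s..v} ?f - integral {s..u} ?f - g w * (z v - z u)) <= eps * (1 + L) * \<bar>v - u\<bar>"
  if uv: "u \<in> {s..t}" "v \<in> {s..t}" "u <= v" and e: "!!tau. tau \<in> {u..v} ==> norm (g tau - g w) <= eps" "eps >= 0" for u v w eps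
 proof -
  have sub: "{s..v} \<subseteq> {s..t}" "{u..v} \<subseteq> {s..t}" using uv by auto
  have "integral {s..u} ?f + integral {u..v} ?f = integral {s..v} ?f"
   by (rule Henstock_Kurzweil_Integration.integral_combine[OF _ _ io[OF sub(1)]]) (use uv in auto)
  hence e1: "integral {s..v} ?f - integral {s..u} ?f = integral {u..v} ?f" by (simp add: algebra_simps)
  have "((%tau. ?f tau - g w * b tau) has_integral (integral {u..v} ?f - g w * (z v - z u))) {u..v}"
   by (intro has_integral_diff integrable_integral io sub has_integral_mult_right b_has_integral uv)
  note hi = this
  have "norm (integral {u..v} ?f - g w * (z v - z u)) <= eps * (1 + L) * measure lborel {u..v}"
  proof (rule has_integral_bound_real[OF _ finite.emptyI hi])
   show "0 <= eps * (1 + L)" using e L_nonneg by simp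
   fix tau assume "tau \<in> {u..v} - {}"
   hence "norm (g tau - g w) * norm (b tau) <= eps * (1 + L)" using e b_upper[of tau] by (intro mult_mono) auto
   thus "norm (?f tau - g w * b tau) <= eps * (1 + L)" by (simp add: norm_mult[symmetric] algebra_simps)
  qed
  thus ?thesis unfolding e1 using uv by simp
 qed
 have "\<exists>c. \<forall>x\<in>{s..t}. G x = c"
 proof (rule has_derivative_zero_constant[OF convex_real_interval(5)])
  fix x assume x: "x \<in> {s..t}"
  show "(G has_derivative (%h. 0)) (at x within {s..t})"
   unfolding has_derivative_within_alt
  proof (intro conjI allI impI)
   fix e :: real assume e: "e > 0"
   define e' where "e' = e / (2 * (1 + L))"
   have e': "e' > 0" "e' * (1 + L) = e / 2" unfolding e'_def using e L_nonneg by (auto simp: divide_simps)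
   obtain d1 where d1: "d1 > 0" "!!tau. tau \<in> {s..t} ==> \<bar>tau - x\<bar> < d1 ==> norm (g tau - g x) <= e'"
    using g x e' unfolding continuous_on_iff dist_norm by (metis less_imp_le real_norm_def)
   have "(phi has_derivative (*) (g x)) (at (z x))" using d[OF x] by (simp add: has_field_derivative_def)
   then obtain d2 where d2: "d2 > 0" "!!y. norm (y - z x) < d2 ==> norm (phi y - phi (z x) - g x * (y - z x)) <= e' * norm (y - z x)"
    unfolding has_derivative_within_alt using e' by auto
   show "\<exists>d>0. \<forall>y\<in>{s..t}. norm (y - x) < d --> norm (G y - G x - 0) <= e * norm (y - x)"
   proof (intro exI[of _ "min d1 (d2 / (1 + L))"] conjI ballI impI)
    show "0 < min d1 (d2 / (1 + L))" using d1 d2 L_nonneg by simp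
    fix y assume y: "y \<in> {s..t}" and yx: "norm (y - x) < min d1 (d2 / (1 + L))"
    have "(1 + L) * \<bar>y - x\<bar> < d2" using yx L_nonneg by (simp add: pos_less_divide_eq mult.commute)
    hence "norm (z y - z x) < d2" using z_lip[of y x] by linarith
    from d2(2)[OF this] have p1: "norm (phi (z y) - phi (z x) - g x * (z y - z x)) <= e' * norm (z y - z x)" .
    also have "... <= e' * ((1 + L) * \<bar>y - x\<bar>)" using e' z_lip by (intro mult_left_mono) auto
    finally have p1: "norm (phi (z y) - phi (z x) - g x * (z y - z x)) <= e / 2 * \<bar>y - x\<bar>" using e' by (simp add: mult.assoc[symmetric])
    have p2: "norm (integral {s..y} ?f - integral {s..x} ?f - g x * (z y - z x)) <= e / 2 * \<bar>y - x\<bar>"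
    proof (cases "x <= y")
    case True
    have "norm (integral {s..y} ?f - integral {s..x} ?f - g x * (z y - z x)) <= e' * (1 + L) * \<bar>y - x\<bar>"
    proof (rule inc[OF x y True])
    fix tau assume "tau \<in> {x..y}"
    thus "norm (g tau - g x) <= e'" using x y yx by (intro d1) auto
    qed (use e' in auto)
    thus ?thesis using e' by simp
    next
    case False
    have "norm (integral {s..x} ?f - integral {s..y} ?f - g x * (z x - z y)) <= e' * (1 + L) * \<bar>x - y\<bar>"
    proof (rule inc[OF y x])
    fix tau assume "tau \<in> {y..x}"
    thus "norm (g tau - g x) <= e'" using x y yx by (intro d1) auto
    qed (use e' False in auto)
    moreover have "norm (integral {s..x} ?f - integral {s..y} ?f - g x * (z x - z y)) = norm (integral {s..y} ?f - integral {s..x} ?f - g x * (z y - z x))"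
    by (subst norm_minus_cancel[symmetric]) (simp add: algebra_simps)
    ultimately show ?thesis using e' by (simp add: abs_minus_commute)
    qed
    have "G y - G x - 0 = (phi (z y) - phi (z x) - g x * (z y - z x)) - (integral {s..y} ?f - integral {s..x} ?f - g x * (z y - z x))"
    unfolding G_def by simp
    also have "norm ... <= e / 2 * \<bar>y - x\<bar> + e / 2 * \<bar>y - x\<bar>"
    by (intro order_trans[OF norm_triangle_ineq4] add_mono p1 p2)
    finally show "norm (G y - G x - 0) <= e * norm (y - x)" by simp
   qed
  qed simp
 qed
 hence "G s = G t" using st by auto
 moreover have "(LBINT tau:{s..t}. ?f tau) = integral {s..t} ?f"
  by (rule set_borel_integral_eq_integral(2)[OF set_integrable_mult_b[OF g]])
 ultimately show ?thesis unfolding G_def by simp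
qed

text \<open>The Cauchy integral of \<open>f\<close> along the graph, evaluated at height \<open>eta\<close> above the point \<open>z x\<close> (below it if \<open>eta < 0\<close>). The factor
\<open>dz/dt\<close> is absorbed into \<open>f\<close>.\<close>
definition F :: "real => (real => complex) => real => complex" where
 "F eta f x = (LBINT t. f t / (z t - z x - \<i> * of_real eta))"

lemma den_lower: "\<bar>t - x\<bar> + \<bar>eta\<bar> <= (2 + L) * norm (z t - z x - \<i> * of_real eta)"
proof -
 let ?u = "z t - z x - \<i> * of_real eta"
 have 1: "\<bar>t - x\<bar> <= norm ?u" using abs_Re_le_cmod[of ?u] by simp
 have 2: "\<bar>A t - A x - eta\<bar> <= norm ?u" using abs_Im_le_cmod[of ?u] by simp
 have "\<bar>eta\<bar> <= \<bar>A t - A x - eta\<bar> + \<bar>A t - A x\<bar>" by linarith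
 also have "... <= norm ?u + L * \<bar>t - x\<bar>" using 2 lip[of t x] by linarith
 also have "L * \<bar>t - x\<bar> <= L * norm ?u" using 1 L_nonneg by (intro mult_left_mono) auto
 finally show ?thesis using 1 by (simp add: distrib_right)
qed

lemma den_nz: "eta ~= 0 ==> z t - z x - \<i> * of_real eta ~= 0"
 using den_lower[of t x eta] by auto

lemma kernel_bound: "eta ~= 0 ==> norm (1 / (z t - z x - \<i> * of_real eta)) <= (2 + L) / \<bar>eta\<bar>"
proof -
 assume eta: "eta ~= 0"
 let ?n = "norm (z t - z x - \<i> * of_real eta)"
 have "?n > 0" using den_nz[OF eta, of t x] by simp
 moreover have "\<bar>eta\<bar> <= (2 + L) * ?n" using den_lower[of t x eta] by linarith
 ultimately show ?thesis using eta by (simp add: norm_divide divide_simps mult.commute)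
qed

lemma z_meas [measurable]: "z \<in> borel_measurable borel"
 by (rule borel_measurable_continuous_onI[OF z_continuous])

lemma F_integrable:
 assumes f: "integrable lborel f" and eta: "eta ~= 0"
 shows "integrable lborel (%t. f t / (z t - z x - \<i> * of_real eta))"
proof (rule integrable_dominated[OF integrable_mult_right[OF f, of "of_real ((2 + L) / \<bar>eta\<bar>)"]])
 have [measurable]: "f \<in> borel_measurable borel" using borel_measurable_integrable[OF f] by simp
 show "(%t. f t / (z t - z x - \<i> * of_real eta)) \<in> borel_measurable lborel" by simp
 show "AE t in lborel. norm (f t / (z t - z x - \<i> * of_real eta)) <= norm (complex_of_real ((2 + L) / \<bar>eta\<bar>) * f t)"
 proof (rule AE_I2)
  fix t
  have "norm (f t) * norm (1 / (z t - z x - \<i> * of_real eta)) <= norm (f t) * ((2 + L) / \<bar>eta\<bar>)"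
   using kernel_bound[OF eta] by (intro mult_left_mono) auto
  moreover have "norm (complex_of_real ((2 + L) / \<bar>eta\<bar>) * f t) = norm (f t) * ((2 + L) / \<bar>eta\<bar>)"
   using L_nonneg by (simp only: norm_mult norm_of_real) simp
  ultimately show "norm (f t / (z t - z x - \<i> * of_real eta)) <= norm (complex_of_real ((2 + L) / \<bar>eta\<bar>) * f t)"
   by (simp only: norm_divide) (simp add: norm_one)
 qed
qed

lemma F_bound:
 assumes f: "integrable lborel f" and eta: "eta ~= 0"
 shows "norm (F eta f x) <= (2 + L) / \<bar>eta\<bar> * (LBINT t. norm (f t))"
proof -
 have "norm (F eta f x) <= (LBINT t. norm (f t / (z t - z x - \<i> * of_real eta)))"
  unfolding F_def by (rule integral_norm_bound)
 also have "... <= (LBINT t. (2 + L) / \<bar>eta\<bar> * norm (f t))"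
 proof (rule integral_mono)
  show "integrable lborel (%t. norm (f t / (z t - z x - \<i> * of_real eta)))" by (intro integrable_norm F_integrable f eta)
  show "integrable lborel (%t. (2 + L) / \<bar>eta\<bar> * norm (f t))" by (intro integrable_mult_right integrable_norm f)
  fix t
  have "norm (f t) * norm (1 / (z t - z x - \<i> * of_real eta)) <= norm (f t) * ((2 + L) / \<bar>eta\<bar>)"
   using kernel_bound[OF eta] by (intro mult_left_mono) auto
  thus "norm (f t / (z t - z x - \<i> * of_real eta)) <= (2 + L) / \<bar>eta\<bar> * norm (f t)"
   by (simp only: norm_divide norm_one) (simp add: mult.commute)
 qed
 finally show ?thesis by simp
qed

lemma F_diff: 
 assumes "integrable lborel f" "integrable lborel g" "eta ~= 0"
 shows "F eta (%t. f t - g t) x = F eta f x - F eta g x"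
 unfolding F_def diff_divide_distrib by (rule lint_diff) (intro F_integrable assms)+

lemma F_continuous:
 assumes f: "integrable lborel f" and eta: "eta ~= 0"
 shows "continuous_on UNIV (F eta f)"
proof -
 have "isCont (F eta f) x" for x
 proof (rule continuous_at_sequentiallyI)
  fix u :: "nat => real" assume u: "u \<longlonglongrightarrow> x"
  have [measurable]: "f \<in> borel_measurable borel" using borel_measurable_integrable[OF f] by simp
  show "(%n. F eta f (u n)) \<longlonglongrightarrow> F eta f x"
   unfolding F_def
  proof (rule integral_dominated_convergence[where w = "%t. (2 + L) / \<bar>eta\<bar> * norm (f t)"])
   show "integrable lborel (%t. (2 + L) / \<bar>eta\<bar> * norm (f t))" by (intro integrable_mult_right integrable_norm f)
   have "isCont z x" using z_continuous[of UNIV] by (simp add: continuous_on_eq_continuous_at)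
   hence zu: "(%n. z (u n)) \<longlonglongrightarrow> z x" using u isCont_tendsto_compose by blast
   show "AE t in lborel. (%n. f t / (z t - z (u n) - \<i> * of_real eta)) \<longlonglongrightarrow> f t / (z t - z x - \<i> * of_real eta)"
    by (intro AE_I2 tendsto_intros zu den_nz eta)
   show "AE t in lborel. norm (f t / (z t - z (u n) - \<i> * of_real eta)) <= (2 + L) / \<bar>eta\<bar> * norm (f t)" for n
   proof (rule AE_I2)
    fix t
    have "norm (f t) * norm (1 / (z t - z (u n) - \<i> * of_real eta)) <= norm (f t) * ((2 + L) / \<bar>eta\<bar>)"
    using kernel_bound[OF eta] by (intro mult_left_mono) auto
    thus "norm (f t / (z t - z (u n) - \<i> * of_real eta)) <= (2 + L) / \<bar>eta\<bar> * norm (f t)"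
    by (simp only: norm_divide norm_one) (simp add: mult.commute)
   qed
  qed simp_all
 qed
 thus ?thesis by (simp add: continuous_on_eq_continuous_at)
qed

lemma LINT_half_open:
 fixes f :: "real => complex"
 assumes "f \<in> borel_measurable borel"
 shows "(LBINT x. indicator {s..<t} x *\<^sub>R f x) = (LBINT x:{s..t}. f x)"
 unfolding set_lebesgue_integral_def
proof (rule integral_cong_AE)
 show "AE x in lborel. indicator {s..<t} x *\<^sub>R f x = indicator {s..t} x *\<^sub>R f x"
  using AE_lborel_singleton[of t] by eventually_elim (auto simp: indicator_def)
qed (use assms in auto)

lemma slit':
 assumes "eta > 0"
 shows "- \<i> * (z f - z e + \<i> * of_real eta) \<notin> \<real>\<^sub>\<le>\<^sub>0"
 using slit[OF assms, of 1 f e] by simp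

definition lg :: "real => real => real => complex" where
 "lg eta e f = Ln (- \<i> * (z f - z e + \<i> * of_real eta))"

lemma inner_integral:
 assumes "e0 <= e1" "eta > 0"
 shows "(LBINT e:{e0..e1}. 1 / (z e - z x - \<i> * of_real eta) * b e) = lg eta e1 x - lg eta e0 x"
 unfolding lg_def
proof (rule z_ftc[OF assms(1), where phi = "%w. Ln (- \<i> * (z x - w + \<i> * of_real eta))"])
 fix e
 have nz: "z x - z e + \<i> * of_real eta ~= 0" using slit'[OF assms(2), of x e] by auto
 have "((%w. Ln (- \<i> * (z x - w + \<i> * of_real eta))) has_field_derivative inverse (z x - z e + \<i> * of_real eta) * (-1)) (at (z e))"
  by (rule DERIV_chain2[where g = "%w. z x - w + \<i> * of_real eta" and f = "%u. Ln (- \<i> * u)", OF cl_deriv(2)[OF slit'[OF assms(2), of x e]]]) (auto intro!: derivative_eq_intros)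
 moreover have "inverse (z x - z e + \<i> * of_real eta) * (-1) = 1 / (z e - z x - \<i> * of_real eta)"
  using nz den_nz[of eta e x] assms(2) by (simp add: field_simps)
 ultimately show "((%w. Ln (- \<i> * (z x - w + \<i> * of_real eta))) has_field_derivative 1 / (z e - z x - \<i> * of_real eta)) (at (z e))"
  by simp
next
 show "continuous_on {e0..e1} (%e. 1 / (z e - z x - \<i> * of_real eta))"
  using den_nz assms(2) by (intro continuous_intros z_continuous) auto
qed

lemma lg_continuous: "eta > 0 ==> continuous_on S (lg eta e)"
 unfolding lg_def[abs_def] using slit'[of eta _ e]
 by (intro continuous_intros continuous_on_Ln z_continuous) auto

lemma outer_integral:
 assumes "f0 <= f1" "eta > 0"
 shows "(LBINT f:{f0..f1}. lg eta e f * b f) = ker eta 1 e f1 - ker eta 1 e f0"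
proof -
 have "(LBINT f:{f0..f1}. lg eta e f * b f) = (%w. cl (w - z e + \<i> * of_real eta)) (z f1) - (%w. cl (w - z e + \<i> * of_real eta)) (z f0)"
 proof (rule z_ftc[OF assms(1)])
  fix f
  have "((%w. cl (w - z e + \<i> * of_real eta)) has_field_derivative lg eta e f * 1) (at (z f))"
   unfolding lg_def
   by (rule DERIV_chain2[where g = "%w. w - z e + \<i> * of_real eta" and f = cl, OF cl_deriv(1)[OF slit'[OF assms(2), of f e]]]) (auto intro!: derivative_eq_intros)
  thus "((%w. cl (w - z e + \<i> * of_real eta)) has_field_derivative lg eta e f) (at (z f))" by simp
 qed (rule lg_continuous[OF assms(2)])
 thus ?thesis unfolding ker_def by simp
qed

definition stepf :: "real => real => nat => (nat => complex) => real => complex" where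
 "stepf X l N c t = (\<Sum>i<2^N. indicator {gp X l N i..<gp X l N (Suc i)} t *\<^sub>R c i)"

lemma gp_mono: "l > 0 ==> gp X l N i <= gp X l N (Suc i)"
 by (simp add: gp_def divide_right_mono mult_left_mono)

lemma LINT_stepf:
 fixes g :: "real => complex"
 assumes l: "l > 0" and g: "continuous_on UNIV g"
 shows "integrable lborel (%t. stepf X l N c t * (g t * b t))"
  "(LBINT t. stepf X l N c t * (g t * b t)) = (\<Sum>i<2^N. c i * (LBINT t:{gp X l N i..gp X l N (Suc i)}. g t * b t))"
proof -
 have gm: "g \<in> borel_measurable borel" by (rule borel_measurable_continuous_onI[OF g])
 have m: "(%t. g t * b t) \<in> borel_measurable borel" using gm by simp
 have e: "stepf X l N c t * (g t * b t) = (\<Sum>i<2^N. c i * (indicator {gp X l N i..<gp X l N (Suc i)} t *\<^sub>R (g t * b t)))" for t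
  unfolding stepf_def sum_distrib_right by (intro sum.cong refl) (simp add: scaleR_conv_of_real)
 have i: "integrable lborel (%t. indicator {s..<u} t *\<^sub>R (g t * b t))" for s u
 proof -
  have "set_integrable lborel {s..u} (%t. g t * b t)"
   by (rule set_integrable_mult_b[OF continuous_on_subset[OF g]]) auto
  hence "set_integrable lborel {s..<u} (%t. g t * b t)"
   by (rule set_integrable_subset) auto
  thus ?thesis unfolding set_integrable_def .
 qed
 show "integrable lborel (%t. stepf X l N c t * (g t * b t))"
  unfolding e by (intro Bochner_Integration.integrable_sum integrable_mult_right i)
 show "(LBINT t. stepf X l N c t * (g t * b t)) = (\<Sum>i<2^N. c i * (LBINT t:{gp X l N i..gp X l N (Suc i)}. g t * b t))"
 proof -
  have "(LBINT t. stepf X l N c t * (g t * b t)) = (\<Sum>j<2^N. (LBINT t. c j * (indicator {gp X l N j..<gp X l N (Suc j)} t *\<^sub>R (g t * b t))))"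
   unfolding e by (rule lint_sum) (intro integrable_mult_right i)
  also have "... = (\<Sum>i<2^N. c i * (LBINT t:{gp X l N i..gp X l N (Suc i)}. g t * b t))"
   by (intro sum.cong refl) (simp only: integral_mult_right_zero LINT_half_open[OF m])
  finally show ?thesis .
 qed
qed

lemma stepf_sq:
 assumes l: "l > 0"
 shows "(norm (stepf X l N c t))^2 = (\<Sum>i<2^N. indicator {gp X l N i..<gp X l N (Suc i)} t * (norm (c i))^2)"
proof (cases "\<exists>i<2^N. t \<in> {gp X l N i..<gp X l N (Suc i)}")
 case True
 then obtain i where i: "i < 2^N" "t \<in> {gp X l N i..<gp X l N (Suc i)}" by blast
 have ind: "indicator {gp X l N j..<gp X l N (Suc j)} t = (if j = i then 1 else 0 :: real)" for j
 proof -
  have "j = i" if "t \<in> {gp X l N j..<gp X l N (Suc j)}"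
  proof -
   have "gp X l N j < gp X l N (Suc i)" "gp X l N i < gp X l N (Suc j)" using that i by auto
   moreover have ord: "j < i" if "gp X l N j < gp X l N i" for i j
   proof (rule ccontr)
    assume "\<not> j < i"
    hence "gp X l N i <= gp X l N j"
    unfolding gp_def using l by (intro add_left_mono divide_right_mono mult_left_mono) auto
    with that show False by simp
   qed
   ultimately have "j < Suc i" "i < Suc j" by blast+
   thus ?thesis by simp
  qed
  note ji = this
  show ?thesis
  proof (cases "j = i")
   case True
   thus ?thesis using i by simp
  next
   case False
   hence "t \<notin> {gp X l N j..<gp X l N (Suc j)}" using ji by blast
   thus ?thesis using False by simp
  qed
 qed
 have "stepf X l N c t = (\<Sum>j<2^N. if j = i then c j else 0)"
  unfolding stepf_def by (intro sum.cong refl) (simp add: ind)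
 also have "... = c i" using i(1) by simp
 finally have 1: "stepf X l N c t = c i" .
 have "(\<Sum>j<2^N. indicator {gp X l N j..<gp X l N (Suc j)} t * (norm (c j))^2) = (\<Sum>j<2^N. if j = i then (norm (c j))^2 else 0)"
  by (intro sum.cong refl) (simp add: ind)
 also have "... = (norm (c i))^2" using i(1) by simp
 finally show ?thesis using 1 by simp
next
 case False
 hence ind: "indicator {gp X l N i..<gp X l N (Suc i)} t = (0::real)" if "i < 2^N" for i
  using that by (simp add: indicator_def)
 have "stepf X l N c t = 0" unfolding stepf_def by (intro sum.neutral ballI) (simp add: ind)
 moreover have "(\<Sum>i<2^N. indicator {gp X l N i..<gp X l N (Suc i)} t * (norm (c i))^2) = 0"
  by (intro sum.neutral ballI) (simp add: ind)
 ultimately show ?thesis by simp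
qed

lemma stepf_sq_integral:
 assumes l: "l > 0"
 shows "(LBINT t. (norm (stepf X l N c t))^2) = (\<Sum>i<2^N. gh l N * (norm (c i))^2)"
proof -
 have i: "integrable lborel (%t. indicator {s..<u} t * (k :: real))" for s u :: real and k
  by (intro integrable_mult_left integrable_real_indicator) (auto intro!: le_less_trans[OF emeasure_mono[of "{s..<u}" "{s..u}" lborel]] simp: emeasure_lborel_Icc_eq)
 have "(LBINT t. (norm (stepf X l N c t))^2) = (\<Sum>i<2^N. (LBINT t. indicator {gp X l N i..<gp X l N (Suc i)} t * (norm (c i))^2))"
  unfolding stepf_sq[OF l] by (rule lint_sum) (rule i)
 also have "... = (\<Sum>i<2^N. gh l N * (norm (c i))^2)"
  using gp_mono[OF l] by (intro sum.cong refl) (simp add: gp_simps(7) )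
 finally show ?thesis .
qed

text \<open>The averages with respect to \<open>dz\<close> of the finest values \<open>c\<close>, where \<open>d\<close> counts the generations upwards from the finest one.\<close>
fun avg :: "real => real => nat => (nat => complex) => nat => nat => complex" where
 "avg X l N c 0 i = c i"
| "avg X l N c (Suc d) i = ((z (gp X l (N - d) (Suc (2*i))) - z (gp X l (N - d) (2*i))) * avg X l N c d (2*i) +
   (z (gp X l (N - d) (Suc (Suc (2*i)))) - z (gp X l (N - d) (Suc (2*i)))) * avg X l N c d (Suc (2*i))) /
   (z (gp X l (N - Suc d) (Suc i)) - z (gp X l (N - Suc d) i))"

lemma averages_avg:
 assumes "l > 0"
 shows "averages X l N (%k i. avg X l N c (N - k) i)"
 unfolding averages_def
proof (intro allI impI)
 fix k i assume k: "k < N" and "i < (2::nat)^k"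
 define d where "d = N - Suc k"
 have d: "N - k = Suc d" "N - Suc k = d" "N - d = Suc k" "N - Suc d = k" using k unfolding d_def by auto
 have "gp X l k (Suc i) ~= gp X l k i" using assms by (simp add: gp_def)
 hence nz: "z (gp X l k (Suc i)) - z (gp X l k i) ~= 0" by (rule z_diff_nz)
 show "(z (gp X l k (Suc i)) - z (gp X l k i)) * avg X l N c (N - k) i =
   (z (gp X l (Suc k) (Suc (2*i))) - z (gp X l (Suc k) (2*i))) * avg X l N c (N - Suc k) (2*i) +
   (z (gp X l (Suc k) (Suc (Suc (2*i)))) - z (gp X l (Suc k) (Suc (2*i)))) * avg X l N c (N - Suc k) (Suc (2*i))"
  unfolding d avg.simps using nz by simp
qed

lemma F_stepf:
 assumes l: "l > 0" and eta: "eta > 0"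
 shows "F eta (%t. stepf X l N c t * b t) x = (\<Sum>i<2^N. c i * (lg eta (gp X l N (Suc i)) x - lg eta (gp X l N i) x))"
proof -
 have "F eta (%t. stepf X l N c t * b t) x = (LBINT t. stepf X l N c t * (1 / (z t - z x - \<i> * of_real eta) * b t))"
  unfolding F_def by simp
 also have "... = (\<Sum>i<2^N. c i * (LBINT t:{gp X l N i..gp X l N (Suc i)}. 1 / (z t - z x - \<i> * of_real eta) * b t))"
  using den_nz eta by (intro LINT_stepf(2)[OF l] continuous_intros z_continuous) auto
 also have "... = (\<Sum>i<2^N. c i * (lg eta (gp X l N (Suc i)) x - lg eta (gp X l N i) x))"
  by (intro sum.cong refl) (simp only: inner_integral[OF gp_mono[OF l] eta])
 finally show ?thesis .
qed

text \<open>Two integrations of the Cauchy kernel give mixed differences of \<open>ker\<close>, so the bilinear form on step functions is the one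
estimated in \<open>discrete_bound\<close>.\<close>
lemma form_stepf:
 assumes l: "l > 0" and eta: "eta > 0"
 shows "(LBINT x. stepf X l N c' x * b x * F eta (%t. stepf X l N c t * b t) x) =
  (\<Sum>i<2^N. c i * ((\<Sum>j<2^N. c' j * (ker eta 1 (gp X l N (Suc i)) (gp X l N (Suc j)) - ker eta 1 (gp X l N (Suc i)) (gp X l N j)))
   - (\<Sum>j<2^N. c' j * (ker eta 1 (gp X l N i) (gp X l N (Suc j)) - ker eta 1 (gp X l N i) (gp X l N j)))))"
proof -
 let ?G = "%x. \<Sum>i<2^N. c i * (lg eta (gp X l N (Suc i)) x - lg eta (gp X l N i) x)"
 have si: "set_integrable lborel {s..u} (%x. lg eta e x * b x)" for s u e
  by (rule set_integrable_mult_b[OF lg_continuous[OF eta]])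
 have "(LBINT x. stepf X l N c' x * b x * F eta (%t. stepf X l N c t * b t) x) = (LBINT x. stepf X l N c' x * (?G x * b x))"
  unfolding F_stepf[OF l eta] by (simp only: mult.assoc mult.commute[of "b _"])
 also have "... = (\<Sum>j<2^N. c' j * (LBINT x:{gp X l N j..gp X l N (Suc j)}. ?G x * b x))"
  by (rule LINT_stepf(2)[OF l]) (intro continuous_intros lg_continuous eta)
 also have "... = (\<Sum>j<2^N. c' j * (\<Sum>i<2^N. c i * ((ker eta 1 (gp X l N (Suc i)) (gp X l N (Suc j)) - ker eta 1 (gp X l N (Suc i)) (gp X l N j))
   - (ker eta 1 (gp X l N i) (gp X l N (Suc j)) - ker eta 1 (gp X l N i) (gp X l N j)))))"
 proof (intro sum.cong refl arg_cong2[where f = "(*)"])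
  fix j
  let ?S = "{gp X l N j..gp X l N (Suc j)}"
  have "(LINT x:?S|lborel. ?G x * b x) = (LINT x:?S|lborel. (\<Sum>i<2^N. c i * (lg eta (gp X l N (Suc i)) x * b x - lg eta (gp X l N i) x * b x)))"
   unfolding sum_distrib_right by (intro arg_cong[where f = "set_lebesgue_integral lborel ?S"] ext sum.cong refl) (simp add: algebra_simps)
  also have "... = (\<Sum>i<2^N. (LINT x:?S|lborel. c i * (lg eta (gp X l N (Suc i)) x * b x - lg eta (gp X l N i) x * b x)))"
   unfolding set_lebesgue_integral_def scaleR_sum_right
   by (rule lint_sum) (use set_integral_diff(1)[OF si si, THEN set_integrable_mult_right] in "simp add: set_integrable_def")
  also have "... = (\<Sum>i<2^N. c i * ((LINT x:?S|lborel. lg eta (gp X l N (Suc i)) x * b x) - (LINT x:?S|lborel. lg eta (gp X l N i) x * b x)))"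
   by (simp add: set_integral_diff(2)[OF si si])
  also have "... = (\<Sum>i<2^N. c i * ((ker eta 1 (gp X l N (Suc i)) (gp X l N (Suc j)) - ker eta 1 (gp X l N (Suc i)) (gp X l N j))
   - (ker eta 1 (gp X l N i) (gp X l N (Suc j)) - ker eta 1 (gp X l N i) (gp X l N j))))"
   unfolding outer_integral[OF gp_mono[OF l] eta] ..
  finally show "(LINT x:?S|lborel. ?G x * b x) = ..." .
 qed
 also have "... = (\<Sum>i<2^N. c i * ((\<Sum>j<2^N. c' j * (ker eta 1 (gp X l N (Suc i)) (gp X l N (Suc j)) - ker eta 1 (gp X l N (Suc i)) (gp X l N j)))
   - (\<Sum>j<2^N. c' j * (ker eta 1 (gp X l N i) (gp X l N (Suc j)) - ker eta 1 (gp X l N i) (gp X l N j)))))"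
  unfolding sum_distrib_left sum_subtractf[symmetric] right_diff_distrib[symmetric]
  by (subst sum.swap) (simp add: mult.left_commute)
 finally show ?thesis .
qed

theorem form_bound_stepf:
 "\<exists>C>0. \<forall>X l N eta c c'. l > 0 --> 0 < eta --> eta <= l -->
   norm (LBINT x. stepf X l N c' x * b x * F eta (%t. stepf X l N c t * b t) x)
   <= C * ((LBINT t. (norm (stepf X l N c t))^2) + (LBINT t. (norm (stepf X l N c' t))^2))"
proof -
 obtain C where C: "C > 0" and Cb: "!!X l N eta q q'. l > 0 ==> 0 < eta ==> eta <= l ==> averages X l N q ==> averages X l N q' ==>
   norm (stp X l N q (%e. stp X l N q' (%f. ker eta 1 e f))) <= C * (nrm2 l N q + nrm2 l N q')"
  using discrete_bound by blast
 show ?thesis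
 proof (intro exI[of _ C] conjI allI impI C)
  fix X l :: real and N and eta :: real and c c' :: "nat => complex"
  assume l: "l > 0" and eta: "0 < eta" "eta <= l"
  show "norm (LBINT x. stepf X l N c' x * b x * F eta (%t. stepf X l N c t * b t) x)
   <= C * ((LBINT t. (norm (stepf X l N c t))^2) + (LBINT t. (norm (stepf X l N c' t))^2))"
   using Cb[OF l eta averages_avg[OF l, of X N c] averages_avg[OF l, of X N c']]
   unfolding form_stepf[OF l eta(1)] stepf_sq_integral[OF l] stp_def nrm2_def by simp
 qed
qed

end

section \<open>The maximal theorem\<close>

text \<open>By Vitali's covering lemma the bad intervals contain a disjoint family whose fivefold enlargements cover
the bad set.\<close>
lemma maximal_weak_type:
 fixes phi :: "real => real"
 assumes int: "integrable lborel phi" and nn: "!!x. phi x >= 0" and lam: "lam > 0"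
 shows "\<exists>U. U \<in> sets borel \<and> emeasure lborel U <= ennreal (5 / lam * (LBINT x. phi x)) \<and>
  (\<forall>x. x \<notin> U --> (\<forall>r>0. (LBINT y. indicator {x - r..x + r} y * phi y) <= 2 * r * lam))"
proof -
 have [measurable]: "phi \<in> borel_measurable borel" using borel_measurable_integrable[OF int] by simp
 define I where "I = (LBINT x. phi x)"
 define J where "J = (%x r. LBINT y. indicator {x - r..x + r} y * phi y)"
 define K where "K = {x. \<exists>r>0. J x r > 2 * r * lam}"
 have "\<exists>r. \<forall>x\<in>K. r x > 0 \<and> J x (r x) > 2 * r x * lam"
  unfolding K_def by (intro bchoice) auto
 then obtain r where r: "!!x. x \<in> K ==> r x > 0 \<and> J x (r x) > 2 * r x * lam" by blast
 have Ji: "integrable lborel (%y. indicator {x - r..x + r} y * phi y)" for x r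
  by (rule integrable_dominated[OF int]) (auto simp: indicator_def nn)
 have JI: "J x r <= I" for x r
  unfolding J_def I_def by (intro integral_mono Ji int) (auto simp: indicator_def nn)
 have rb: "0 < r x \<and> r x <= I / (2 * lam)" if "x \<in> K" for x
 proof -
  have "2 * r x * lam <= I" using r[OF that] JI[of x "r x"] by simp
  thus ?thesis using r[OF that] lam by (simp add: pos_le_divide_eq mult.commute mult.left_commute)
 qed
 have sub: "K \<subseteq> (\<Union>x\<in>K. cball (id x) (r x))" using r by (force simp: less_imp_le)
 obtain C where C: "countable C" "C \<subseteq> K" "pairwise (%i j. disjnt (cball (id i) (r i)) (cball (id j) (r j))) C"
  "K \<subseteq> (\<Union>i\<in>C. cball (id i) (5 * r i))"
  by (rule Vitali_covering_lemma_cballs[OF sub rb])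
 define D where "D = to_nat_on C ` C"
 define g where "g = from_nat_into C"
 have gD: "g n \<in> C" "to_nat_on C (g n) = n" if "n \<in> D" for n
  using that C(1) unfolding D_def g_def by auto
 have gC: "to_nat_on C i \<in> D" "g (to_nat_on C i) = i" if "i \<in> C" for i
  using that C(1) unfolding D_def g_def by auto
 define X where "X = (%n. if n \<in> D then cball (g n) (5 * r (g n)) else {})"
 define Y where "Y = (%n. if n \<in> D then cball (g n) (r (g n)) else {})"
 have Xm: "X n \<in> sets lborel" and Ym: "Y n \<in> sets lborel" for n unfolding X_def Y_def by auto
 define N where "N = density lborel (%x. ennreal (phi x))"
 have Nm: "sets N = sets borel" unfolding N_def by simp
 have NI: "emeasure N A = (\<integral>\<^sup>+x. ennreal (phi x) * indicator A x \<partial>lborel)" if "A \<in> sets borel" for A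
  unfolding N_def using that by (subst emeasure_density) auto
 have NU: "emeasure N UNIV = ennreal I"
  using nn_integral_eq_integral[OF int] nn NI[of UNIV] unfolding I_def by simp
 have NJ: "emeasure N (cball x r) = ennreal (J x r)" for x r
 proof -
  have "emeasure N (cball x r) = (\<integral>\<^sup>+y. ennreal (indicator {x - r..x + r} y * phi y) \<partial>lborel)"
   unfolding cball_eq_atLeastAtMost
   by (subst NI) (auto intro!: nn_integral_cong simp: indicator_def)
  also have "... = ennreal (J x r)" unfolding J_def
   by (rule nn_integral_eq_integral[OF Ji]) (auto simp: nn)
  finally show ?thesis .
 qed
 have XY: "emeasure lborel (X n) <= ennreal (5 / lam) * emeasure N (Y n)" for n
 proof (cases "n \<in> D")
  case True
  let ?x = "g n"
  have x: "?x \<in> K" using gD(1)[OF True] C(2) by auto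
  have "emeasure lborel (X n) = ennreal (10 * r ?x)"
   using True r[OF x] unfolding X_def by (simp add: cball_eq_atLeastAtMost)
  also have "... <= ennreal (5 / lam * J ?x (r ?x))"
  proof (rule ennreal_leI)
   have "5 / lam * (2 * r ?x * lam) <= 5 / lam * J ?x (r ?x)" using r[OF x] lam by (intro mult_left_mono) auto
   thus "10 * r ?x <= 5 / lam * J ?x (r ?x)" using lam by simp
  qed
  also have "... = ennreal (5 / lam) * emeasure N (Y n)"
   using True lam unfolding Y_def by (simp add: NJ ennreal_mult'[symmetric])
  finally show ?thesis .
 qed (simp add: X_def)
 have disj: "disjoint_family Y"
  unfolding disjoint_family_on_def
 proof (intro ballI impI)
  fix m n :: nat assume mn: "m ~= n"
  show "Y m \<inter> Y n = {}"
  proof (cases "m \<in> D \<and> n \<in> D")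
   case True
   hence "g m ~= g n" using gD(2) mn by metis
   hence "disjnt (cball (g m) (r (g m))) (cball (g n) (r (g n)))"
    using C(3) gD(1) True unfolding pairwise_def by auto
   thus ?thesis using True unfolding Y_def disjnt_def by simp
  qed (auto simp: Y_def)
 qed
 let ?U = "\<Union>n. X n"
 have "emeasure lborel ?U <= (\<Sum>n. emeasure lborel (X n))"
  by (rule emeasure_subadditive_countably) (use Xm in auto)
 also have "... <= (\<Sum>n. ennreal (5 / lam) * emeasure N (Y n))"
  by (intro suminf_le XY summableI)
 also have "... = ennreal (5 / lam) * (\<Sum>n. emeasure N (Y n))" by (rule ennreal_suminf_cmult)
 also have "(\<Sum>n. emeasure N (Y n)) = emeasure N (\<Union>n. Y n)"
  by (rule suminf_emeasure) (use Ym Nm disj in auto)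
 also have "... <= emeasure N UNIV" by (rule emeasure_mono) (auto simp: Nm)
 also have "ennreal (5 / lam) * emeasure N UNIV = ennreal (5 / lam * I)"
  unfolding NU using lam by (simp add: ennreal_mult'[symmetric])
 finally have meas: "emeasure lborel ?U <= ennreal (5 / lam * I)" by (simp add: mult_left_mono)
 show ?thesis
 proof (intro exI[of _ ?U] conjI allI impI)
  show "?U \<in> sets borel" using Xm by auto
  show "emeasure lborel ?U <= ennreal (5 / lam * (LBINT x. phi x))" using meas unfolding I_def .
  fix x r' :: real assume x: "x \<notin> ?U" and r': "0 < r'"
  have "x \<notin> K"
  proof
   assume "x \<in> K"
   then obtain i where i: "i \<in> C" "x \<in> cball (id i) (5 * r i)" using C(4) by auto
   hence "x \<in> X (to_nat_on C i)" unfolding X_def using gC[OF i(1)] by simp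
   with x show False by blast
  qed
  thus "(LBINT y. indicator {x - r'..x + r'} y * phi y) <= 2 * r' * lam"
   unfolding K_def J_def using r' by (metis (mono_tags, lifting) mem_Collect_eq not_less)
 qed
qed

text \<open>The kernel is dominated by a geometric series of normalised indicators of intervals with radii \<open>2^n delta\<close>.\<close>
lemma poisson_majorant:
 fixes phi :: "real => real"
 assumes int: "integrable lborel phi" and nn: "!!x. phi x >= 0" and lam: "lam > 0" and delta: "delta > 0"
  and good: "!!r. r > 0 ==> (LBINT y. indicator {x - r..x + r} y * phi y) <= 2 * r * lam"
 shows "(\<integral>\<^sup>+y. ennreal (phi y * (delta / (delta + \<bar>x - y\<bar>)^2)) \<partial>lborel) <= ennreal (16 * lam)"
proof -
 have [measurable]: "phi \<in> borel_measurable borel" using borel_measurable_integrable[OF int] by simp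
 have Ji: "integrable lborel (%y. indicator {x - r..x + r} y * phi y)" for r
  by (rule integrable_dominated[OF int]) (auto simp: indicator_def nn)
 let ?t = "%n y. ennreal (4 * (1/4)^n / delta) * ennreal (indicator {x - 2^n * delta..x + 2^n * delta} y * phi y)"
 have pt: "ennreal (phi y * (delta / (delta + \<bar>x - y\<bar>)^2)) <= (\<Sum>n. ?t n y)" for y
 proof -
  define r where "r = \<bar>x - y\<bar>"
  have r0: "r >= 0" unfolding r_def by simp
  have "\<exists>n. r <= 2^n * delta"
  proof -
   obtain n where "r / delta < 2^n" using real_arch_pow[of 2 "r / delta"] by auto
   thus ?thesis using delta by (intro exI[of _ n]) (simp add: pos_divide_less_eq)
  qed
  then obtain n where n: "r <= 2^n * delta" "!!m. m < n ==> \<not> r <= 2^m * delta"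
   using exists_least_iff[of "%n. r <= 2^n * delta"] by blast
  have k: "delta / (delta + r)^2 <= 4 * (1/4)^n / delta"
  proof (cases n)
   case 0
   have "delta / (delta + r)^2 <= delta / delta^2" using delta r0 by (intro divide_left_mono power_mono) auto
   also have "... = 1 / delta" using delta by (simp add: power2_eq_square)
   also have "... <= 4 / delta" using delta by (intro divide_right_mono) auto
   finally show ?thesis using 0 by simp
  next
   case (Suc m)
   have "2^m * delta <= delta + r" using n(2)[of m] Suc delta by simp
   hence "(2^m * delta)^2 <= (delta + r)^2" using delta by (intro power_mono) auto
   hence "delta / (delta + r)^2 <= delta / (2^m * delta)^2" using delta r0 by (intro divide_left_mono) auto
   also have "... = 1 / (2^m * 2^m * delta)" using delta by (simp add: power2_eq_square)
   also have "(2::real)^m * 2^m = 4^m" by (simp add: power_mult_distrib[symmetric])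
   finally show ?thesis using Suc delta by (simp add: power_one_over)
  qed
  have "ennreal (phi y * (delta / (delta + r)^2)) <= ennreal (phi y * (4 * (1/4)^n / delta))"
   using k nn by (intro ennreal_leI mult_left_mono) auto
  also have "... = ?t n y"
  proof -
   have "y \<in> {x - 2^n * delta..x + 2^n * delta}" using n(1) unfolding r_def by auto
   thus ?thesis using delta by (subst ennreal_mult'[symmetric]) (auto simp: mult.commute)
  qed
  also have "... = (\<Sum>m\<in>{n}. ?t m y)" by simp
  also have "... <= (\<Sum>n. ?t n y)" by (intro sum_le_suminf summableI) auto
  finally show ?thesis unfolding r_def .
 qed
 have "(\<integral>\<^sup>+y. ennreal (phi y * (delta / (delta + \<bar>x - y\<bar>)^2)) \<partial>lborel) <= (\<integral>\<^sup>+y. (\<Sum>n. ?t n y) \<partial>lborel)"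
  by (intro nn_integral_mono pt)
 also have "... = (\<Sum>n. \<integral>\<^sup>+y. ?t n y \<partial>lborel)"
  by (rule nn_integral_suminf) measurable
 also have "... <= (\<Sum>n. ennreal (8 * lam * (1/2)^n))"
 proof (intro suminf_le summableI)
  fix n
  have "(\<integral>\<^sup>+y. ?t n y \<partial>lborel) = ennreal (4 * (1/4)^n / delta) * (\<integral>\<^sup>+y. ennreal (indicator {x - 2^n * delta..x + 2^n * delta} y * phi y) \<partial>lborel)"
   by (rule nn_integral_cmult) measurable
  also have "(\<integral>\<^sup>+y. ennreal (indicator {x - 2^n * delta..x + 2^n * delta} y * phi y) \<partial>lborel) = ennreal (LBINT y. indicator {x - 2^n * delta..x + 2^n * delta} y * phi y)"
   by (rule nn_integral_eq_integral[OF Ji]) (auto simp: nn)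
  also have "ennreal (4 * (1/4)^n / delta) * ... <= ennreal (4 * (1/4)^n / delta) * ennreal (2 * (2^n * delta) * lam)"
   using good[of "2^n * delta"] delta by (intro mult_left_mono ennreal_leI) auto
  also have "... = ennreal (4 * (1/4)^n / delta * (2 * (2^n * delta) * lam))"
   using delta by (subst ennreal_mult'[symmetric]) auto
  also have "4 * (1/4)^n / delta * (2 * (2^n * delta) * lam) = 8 * lam * (1/2)^n"
  proof -
   have "(1/4::real)^n * 2^n = (1/2)^n" by (simp add: power_mult_distrib[symmetric])
   thus ?thesis using delta by (simp add: field_simps)
  qed
  finally show "(\<integral>\<^sup>+y. ?t n y \<partial>lborel) <= ennreal (8 * lam * (1/2)^n)" .
 qed
 also have "... = ennreal (\<Sum>n. 8 * lam * (1/2)^n)"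
  using lam by (intro suminf_ennreal2 summable_mult summable_geometric) auto
 also have "(\<Sum>n. 8 * lam * (1/2::real)^n) = 16 * lam"
  by (subst suminf_mult) (auto simp: suminf_geometric)
 finally show ?thesis .
qed

section \<open>Square integrable functions on the line\<close>

context lip_graph_deriv begin

definition sq :: "(real => complex) => real" where "sq f = (LBINT t. (norm (f t))^2)"

definition L2R :: "(real => complex) => bool" where
 "L2R f \<longleftrightarrow> f \<in> borel_measurable borel \<and> integrable lborel (%t. (norm (f t))^2)"

lemma norm_add_sq: "(norm (x + y))^2 <= 2 * (norm x)^2 + 2 * (norm y)^2" for x y :: complex
proof -
 have "(norm (x + y))^2 <= (norm x + norm y)^2" by (intro power_mono norm_triangle_ineq) auto
 also have "... <= 2 * (norm x)^2 + 2 * (norm y)^2"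
  using sum_squares_bound[of "norm x" "norm y"] by (simp add: power2_sum)
 finally show ?thesis .
qed

lemma L2R_add: "L2R f ==> L2R g ==> L2R (%t. f t + g t)"
 and sq_add: "L2R f ==> L2R g ==> sq (%t. f t + g t) <= 2 * sq f + 2 * sq g"
proof -
 assume f: "L2R f" and g: "L2R g"
 hence [measurable]: "f \<in> borel_measurable borel" "g \<in> borel_measurable borel" unfolding L2R_def by auto
 have i: "integrable lborel (%t. 2 * (norm (f t))^2 + 2 * (norm (g t))^2)"
  using f g unfolding L2R_def by auto
 have "integrable lborel (%t. (norm (f t + g t))^2)"
  by (rule integrable_dominated[OF i]) (auto simp: norm_add_sq)
 thus 1: "L2R (%t. f t + g t)" unfolding L2R_def by simp
 have "sq (%t. f t + g t) <= (LBINT t. 2 * (norm (f t))^2 + 2 * (norm (g t))^2)"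
  unfolding sq_def using 1 i unfolding L2R_def by (intro integral_mono) (auto simp: norm_add_sq)
 also have "... = 2 * sq f + 2 * sq g" using f g unfolding sq_def L2R_def by simp
 finally show "sq (%t. f t + g t) <= 2 * sq f + 2 * sq g" .
qed

lemma L2R_mult_bounded:
 assumes f: "L2R f" and k: "k \<in> borel_measurable borel" "!!t. norm (k t) <= M"
 shows "L2R (%t. k t * f t)" "sq (%t. k t * f t) <= M^2 * sq f"
proof -
 have [measurable]: "f \<in> borel_measurable borel" "k \<in> borel_measurable borel" using f k unfolding L2R_def by auto
 have i: "integrable lborel (%t. M^2 * (norm (f t))^2)"
  using f unfolding L2R_def by auto
 have p: "(norm (k t * f t))^2 <= M^2 * (norm (f t))^2" for t
  unfolding norm_mult power_mult_distrib using k(2)[of t] by (intro mult_right_mono power_mono) auto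
 have "integrable lborel (%t. (norm (k t * f t))^2)"
  by (rule integrable_dominated[OF i]) (use p in "auto simp: abs_le_iff")
 thus 1: "L2R (%t. k t * f t)" unfolding L2R_def by simp
 have "sq (%t. k t * f t) <= (LBINT t. M^2 * (norm (f t))^2)"
  unfolding sq_def using 1 i p unfolding L2R_def by (intro integral_mono) auto
 thus "sq (%t. k t * f t) <= M^2 * sq f" unfolding sq_def by simp
qed

lemma L2R_diff: "L2R f ==> L2R g ==> L2R (%t. f t - g t)"
 using L2R_add[of f "%t. (-1) * g t"] L2R_mult_bounded(1)[of g "%t. -1" 1] by simp

lemma sq_nonneg: "sq f >= 0"
 unfolding sq_def by simp

lemma L2R_bounded_support:
 assumes "f \<in> borel_measurable borel" "!!t. norm (f t) <= M" "!!t. t \<notin> {s..<u} ==> f t = 0" "s <= u"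
 shows "L2R f" "sq f <= M^2 * (u - s)"
proof -
 have i: "integrable lborel (%t. indicator {s..<u} t * M^2)"
  by (intro integrable_mult_left integrable_real_indicator) (use assms(4) in auto)
 have p: "(norm (f t))^2 <= indicator {s..<u} t * M^2" for t
  using assms(2)[of t] assms(3)[of t] by (cases "t \<in> {s..<u}") (auto intro: power_mono)
 have "integrable lborel (%t. (norm (f t))^2)"
  by (rule integrable_dominated[OF i]) (use p assms(1) in "auto simp: abs_le_iff")
 thus 1: "L2R f" using assms(1) unfolding L2R_def by simp
 have "sq f <= (LBINT t. indicator {s..<u} t * M^2)"
  unfolding sq_def using 1 i p unfolding L2R_def by (intro integral_mono) auto
 also have "... = M^2 * (u - s)" using assms(4) by simp
 finally show "sq f <= M^2 * (u - s)" .
qed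

lemma stepf_outside: 
 assumes l: "l > 0" and t: "t \<notin> {X..<X + l}"
 shows "stepf X l N c t = 0"
 unfolding stepf_def
proof (intro sum.neutral ballI)
 fix i assume "i \<in> {..<(2::nat)^N}"
 hence "Suc i <= 2^N" by simp
 hence "real (Suc i) <= 2^N" by (metis of_nat_le_iff of_nat_numeral of_nat_power)
 hence "gp X l N (Suc i) <= X + l" unfolding gp_def using l by (simp add: divide_le_eq mult_left_mono)
 moreover have "X <= gp X l N i" unfolding gp_def using l by simp
 ultimately show "indicator {gp X l N i..<gp X l N (Suc i)} t *\<^sub>R c i = 0" using t by (auto simp: indicator_def)
qed

lemma stepf_meas [measurable]: "stepf X l N c \<in> borel_measurable borel"
 unfolding stepf_def[abs_def] by measurable

lemma stepf_L2R: "l > 0 ==> L2R (stepf X l N c)"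
 unfolding L2R_def
proof
 assume l: "l > 0"
 show "integrable lborel (%t. (norm (stepf X l N c t))^2)"
  unfolding stepf_sq[OF l]
  by (intro Bochner_Integration.integrable_sum integrable_mult_left integrable_real_indicator)
   (simp_all add: gp_mono[OF l])
qed measurable

lemma step_dense_continuous:
 assumes g: "continuous_on UNIV g" and l: "l > 0" and e: "e > 0"
 shows "\<exists>N c. sq (%t. indicator {X..<X + l} t *\<^sub>R g t - stepf X l N c t) <= e"
proof -
 define d where "d = sqrt (e / l)"
 have d: "d > 0" "d^2 * l = e" unfolding d_def using e l by auto
 have "uniformly_continuous_on {X..X + l} g"
  by (rule compact_uniformly_continuous[OF continuous_on_subset[OF g]]) auto
 then obtain delta where delta: "delta > 0" "!!s t. s \<in> {X..X + l} ==> t \<in> {X..X + l} ==> dist s t < delta ==> dist (g s) (g t) < d"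
  unfolding uniformly_continuous_on_def using d by metis
 obtain N where "l / delta < 2^N" using real_arch_pow[of 2 "l / delta"] by auto
 hence N: "l / 2^N < delta" using delta by (simp add: field_simps)
 define c where "c = (%i. g (gp X l N i))"
 have g_meas [measurable]: "g \<in> borel_measurable borel" by (rule borel_measurable_continuous_onI[OF g])
 have b: "norm (indicator {X..<X + l} t *\<^sub>R g t - stepf X l N c t) <= d" for t
 proof (cases "t \<in> {X..<X + l}")
  case True
  define i where "i = nat \<lfloor>(t - X) / l * 2^N\<rfloor>"
  have p0: "0 <= (t - X) / l * 2^N" using True l by auto
  have i1: "real i <= (t - X) / l * 2^N" "(t - X) / l * 2^N < real i + 1" unfolding i_def using p0 by linarith+
  have "(t - X) / l * 2^N < 1 * 2^N" using True l by (intro mult_strict_right_mono) auto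
  hence "real i < 2^N" using i1 by linarith
  hence iN: "i < 2^N" by (metis of_nat_less_iff of_nat_numeral of_nat_power)
  have ti: "t \<in> {gp X l N i..<gp X l N (Suc i)}"
  proof -
   have "l * real i / 2^N <= t - X" using i1(1) l by (simp add: field_simps)
   moreover have "t - X < l * real (Suc i) / 2^N" using i1(2) l by (simp add: field_simps)
   ultimately show ?thesis unfolding gp_def by auto
  qed
  have ind: "indicator {gp X l N j..<gp X l N (Suc j)} t = (if j = i then 1 else 0 :: real)" for j
  proof (cases "j = i")
   case False
   have "t \<notin> {gp X l N j..<gp X l N (Suc j)}"
   proof
    assume tj: "t \<in> {gp X l N j..<gp X l N (Suc j)}"
    have mono: "gp X l N m <= gp X l N n" if "m <= n" for m n
    unfolding gp_def using l that by (intro add_left_mono divide_right_mono mult_left_mono) auto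
    show False
    proof (cases "j < i")
    case True thus False using mono[of "Suc j" i] tj ti by auto
    next
    case False thus False using mono[of "Suc i" j] \<open>j ~= i\<close> tj ti by auto
    qed
   qed
   thus ?thesis using False by simp
  qed (use ti in simp)
  have "stepf X l N c t = (\<Sum>j<2^N. if j = i then c j else 0)"
   unfolding stepf_def by (intro sum.cong refl) (simp add: ind)
  also have "... = g (gp X l N i)" using iN by (simp add: c_def)
  finally have s: "stepf X l N c t = g (gp X l N i)" .
  have "gp X l N i >= X" unfolding gp_def using l by simp
  moreover have "t - gp X l N i < delta" using ti gp_simps(7)[of X l N i] N unfolding gh_def by auto
  ultimately have "dist (g t) (g (gp X l N i)) < d" using True ti by (intro delta(2)) (auto simp: dist_real_def)
  thus ?thesis using True s by (simp add: dist_norm)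
 qed (use stepf_outside[OF l] d in simp)
 have "sq (%t. indicator {X..<X + l} t *\<^sub>R g t - stepf X l N c t) <= d^2 * (X + l - X)"
  by (rule L2R_bounded_support(2)[OF _ b]) (use stepf_outside[OF l] l in "auto simp: indicator_def")
 thus ?thesis using d by auto
qed

lemma sq_tendsto_zero:
 assumes f: "!!n. f n \<in> borel_measurable borel" and lim: "AE t in lborel. (%n. f n t) \<longlonglongrightarrow> 0"
  and w: "integrable lborel w" "!!n t. (norm (f n t))^2 <= w t"
 shows "(%n. sq (f n)) \<longlonglongrightarrow> 0"
proof -
 have "(%n. sq (f n)) \<longlonglongrightarrow> (LINT t|(lborel :: real measure). (0::real))"
  unfolding sq_def
 proof (rule integral_dominated_convergence[where w = w and f = "%_. 0" and s = "%n t. (norm (f n t))^2" and M = lborel])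
  show "AE t in lborel. (%n. (norm (f n t))^2) \<longlonglongrightarrow> 0"
   using lim
  proof eventually_elim
   case (elim t)
   from tendsto_power[OF tendsto_norm[OF elim], of 2] show ?case by simp
  qed
  show "(%t. (norm (f n t))^2) \<in> borel_measurable lborel" for n using f by simp
 qed (use w in auto)
 thus ?thesis by simp
qed

text \<open>Truncation at large values makes the function bounded; a bounded measurable function is an almost everywhere limit of
continuous functions, and these are approximated by step functions on a fine grid.\<close>
lemma step_dense:
 assumes f: "L2R f" and supp: "!!t. t \<notin> {X..<X + l} ==> f t = 0" and l: "l > 0" and e: "e > 0"
 shows "\<exists>N c. sq (%t. f t - stepf X l N c t) <= e"
proof -
 have fm [measurable]: "f \<in> borel_measurable borel" using f unfolding L2R_def by auto
 have bounded: "\<exists>N c. sq (%t. h t - stepf X l N c t) <= e"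
  if h: "h \<in> borel_measurable borel" "!!t. norm (h t) <= B" "!!t. t \<notin> {X..<X + l} ==> h t = 0" "B > 0" and e: "e > 0" for h B e
 proof -
  have [measurable]: "h \<in> borel_measurable borel" by (rule h)
  have "h measurable_on UNIV"
   by (rule lebesgue_measurable_imp_measurable_on) (use h(1) in "auto intro: measurable_completion")
  then obtain M g where M: "negligible M" and g: "!!n. continuous_on UNIV (g n)" and lim: "!!x. x \<notin> M ==> (%n. g n x) \<longlonglongrightarrow> h x"
   unfolding measurable_on_def by auto
  define cl' where "cl' = (%w :: complex. w / of_real (max 1 (norm w / B)))"
  have cc: "continuous_on UNIV cl'" unfolding cl'_def
   using h(4) by (intro continuous_intros) (auto simp: max_def)
  have cb: "norm (cl' w) <= B" for w
  proof -
   have "norm w <= B * max 1 (norm w / B)" using h(4) by (simp add: max_def field_simps)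
   moreover have "norm (cl' w) = norm w / max 1 (norm w / B)" unfolding cl'_def by (simp only: norm_divide norm_of_real)
   moreover have "max 1 (norm w / B) > 0" by simp
   ultimately show ?thesis by (simp only: pos_divide_le_eq)
  qed
  have ch: "cl' (h x) = h x" for x
  proof -
   have "norm (h x) / B <= 1" using h(2)[of x] h(4) by simp
   thus ?thesis unfolding cl'_def by (simp add: max_def)
  qed
  define k where "k = (%n t. indicator {X..<X + l} t *\<^sub>R cl' (g n t))"
  have kc: "continuous_on UNIV (%t. cl' (g n t))" for n
   by (rule continuous_on_compose2[OF cc g]) auto
  have km [measurable]: "k n \<in> borel_measurable borel" for n
   unfolding k_def using borel_measurable_continuous_onI[OF kc] by measurable
  have "(%n. sq (%t. h t - k n t)) \<longlonglongrightarrow> 0"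
  proof (rule sq_tendsto_zero)
   show "(%t. h t - k n t) \<in> borel_measurable borel" for n by measurable
   have "AE t in lborel. t \<notin> M"
    using M unfolding negligible_iff_null_sets by (intro AE_not_in[THEN AE_completion_iff[THEN iffD1]]) auto
   thus "AE t in lborel. (%n. h t - k n t) \<longlonglongrightarrow> 0"
   proof eventually_elim
    case (elim t)
    have "isCont cl' (h t)" using cc by (simp add: continuous_on_eq_continuous_at)
    from isCont_tendsto_compose[OF this lim[OF elim]]
    have "(%n. cl' (g n t)) \<longlonglongrightarrow> h t" unfolding ch .
    hence "(%n. k n t) \<longlonglongrightarrow> indicator {X..<X + l} t *\<^sub>R h t" unfolding k_def by (intro tendsto_intros)
    moreover have "indicator {X..<X + l} t *\<^sub>R h t = h t" using h(3)[of t] by (auto simp: indicator_def)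
    ultimately show ?case using LIM_zero_iff[of "%n. k n t"] tendsto_diff[OF tendsto_const[of "h t"], of "%n. k n t" "h t"] by simp
   qed
   show "integrable lborel (%t. indicator {X..<X + l} t * (2 * B)^2)"
    by (intro integrable_mult_left integrable_real_indicator) (use l in auto)
   show "(norm (h t - k n t))^2 <= indicator {X..<X + l} t * (2 * B)^2" for n t
   proof (cases "t \<in> {X..<X + l}")
    case True
    have "norm (h t - k n t) <= B + B"
    unfolding k_def using True h(2)[of t] cb[of "g n t"] by (intro order_trans[OF norm_triangle_ineq4] add_mono) auto
    hence "(norm (h t - k n t))^2 <= (2 * B)^2" by (intro power_mono) auto
    thus ?thesis using True by simp
   qed (use h(3) in "simp add: k_def")
  qed
  hence "eventually (%n. sq (%t. h t - k n t) < e / 4) sequentially" using e by (intro order_tendstoD(2)) auto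
  then obtain n where n: "sq (%t. h t - k n t) < e / 4" by (auto simp: eventually_sequentially)
  obtain N c where Nc: "sq (%t. k n t - stepf X l N c t) <= e / 4"
   using step_dense_continuous[OF kc l, of "e/4" X n] e unfolding k_def by auto
  have kL: "L2R (k n)"
   by (rule L2R_bounded_support(1)[where M = B and s = X and u = "X + l", OF km]) (use cb h(4) l in "auto simp: k_def indicator_def")
  have hL: "L2R h" by (rule L2R_bounded_support(1)[OF h(1) h(2) h(3)]) (use l in auto)
  have "sq (%t. (h t - k n t) + (k n t - stepf X l N c t)) <= 2 * sq (%t. h t - k n t) + 2 * sq (%t. k n t - stepf X l N c t)"
   by (intro sq_add L2R_diff hL kL stepf_L2R l)
  thus ?thesis using n Nc by (intro exI[of _ N] exI[of _ c]) simp
 qed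
 define h where "h = (%n t. if norm (f t) <= real (Suc n) then f t else 0)"
 have hm [measurable]: "h n \<in> borel_measurable borel" for n unfolding h_def by measurable
 have "(%n. sq (%t. f t - h n t)) \<longlonglongrightarrow> 0"
 proof (rule sq_tendsto_zero)
  show "AE t in lborel. (%n. f t - h n t) \<longlonglongrightarrow> 0"
  proof (rule AE_I2)
   fix t
   obtain m :: nat where m: "norm (f t) <= real m" using real_arch_simple by blast
   have "eventually (%n. f t - h n t = 0) sequentially"
    using eventually_ge_at_top[of m] by eventually_elim (use m in "simp add: h_def")
   thus "(%n. f t - h n t) \<longlonglongrightarrow> 0" by (rule tendsto_eventually)
  qed
  show "integrable lborel (%t. (norm (f t))^2)" using f unfolding L2R_def by simp
 qed (auto simp: h_def)
 hence "eventually (%n. sq (%t. f t - h n t) < e / 4) sequentially" using e by (intro order_tendstoD(2)) auto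
 then obtain n where n: "sq (%t. f t - h n t) < e / 4" by (auto simp: eventually_sequentially)
 have hb: "norm (h n t) <= real (Suc n)" "t \<notin> {X..<X + l} ==> h n t = 0" for t
  unfolding h_def using supp by auto
 obtain N c where Nc: "sq (%t. h n t - stepf X l N c t) <= e / 4"
  using bounded[OF hm hb, of "e/4"] e by auto
 have hL: "L2R (h n)" by (rule L2R_bounded_support(1)[OF hm hb]) (use l in auto)
 have "sq (%t. (f t - h n t) + (h n t - stepf X l N c t)) <= 2 * sq (%t. f t - h n t) + 2 * sq (%t. h n t - stepf X l N c t)"
  by (intro sq_add L2R_diff hL f stepf_L2R l)
 thus ?thesis using n Nc by (intro exI[of _ N] exI[of _ c]) simp
qed

lemma L1_of_L2:
 assumes f: "L2R f" and supp: "!!t. t \<notin> {X..<X + l} ==> f t = 0" and l: "l > 0" and d: "d > 0"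
 shows "integrable lborel f" "(LBINT t. norm (f t)) <= (d * l + sq f / d) / 2"
proof -
 have [measurable]: "f \<in> borel_measurable borel" using f unfolding L2R_def by auto
 let ?w = "%t. (d * indicator {X..<X + l} t + (norm (f t))^2 / d) / 2"
 have i1: "integrable lborel (%t. d * indicator {X..<X + l} t)"
  by (intro integrable_mult_right integrable_real_indicator) (use l in auto)
 have i2: "integrable lborel (%t. (norm (f t))^2 / d)" using f unfolding L2R_def by auto
 have i: "integrable lborel ?w" using i1 i2 by auto
 have p: "norm (f t) <= ?w t" for t
 proof (cases "t \<in> {X..<X + l}")
  case True
  have "0 <= (norm (f t) - d)^2 / d" using d by simp
  thus ?thesis using True d by (simp add: field_simps power2_eq_square)
 qed (use supp d in simp)
 show "integrable lborel f"
 proof (rule integrable_dominated[OF i])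
  show "AE t in lborel. norm (f t) <= norm (?w t)"
   using p by (intro AE_I2) (metis abs_ge_self order_trans real_norm_def)
 qed simp
 hence "(LBINT t. norm (f t)) <= (LBINT t. ?w t)"
  by (intro integral_mono integrable_norm i p)
 also have "... = (d * l + sq f / d) / 2"
  unfolding sq_def using i1 i2 l by simp
 finally show "(LBINT t. norm (f t)) <= (d * l + sq f / d) / 2" .
qed

end

section \<open>Uniform boundedness of the Cauchy integral\<close>

lemma poisson_mass:
 assumes delta: "delta > 0"
 shows "(\<integral>\<^sup>+y. ennreal (delta / (delta + \<bar>x - y\<bar>)^2) \<partial>lborel) <= 2"
proof -
 let ?P = "%u::real. ennreal (delta / (delta + \<bar>u\<bar>)^2)"
 have "(\<integral>\<^sup>+y. ennreal (delta / (delta + \<bar>x - y\<bar>)^2) \<partial>lborel) = (\<integral>\<^sup>+u. ?P u \<partial>lborel)"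
  using nn_integral_real_affine[of "%y. ennreal (delta / (delta + \<bar>x - y\<bar>)^2)" 1 x] by simp
 also have "... <= (\<integral>\<^sup>+u. ?P u * indicator {0..} u + ?P (-u) * indicator {0..} (-u) \<partial>lborel)"
  by (intro nn_integral_mono) (auto simp: indicator_def)
 also have "... = (\<integral>\<^sup>+u. ?P u * indicator {0..} u \<partial>lborel) + (\<integral>\<^sup>+u. ?P (-u) * indicator {0..} (-u) \<partial>lborel)"
  by (rule nn_integral_add) measurable
 also have "(\<integral>\<^sup>+u. ?P (-u) * indicator {0..} (-u) \<partial>lborel) = (\<integral>\<^sup>+u. ?P u * indicator {0..} u \<partial>lborel)"
  using nn_integral_real_affine[of "%u. ?P u * indicator {0..} u" "-1" 0] by simp
 also have "(\<integral>\<^sup>+u. ?P u * indicator {0..} u \<partial>lborel) = ennreal (0 - (- delta / (delta + 0)))"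
 proof -
  have "(\<integral>\<^sup>+u. ?P u * indicator {0..} u \<partial>lborel) = (\<integral>\<^sup>+u. ennreal (delta / (delta + u)^2) * indicator {0..} u \<partial>lborel)"
   by (intro nn_integral_cong) (auto simp: indicator_def)
  also have "... = ennreal (0 - (- delta / (delta + 0)))"
  proof (rule nn_integral_FTC_atLeast)
   fix u :: real assume u: "0 <= u"
   show "((%u. - delta / (delta + u)) has_real_derivative delta / (delta + u)^2) (at u)"
    using u delta by (auto intro!: derivative_eq_intros simp: power2_eq_square)
   show "0 <= delta / (delta + u)^2" using delta by simp
  next
   show "((%u. - delta / (delta + u)) \<longlongrightarrow> 0) at_top"
    by (intro tendsto_divide_0[OF tendsto_const] filterlim_at_top_imp_at_infinity filterlim_tendsto_add_at_top[OF tendsto_const] filterlim_ident)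
  qed measurable
  finally show ?thesis .
 qed
 also have "ennreal (0 - (- delta / (delta + 0))) = 1" using delta by simp
 finally show ?thesis by simp
qed

text \<open>The inequality \<open>2 |g| \<le> lam + |g|\<^sup>2 / lam\<close> reduces the claim to \<open>poisson_mass\<close> and \<open>poisson_majorant\<close>, which give
\<open>(2 lam + 16 lam) / 2\<close>.\<close>
lemma poisson_average:
 fixes g :: "real => complex"
 assumes g: "g \<in> borel_measurable borel" "integrable lborel (%t. (norm (g t))^2)" and lam: "lam > 0" and delta: "delta > 0"
  and good: "!!r. r > 0 ==> (LBINT y. indicator {x - r..x + r} y * (norm (g y))^2) <= 2 * r * lam^2"
 shows "integrable lborel (%y. norm (g y) * (delta / (delta + \<bar>x - y\<bar>)^2))"
  "(LBINT y. norm (g y) * (delta / (delta + \<bar>x - y\<bar>)^2)) <= 9 * lam"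
proof -
 have [measurable]: "g \<in> borel_measurable borel" by (rule g)
 define P where "P = (%y::real. delta / (delta + \<bar>x - y\<bar>)^2)"
 have P0: "P y >= 0" for y using delta unfolding P_def by simp
 have [measurable]: "P \<in> borel_measurable borel" unfolding P_def by measurable
 have mass: "(\<integral>\<^sup>+y. ennreal (P y) \<partial>lborel) <= 2" unfolding P_def by (rule poisson_mass[OF delta])
 have pt: "norm (g y) * P y <= lam / 2 * P y + 1 / (2 * lam) * ((norm (g y))^2 * P y)" for y
 proof -
  have "0 <= (norm (g y) - lam)^2 / (2 * lam)" using lam by simp
  hence "norm (g y) <= lam / 2 + 1 / (2 * lam) * (norm (g y))^2" using lam by (simp add: field_simps power2_eq_square)
  from mult_right_mono[OF this P0[of y]] show ?thesis by (simp only: distrib_right mult.assoc)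
 qed
 have nn: "(\<integral>\<^sup>+y. ennreal (norm (g y) * P y) \<partial>lborel) <= ennreal (9 * lam)"
 proof -
  have "(\<integral>\<^sup>+y. ennreal (norm (g y) * P y) \<partial>lborel) <= (\<integral>\<^sup>+y. ennreal (lam / 2) * ennreal (P y) + ennreal (1 / (2 * lam)) * ennreal ((norm (g y))^2 * P y) \<partial>lborel)"
  proof (intro nn_integral_mono)
   fix y
   have "ennreal (norm (g y) * P y) <= ennreal (lam / 2 * P y + 1 / (2 * lam) * ((norm (g y))^2 * P y))"
    by (rule ennreal_leI[OF pt])
   also have "... = ennreal (lam / 2) * ennreal (P y) + ennreal (1 / (2 * lam)) * ennreal ((norm (g y))^2 * P y)"
   proof -
    have 1: "ennreal (lam / 2 * P y) = ennreal (lam / 2) * ennreal (P y)"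
    by (rule ennreal_mult) (use lam P0[of y] in auto)
    have 2: "ennreal (1 / (2 * lam) * ((norm (g y))^2 * P y)) = ennreal (1 / (2 * lam)) * ennreal ((norm (g y))^2 * P y)"
    by (rule ennreal_mult) (use lam P0[of y] in auto)
    show ?thesis unfolding 1[symmetric] 2[symmetric] by (rule ennreal_plus) (use lam P0[of y] in auto)
   qed
   finally show "ennreal (norm (g y) * P y) <= ..." .
  qed
  also have "... = ennreal (lam / 2) * (\<integral>\<^sup>+y. ennreal (P y) \<partial>lborel) + ennreal (1 / (2 * lam)) * (\<integral>\<^sup>+y. ennreal ((norm (g y))^2 * P y) \<partial>lborel)"
   by (simp add: nn_integral_add nn_integral_cmult)
  also have "... <= ennreal (lam / 2) * 2 + ennreal (1 / (2 * lam)) * ennreal (16 * lam^2)"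
  proof (intro add_mono mult_left_mono mass)
   show "(\<integral>\<^sup>+y. ennreal ((norm (g y))^2 * P y) \<partial>lborel) <= ennreal (16 * lam^2)"
    unfolding P_def by (rule poisson_majorant[OF g(2) _ _ delta good]) (use lam in auto)
  qed auto
  also have "... = ennreal (lam / 2 * 2) + ennreal (1 / (2 * lam) * (16 * lam^2))"
   using lam by (simp add: ennreal_mult'[symmetric] ennreal_mult''[symmetric] flip: ennreal_numeral)
  also have "... = ennreal (9 * lam)"
   using lam by (subst ennreal_plus[symmetric]) (auto simp: power2_eq_square)
  finally show ?thesis .
 qed
 have i: "integrable lborel (%y. norm (g y) * P y)"
 proof (rule integrableI_nonneg)
  show "(\<integral>\<^sup>+y. ennreal (norm (g y) * P y) \<partial>lborel) < \<infinity>" using nn by (rule le_less_trans) simp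
 qed (use P0 in auto)
 have "ennreal (LBINT y. norm (g y) * P y) = (\<integral>\<^sup>+y. ennreal (norm (g y) * P y) \<partial>lborel)"
  using nn_integral_eq_integral[OF i] P0 by simp
 hence "ennreal (LBINT y. norm (g y) * P y) <= ennreal (9 * lam)" using nn by simp
 hence "(LBINT y. norm (g y) * P y) <= 9 * lam" using lam by (subst (asm) ennreal_le_iff) auto
 thus "(LBINT y. norm (g y) * (delta / (delta + \<bar>x - y\<bar>)^2)) <= 9 * lam" by (simp only: P_def)
 show "integrable lborel (%y. norm (g y) * (delta / (delta + \<bar>x - y\<bar>)^2))" using i by (simp only: P_def)
qed

lemma poisson_integrable:
 fixes x delta :: real
 assumes delta: "delta > 0"
 shows "integrable lborel (%y. delta / (delta + \<bar>x - y\<bar>)^2)"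
proof (rule integrableI_nonneg)
 show "(\<integral>\<^sup>+y. ennreal (delta / (delta + \<bar>x - y\<bar>)^2) \<partial>lborel) < \<infinity>"
  using poisson_mass[OF delta, of x] by (rule le_less_trans) simp
qed (use delta in auto)

context lip_graph_deriv begin

lemma stepf_refine_Suc: "l > 0 ==> stepf X l (Suc N) (%i. c (i div 2)) = stepf X l N c"
proof
 fix t assume l: "l > 0"
 have "stepf X l (Suc N) (%i. c (i div 2)) t = (\<Sum>i<2^N. indicator {gp X l (Suc N) (2*i)..<gp X l (Suc N) (Suc (2*i))} t *\<^sub>R c i
  + indicator {gp X l (Suc N) (Suc (2*i))..<gp X l (Suc N) (Suc (Suc (2*i)))} t *\<^sub>R c i)"
  unfolding stepf_def power_Suc sum_pairs by simp
 also have "... = stepf X l N c t"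
  unfolding stepf_def
 proof (intro sum.cong refl)
  fix i
  have "gp X l (Suc N) (2*i) <= gp X l (Suc N) (Suc (2*i))" "gp X l (Suc N) (Suc (2*i)) <= gp X l (Suc N) (Suc (Suc (2*i)))"
   using gp_mono[OF l] by auto
  hence "(indicator {gp X l N i..<gp X l N (Suc i)} t :: real) = indicator {gp X l (Suc N) (2*i)..<gp X l (Suc N) (Suc (2*i))} t
   + indicator {gp X l (Suc N) (Suc (2*i))..<gp X l (Suc N) (Suc (Suc (2*i)))} t"
   unfolding gp_simps(3,4) by (auto simp: indicator_def)
  thus "indicator {gp X l (Suc N) (2*i)..<gp X l (Suc N) (Suc (2*i))} t *\<^sub>R c i
  + indicator {gp X l (Suc N) (Suc (2*i))..<gp X l (Suc N) (Suc (Suc (2*i)))} t *\<^sub>R c i = indicator {gp X l N i..<gp X l N (Suc i)} t *\<^sub>R c i"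
   by (simp add: scaleR_left_distrib)
 qed
 finally show "stepf X l (Suc N) (%i. c (i div 2)) t = stepf X l N c t" .
qed

lemma stepf_refine:
 assumes l: "l > 0" and "N <= M"
 shows "\<exists>c'. stepf X l M c' = stepf X l N c"
 using assms(2)
proof (induction M rule: dec_induct)
 case (step M)
 then obtain c' where "stepf X l M c' = stepf X l N c" by auto
 hence "stepf X l (Suc M) (%i. c' (i div 2)) = stepf X l N c" using stepf_refine_Suc[OF l] by simp
 thus ?case by blast
qed auto

text \<open>For fixed \<open>eta\<close> the kernel is bounded, so the form is continuous, with a constant that depends on \<open>eta\<close>.\<close>
lemma form_error:
 assumes l: "l > 0" and eta: "0 < eta" and f: "L2R f" "L2R f'" and h: "L2R h" "L2R h'"
  and fs: "!!t. t \<notin> {X..<X + l} ==> f t = 0" "!!t. t \<notin> {X..<X + l} ==> f' t = 0"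
  and hs: "!!t. t \<notin> {X..<X + l} ==> h t = 0" "!!t. t \<notin> {X..<X + l} ==> h' t = 0"
  and e: "0 < e" "e <= 1" and ef: "sq (%t. f t - f' t) <= B * e^2" and eh: "sq (%t. h t - h' t) <= B * e^2"
 shows "norm (LBINT x. h x * F eta f x) <= norm (LBINT x. h' x * F eta f' x)
  + e * ((2 + L) / eta * ((l + B) / 2) * ((LBINT t. norm (f t)) + (LBINT t. norm (h t)) + (l + B) / 2))"
proof -
 let ?K = "(2 + L) / eta"
 have K: "?K >= 0" using L_nonneg eta by simp
 have fi: "integrable lborel f" "integrable lborel f'" "integrable lborel h" "integrable lborel h'"
  using L1_of_L2(1)[OF f(1) fs(1) l zero_less_one] L1_of_L2(1)[OF f(2) fs(2) l zero_less_one] L1_of_L2(1)[OF h(1) hs(1) l zero_less_one] L1_of_L2(1)[OF h(2) hs(2) l zero_less_one] by auto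
 have B0: "B >= 0" using order_trans[OF sq_nonneg ef] e by (simp add: zero_le_mult_iff)
 have d1: "(LBINT t. norm (k t - k' t)) <= e * ((l + B) / 2)"
  if k: "L2R k" "L2R k'" "!!t. t \<notin> {X..<X + l} ==> k t = 0" "!!t. t \<notin> {X..<X + l} ==> k' t = 0" "sq (%t. k t - k' t) <= B * e^2" for k k'
 proof -
  have "(LBINT t. norm (k t - k' t)) <= (e * l + sq (%t. k t - k' t) / e) / 2"
   by (rule L1_of_L2(2)[where X = X, OF L2R_diff[OF k(1,2)] _ l e(1)]) (use k in auto)
  also have "... <= (e * l + B * e^2 / e) / 2" using k(5) e by (intro divide_right_mono add_left_mono) auto
  also have "... = e * ((l + B) / 2)" using e by (simp add: power2_eq_square field_simps)
  finally show ?thesis .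
 qed
 note df = d1[OF f fs ef] and dh = d1[OF h hs eh]
 have ci: "integrable lborel (%x. k x * F eta g x)" if "integrable lborel k" "integrable lborel g" for k g
 proof (rule integrable_dominated[OF integrable_mult_right[OF that(1), of "of_real (?K * (LBINT t. norm (g t)))"]])
  have [measurable]: "k \<in> borel_measurable borel" using borel_measurable_integrable[OF that(1)] by simp
  have [measurable]: "F eta g \<in> borel_measurable borel"
   by (rule borel_measurable_continuous_onI[OF F_continuous[OF that(2)]]) (use eta in auto)
  show "(%x. k x * F eta g x) \<in> borel_measurable lborel" by measurable
  show "AE x in lborel. norm (k x * F eta g x) <= norm (complex_of_real (?K * (LBINT t. norm (g t))) * k x)"
  proof (rule AE_I2)
   fix x
   have "norm (F eta g x) <= ?K * (LBINT t. norm (g t))" using F_bound[OF that(2), of eta x] eta by simp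
   thus "norm (k x * F eta g x) <= norm (complex_of_real (?K * (LBINT t. norm (g t))) * k x)"
    unfolding norm_mult norm_of_real mult.commute[of "norm (k x)"]
    by (intro mult_right_mono order_trans[OF _ abs_ge_self]) auto
  qed
 qed
 have est: "norm (LBINT x. k x * F eta g x) <= ?K * (LBINT t. norm (g t)) * (LBINT t. norm (k t))"
  if "integrable lborel k" "integrable lborel g" for k g
 proof -
  have "norm (LBINT x. k x * F eta g x) <= (LBINT x. norm (k x * F eta g x))" by (rule integral_norm_bound)
  also have "... <= (LBINT x. ?K * (LBINT t. norm (g t)) * norm (k x))"
  proof (rule integral_mono)
   show "integrable lborel (%x. norm (k x * F eta g x))" by (intro integrable_norm ci that)
   show "integrable lborel (%x. ?K * (LBINT t. norm (g t)) * norm (k x))" by (intro integrable_mult_right integrable_norm that)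
   fix x
   have "norm (F eta g x) <= ?K * (LBINT t. norm (g t))" using F_bound[OF that(2), of eta x] eta by simp
   thus "norm (k x * F eta g x) <= ?K * (LBINT t. norm (g t)) * norm (k x)"
    unfolding norm_mult mult.commute[of "norm (k x)"] by (intro mult_right_mono) auto
  qed
  finally show ?thesis by simp
 qed
 let ?nf = "LBINT t. norm (f t)" and ?nh = "LBINT t. norm (h t)"
 have e1: "(LBINT x. h x * F eta f x) = (LBINT x. h' x * F eta f' x) + (LBINT x. (h x - h' x) * F eta f x) + (LBINT x. h' x * F eta (%t. f t - f' t) x)"
 proof -
  have Fd: "F eta (%t. f t - f' t) x = F eta f x - F eta f' x" for x by (rule F_diff[OF fi(1,2)]) (use eta in auto)
  have "h x * F eta f x = h' x * F eta f' x + (h x - h' x) * F eta f x + h' x * F eta (%t. f t - f' t) x" for x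
   unfolding Fd by (simp add: algebra_simps)
  thus ?thesis using ci[OF fi(4,2)] ci[of "%x. h x - h' x" f] ci[of h' "%t. f t - f' t"] fi by simp
 qed
 have n2: "norm (LBINT x. (h x - h' x) * F eta f x) <= ?K * ?nf * (e * ((l + B) / 2))"
 proof (rule order_trans[OF est])
  show "?K * ?nf * (LBINT t. norm (h t - h' t)) <= ?K * ?nf * (e * ((l + B) / 2))"
   by (intro mult_left_mono dh mult_nonneg_nonneg K) auto
 qed (use fi in auto)
 have nh': "(LBINT t. norm (h' t)) <= ?nh + (l + B) / 2"
 proof -
  have "(LBINT t. norm (h' t)) <= (LBINT t. norm (h t) + norm (h t - h' t))"
  proof (intro integral_mono)
   show "norm (h' t) <= norm (h t) + norm (h t - h' t)" for t
    using norm_triangle_ineq4[of "h t" "h t - h' t"] by simp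
  qed (use fi in auto)
  also have "... = ?nh + (LBINT t. norm (h t - h' t))" using fi by simp
  also have "... <= ?nh + 1 * ((l + B) / 2)" using dh e l B0 by (intro add_left_mono order_trans[OF dh] mult_right_mono) auto
  finally show ?thesis by simp
 qed
 have n3: "norm (LBINT x. h' x * F eta (%t. f t - f' t) x) <= ?K * (e * ((l + B) / 2)) * (?nh + (l + B) / 2)"
 proof (rule order_trans[OF est])
  show "?K * (LBINT t. norm (f t - f' t)) * (LBINT t. norm (h' t)) <= ?K * (e * ((l + B) / 2)) * (?nh + (l + B) / 2)"
   using K df nh' e l B0 by (intro mult_mono mult_left_mono mult_nonneg_nonneg) auto
 qed (use fi in auto)
 have "norm (LBINT x. h x * F eta f x) <= norm (LBINT x. h' x * F eta f' x) + ?K * ?nf * (e * ((l + B) / 2)) + ?K * (e * ((l + B) / 2)) * (?nh + (l + B) / 2)"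
  unfolding e1 by (intro order_trans[OF norm_triangle_ineq] add_mono n2 n3 order_refl)
 also have "... = norm (LBINT x. h' x * F eta f' x) + e * (?K * ((l + B) / 2) * (?nf + ?nh + (l + B) / 2))"
  by (simp only: distrib_left add.assoc mult.assoc mult.commute mult.left_commute)
 finally show ?thesis .
qed

text \<open>Step functions are dense, and for a fixed height the error is controlled by \<open>form_error\<close>.\<close>
lemma form_bound_L2:
 "\<exists>C>0. \<forall>X l eta f h. l > 0 --> 0 < eta --> eta <= l --> L2R f --> L2R h -->
   (\<forall>t. t \<notin> {X..<X + l} --> f t = 0) --> (\<forall>t. t \<notin> {X..<X + l} --> h t = 0) -->
   norm (LBINT x. h x * F eta f x) <= C * (sq f + sq h)"
proof -
 obtain C where C: "C > 0" and Cb: "!!X l N eta c c'. l > 0 ==> 0 < eta ==> eta <= l ==>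
   norm (LBINT x. stepf X l N c' x * b x * F eta (%t. stepf X l N c t * b t) x)
   <= C * (sq (stepf X l N c) + sq (stepf X l N c'))"
  using form_bound_stepf unfolding sq_def by blast
 show ?thesis
 proof (intro exI[of _ "2 * C"] conjI allI impI)
  show "2 * C > 0" using C by simp
  fix X l eta :: real and f h
  assume l: "l > 0" and eta: "0 < eta" "eta <= l" and f: "L2R f" and h: "L2R h"
   and fs: "\<forall>t. t \<notin> {X..<X + l} --> f t = 0" and hs: "\<forall>t. t \<notin> {X..<X + l} --> h t = 0"
  have bi: "(%t. 1 / b t) \<in> borel_measurable borel" "!!t. norm (1 / b t) <= 1"
   using b_lower by (auto simp: norm_divide divide_le_eq)
  have bb: "(%t. b t) \<in> borel_measurable borel" "!!t. norm (b t) <= 1 + L" using b_upper by auto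
  have appr: "\<exists>N c. sq (%t. 1 / b t * k t - stepf X l N c t) <= e^2"
   if "L2R k" "\<forall>t. t \<notin> {X..<X + l} --> k t = 0" "e > 0" for k e
   by (rule step_dense[OF L2R_mult_bounded(1)[OF that(1) bi] _ l]) (use that in auto)
  define Q where "Q = (2 + L) / eta * ((l + (1 + L)^2) / 2) * ((LBINT t. norm (f t)) + (LBINT t. norm (h t)) + (l + (1 + L)^2) / 2)"
  have main: "norm (LBINT x. h x * F eta f x) <= 2 * C * (sq f + sq h) + e * (4 * C + Q)" if e: "0 < e" "e <= 1" for e
  proof -
   obtain N1 c1 where 1: "sq (%t. 1 / b t * f t - stepf X l N1 c1 t) <= e^2" using appr[OF f fs e(1)] by blast
   obtain N2 c2 where 2: "sq (%t. 1 / b t * h t - stepf X l N2 c2 t) <= e^2" using appr[OF h hs e(1)] by blast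
   define N where "N = max N1 N2"
   obtain c where c: "stepf X l N c = stepf X l N1 c1" using stepf_refine[OF l, of N1 N] unfolding N_def by auto
   obtain c' where c': "stepf X l N c' = stepf X l N2 c2" using stepf_refine[OF l, of N2 N] unfolding N_def by auto
   let ?s = "stepf X l N c" and ?s' = "stepf X l N c'"
   have sL: "L2R ?s" "L2R ?s'" by (auto intro: stepf_L2R l)
   have ns: "sq s <= 2 * sq k + 2 * e" if k: "L2R k" "L2R s" "sq (%t. 1 / b t * k t - s t) <= e^2" for k s
   proof -
    have k1: "L2R (%t. 1 / b t * k t)" "sq (%t. 1 / b t * k t) <= sq k"
    using L2R_mult_bounded[OF k(1) bi] by auto
    have "sq s = sq (%t. 1 / b t * k t + (-1) * (1 / b t * k t - s t))" by simp
    also have "... <= 2 * sq (%t. 1 / b t * k t) + 2 * sq (%t. (-1) * (1 / b t * k t - s t))"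
    by (intro sq_add k1 L2R_mult_bounded(1)[OF L2R_diff[OF k1(1) k(2)], of "%t. -1" 1]) auto
    also have "sq (%t. (-1) * (1 / b t * k t - s t)) = sq (%t. 1 / b t * k t - s t)" unfolding sq_def by (simp add: norm_minus_commute)
    also have "2 * sq (%t. 1 / b t * k t) + 2 * sq (%t. 1 / b t * k t - s t) <= 2 * sq k + 2 * e^2" using k1 k by simp
    also have "e^2 <= e" using e by (simp add: power2_eq_square mult_left_le)
    finally show ?thesis by simp
   qed
   have er: "sq (%t. k t - s t * b t) <= (1 + L)^2 * e^2" if k: "L2R k" "L2R s" "sq (%t. 1 / b t * k t - s t) <= e^2" for k s
   proof -
    have "sq (%t. k t - s t * b t) = sq (%t. b t * (1 / b t * k t - s t))"
    using b_nz by (simp add: right_diff_distrib mult.commute)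
    also have "... <= (1 + L)^2 * sq (%t. 1 / b t * k t - s t)"
    by (rule L2R_mult_bounded(2)[OF L2R_diff[OF L2R_mult_bounded(1)[OF k(1) bi] k(2)] bb])
    also have "... <= (1 + L)^2 * e^2" using k(3) by (intro mult_left_mono) auto
    finally show ?thesis .
   qed
   have sbL: "L2R (%t. s t * b t)" if "L2R s" for s
    using L2R_mult_bounded(1)[OF that bb] by (simp add: mult.commute)
   have "norm (LBINT x. h x * F eta f x) <= norm (LBINT x. (?s' x * b x) * F eta (%t. ?s t * b t) x) + e * Q"
    unfolding Q_def
   proof (rule form_error[OF l eta(1) f sbL[OF sL(1)] h sbL[OF sL(2)]])
    show "sq (%t. f t - ?s t * b t) <= (1 + L)^2 * e^2" by (rule er[OF f sL(1)]) (use 1 c in simp)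
    show "sq (%t. h t - ?s' t * b t) <= (1 + L)^2 * e^2" by (rule er[OF h sL(2)]) (use 2 c' in simp)
   qed (use fs hs e stepf_outside[OF l] in auto)
   also have "norm (LBINT x. (?s' x * b x) * F eta (%t. ?s t * b t) x) <= C * (sq ?s + sq ?s')"
    by (rule Cb[OF l eta])
   also have "C * (sq ?s + sq ?s') <= C * ((2 * sq f + 2 * e) + (2 * sq h + 2 * e))"
    using C by (intro mult_left_mono add_mono ns f h sL) (use 1 2 c c' in auto)
   finally show ?thesis by (simp add: algebra_simps)
  qed
  show "norm (LBINT x. h x * F eta f x) <= 2 * C * (sq f + sq h)"
  proof (rule LIMSEQ_le_const)
   have "(%n. 2 * C * (sq f + sq h) + inverse (real (Suc n)) * (4 * C + Q)) \<longlonglongrightarrow> 2 * C * (sq f + sq h) + 0 * (4 * C + Q)"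
    by (intro tendsto_intros LIMSEQ_inverse_real_of_nat)
   thus "(%n. 2 * C * (sq f + sq h) + inverse (real (Suc n)) * (4 * C + Q)) \<longlonglongrightarrow> 2 * C * (sq f + sq h)" by simp
   show "\<exists>N. \<forall>n\<ge>N. norm (LBINT x. h x * F eta f x) <= 2 * C * (sq f + sq h) + inverse (real (Suc n)) * (4 * C + Q)"
    by (intro exI[of _ 0] allI impI main) (auto simp: field_simps)
  qed
 qed
qed

text \<open>Test the bilinear form with a small multiple of the conjugate of \<open>F eta f\<close>; the multiple is chosen such that half of the
left side absorbs the second term.\<close>
lemma F_L2_interval:
 "\<exists>C>0. \<forall>X l eta f. l > 0 --> 0 < eta --> eta <= l --> L2R f -->
   (\<forall>t. t \<notin> {X..<X + l} --> f t = 0) --> sq (%x. indicator {X..<X + l} x *\<^sub>R F eta f x) <= C * sq f"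
proof -
 obtain C where C: "C > 0" and Cb: "!!X l eta f h. l > 0 ==> 0 < eta ==> eta <= l ==> L2R f ==> L2R h ==>
   \<forall>t. t \<notin> {X..<X + l} --> f t = 0 ==> \<forall>t. t \<notin> {X..<X + l} --> h t = 0 ==>
   norm (LBINT x. h x * F eta f x) <= C * (sq f + sq h)"
  using form_bound_L2 by blast
 show ?thesis
 proof (intro exI[of _ "4 * C^2"] conjI allI impI)
  show "4 * C^2 > 0" using C by simp
  fix X l eta :: real and f
  assume l: "l > 0" and eta: "0 < eta" "eta <= l" and f: "L2R f" and fs: "\<forall>t. t \<notin> {X..<X + l} --> f t = 0"
  \<comment> \<open>the multiple for which the second term takes half of the left side\<close>
  define lam where "lam = 1 / (2 * C)"
  have lam: "lam > 0" unfolding lam_def using C by simp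
  have fi: "integrable lborel f" using L1_of_L2(1)[OF f _ l, of X 1] fs by auto
  have Fm [measurable]: "F eta f \<in> borel_measurable borel"
   by (rule borel_measurable_continuous_onI[OF F_continuous[OF fi]]) (use eta in auto)
  define G where "G = (%x. indicator {X..<X + l} x *\<^sub>R F eta f x)"
  have Gm [measurable]: "G \<in> borel_measurable borel" unfolding G_def by measurable
  have GL: "L2R G"
  proof (rule L2R_bounded_support(1)[OF Gm])
   show "norm (G t) <= (2 + L) / \<bar>eta\<bar> * (LBINT t. norm (f t))" for t
    unfolding G_def using F_bound[OF fi, of eta t] eta L_nonneg
    by (cases "t \<in> {X..<X + l}") (auto intro!: mult_nonneg_nonneg divide_nonneg_nonneg)
   show "t \<notin> {X..<X + l} ==> G t = 0" for t unfolding G_def by simp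
  qed (use l in auto)
  define h where "h = (%x. of_real lam * cnj (G x))"
  have [measurable]: "(%x. cnj (G x)) \<in> borel_measurable borel"
   by (rule measurable_compose[OF Gm borel_measurable_continuous_onI]) (intro continuous_intros)
  have cG: "L2R (%x. cnj (G x))" "sq (%x. cnj (G x)) = sq G" using GL unfolding L2R_def sq_def by auto
  have hL: "L2R h" "sq h <= lam^2 * sq G"
   unfolding h_def using L2R_mult_bounded[OF cG(1), of "%_. of_real lam" lam] lam cG(2) by auto
  have "(LBINT x. h x * F eta f x) = (LBINT x. complex_of_real (lam * (norm (G x))^2))"
  proof (intro lint_cong refl)
   fix x
   have "cnj (G x) * F eta f x = G x * cnj (G x)" unfolding G_def by (auto simp: indicator_def mult.commute)
   thus "h x * F eta f x = complex_of_real (lam * (norm (G x))^2)"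
    unfolding h_def using complex_norm_square[of "G x"] by (simp add: mult.assoc)
  qed
  also have "... = complex_of_real (lam * sq G)" unfolding sq_def integral_complex_of_real by simp
  finally have "norm (LBINT x. h x * F eta f x) = lam * sq G" using lam sq_nonneg[of G] by (simp only: norm_of_real) simp
  moreover have "norm (LBINT x. h x * F eta f x) <= C * (sq f + sq h)"
   by (rule Cb[OF l eta f hL(1) fs]) (auto simp: h_def G_def)
  moreover have "C * (sq f + sq h) <= C * (sq f + lam^2 * sq G)" using hL(2) C by (intro mult_left_mono) auto
  ultimately have "lam * sq G <= C * (sq f + lam^2 * sq G)" by linarith
  hence "sq G <= 4 * C^2 * sq f" unfolding lam_def using C by (simp add: field_simps power2_eq_square)
  thus "sq (%x. indicator {X..<X + l} x *\<^sub>R F eta f x) <= 4 * C^2 * sq f" unfolding G_def .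
 qed
qed

text \<open>The constant does not depend on the interval, so the interval can be exhausted to the whole line.\<close>
theorem F_L2:
 "\<exists>C>0. \<forall>R eta f. R > 0 --> 0 < eta --> L2R f --> (\<forall>t. t \<notin> {-R..<R} --> f t = 0) -->
   L2R (F eta f) \<and> sq (F eta f) <= C * sq f"
proof -
 obtain C where C: "C > 0" and Cb: "!!X l eta f. l > 0 ==> 0 < eta ==> eta <= l ==> L2R f ==>
   \<forall>t. t \<notin> {X..<X + l} --> f t = 0 ==> sq (%x. indicator {X..<X + l} x *\<^sub>R F eta f x) <= C * sq f"
  using F_L2_interval by blast
 show ?thesis
 proof (intro exI[of _ C] conjI[OF C] allI impI)
  fix R eta :: real and f
  assume R: "R > 0" and eta: "0 < eta" and f: "L2R f" and fs: "\<forall>t. t \<notin> {-R..<R} --> f t = 0"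
  have fi: "integrable lborel f" using L1_of_L2(1)[OF f, of "-R" "2 * R" 1] fs R by auto
  have Fm [measurable]: "F eta f \<in> borel_measurable borel"
   by (rule borel_measurable_continuous_onI[OF F_continuous[OF fi]]) (use eta in auto)
  \<comment> \<open>the summand \<open>eta\<close> secures that the height is at most the length of the interval\<close>
  define r where "r = (%n. R + eta + real n)"
  define u where "u = (%n x. ennreal ((norm (indicator {- r n..<r n} x *\<^sub>R F eta f x))^2))"
  have un: "(\<integral>\<^sup>+x. u n x \<partial>lborel) <= ennreal (C * sq f)" for n
  proof -
   let ?G = "%x. indicator {- r n..<r n} x *\<^sub>R F eta f x"
   have r0: "r n > 0" "2 * r n >= eta" unfolding r_def using R eta by auto
   have e: "{- r n..<- r n + 2 * r n} = {- r n..<r n}" by simp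
   have "sq (%x. indicator {- r n..<- r n + 2 * r n} x *\<^sub>R F eta f x) <= C * sq f"
    by (rule Cb) (use r0 eta f fs in "auto simp: r_def")
   hence G: "sq ?G <= C * sq f" unfolding e .
   have GL: "L2R ?G"
   proof (rule L2R_bounded_support(1))
    show "norm (?G t) <= (2 + L) / \<bar>eta\<bar> * (LBINT t. norm (f t))" for t
    using F_bound[OF fi, of eta t] eta L_nonneg
    by (cases "t \<in> {- r n..<r n}") (auto intro!: mult_nonneg_nonneg divide_nonneg_nonneg)
    show "t \<notin> {- r n..<r n} ==> ?G t = 0" for t by simp
   qed (use r0 in auto)
   have "(\<integral>\<^sup>+x. u n x \<partial>lborel) = ennreal (sq ?G)"
    unfolding u_def sq_def using GL unfolding L2R_def by (intro nn_integral_eq_integral) auto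
   also have "... <= ennreal (C * sq f)" using G by (rule ennreal_leI)
   finally show ?thesis .
  qed
  have "(\<integral>\<^sup>+x. ennreal ((norm (F eta f x))^2) \<partial>lborel) = (\<integral>\<^sup>+x. liminf (%n. u n x) \<partial>lborel)"
  proof (intro nn_integral_cong)
   fix x
   obtain m :: nat where m: "\<bar>x\<bar> < real m" using reals_Archimedean2 by blast
   have "eventually (%n. u n x = ennreal ((norm (F eta f x))^2)) sequentially"
    using eventually_ge_at_top[of m]
   proof eventually_elim
    case (elim n)
    hence "real m <= real n" by simp
    hence "x \<in> {- r n..<r n}" using m R eta unfolding r_def by auto
    thus ?case unfolding u_def by simp
   qed
   hence "(%n. u n x) \<longlonglongrightarrow> ennreal ((norm (F eta f x))^2)" by (rule tendsto_eventually)
   thus "ennreal ((norm (F eta f x))^2) = liminf (%n. u n x)" using lim_imp_Liminf[OF sequentially_bot] by metis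
  qed
  also have "... <= liminf (%n. \<integral>\<^sup>+x. u n x \<partial>lborel)"
   by (rule nn_integral_liminf) (unfold u_def, measurable)
  also have "... <= liminf (%n. ennreal (C * sq f))" by (intro Liminf_mono always_eventually allI un)
  also have "... = ennreal (C * sq f)" by (simp add: Liminf_const)
  finally have nn: "(\<integral>\<^sup>+x. ennreal ((norm (F eta f x))^2) \<partial>lborel) <= ennreal (C * sq f)" .
  have i: "integrable lborel (%x. (norm (F eta f x))^2)"
  proof (rule integrableI_nonneg)
   show "(\<integral>\<^sup>+x. ennreal ((norm (F eta f x))^2) \<partial>lborel) < \<infinity>" using nn by (rule le_less_trans) simp
  qed auto
  hence FL: "L2R (F eta f)" unfolding L2R_def by simp
  have "ennreal (sq (F eta f)) = (\<integral>\<^sup>+x. ennreal ((norm (F eta f x))^2) \<partial>lborel)"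
   unfolding sq_def using nn_integral_eq_integral[OF i] by simp
  hence "ennreal (sq (F eta f)) <= ennreal (C * sq f)" using nn by simp
  hence "sq (F eta f) <= C * sq f" using C sq_nonneg[of f] by (subst (asm) ennreal_le_iff) auto
  with FL show "L2R (F eta f) \<and> sq (F eta f) <= C * sq f" by simp
 qed
qed

end

section \<open>The reproducing formula\<close>

lemma Ln_minus_ii: 
 assumes "Re u > 0"
 shows "Ln (- \<i> * u) = Ln u - \<i> * pi / 2" "Ln (\<i> * u) = Ln u + \<i> * pi / 2"
proof -
 have u: "u ~= 0" using assms by auto
 have "Ln (\<i> * (- \<i> * u)) = Ln (- \<i> * u) + \<i> * pi / 2"
  using u assms by (subst Ln_times_ii) auto
 thus "Ln (- \<i> * u) = Ln u - \<i> * pi / 2" by (simp add: algebra_simps)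
 show "Ln (\<i> * u) = Ln u + \<i> * pi / 2"
  using u assms by (subst Ln_times_ii) auto
qed

lemma Ln_lipschitz_half_plane:
 assumes "rho > 0" "rho <= Re u" "rho <= Re v"
 shows "norm (Ln u - Ln v) <= norm (u - v) / rho"
proof -
 have S: "convex {w. rho <= Re w}" using half_plane_cl(1)[of 1 rho] assms by simp
 have "norm (Ln u - Ln v) <= (1 / rho) * norm (u - v)"
 proof (rule field_differentiable_bound[OF S])
  fix w assume w: "w \<in> {w. rho <= Re w}"
  hence "w \<notin> \<real>\<^sub>\<le>\<^sub>0" using assms by (auto simp: complex_nonpos_Reals_iff)
  thus "(Ln has_field_derivative inverse w) (at w within {w. rho <= Re w})"
   by (rule has_field_derivative_at_within[OF has_field_derivative_Ln])
  have "rho <= norm w" using w complex_Re_le_cmod[of w] by simp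
  thus "norm (inverse w) <= 1 / rho" using assms by (simp add: norm_inverse divide_inverse le_imp_inverse_le)
 qed (use assms in auto)
 thus ?thesis by simp
qed

context lip_graph_deriv begin

text \<open>The two arguments differ by a constant, while both tend to infinity in a fixed half plane.\<close>
lemma Ln_diff_tendsto:
 fixes p q :: complex
 shows "((%y. Ln (z y - p) - Ln (z y - q)) \<longlongrightarrow> 0) at_top"
  "((%y. Ln (- (z y - p)) - Ln (- (z y - q))) \<longlongrightarrow> 0) at_bot"
proof -
 have 0: "((%y. norm (q - p) / (y - max (Re p) (Re q))) \<longlongrightarrow> 0) at_top"
  using filterlim_tendsto_add_at_top[OF tendsto_const[of "- max (Re p) (Re q)"] filterlim_ident]
  by (intro tendsto_divide_0[OF tendsto_const] filterlim_at_top_imp_at_infinity) simp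
 show "((%y. Ln (z y - p) - Ln (z y - q)) \<longlongrightarrow> 0) at_top"
 proof (rule Lim_null_comparison[OF _ 0])
  show "\<forall>\<^sub>F y in at_top. norm (Ln (z y - p) - Ln (z y - q)) <= norm (q - p) / (y - max (Re p) (Re q))"
   using eventually_gt_at_top[of "max (Re p) (Re q)"]
  proof eventually_elim
   case (elim y)
   have "norm (Ln (z y - p) - Ln (z y - q)) <= norm ((z y - p) - (z y - q)) / (y - max (Re p) (Re q))"
    by (rule Ln_lipschitz_half_plane) (use elim in auto)
   thus ?case by simp
  qed
 qed
 have 1: "((%y. norm (q - p) / (min (Re p) (Re q) - y)) \<longlongrightarrow> 0) at_bot"
  using filterlim_tendsto_add_at_top[OF tendsto_const[of "min (Re p) (Re q)"] filterlim_uminus_at_top_at_bot]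
  by (intro tendsto_divide_0[OF tendsto_const] filterlim_at_top_imp_at_infinity) simp
 show "((%y. Ln (- (z y - p)) - Ln (- (z y - q))) \<longlongrightarrow> 0) at_bot"
 proof (rule Lim_null_comparison[OF _ 1])
  show "\<forall>\<^sub>F y in at_bot. norm (Ln (- (z y - p)) - Ln (- (z y - q))) <= norm (q - p) / (min (Re p) (Re q) - y)"
   using eventually_gt_at_bot[of "min (Re p) (Re q)"]
  proof eventually_elim
   case (elim y)
   have "norm (Ln (- (z y - p)) - Ln (- (z y - q))) <= norm ((- (z y - p)) - (- (z y - q))) / (min (Re p) (Re q) - y)"
    by (rule Ln_lipschitz_half_plane) (use elim in auto)
   thus ?case by (simp add: norm_minus_commute)
  qed
 qed
qed

lemma lg_asymptotics:
 "((%y. lg delta y x - lg eta t y) \<longlongrightarrow> \<i> * pi) at_top"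
 "((%y. lg delta y x - lg eta t y) \<longlongrightarrow> - (\<i> * pi)) at_bot"
 "((%y. lg delta x y - lg eta t y) \<longlongrightarrow> 0) at_top"
 "((%y. lg delta x y - lg eta t y) \<longlongrightarrow> 0) at_bot"
proof -
 let ?p = "z x + \<i> * of_real delta" and ?q = "z t - \<i> * of_real eta" and ?r = "z x - \<i> * of_real delta"
 have e: "lg delta y x = Ln (\<i> * (z y - ?p))" "lg eta t y = Ln (- \<i> * (z y - ?q))" "lg delta x y = Ln (- \<i> * (z y - ?r))" for y
  unfolding lg_def by (simp_all add: algebra_simps)
 have pos: "lg delta y x - lg eta t y = (Ln (z y - ?p) - Ln (z y - ?q)) + \<i> * pi"
  "lg delta x y - lg eta t y = Ln (z y - ?r) - Ln (z y - ?q)" if "y > max x t" for y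
 proof -
  have R: "Re (z y - ?p) > 0" "Re (z y - ?q) > 0" "Re (z y - ?r) > 0" using that by auto
  show "lg delta y x - lg eta t y = (Ln (z y - ?p) - Ln (z y - ?q)) + \<i> * pi"
   unfolding e Ln_minus_ii(1)[OF R(2)] Ln_minus_ii(2)[OF R(1)] by simp
  show "lg delta x y - lg eta t y = Ln (z y - ?r) - Ln (z y - ?q)"
   unfolding e Ln_minus_ii(1)[OF R(2)] Ln_minus_ii(1)[OF R(3)] by simp
 qed
 have neg: "lg delta y x - lg eta t y = (Ln (- (z y - ?p)) - Ln (- (z y - ?q))) - \<i> * pi"
  "lg delta x y - lg eta t y = Ln (- (z y - ?r)) - Ln (- (z y - ?q))" if "y < min x t" for y
 proof -
  have R: "Re (- (z y - ?p)) > 0" "Re (- (z y - ?q)) > 0" "Re (- (z y - ?r)) > 0" using that by auto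
  have f: "Ln (\<i> * u) = Ln (- \<i> * (- u))" "Ln (- \<i> * u) = Ln (\<i> * (- u))" for u by simp_all
  show "lg delta y x - lg eta t y = (Ln (- (z y - ?p)) - Ln (- (z y - ?q))) - \<i> * pi"
   unfolding e f(1)[of "z y - ?p"] f(2)[of "z y - ?q"] Ln_minus_ii(2)[OF R(2)] Ln_minus_ii(1)[OF R(1)] by simp
  show "lg delta x y - lg eta t y = Ln (- (z y - ?r)) - Ln (- (z y - ?q))"
   unfolding e f(2)[of "z y - ?r"] f(2)[of "z y - ?q"] Ln_minus_ii(2)[OF R(2)] Ln_minus_ii(2)[OF R(3)] by simp
 qed
 have "((%y. (Ln (z y - ?p) - Ln (z y - ?q)) + \<i> * pi) \<longlongrightarrow> 0 + \<i> * pi) at_top"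
  by (intro tendsto_add Ln_diff_tendsto tendsto_const)
 hence n0: "((%y. (Ln (z y - ?p) - Ln (z y - ?q)) + \<i> * pi) \<longlongrightarrow> \<i> * pi) at_top" by simp
 show "((%y. lg delta y x - lg eta t y) \<longlongrightarrow> \<i> * pi) at_top"
  by (rule Lim_transform_eventually[OF n0])
   (use eventually_gt_at_top[of "max x t"] in eventually_elim, simp add: pos)
 have "((%y. (Ln (- (z y - ?p)) - Ln (- (z y - ?q))) - \<i> * pi) \<longlongrightarrow> 0 - \<i> * pi) at_bot"
  by (intro tendsto_diff Ln_diff_tendsto tendsto_const)
 hence n: "((%y. (Ln (- (z y - ?p)) - Ln (- (z y - ?q))) - \<i> * pi) \<longlongrightarrow> - (\<i> * pi)) at_bot" by simp
 show "((%y. lg delta y x - lg eta t y) \<longlongrightarrow> - (\<i> * pi)) at_bot"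
  by (rule Lim_transform_eventually[OF n])
   (use eventually_gt_at_bot[of "min x t"] in eventually_elim, simp add: neg)
 show "((%y. lg delta x y - lg eta t y) \<longlongrightarrow> 0) at_top"
  by (rule Lim_transform_eventually[OF Ln_diff_tendsto(1)[of ?r ?q]])
   (use eventually_gt_at_top[of "max x t"] in eventually_elim, simp add: pos)
 show "((%y. lg delta x y - lg eta t y) \<longlongrightarrow> 0) at_bot"
  by (rule Lim_transform_eventually[OF Ln_diff_tendsto(2)[of ?r ?q]])
   (use eventually_gt_at_bot[of "min x t"] in eventually_elim, simp add: neg)
qed

text \<open>The jump of the Cauchy kernel across the graph, which is the Poisson kernel up to a factor if the graph is a line.\<close>
definition pk :: "real => real => real => complex" where
 "pk delta x y = 1 / (z y - z x - \<i> * of_real delta) - 1 / (z y - z x + \<i> * of_real delta)"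

lemma den_lower': "\<bar>t - x\<bar> + \<bar>eta\<bar> <= (2 + L) * norm (z t - z x + \<i> * of_real eta)"
 using den_lower[of t x "-eta"] by simp

lemma quad_lower:
 assumes delta: "delta > 0"
 shows "(delta + \<bar>x - y\<bar>)^2 <= (2 + L)^2 * norm ((z y - z x - \<i> * of_real delta) * (z y - z x + \<i> * of_real delta))"
proof -
 have "(delta + \<bar>x - y\<bar>) * (delta + \<bar>x - y\<bar>) <= ((2 + L) * norm (z y - z x - \<i> * of_real delta)) * ((2 + L) * norm (z y - z x + \<i> * of_real delta))"
  using den_lower[of y x delta] den_lower'[of y x delta] delta L_nonneg by (intro mult_mono) (auto simp: abs_minus_commute)
 thus ?thesis by (simp only: power2_eq_square norm_mult mult.assoc mult.left_commute mult.commute)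
qed

lemma pk_eq:
 assumes delta: "delta > 0"
 shows "pk delta x y = 2 * \<i> * of_real delta / ((z y - z x - \<i> * of_real delta) * (z y - z x + \<i> * of_real delta))"
proof -
 have "z y - z x - \<i> * of_real delta ~= 0" "z y - z x + \<i> * of_real delta ~= 0"
  using den_nz[of delta y x] den_nz[of "-delta" y x] delta by auto
 thus ?thesis unfolding pk_def by (simp add: field_simps)
qed

lemma pk_bound:
 assumes delta: "delta > 0"
 shows "norm (pk delta x y) <= 2 * (2 + L)^2 * (delta / (delta + \<bar>x - y\<bar>)^2)"
proof -
 let ?D = "norm ((z y - z x - \<i> * of_real delta) * (z y - z x + \<i> * of_real delta))"
 have D: "?D > 0" using den_nz[of delta y x] den_nz[of "-delta" y x] delta by auto
 have q: "(delta + \<bar>x - y\<bar>)^2 > 0" using delta by (intro zero_less_power) auto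
 have "norm (pk delta x y) = 2 * delta / ?D" unfolding pk_eq[OF delta] norm_divide using delta by (simp add: norm_mult)
 also have "... <= 2 * delta * ((2 + L)^2 / (delta + \<bar>x - y\<bar>)^2)"
 proof -
  have "1 / ?D <= (2 + L)^2 / (delta + \<bar>x - y\<bar>)^2" using quad_lower[OF delta, of x y] D q by (simp add: divide_simps mult.commute)
  hence "2 * delta * (1 / ?D) <= 2 * delta * ((2 + L)^2 / (delta + \<bar>x - y\<bar>)^2)" using delta by (intro mult_left_mono) auto
  thus ?thesis by simp
 qed
 finally show ?thesis by (simp add: mult.commute mult.left_commute)
qed

lemma pk_meas [measurable]: "pk delta x \<in> borel_measurable borel"
 unfolding pk_def[abs_def] by measurable

text \<open>By partial fractions the integrand has a logarithmic primitive along the curve. The pole \<open>z x - \<i> delta\<close> lies on the same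
side of the graph as the pole of the first factor and contributes nothing; the pole \<open>z x + \<i> delta\<close> contributes its residue.\<close>
lemma cauchy_of_cauchy:
 assumes eta: "eta > 0" and delta: "delta > 0" and t: "t ~= x"
 shows "integrable lborel (%y. 1 / (z t - z y - \<i> * of_real eta) * pk delta x y * b y)"
  "(LBINT y. 1 / (z t - z y - \<i> * of_real eta) * pk delta x y * b y) = 2 * pi * \<i> / (z t - z x - \<i> * of_real (eta + delta))"
proof -
 let ?\<zeta> = "z t - \<i> * of_real eta" and ?w = "z x + \<i> * of_real delta" and ?w' = "z x - \<i> * of_real delta"
 let ?g = "%y. 1 / (z t - z y - \<i> * of_real eta) * pk delta x y * b y"
 show int: "integrable lborel ?g"
 proof (rule integrable_dominated[OF integrable_mult_right[OF poisson_integrable[OF delta, of x], of "(2 + L) / eta * (2 * (2 + L)^2) * (1 + L)"]])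
  show "AE y in lborel. norm (?g y) <= norm ((2 + L) / eta * (2 * (2 + L)^2) * (1 + L) * (delta / (delta + \<bar>x - y\<bar>)^2))"
  proof (rule AE_I2)
   fix y
   have "norm (?g y) <= (2 + L) / eta * (2 * (2 + L)^2 * (delta / (delta + \<bar>x - y\<bar>)^2)) * (1 + L)"
    unfolding norm_mult using kernel_bound[of eta t y] pk_bound[OF delta, of x y] b_upper[of y] eta delta L_nonneg
    by (intro mult_mono) auto
   also have "... = (2 + L) / eta * (2 * (2 + L)^2) * (1 + L) * (delta / (delta + \<bar>x - y\<bar>)^2)" by simp
   finally show "norm (?g y) <= norm ((2 + L) / eta * (2 * (2 + L)^2) * (1 + L) * (delta / (delta + \<bar>x - y\<bar>)^2))"
    unfolding real_norm_def by (rule order_trans[OF _ abs_ge_self])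
  qed
 qed measurable
 have zw: "?\<zeta> - ?w ~= 0" "?\<zeta> - ?w' ~= 0" using t by (auto simp: complex_eq_iff)
 define phi where "phi = (%p. 1 / (?\<zeta> - ?w) * (Ln (- \<i> * (z x - p + \<i> * of_real delta)) - Ln (- \<i> * (p - z t + \<i> * of_real eta)))
   - 1 / (?\<zeta> - ?w') * (Ln (- \<i> * (p - z x + \<i> * of_real delta)) - Ln (- \<i> * (p - z t + \<i> * of_real eta))))"
 have ftc: "(LBINT y:{s..u}. ?g y) = phi (z u) - phi (z s)" if "s <= u" for s u
 proof (rule z_ftc[OF that])
  fix y
  have p1: "((%p. Ln (- \<i> * (z x - p + \<i> * of_real delta))) has_field_derivative inverse (z x - z y + \<i> * of_real delta) * (-1)) (at (z y))"
   by (rule DERIV_chain2[where g = "%p. z x - p + \<i> * of_real delta" and f = "%u. Ln (- \<i> * u)", OF cl_deriv(2)[OF slit'[OF delta, of x y]]])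
    (auto intro!: derivative_eq_intros)
  have p2: "((%p. Ln (- \<i> * (p - z t + \<i> * of_real eta))) has_field_derivative inverse (z y - z t + \<i> * of_real eta) * 1) (at (z y))"
   by (rule DERIV_chain2[where g = "%p. p - z t + \<i> * of_real eta" and f = "%u. Ln (- \<i> * u)", OF cl_deriv(2)[OF slit'[OF eta, of y t]]])
    (auto intro!: derivative_eq_intros)
  have p3: "((%p. Ln (- \<i> * (p - z x + \<i> * of_real delta))) has_field_derivative inverse (z y - z x + \<i> * of_real delta) * 1) (at (z y))"
   by (rule DERIV_chain2[where g = "%p. p - z x + \<i> * of_real delta" and f = "%u. Ln (- \<i> * u)", OF cl_deriv(2)[OF slit'[OF delta, of y x]]])
    (auto intro!: derivative_eq_intros)
  have d: "(phi has_field_derivative 1 / (?\<zeta> - ?w) * (inverse (z x - z y + \<i> * of_real delta) * (-1) - inverse (z y - z t + \<i> * of_real eta) * 1)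
   - 1 / (?\<zeta> - ?w') * (inverse (z y - z x + \<i> * of_real delta) * 1 - inverse (z y - z t + \<i> * of_real eta) * 1)) (at (z y))"
   unfolding phi_def by (intro DERIV_diff DERIV_cmult p1 p2 p3)
  have n: "z x - z y + \<i> * of_real delta ~= 0" "z y - z t + \<i> * of_real eta ~= 0" "z y - z x + \<i> * of_real delta ~= 0"
   using slit'[OF delta, of x y] slit'[OF eta, of y t] slit'[OF delta, of y x] by auto
  have gen: "1 / (zeta - w) * (inverse (w - p) * (-1) - inverse (p - zeta) * 1) = 1 / (zeta - p) * (1 / (p - w))"
   "1 / (zeta - w) * (inverse (p - w) * 1 - inverse (p - zeta) * 1) = 1 / (zeta - p) * (1 / (p - w))"
   if "zeta - w ~= 0" "p - zeta ~= 0" "p - w ~= 0" for zeta w p :: complex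
  proof -
   have 1: "inverse (w - p) * (-1) = 1 / (p - w)" "inverse (p - w) * 1 = 1 / (p - w)" using that by (auto simp: field_simps)
   have 2: "1 / (p - w) - inverse (p - zeta) * 1 = (zeta - w) * (1 / (zeta - p) * (1 / (p - w)))"
   proof -
    have "1 / A' - inverse B * 1 = (A' - B) * (1 / (- B) * (1 / A'))" if "A' ~= 0" "B ~= 0" for A' B :: complex
    using that by (simp add: field_simps)
    from this[OF that(3,2)] show ?thesis by simp
   qed
   show "1 / (zeta - w) * (inverse (w - p) * (-1) - inverse (p - zeta) * 1) = 1 / (zeta - p) * (1 / (p - w))"
    unfolding 1 2 using that(1) by simp
   show "1 / (zeta - w) * (inverse (p - w) * 1 - inverse (p - zeta) * 1) = 1 / (zeta - p) * (1 / (p - w))"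
    unfolding 1 2 using that(1) by simp
  qed
  have ne: "z y - ?\<zeta> ~= 0" "z y - ?w ~= 0" "z y - ?w' ~= 0" using n by (auto simp: algebra_simps)
  have r: "z x - z y + \<i> * of_real delta = ?w - z y" "z y - z t + \<i> * of_real eta = z y - ?\<zeta>" "z y - z x + \<i> * of_real delta = z y - ?w'"
   "z y - z x - \<i> * of_real delta = z y - ?w" "z t - z y - \<i> * of_real eta = ?\<zeta> - z y" by (simp_all add: algebra_simps)
  show "(phi has_field_derivative 1 / (z t - z y - \<i> * of_real eta) * pk delta x y) (at (z y))"
   using d unfolding pk_def r gen(1)[OF zw(1) ne(1,2)] gen(2)[OF zw(2) ne(1,3)] by (simp add: right_diff_distrib)
 next
  show "continuous_on {s..u} (%y. 1 / (z t - z y - \<i> * of_real eta) * pk delta x y)"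
   unfolding pk_def using den_nz[of eta t] den_nz[of delta _ x] den_nz[of "-delta" _ x] eta delta
   by (intro continuous_intros z_continuous) auto
 qed
 let ?a = "%y. lg delta y x - lg eta t y" and ?b = "%y. lg delta x y - lg eta t y"
 have \<phi>z: "phi (z y) = 1 / (?\<zeta> - ?w) * ?a y - 1 / (?\<zeta> - ?w') * ?b y" for y
  unfolding phi_def lg_def ..
 have top: "((%y. phi (z y)) \<longlongrightarrow> 1 / (?\<zeta> - ?w) * (\<i> * pi) - 1 / (?\<zeta> - ?w') * 0) at_top"
  unfolding \<phi>z by (intro tendsto_intros lg_asymptotics)
 have bot: "((%y. phi (z y)) \<longlongrightarrow> 1 / (?\<zeta> - ?w) * (- (\<i> * pi)) - 1 / (?\<zeta> - ?w') * 0) at_bot"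
  unfolding \<phi>z by (intro tendsto_intros lg_asymptotics)
 have seq: "(%n. phi (z (real n)) - phi (z (- real n))) \<longlonglongrightarrow> (1 / (?\<zeta> - ?w) * (\<i> * pi) - 1 / (?\<zeta> - ?w') * 0) - (1 / (?\<zeta> - ?w) * (- (\<i> * pi)) - 1 / (?\<zeta> - ?w') * 0)"
 proof (intro tendsto_diff)
  have r: "filterlim real at_top sequentially" by (rule filterlim_real_sequentially)
  show "(%n. phi (z (real n))) \<longlonglongrightarrow> 1 / (?\<zeta> - ?w) * (\<i> * pi) - 1 / (?\<zeta> - ?w') * 0"
   by (rule filterlim_compose[OF top r])
  show "(%n. phi (z (- real n))) \<longlonglongrightarrow> 1 / (?\<zeta> - ?w) * (- (\<i> * pi)) - 1 / (?\<zeta> - ?w') * 0"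
   by (rule filterlim_compose[OF bot filterlim_compose[OF filterlim_uminus_at_bot_at_top r]])
 qed
 have seq2: "(%n. LBINT y:{- real n..real n}. ?g y) \<longlonglongrightarrow> (LBINT y. ?g y)"
  unfolding set_lebesgue_integral_def
 proof (rule integral_dominated_convergence[where w = "%y. norm (?g y)"])
  show "AE y in lborel. (%n. indicator {- real n..real n} y *\<^sub>R ?g y) \<longlonglongrightarrow> ?g y"
  proof (rule AE_I2)
   fix y
   obtain m :: nat where m: "\<bar>y\<bar> <= real m" using real_arch_simple by blast
   have "eventually (%n. indicator {- real n..real n} y *\<^sub>R ?g y = ?g y) sequentially"
    using eventually_ge_at_top[of m]
   proof eventually_elim
    case (elim n)
    hence "real m <= real n" by simp
    hence "y \<in> {- real n..real n}" using m by auto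
    thus ?case by simp
   qed
   thus "(%n. indicator {- real n..real n} y *\<^sub>R ?g y) \<longlonglongrightarrow> ?g y" by (rule tendsto_eventually)
  qed
  show "AE y in lborel. norm (indicator {- real n..real n} y *\<^sub>R ?g y) <= norm (?g y)" for n
   by (intro AE_I2) (auto simp: indicator_def)
 qed (use int in "auto intro: integrable_norm")
 have "(%n. LBINT y:{- real n..real n}. ?g y) = (%n. phi (z (real n)) - phi (z (- real n)))"
  by (intro ext ftc) simp
 from LIMSEQ_unique[OF seq2 seq[folded this]]
 have "(LBINT y. ?g y) = 1 / (?\<zeta> - ?w) * (\<i> * pi) + 1 / (?\<zeta> - ?w) * (\<i> * pi)" by simp
 also have "... = 2 * pi * \<i> / (?\<zeta> - ?w)" by (simp add: add_divide_distrib[symmetric])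
 also have "?\<zeta> - ?w = z t - z x - \<i> * of_real (eta + delta)" by (simp add: algebra_simps)
 finally show "(LBINT y. ?g y) = 2 * pi * \<i> / (z t - z x - \<i> * of_real (eta + delta))" .
qed

lemma F_reproduce:
 assumes eta: "eta > 0" and delta: "delta > 0" and f: "integrable lborel f"
 shows "2 * pi * \<i> * F (eta + delta) f x = (LBINT y. F eta f y * (pk delta x y * b y))"
proof -
 have [measurable]: "f \<in> borel_measurable borel" using borel_measurable_integrable[OF f] by simp
 let ?G = "%t y. f t * (1 / (z t - z y - \<i> * of_real eta) * pk delta x y * b y)"
 have int: "integrable (lborel \<Otimes>\<^sub>M lborel) (%(t, y). ?G t y)"
 proof (rule integrable_dominated)
  let ?c = "(2 + L) / eta * (2 * (2 + L)^2) * (1 + L)"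
  show "integrable (lborel \<Otimes>\<^sub>M lborel) (%(t, y). norm (f t) * (?c * (delta / (delta + \<bar>x - y\<bar>)^2)))"
  proof -
   show ?thesis
   proof (rule lborel_pair.Fubini_integrable)
    show "integrable lborel (%t. LBINT y. norm (case (t, y) of (t, y) => norm (f t) * (?c * (delta / (delta + \<bar>x - y\<bar>)^2))))"
    proof -
    have "(LBINT y. norm (case (t, y) of (t, y) => norm (f t) * (?c * (delta / (delta + \<bar>x - y\<bar>)^2)))) = norm (f t) * (LBINT y. norm (?c * (delta / (delta + \<bar>x - y\<bar>)^2)))" for t
    by (simp only: prod.case norm_mult integral_mult_right_zero real_norm_def abs_norm_cancel abs_mult)
    thus ?thesis using f by (auto intro!: integrable_mult_left integrable_norm)
    qed
    show "AE t in lborel. integrable lborel (%y. case (t, y) of (t, y) => norm (f t) * (?c * (delta / (delta + \<bar>x - y\<bar>)^2)))"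
    by (intro AE_I2) (simp only: prod.case, intro integrable_mult_right poisson_integrable delta)
   qed measurable
  qed
  show "AE p in lborel \<Otimes>\<^sub>M lborel. norm (case p of (t, y) => ?G t y) <= norm (case p of (t, y) => norm (f t) * (?c * (delta / (delta + \<bar>x - y\<bar>)^2)))"
  proof (rule AE_I2)
   fix p :: "real \<times> real"
   obtain t y where p: "p = (t, y)" by (cases p)
   have "norm (1 / (z t - z y - \<i> * of_real eta) * pk delta x y * b y) <= (2 + L) / eta * (2 * (2 + L)^2 * (delta / (delta + \<bar>x - y\<bar>)^2)) * (1 + L)"
    unfolding norm_mult using kernel_bound[of eta t y] pk_bound[OF delta, of x y] b_upper[of y] eta delta L_nonneg
    by (intro mult_mono) auto
   also have "... = ?c * (delta / (delta + \<bar>x - y\<bar>)^2)" by simp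
   finally have "norm (?G t y) <= norm (f t) * (?c * (delta / (delta + \<bar>x - y\<bar>)^2))"
    unfolding norm_mult[of "f t"] by (intro mult_left_mono) auto
   thus "norm (case p of (t, y) => ?G t y) <= norm (case p of (t, y) => norm (f t) * (?c * (delta / (delta + \<bar>x - y\<bar>)^2)))"
    unfolding p prod.case real_norm_def by (rule order_trans[OF _ abs_ge_self])
  qed
 qed measurable
 have "(LBINT y. F eta f y * (pk delta x y * b y)) = (LBINT y. LBINT t. ?G t y)"
 proof (intro lint_cong refl)
  fix y
  have "F eta f y * (pk delta x y * b y) = (LBINT t. f t / (z t - z y - \<i> * of_real eta) * (pk delta x y * b y))"
   unfolding F_def by (rule integral_mult_left_zero[symmetric])
  also have "... = (LBINT t. ?G t y)" by (intro lint_cong refl) simp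
  finally show "F eta f y * (pk delta x y * b y) = (LBINT t. ?G t y)" .
 qed
 also have "... = (LBINT t. LBINT y. ?G t y)" by (rule lborel_pair.Fubini_integral[OF int])
 also have "... = (LBINT t. 2 * pi * \<i> * (f t / (z t - z x - \<i> * of_real (eta + delta))))"
 proof (rule integral_cong_AE)
  show "AE t in lborel. (LBINT y. ?G t y) = 2 * pi * \<i> * (f t / (z t - z x - \<i> * of_real (eta + delta)))"
   using AE_lborel_singleton[of x]
  proof eventually_elim
   case (elim t)
   have "(LBINT y. ?G t y) = f t * (LBINT y. 1 / (z t - z y - \<i> * of_real eta) * pk delta x y * b y)"
    by (rule integral_mult_right_zero)
   thus ?case unfolding cauchy_of_cauchy(2)[OF eta delta elim] by simp
  qed
  show "(%t. LBINT y. ?G t y) \<in> borel_measurable lborel"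
   by measurable
 qed measurable
 also have "... = 2 * pi * \<i> * F (eta + delta) f x" unfolding F_def by (rule integral_mult_right_zero)
 finally show ?thesis by simp
qed

end

section \<open>Maximal truncations\<close>

lemma tendsto_at_right_of_cauchy:
 fixes g :: "real => complex"
 assumes c: "!!k::nat. \<exists>d>0. \<forall>eps eps'. 0 < eps --> eps < d --> 0 < eps' --> eps' < d --> norm (g eps - g eps') <= 1 / real (Suc k)"
 shows "\<exists>v. (g \<longlongrightarrow> v) (at_right 0)"
proof -
 have "cauchy_filter (filtermap g (at_right 0))"
  unfolding cauchy_filter_metric_filtermap
 proof (intro allI impI)
  fix e :: real assume "e > 0"
  then obtain k where k: "inverse (real (Suc k)) < e" using reals_Archimedean by blast
  obtain d where d: "d > 0" "!!eps eps'. 0 < eps ==> eps < d ==> 0 < eps' ==> eps' < d ==> norm (g eps - g eps') <= 1 / real (Suc k)"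
   using c[of k] by blast
  have "eventually (%eps. eps \<in> {0<..<d}) (at_right 0)" by (rule eventually_at_rightI[OF _ d(1)])
  moreover have "dist (g eps) (g eps') < e" if "eps \<in> {0<..<d}" "eps' \<in> {0<..<d}" for eps eps'
   using d(2)[of eps eps'] that k by (simp add: dist_norm inverse_eq_divide)
  ultimately show "\<exists>P. eventually P (at_right 0) \<and> (\<forall>x y. P x \<and> P y --> dist (g x) (g y) < e)" by blast
 qed
 moreover have "filtermap g (at_right 0) ~= bot" by (simp add: filtermap_bot_iff)
 ultimately obtain v where "filtermap g (at_right 0) <= nhds v"
  using complete_UNIV[where 'a = complex] unfolding complete_uniform by auto
 thus ?thesis unfolding filterlim_def by blast
qed

context lip_graph_deriv begin

text \<open>By \<open>F_reproduce\<close>, values at heights above \<open>eta\<close> are Poisson averages of \<open>F eta f\<close>, whose square has a maximal function of weak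
type (1,1). The bound does not depend on \<open>eta\<close>, and the exceptional sets for \<open>eta = 1 / (n + 1)\<close> increase to the one for
all heights.\<close>
theorem F_maximal_upper:
 "\<exists>C>0. \<forall>R f lam. R > 0 --> lam > 0 --> L2R f --> (\<forall>t. t \<notin> {-R..<R} --> f t = 0) -->
   (\<exists>U\<in>sets borel. emeasure lborel U <= ennreal (C * sq f / lam^2) \<and> (\<forall>x. x \<notin> U --> (\<forall>eps>0. norm (F eps f x) <= lam)))"
proof -
 obtain C where C: "C > 0" and Cb: "!!R eta f. R > 0 ==> 0 < eta ==> L2R f ==> \<forall>t. t \<notin> {-R..<R} --> f t = 0 ==>
   L2R (F eta f) \<and> sq (F eta f) <= C * sq f"
  using F_L2 by blast
 define K where "K = 9 * (2 + L)^2 * (1 + L)"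
 have K: "K > 0" unfolding K_def using L_nonneg by (intro mult_pos_pos zero_less_power) auto
 show ?thesis
 proof (intro exI[of _ "5 * K^2 * C"] conjI allI impI)
  show "5 * K^2 * C > 0" using K C by simp
  fix R lam :: real and f
  assume R: "R > 0" and lam: "lam > 0" and f: "L2R f" and fs: "\<forall>t. t \<notin> {-R..<R} --> f t = 0"
  have fi: "integrable lborel f" using L1_of_L2(1)[OF f, of "-R" "2 * R" 1] fs R by auto
  define lam' where "lam' = lam / K"
  have lam': "lam' > 0" "K * lam' = lam" unfolding lam'_def using lam K by auto
  define Bad where "Bad = (%n. {x. \<exists>eps>1 / real (Suc n). norm (F eps f x) > lam})"
  have opn: "open (Bad n)" for n
  proof -
   have "Bad n = (\<Union>eps\<in>{1 / real (Suc n)<..}. {x. lam < norm (F eps f x)})" unfolding Bad_def by auto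
   also have "open ..."
   proof (intro open_UN ballI open_Collect_less continuous_intros)
    fix eps :: real assume "eps \<in> {1 / real (Suc n)<..}"
    hence "eps ~= 0" by (auto simp: field_simps)
    thus "continuous_on UNIV (F eps f)" by (rule F_continuous[OF fi])
   qed
   finally show ?thesis .
  qed
  have bm: "emeasure lborel (Bad n) <= ennreal (5 * K^2 * C * sq f / lam^2)" for n
  proof -
   define eta where "eta = 1 / real (Suc n)"
   have eta: "eta > 0" unfolding eta_def by simp
   have FL: "L2R (F eta f)" "sq (F eta f) <= C * sq f" using Cb[OF R eta f fs] by auto
   have Fi: "F eta f \<in> borel_measurable borel" "integrable lborel (%t. (norm (F eta f t))^2)"
    using FL(1) unfolding L2R_def by auto
   have "\<exists>U. U \<in> sets borel \<and> emeasure lborel U <= ennreal (5 / lam'^2 * (LBINT x. (norm (F eta f x))^2)) \<and>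
    (\<forall>x. x \<notin> U --> (\<forall>r>0. (LBINT y. indicator {x - r..x + r} y * (norm (F eta f y))^2) <= 2 * r * lam'^2))"
    by (rule maximal_weak_type[OF Fi(2)]) (use lam' in auto)
   then obtain U where U: "U \<in> sets borel" "emeasure lborel U <= ennreal (5 / lam'^2 * (LBINT x. (norm (F eta f x))^2))"
    and good: "!!x r. x \<notin> U ==> r > 0 ==> (LBINT y. indicator {x - r..x + r} y * (norm (F eta f y))^2) <= 2 * r * lam'^2"
    by blast
   have "Bad n \<subseteq> U"
   proof (rule ccontr)
    assume "\<not> Bad n \<subseteq> U"
    then obtain x eps where x: "x \<notin> U" and eps: "eps > eta" "norm (F eps f x) > lam" unfolding Bad_def eta_def by auto
    define delta where "delta = eps - eta"
    have delta: "delta > 0" "eps = eta + delta" unfolding delta_def using eps by auto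
    note pa = poisson_average[OF Fi lam'(1) delta(1) good[OF x]]
    have "norm (2 * pi * \<i> * F eps f x) = norm (LBINT y. F eta f y * (pk delta x y * b y))"
    unfolding delta(2) F_reproduce[OF eta delta(1) fi] ..
    also have "... <= (LBINT y. 2 * (2 + L)^2 * (1 + L) * (norm (F eta f y) * (delta / (delta + \<bar>x - y\<bar>)^2)))"
    proof (rule lint_norm_bound)
    have pt: "norm (F eta f y * (pk delta x y * b y)) <= 2 * (2 + L)^2 * (1 + L) * (norm (F eta f y) * (delta / (delta + \<bar>x - y\<bar>)^2))" for y
    proof -
    have "norm (pk delta x y) * norm (b y) <= (2 * (2 + L)^2 * (delta / (delta + \<bar>x - y\<bar>)^2)) * (1 + L)"
    using pk_bound[OF delta(1), of x y] b_upper[of y] delta by (intro mult_mono) auto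
    hence "norm (F eta f y) * (norm (pk delta x y) * norm (b y)) <= norm (F eta f y) * ((2 * (2 + L)^2 * (delta / (delta + \<bar>x - y\<bar>)^2)) * (1 + L))"
    by (rule mult_left_mono) simp
    thus ?thesis unfolding norm_mult by (simp only: mult.assoc mult.left_commute mult.commute)
    qed
    show "norm (F eta f y * (pk delta x y * b y)) <= 2 * (2 + L)^2 * (1 + L) * (norm (F eta f y) * (delta / (delta + \<bar>x - y\<bar>)^2))" for y by (rule pt)
    show i2: "integrable lborel (%y. 2 * (2 + L)^2 * (1 + L) * (norm (F eta f y) * (delta / (delta + \<bar>x - y\<bar>)^2)))"
    by (intro integrable_mult_right pa(1))
    show "integrable lborel (%y. F eta f y * (pk delta x y * b y))"
    proof (rule integrable_dominated[OF i2])
    have [measurable]: "F eta f \<in> borel_measurable borel" by (rule Fi)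
    show "(%y. F eta f y * (pk delta x y * b y)) \<in> borel_measurable lborel" by measurable
    qed (use order_trans[OF pt abs_ge_self] in auto)
    qed
    also have "... = 2 * (2 + L)^2 * (1 + L) * (LBINT y. norm (F eta f y) * (delta / (delta + \<bar>x - y\<bar>)^2))"
    by (rule integral_mult_right_zero)
    also have "... <= 2 * (2 + L)^2 * (1 + L) * (9 * lam')"
    using pa(2) L_nonneg by (intro mult_left_mono) auto
    also have "... = 2 * (K * lam')" unfolding K_def by simp
    also have "... = 2 * lam" using lam'(2) by simp
    finally have "2 * pi * norm (F eps f x) <= 2 * lam" by (simp add: norm_mult)
    moreover have "2 * 1 * norm (F eps f x) <= 2 * pi * norm (F eps f x)" using pi_ge_two by (intro mult_right_mono) auto
    ultimately show False using eps by simp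
   qed
   hence "emeasure lborel (Bad n) <= emeasure lborel U" using U by (intro emeasure_mono) auto
   also have "... <= ennreal (5 / lam'^2 * sq (F eta f))" using U unfolding sq_def by simp
   also have "... <= ennreal (5 / lam'^2 * (C * sq f))" using FL lam' by (intro ennreal_leI mult_left_mono) auto
   also have "5 / lam'^2 * (C * sq f) = 5 * K^2 * C * sq f / lam^2" unfolding lam'_def by (simp add: power_divide)
   finally show ?thesis .
  qed
  have inc: "incseq Bad"
  proof (rule incseq_SucI, rule subsetI)
   fix n x assume "x \<in> Bad n"
   then obtain eps where eps: "eps > 1 / real (Suc n)" "norm (F eps f x) > lam" unfolding Bad_def by auto
   have "1 / real (Suc (Suc n)) <= 1 / real (Suc n)" by (intro divide_left_mono) auto
   thus "x \<in> Bad (Suc n)" unfolding Bad_def using eps by (auto intro!: exI[of _ eps])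
  qed
  show "\<exists>U\<in>sets borel. emeasure lborel U <= ennreal (5 * K^2 * C * sq f / lam^2) \<and> (\<forall>x. x \<notin> U --> (\<forall>eps>0. norm (F eps f x) <= lam))"
  proof (intro bexI[of _ "\<Union>n. Bad n"] conjI allI impI)
   show "(\<Union>n. Bad n) \<in> sets borel" using opn by auto
   have "emeasure lborel (\<Union>n. Bad n) = (SUP n. emeasure lborel (Bad n))"
    by (rule SUP_emeasure_incseq[symmetric]) (use opn inc in auto)
   also have "... <= ennreal (5 * K^2 * C * sq f / lam^2)" by (rule SUP_least) (rule bm)
   finally show "emeasure lborel (\<Union>n. Bad n) <= ennreal (5 * K^2 * C * sq f / lam^2)" .
   fix x eps :: real assume x: "x \<notin> (\<Union>n. Bad n)" and eps: "0 < eps"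
   obtain n where "inverse (real (Suc n)) < eps" using reals_Archimedean[OF eps] by blast
   hence "eps > 1 / real (Suc n)" by (simp add: inverse_eq_divide)
   moreover have "x \<notin> Bad n" using x by blast
   ultimately have "\<not> lam < norm (F eps f x)" unfolding Bad_def by blast
   thus "norm (F eps f x) <= lam" by simp
  qed
 qed
qed

text \<open>Complex conjugation reflects the graph and exchanges the two sides of it.\<close>
lemma neg_locale: "lip_graph_deriv (%t. - A t) L (%t. - a t)"
proof unfold_locales
 show "\<bar>- A s - - A t\<bar> <= L * \<bar>s - t\<bar>" for s t using lip[of s t] by simp
 show "(%t. - a t) \<in> borel_measurable borel" using a_meas by simp
 show "\<bar>- a t\<bar> <= L" for t using a_bd[of t] by simp
 show "(LBINT x:{s..t}. - a x) = - A t - - A s" if "s <= t" for s t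
  using A_int[OF that] by (simp add: set_lebesgue_integral_def)
qed

theorem F_maximal_lower:
 "\<exists>C>0. \<forall>R f lam. R > 0 --> lam > 0 --> L2R f --> (\<forall>t. t \<notin> {-R..<R} --> f t = 0) -->
   (\<exists>U\<in>sets borel. emeasure lborel U <= ennreal (C * sq f / lam^2) \<and> (\<forall>x. x \<notin> U --> (\<forall>eps>0. norm (F (-eps) f x) <= lam)))"
proof -
 interpret neg: lip_graph_deriv "%t. - A t" L "%t. - a t" by (rule neg_locale)
 have zc: "neg.z t = cnj (z t)" for t by (simp add: neg.z_def z_def complex_eq_iff)
 have Fc: "neg.F eps (%t. cnj (f t)) x = cnj (F (-eps) f x)" for eps f x
  unfolding neg.F_def F_def zc by (subst lint_cnj[symmetric]) simp
 have cm: "(%t. cnj (f t)) \<in> borel_measurable borel" if "f \<in> borel_measurable borel" for f :: "real => complex"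
  by (rule measurable_compose[OF that borel_measurable_continuous_onI]) (intro continuous_intros)
 have cL: "L2R (%t. cnj (f t))" "sq (%t. cnj (f t)) = sq f" if "L2R f" for f
  using that cm unfolding L2R_def sq_def by auto
 obtain C where C: "C > 0" and Cb: "!!R f lam. R > 0 ==> lam > 0 ==> L2R f ==> \<forall>t. t \<notin> {-R..<R} --> f t = 0 ==>
   \<exists>U\<in>sets borel. emeasure lborel U <= ennreal (C * sq f / lam^2) \<and> (\<forall>x. x \<notin> U --> (\<forall>eps>0. norm (neg.F eps f x) <= lam))"
  using neg.F_maximal_upper by blast
 show ?thesis
 proof (intro exI[of _ C] conjI C allI impI)
  fix R lam :: real and f
  assume R: "R > 0" and lam: "lam > 0" and f: "L2R f" and fs: "\<forall>t. t \<notin> {-R..<R} --> f t = 0"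
  show "\<exists>U\<in>sets borel. emeasure lborel U <= ennreal (C * sq f / lam^2) \<and> (\<forall>x. x \<notin> U --> (\<forall>eps>0. norm (F (-eps) f x) <= lam))"
   using Cb[OF R lam cL(1)[OF f]] fs unfolding Fc cL(2)[OF f] by simp
 qed
qed

definition PV :: "real => (real => complex) => real => complex" where
 "PV eps f x = (LBINT t. indicator {t. eps < norm (z t - z x)} t *\<^sub>R (f t / (z t - z x)))"

lemma PV_integrable:
 assumes f: "integrable lborel f" and eps: "eps > 0"
 shows "integrable lborel (%t. indicator {t. eps < norm (z t - z x)} t *\<^sub>R (f t / (z t - z x)))"
proof (rule integrable_dominated[OF integrable_mult_right[OF integrable_norm[OF f], of "1 / eps"]])
 have [measurable]: "f \<in> borel_measurable borel" using borel_measurable_integrable[OF f] by simp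
 show "(%t. indicator {t. eps < norm (z t - z x)} t *\<^sub>R (f t / (z t - z x))) \<in> borel_measurable lborel" by measurable
 show "AE t in lborel. norm (indicator {t. eps < norm (z t - z x)} t *\<^sub>R (f t / (z t - z x))) <= norm (1 / eps * norm (f t))"
 proof (rule AE_I2)
  fix t
  show "norm (indicator {t. eps < norm (z t - z x)} t *\<^sub>R (f t / (z t - z x))) <= norm (1 / eps * norm (f t))"
  proof (cases "eps < norm (z t - z x)")
   case True
   have "norm (z t - z x) > 0" using True eps by linarith
   hence "norm (f t) / norm (z t - z x) <= norm (f t) / eps" using True eps by (intro divide_left_mono mult_pos_pos) auto
   thus ?thesis using True eps by (simp add: norm_divide)
  qed simp
 qed
qed

lemma PV_diff:
 assumes "integrable lborel f" "integrable lborel g" "eps > 0"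
 shows "PV eps (%t. f t - g t) x = PV eps f x - PV eps g x"
proof -
 have e: "indicator {t. eps < norm (z t - z x)} t *\<^sub>R ((f t - g t) / (z t - z x)) =
  indicator {t. eps < norm (z t - z x)} t *\<^sub>R (f t / (z t - z x)) - indicator {t. eps < norm (z t - z x)} t *\<^sub>R (g t / (z t - z x))" for t
  by (simp add: diff_divide_distrib scaleR_right_diff_distrib)
 show ?thesis unfolding PV_def e
  by (rule lint_diff) (intro PV_integrable assms)+
qed

text \<open>The sharp truncation is compared with the mean of the Cauchy kernels at heights \<open>eps\<close> and \<open>- eps\<close>: for distant points the
two agree to second order, and for near points all terms have size \<open>1 / eps\<close>.\<close>
lemma truncation_kernel_bound:
 assumes eps: "eps > 0"
 shows "norm (indicator {t. eps < norm (z t - z x)} t *\<^sub>R (1 / (z t - z x)) - (1 / (z t - z x - \<i> * of_real eps) + 1 / (z t - z x + \<i> * of_real eps)) / 2)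
  <= (2 + L)^2 * (eps / (eps + \<bar>x - t\<bar>)^2)"
proof -
 let ?u = "z t - z x"
 let ?D = "(?u - \<i> * of_real eps) * (?u + \<i> * of_real eps)"
 have n: "?u - \<i> * of_real eps ~= 0" "?u + \<i> * of_real eps ~= 0" using den_nz[of eps t x] den_nz[of "-eps" t x] eps by auto
 have Dn: "norm ?D > 0" using n by simp
 have Du: "?D = ?u^2 + of_real (eps^2)" by (simp add: power2_eq_square algebra_simps)
 have avg: "(1 / (?u - \<i> * of_real eps) + 1 / (?u + \<i> * of_real eps)) / 2 = ?u / ?D"
 proof -
  have "(1 / p + 1 / q) / 2 = ((p + q) / 2) / (p * q)" if "p ~= 0" "q ~= 0" for p q :: complex
   using that by (simp add: field_simps)
  note this[OF n]
  also have "(?u - \<i> * of_real eps + (?u + \<i> * of_real eps)) / 2 = ?u" by simp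
  finally show ?thesis .
 qed
 have q: "(eps + \<bar>x - t\<bar>)^2 > 0" using eps by (intro zero_less_power) auto
 have iD: "1 / norm ?D <= (2 + L)^2 / (eps + \<bar>x - t\<bar>)^2"
  using quad_lower[OF eps, of x t] Dn q by (simp add: divide_simps mult.commute)
 have "norm (indicator {t. eps < norm (z t - z x)} t *\<^sub>R (1 / ?u) - ?u / ?D) <= eps * (1 / norm ?D)"
 proof (cases "eps < norm ?u")
  case True
  hence u0: "?u ~= 0" using eps by auto
  have "1 / ?u - ?u / ?D = (?D - ?u * ?u) / (?u * ?D)" using u0 n by (simp add: diff_frac_eq)
  also have "?D - ?u * ?u = of_real (eps^2)" unfolding Du by (simp add: power2_eq_square)
  finally have "norm (1 / ?u - ?u / ?D) = eps^2 / (norm ?u * norm ?D)" by (simp only: norm_divide norm_mult norm_of_real) simp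
  also have "... <= eps^2 / (eps * norm ?D)" using True eps Dn by (intro divide_left_mono mult_right_mono mult_pos_pos) auto
  also have "... = eps * (1 / norm ?D)" using eps by (simp add: power2_eq_square)
  finally show ?thesis using True by simp
 next
  case False
  hence "norm ?u / norm ?D <= eps / norm ?D" by (intro divide_right_mono) auto
  thus ?thesis using False by (simp add: norm_divide)
 qed
 also have "... <= eps * ((2 + L)^2 / (eps + \<bar>x - t\<bar>)^2)" using iD eps by (intro mult_left_mono) auto
 finally show ?thesis unfolding avg by (simp add: mult.commute)
qed

lemma PV_vs_F:
 assumes f: "integrable lborel f" and eps: "eps > 0" and i: "integrable lborel (%y. norm (f y) * (eps / (eps + \<bar>x - y\<bar>)^2))"
 shows "norm (PV eps f x) <= (norm (F eps f x) + norm (F (-eps) f x)) / 2 + (2 + L)^2 * (LBINT y. norm (f y) * (eps / (eps + \<bar>x - y\<bar>)^2))"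
proof -
 have ne: "eps ~= 0" "-eps ~= 0" using eps by auto
 let ?k = "%t. indicator {t. eps < norm (z t - z x)} t *\<^sub>R (1 / (z t - z x)) - (1 / (z t - z x - \<i> * of_real eps) + 1 / (z t - z x + \<i> * of_real eps)) / 2"
 note I1 = PV_integrable[OF f eps, of x] and I2 = F_integrable[OF f ne(1), of x] and I3 = F_integrable[OF f ne(2), of x]
 have e: "f t * ?k t = indicator {t. eps < norm (z t - z x)} t *\<^sub>R (f t / (z t - z x)) - (f t / (z t - z x - \<i> * of_real eps) + f t / (z t - z x - \<i> * of_real (-eps))) / 2" for t
  by (simp add: right_diff_distrib distrib_left add_divide_distrib)
 have I4: "integrable lborel (%t. f t * ?k t)" unfolding e using I1 I2 I3 by auto
 have "(LBINT t. f t * ?k t) = PV eps f x - (F eps f x + F (-eps) f x) / 2"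
  unfolding e PV_def F_def using I1 I2 I3 by simp
 hence "PV eps f x = (F eps f x + F (-eps) f x) / 2 + (LBINT t. f t * ?k t)" by simp
 hence "norm (PV eps f x) <= norm ((F eps f x + F (-eps) f x) / 2) + norm (LBINT t. f t * ?k t)"
  by (simp only: norm_triangle_ineq)
 also have "norm ((F eps f x + F (-eps) f x) / 2) <= (norm (F eps f x) + norm (F (-eps) f x)) / 2"
  using norm_triangle_ineq[of "F eps f x" "F (-eps) f x"] by (simp add: norm_divide)
 also have "norm (LBINT t. f t * ?k t) <= (LBINT t. (2 + L)^2 * (norm (f t) * (eps / (eps + \<bar>x - t\<bar>)^2)))"
 proof (rule lint_norm_bound[OF I4])
  show "integrable lborel (%t. (2 + L)^2 * (norm (f t) * (eps / (eps + \<bar>x - t\<bar>)^2)))" by (intro integrable_mult_right i)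
  fix t
  have "norm (f t) * norm (?k t) <= norm (f t) * ((2 + L)^2 * (eps / (eps + \<bar>x - t\<bar>)^2))"
   by (intro mult_left_mono truncation_kernel_bound eps) auto
  thus "norm (f t * ?k t) <= (2 + L)^2 * (norm (f t) * (eps / (eps + \<bar>x - t\<bar>)^2))"
   unfolding norm_mult by (simp only: mult.left_commute)
 qed
 finally show ?thesis by (simp only: integral_mult_right_zero)
qed

text \<open>By \<open>PV_vs_F\<close> a large truncated integral forces a large Cauchy integral above or below the graph, or a large Poisson average
of \<open>|f|\<close>; each of these happens only on a small set.\<close>
theorem PV_maximal:
 "\<exists>C>0. \<forall>R f lam. R > 0 --> lam > 0 --> L2R f --> (\<forall>t. t \<notin> {-R..<R} --> f t = 0) -->
   (\<exists>U\<in>sets borel. emeasure lborel U <= ennreal (C * sq f / lam^2) \<and> (\<forall>x. x \<notin> U --> (\<forall>eps>0. norm (PV eps f x) <= lam)))"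
proof -
 obtain Ca where Ca: "Ca > 0" and Cab: "!!R f lam. R > 0 ==> lam > 0 ==> L2R f ==> \<forall>t. t \<notin> {-R..<R} --> f t = 0 ==>
   \<exists>U\<in>sets borel. emeasure lborel U <= ennreal (Ca * sq f / lam^2) \<and> (\<forall>x. x \<notin> U --> (\<forall>eps>0. norm (F eps f x) <= lam))"
  using F_maximal_upper by blast
 obtain Cc where Cc: "Cc > 0" and Ccb: "!!R f lam. R > 0 ==> lam > 0 ==> L2R f ==> \<forall>t. t \<notin> {-R..<R} --> f t = 0 ==>
   \<exists>U\<in>sets borel. emeasure lborel U <= ennreal (Cc * sq f / lam^2) \<and> (\<forall>x. x \<notin> U --> (\<forall>eps>0. norm (F (-eps) f x) <= lam))"
  using F_maximal_lower by blast
 define K where "K = 18 * (2 + L)^2"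
 have K: "K > 0" unfolding K_def using L_nonneg by simp
 let ?C = "4 * Ca + 4 * Cc + 5 * K^2"
 show ?thesis
 proof (intro exI[of _ ?C] conjI allI impI)
  show "?C > 0" using Ca Cc K by (intro add_pos_pos) auto
  fix R lam :: real and f
  assume R: "R > 0" and lam: "lam > 0" and f: "L2R f" and fs: "\<forall>t. t \<notin> {-R..<R} --> f t = 0"
  have fi: "integrable lborel f" using L1_of_L2(1)[OF f, of "-R" "2 * R" 1] fs R by auto
  have l2: "lam / 2 > 0" "lam / K > 0" using lam K by auto
  obtain U1 where U1: "U1 \<in> sets borel" "emeasure lborel U1 <= ennreal (Ca * sq f / (lam/2)^2)" "!!x eps. x \<notin> U1 ==> eps > 0 ==> norm (F eps f x) <= lam / 2"
   using Cab[OF R l2(1) f fs] by blast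
  obtain U2 where U2: "U2 \<in> sets borel" "emeasure lborel U2 <= ennreal (Cc * sq f / (lam/2)^2)" "!!x eps. x \<notin> U2 ==> eps > 0 ==> norm (F (-eps) f x) <= lam / 2"
   using Ccb[OF R l2(1) f fs] by blast
  have f2: "f \<in> borel_measurable borel" "integrable lborel (%t. (norm (f t))^2)" using f unfolding L2R_def by auto
  have "\<exists>U. U \<in> sets borel \<and> emeasure lborel U <= ennreal (5 / (lam/K)^2 * (LBINT x. (norm (f x))^2)) \<and>
    (\<forall>x. x \<notin> U --> (\<forall>r>0. (LBINT y. indicator {x - r..x + r} y * (norm (f y))^2) <= 2 * r * (lam/K)^2))"
   by (rule maximal_weak_type[OF f2(2)]) (use l2 in auto)
  then obtain U3 where U3: "U3 \<in> sets borel" "emeasure lborel U3 <= ennreal (5 / (lam/K)^2 * sq f)"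
    and good: "!!x r. x \<notin> U3 ==> r > 0 ==> (LBINT y. indicator {x - r..x + r} y * (norm (f y))^2) <= 2 * r * (lam/K)^2"
   unfolding sq_def by blast
  show "\<exists>U\<in>sets borel. emeasure lborel U <= ennreal (?C * sq f / lam^2) \<and> (\<forall>x. x \<notin> U --> (\<forall>eps>0. norm (PV eps f x) <= lam))"
  proof (intro bexI[of _ "U1 \<union> U2 \<union> U3"] conjI allI impI)
   show "U1 \<union> U2 \<union> U3 \<in> sets borel" using U1 U2 U3 by auto
   have s0: "sq f >= 0" by (rule sq_nonneg)
   have "emeasure lborel (U1 \<union> U2 \<union> U3) <= emeasure lborel U1 + emeasure lborel U2 + emeasure lborel U3"
    using U1 U2 U3 by (intro order_trans[OF emeasure_subadditive] add_mono emeasure_subadditive) auto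
   also have "... <= ennreal (Ca * sq f / (lam/2)^2) + ennreal (Cc * sq f / (lam/2)^2) + ennreal (5 / (lam/K)^2 * sq f)"
    by (intro add_mono U1 U2 U3)
   also have "... = ennreal (Ca * sq f / (lam/2)^2 + Cc * sq f / (lam/2)^2 + 5 / (lam/K)^2 * sq f)"
    using Ca Cc s0 by (simp add: ennreal_plus)
   also have "Ca * sq f / (lam/2)^2 + Cc * sq f / (lam/2)^2 + 5 / (lam/K)^2 * sq f = ?C * sq f / lam^2"
    using lam K by (simp add: field_simps power_divide)
   finally show "emeasure lborel (U1 \<union> U2 \<union> U3) <= ennreal (?C * sq f / lam^2)" .
   fix x eps :: real assume x: "x \<notin> U1 \<union> U2 \<union> U3" and eps: "0 < eps"
   note pa = poisson_average[OF f2 l2(2) eps good[of x]]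
   have "norm (PV eps f x) <= (norm (F eps f x) + norm (F (-eps) f x)) / 2 + (2 + L)^2 * (LBINT y. norm (f y) * (eps / (eps + \<bar>x - y\<bar>)^2))"
    by (rule PV_vs_F[OF fi eps pa(1)]) (use x in auto)
   also have "... <= (lam/2 + lam/2) / 2 + (2 + L)^2 * (9 * (lam / K))"
    using U1(3)[of x eps] U2(3)[of x eps] x eps pa(2) by (intro add_mono divide_right_mono mult_left_mono) auto
   also have "... = lam" using L_nonneg unfolding K_def by (simp add: field_simps)
   finally show "norm (PV eps f x) <= lam" .
  qed
 qed
qed

end

section \<open>Principal values on a Lipschitz graph\<close>

context lip_graph_deriv begin

lemma PV_interval_outside:
 assumes pq: "p < q" and x: "x < p \<or> q < x"
 shows "\<exists>v. ((%eps. PV eps (%t. indicator {p..<q} t *\<^sub>R b t) x) \<longlongrightarrow> v) (at_right 0)"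
proof -
 define d where "d = (if x < p then p - x else x - q)"
 have d: "d > 0" unfolding d_def using x by auto
 let ?v = "LBINT t. (indicator {p..<q} t *\<^sub>R b t) / (z t - z x)"
 have "PV eps (%t. indicator {p..<q} t *\<^sub>R b t) x = ?v" if "eps \<in> {0<..<d}" for eps
  unfolding PV_def
 proof (intro lint_cong refl)
  fix t
  show "indicator {t. eps < norm (z t - z x)} t *\<^sub>R ((indicator {p..<q} t *\<^sub>R b t) / (z t - z x)) = (indicator {p..<q} t *\<^sub>R b t) / (z t - z x)"
  proof (cases "t \<in> {p..<q}")
   case True
   hence "d <= \<bar>t - x\<bar>" using x unfolding d_def by auto
   hence "eps < norm (z t - z x)" using that z_lower[of t x] by auto
   thus ?thesis by simp
  qed simp
 qed
 hence "eventually (%eps. PV eps (%t. indicator {p..<q} t *\<^sub>R b t) x = ?v) (at_right 0)"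
  by (rule eventually_at_rightI[OF _ d])
 thus ?thesis by (intro exI[of _ ?v] tendsto_eventually)
qed

text \<open>The sign \<open>c\<close> selects a logarithm that is holomorphic along the arc: \<open>c = 1\<close> to the right of \<open>x\<close> and \<open>c = -1\<close> to the left.\<close>
lemma side_integral:
 assumes su: "s <= u" and c: "c = 1 \<or> c = -1" and pos: "!!t. t \<in> {s..u} ==> Re (c * (z t - z x)) > 0"
 shows "set_integrable lborel {s..u} (%t. 1 / (z t - z x) * b t)"
  and "(LBINT t:{s..u}. 1 / (z t - z x) * b t) = Ln (c * (z u - z x)) - Ln (c * (z s - z x))"
proof -
 have nz: "z t - z x ~= 0" if "t \<in> {s..u}" for t using pos[OF that] by (metis less_irrefl mult_zero_right zero_complex.simps(1))
 have cont: "continuous_on {s..u} (%t. 1 / (z t - z x))"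
  by (intro continuous_intros z_continuous ballI nz)
 show "set_integrable lborel {s..u} (%t. 1 / (z t - z x) * b t)" by (rule set_integrable_mult_b[OF cont])
 show "(LBINT t:{s..u}. 1 / (z t - z x) * b t) = Ln (c * (z u - z x)) - Ln (c * (z s - z x))"
 proof (rule z_ftc[OF su _ cont, where phi = "%p. Ln (c * (p - z x))"])
  fix t assume t: "t \<in> {s..u}"
  have "c * (z t - z x) \<notin> \<real>\<^sub>\<le>\<^sub>0" using pos[OF t] by (auto simp: complex_nonpos_Reals_iff)
  hence "((%p. Ln (c * (p - z x))) has_field_derivative inverse (c * (z t - z x)) * c) (at (z t))"
   by (intro DERIV_chain2[where f = Ln and g = "%p. c * (p - z x)", OF has_field_derivative_Ln]) (auto intro!: derivative_eq_intros)
  moreover have "inverse (c * (z t - z x)) * c = 1 / (z t - z x)" using c nz[OF t] by (auto simp: field_simps)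
  ultimately show "((%p. Ln (c * (p - z x))) has_field_derivative 1 / (z t - z x)) (at (z t))" by simp
 qed
qed

lemma difference_quotient:
 assumes "(A has_real_derivative A1) (at x)"
 shows "((%h. (z (x + h) - z x) / of_real h) \<longlongrightarrow> Complex 1 A1) (at 0)"
proof -
 have "((%h. Complex 1 ((A (x + h) - A x) / h)) \<longlongrightarrow> Complex 1 A1) (at 0)"
  using assms unfolding DERIV_def by (intro tendsto_Complex tendsto_const)
 thus ?thesis
  by (rule Lim_transform_eventually)
   (auto simp: eventually_at_filter complex_eq_iff z_def Re_divide_of_real Im_divide_of_real)
qed

text \<open>Truncation in the parameter instead of the distance: here the remaining set consists of two intervals.\<close>
definition PVs :: "real => real => real => real => complex" where
 "PVs p q e x = (LBINT t. indicator ({p..x - e} \<union> {x + e..<q}) t *\<^sub>R (b t / (z t - z x)))"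

lemma PVs_eq:
 assumes e: "e > 0" "p <= x - e" "x + e <= q"
 shows "integrable lborel (%t. indicator ({p..x - e} \<union> {x + e..<q}) t *\<^sub>R (b t / (z t - z x)))"
  and "PVs p q e x = (Ln (z x - z (x - e)) - Ln (z x - z p)) + (Ln (z q - z x) - Ln (z (x + e) - z x))"
proof -
 let ?g = "%t. 1 / (z t - z x) * b t"
 have gm: "?g \<in> borel_measurable borel" by measurable
 have ind: "indicator ({p..x - e} \<union> {x + e..<q}) t *\<^sub>R (b t / (z t - z x)) = indicator {p..x - e} t *\<^sub>R ?g t + indicator {x + e..<q} t *\<^sub>R ?g t" for t
  using e by (auto simp: indicator_def)
 have l: "set_integrable lborel {p..x - e} ?g" "(LBINT t:{p..x - e}. ?g t) = Ln (z x - z (x - e)) - Ln (z x - z p)"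
  using side_integral[of p "x - e" "-1" x] e by auto
 have r: "set_integrable lborel {x + e..q} ?g" "(LBINT t:{x + e..q}. ?g t) = Ln (z q - z x) - Ln (z (x + e) - z x)"
  using side_integral[of "x + e" q 1 x] e by auto
 have i1: "integrable lborel (%t. indicator {p..x - e} t *\<^sub>R ?g t)" using l(1) unfolding set_integrable_def .
 have i2: "integrable lborel (%t. indicator {x + e..<q} t *\<^sub>R ?g t)"
  by (rule set_integrable_subset[OF r(1), unfolded set_integrable_def]) auto
 show "integrable lborel (%t. indicator ({p..x - e} \<union> {x + e..<q}) t *\<^sub>R (b t / (z t - z x)))"
  unfolding ind by (rule Bochner_Integration.integrable_add[OF i1 i2])
 show "PVs p q e x = (Ln (z x - z (x - e)) - Ln (z x - z p)) + (Ln (z q - z x) - Ln (z (x + e) - z x))"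
  unfolding PVs_def ind lint_add[OF i1 i2] LINT_half_open[OF gm]
  using l(2) r(2) unfolding set_lebesgue_integral_def by simp
qed

lemma filterlim_times_at_0: "c ~= 0 ==> filterlim (%e. c * e) (at 0) (at_right (0::real))"
 unfolding filterlim_at by (auto simp: eventually_at_filter intro!: tendsto_eq_intros)

text \<open>The logarithms at the two inner end points cancel in the limit, because both difference quotients tend to the
tangent vector.\<close>
lemma PVs_tendsto:
 assumes d: "(A has_real_derivative A1) (at x)" and px: "p < x" "x < q"
 shows "((%e. PVs p q e x) \<longlongrightarrow> Ln (z q - z x) - Ln (z x - z p)) (at_right 0)"
proof -
 let ?v = "Complex 1 A1" and ?c = "Ln (z q - z x) - Ln (z x - z p)"
 have t: "((%e. Ln ((z (x + c * e) - z x) / of_real (c * e))) \<longlongrightarrow> Ln ?v) (at_right 0)" if "c ~= 0" for c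
  by (rule isCont_tendsto_compose[OF continuous_at_Ln filterlim_compose[OF difference_quotient[OF d] filterlim_times_at_0[OF that]]])
   (auto simp: complex_nonpos_Reals_iff)
 have lim: "((%e. ?c + (Ln ((z (x + (-1) * e) - z x) / of_real ((-1) * e)) - Ln ((z (x + 1 * e) - z x) / of_real (1 * e)))) \<longlongrightarrow> ?c + (Ln ?v - Ln ?v)) (at_right 0)"
  by (intro tendsto_intros t) auto
 have "((%e. PVs p q e x) \<longlongrightarrow> ?c + (Ln ?v - Ln ?v)) (at_right 0)"
 proof (rule Lim_transform_eventually[OF lim], rule eventually_at_rightI)
  show "0 < min (x - p) (q - x)" using px by simp
  fix e assume "e \<in> {0<..<min (x - p) (q - x)}"
  hence e: "e > 0" "p <= x - e" "x + e <= q" by auto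
  have n: "z (x + e) - z x ~= 0" "z x - z (x - e) ~= 0" by (rule z_diff_nz, use e(1) in simp)+
  have r: "(z (x + (-1) * e) - z x) / of_real ((-1) * e) = (z x - z (x - e)) / of_real e"
   using e(1) by (simp add: field_simps)
  show "?c + (Ln ((z (x + (-1) * e) - z x) / of_real ((-1) * e)) - Ln ((z (x + 1 * e) - z x) / of_real (1 * e))) = PVs p q e x"
   unfolding r mult_1 PVs_eq(2)[OF e] Ln_divide_of_real[OF e(1) n(1)] Ln_divide_of_real[OF e(1) n(2)] by simp
 qed
 thus ?thesis by simp
qed

text \<open>After the substitution \<open>t = x + e s\<close> the difference of the two truncated integrals has an integrand that is bounded and supported in
\<open>|s| \<le> m\<close>. Since the distance \<open>|z(x + e s) - z x|\<close> is asymptotically \<open>m e |s|\<close>, the two indicators agree for small \<open>e\<close> unless \<open>|s|\<close> is 0 or 1.\<close>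
lemma truncation_shape:
 assumes d: "(A has_real_derivative A1) (at x)" and px: "p < x" "x < q"
 defines "m \<equiv> norm (Complex 1 A1)"
 shows "((%e. PV (m * e) (%t. indicator {p..<q} t *\<^sub>R b t) x - PVs p q e x) \<longlongrightarrow> 0) (at_right 0)"
proof -
 have m: "m >= 1" unfolding m_def using complex_Re_le_cmod[of "Complex 1 A1"] by simp
 define k where "k t = indicator {p..<q} t *\<^sub>R (b t / (z t - z x))" for t
 define I where "I e t = (indicator {t. m * e < norm (z t - z x)} t - indicator {t. e <= \<bar>t - x\<bar>} t :: real)" for e t
 define h where "h u s = inverse u *\<^sub>R (I (inverse u) (x + inverse u * s) *\<^sub>R k (x + inverse u * s))" for u s
 have km [measurable]: "k \<in> borel_measurable borel" unfolding k_def by measurable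
 have Im [measurable]: "I e \<in> borel_measurable borel" for e unfolding I_def by measurable
 have ib: "integrable lborel (%t. indicator {p..<q} t *\<^sub>R b t)"
  using set_integrable_subset[OF set_integrable_mult_b[OF continuous_on_const[of "{p..q}" 1]], of "{p..<q}"]
  by (auto simp: set_integrable_def subset_eq)
 have "\<forall>\<^sub>F e in at_right 0. PV (m * e) (%t. indicator {p..<q} t *\<^sub>R b t) x - PVs p q e x = (LBINT s. h (inverse e) s)"
 proof (rule eventually_at_rightI)
  show "0 < min (x - p) (q - x)" using px by simp
  fix e assume "e \<in> {0<..<min (x - p) (q - x)}"
  hence e: "e > 0" "p <= x - e" "x + e <= q" by auto
  have "m * e > 0" using e m by simp
  note i1 = PV_integrable[OF ib this, of x]
  have "PV (m * e) (%t. indicator {p..<q} t *\<^sub>R b t) x - PVs p q e x = (LBINT t. I e t *\<^sub>R k t)"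
   unfolding PV_def PVs_def lint_diff[OF i1 PVs_eq(1)[OF e], symmetric]
   by (rule lint_cong) (use e px in "auto simp: I_def k_def indicator_def")
  also have "... = (LBINT s. h (inverse e) s)"
   using lborel_integral_real_affine[of e "%t. I e t *\<^sub>R k t" x] e unfolding h_def integral_scaleR_right by simp
  finally show "PV (m * e) (%t. indicator {p..<q} t *\<^sub>R b t) x - PVs p q e x = (LBINT s. h (inverse e) s)" .
 qed
 moreover have "((%u. LBINT s. h u s) \<longlongrightarrow> (LINT s|(lborel :: real measure). 0)) at_top"
 proof (rule integral_dominated_convergence_at_top)
  show "integrable lborel (%s. (1 + L) * indicator {-m..m} s)"
   by (intro integrable_mult_right integrable_real_indicator) (auto simp: emeasure_lborel_Icc_eq)
  show "h u \<in> borel_measurable lborel" for u unfolding h_def by measurable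
  have "AE s in lborel. s \<notin> {0, 1, -1::real}" by (rule AE_not_in) (rule finite_imp_null_set_lborel, simp)
  thus "AE s in lborel. ((%u. h u s) \<longlongrightarrow> 0) at_top"
  proof (rule AE_mp, intro AE_I2 impI)
   fix s :: real assume s: "s \<notin> {0, 1, -1}"
   have q: "((%e. \<bar>s\<bar> * norm ((z (x + s * e) - z x) / of_real (s * e))) \<longlongrightarrow> \<bar>s\<bar> * m) (at_right 0)"
    unfolding m_def using s by (intro tendsto_intros filterlim_compose[OF difference_quotient[OF d] filterlim_times_at_0]) auto
   have "\<forall>\<^sub>F e in at_right 0. (m < \<bar>s\<bar> * norm ((z (x + s * e) - z x) / of_real (s * e))) = (1 <= \<bar>s\<bar>)"
   proof (cases "\<bar>s\<bar> > 1")
    case True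
    hence "1 * m < \<bar>s\<bar> * m" using m by (intro mult_strict_right_mono) auto
    thus ?thesis using order_tendstoD(1)[OF q, of m] True by (auto elim: eventually_mono)
   next
    case False
    hence "\<bar>s\<bar> < 1" using s by (auto simp: abs_if split: if_splits)
    hence "\<bar>s\<bar> * m < 1 * m" using m by (intro mult_strict_right_mono) auto
    thus ?thesis using order_tendstoD(2)[OF q, of m] \<open>\<bar>s\<bar> < 1\<close> by (auto elim!: eventually_mono)
   qed
   moreover have "\<forall>\<^sub>F e in at_right (0::real). 0 < e" by (rule eventually_at_right_less)
   ultimately have "\<forall>\<^sub>F e in at_right 0. 0 = h (inverse e) s"
   proof eventually_elim
    fix e :: real assume e: "(m < \<bar>s\<bar> * norm ((z (x + s * e) - z x) / of_real (s * e))) = (1 <= \<bar>s\<bar>)" "0 < e"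
    have "m * e < norm (z (x + e * s) - z x) \<longleftrightarrow> e <= \<bar>e * s\<bar>"
    proof -
    have "\<bar>s\<bar> * norm ((z (x + s * e) - z x) / of_real (s * e)) = norm (z (x + e * s) - z x) / e"
    using e(2) s by (simp add: norm_divide norm_mult mult.commute)
    thus ?thesis using e by (simp add: pos_less_divide_eq abs_mult)
    qed
    thus "0 = h (inverse e) s" unfolding h_def I_def by (simp add: indicator_def)
   qed
   thus "((%u. h u s) \<longlongrightarrow> 0) at_top"
    unfolding eventually_at_right_to_top by (intro Lim_transform_eventually[OF tendsto_const]) simp
  qed
  show "\<forall>\<^sub>F u in at_top. AE s in lborel. norm (h u s) <= (1 + L) * indicator {-m..m} s"
  proof (rule eventually_mono[OF eventually_gt_at_top[of 0]], rule AE_I2)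
   fix u s :: real assume "0 < u"
   define e where "e = inverse u"
   have e: "e > 0" unfolding e_def using \<open>0 < u\<close> by simp
   let ?t = "x + e * s" and ?n = "norm (z (x + e * s) - z x)"
   have lo: "e * \<bar>s\<bar> <= ?n" using z_lower[of ?t x] e by (simp add: abs_mult)
   show "norm (h u s) <= (1 + L) * indicator {-m..m} s"
   proof (cases "I e ?t = 0")
    case False
    hence "(m * e < ?n \<and> \<bar>s\<bar> < 1) \<or> (?n <= m * e \<and> 1 <= \<bar>s\<bar>)"
    unfolding I_def using e by (auto simp: indicator_def abs_mult split: if_splits)
    moreover have "1 * e <= m * e" using m e by (intro mult_right_mono) auto
    moreover have "\<bar>s\<bar> >= 1 ==> e <= e * \<bar>s\<bar>" using e by simp
    moreover have "e * \<bar>s\<bar> <= e * m ==> \<bar>s\<bar> <= m" using e by simp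
    ultimately have n: "e <= ?n" and s: "\<bar>s\<bar> <= m" using lo m by (auto simp: mult.commute)
    have "norm (b ?t) / ?n <= (1 + L) / e" using b_upper[of ?t] n e L_nonneg by (intro frac_le) auto
    hence "e * norm (k ?t) <= 1 + L" unfolding k_def using e L_nonneg
    by (simp add: indicator_def norm_divide pos_le_divide_eq mult.commute)
    moreover have "norm (h u s) <= e * norm (k ?t)"
    unfolding h_def e_def[symmetric] I_def using e by (auto simp: indicator_def)
    ultimately show ?thesis using s by (simp add: indicator_def abs_le_iff minus_le_iff)
   qed (use L_nonneg in "simp add: h_def e_def")
  qed
 qed simp
 ultimately show ?thesis unfolding filterlim_at_top_to_right
  by (auto intro: Lim_transform_eventually elim: eventually_mono simp: eq_commute)
qed

lemma filterlim_divide_at_right: "c > 0 ==> filterlim (%e. e / c) (at_right 0) (at_right (0::real))"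
 unfolding filterlim_at by (auto simp: eventually_at_filter intro!: tendsto_eq_intros)

lemma PV_interval:
 assumes pq: "p < q" and x: "x ~= p" "x ~= q" and d: "(A has_real_derivative A1) (at x)"
 shows "\<exists>v. ((%eps. PV eps (%t. indicator {p..<q} t *\<^sub>R b t) x) \<longlongrightarrow> v) (at_right 0)"
proof (cases "x < p \<or> q < x")
 case False
 hence px: "p < x" "x < q" using x by auto
 let ?m = "norm (Complex 1 A1)"
 have "?m >= 1" using complex_Re_le_cmod[of "Complex 1 A1"] by simp
 hence m: "?m > 0" by linarith
 from filterlim_compose[OF tendsto_add[OF truncation_shape[OF d px] PVs_tendsto[OF d px]] filterlim_divide_at_right[OF m]]
 show ?thesis using m by auto
qed (rule PV_interval_outside[OF pq])

lemma PV_stepf: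
 assumes l: "l > 0" and d: "(A has_real_derivative A1) (at x)" and x: "!!i. x ~= gp X l N i"
 shows "\<exists>v. ((%eps. PV eps (%t. stepf X l N c t * b t) x) \<longlongrightarrow> v) (at_right 0)"
proof -
 have lt: "gp X l N i < gp X l N (Suc i)" for i 
 proof -
  have "gh l N > 0" using l by (simp add: gh_def)
  thus ?thesis using gp_simps(7)[of X l N i] by linarith
 qed
 have "\<exists>v. ((%eps. PV eps (%t. indicator {gp X l N i..<gp X l N (Suc i)} t *\<^sub>R b t) x) \<longlongrightarrow> v) (at_right 0)" for i
  by (rule PV_interval[OF lt _ _ d]) (use x in auto)
 then obtain v where v: "!!i. ((%eps. PV eps (%t. indicator {gp X l N i..<gp X l N (Suc i)} t *\<^sub>R b t) x) \<longlongrightarrow> v i) (at_right 0)"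
  using choice[of "%i v. ((%eps. PV eps (%t. indicator {gp X l N i..<gp X l N (Suc i)} t *\<^sub>R b t) x) \<longlongrightarrow> v) (at_right 0)"] by blast
 have lim: "((%eps. \<Sum>i<2^N. c i * PV eps (%t. indicator {gp X l N i..<gp X l N (Suc i)} t *\<^sub>R b t) x) \<longlongrightarrow> (\<Sum>i<2^N. c i * v i)) (at_right 0)"
  by (intro tendsto_intros v)
 have eq: "(\<Sum>i<2^N. c i * PV eps (%t. indicator {gp X l N i..<gp X l N (Suc i)} t *\<^sub>R b t) x) = PV eps (%t. stepf X l N c t * b t) x"
  if eps: "eps \<in> {0<..<1}" for eps
 proof -
  let ?k = "%i t. indicator {t. eps < norm (z t - z x)} t *\<^sub>R ((indicator {gp X l N i..<gp X l N (Suc i)} t *\<^sub>R b t) / (z t - z x))"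
  have ib: "integrable lborel (%t. indicator {p..<q} t *\<^sub>R b t)" for p q
  proof -
   have "set_integrable lborel {p..q} (%t. 1 * b t)" by (intro set_integrable_mult_b continuous_intros)
   hence "set_integrable lborel {p..<q} (%t. 1 * b t)" by (rule set_integrable_subset) auto
   thus ?thesis unfolding set_integrable_def by simp
  qed
  have ik: "integrable lborel (?k i)" for i by (rule PV_integrable[OF ib]) (use eps in auto)
  have "indicator {t. eps < norm (z t - z x)} t *\<^sub>R ((stepf X l N c t * b t) / (z t - z x)) = (\<Sum>i<2^N. c i * ?k i t)" for t
   unfolding stepf_def sum_distrib_right sum_divide_distrib scaleR_sum_right
   by (intro sum.cong refl) (simp add: scaleR_conv_of_real)
  hence "PV eps (%t. stepf X l N c t * b t) x = (LBINT t. (\<Sum>i<2^N. c i * ?k i t))" unfolding PV_def by simp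
  also have "... = (\<Sum>i<2^N. (LBINT t. c i * ?k i t))"
   by (rule lint_sum) (intro integrable_mult_right ik)
  also have "... = (\<Sum>i<2^N. c i * PV eps (%t. indicator {gp X l N i..<gp X l N (Suc i)} t *\<^sub>R b t) x)"
   unfolding PV_def by (intro sum.cong refl) (rule integral_mult_right_zero)
  finally show ?thesis by simp
 qed
 show ?thesis
  by (intro exI, rule Lim_transform_eventually[OF lim], rule eventually_at_rightI[OF eq zero_less_one])
qed

text \<open>Write \<open>f = g + h\<close> with \<open>g\<close> a step function times \<open>b\<close> and \<open>h\<close> small in \<open>L\<^sup>2\<close>. The truncated integrals of \<open>g\<close> converge, and those of \<open>h\<close> are
uniformly small off a set of small measure by \<open>PV_maximal\<close>. So the truncated integrals of \<open>f\<close> have the Cauchy property almost everywhere.\<close>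
theorem PV_exists_ae:
 assumes f: "L2R f" and R: "R > 0" and fs: "!!t. t \<notin> {-R..<R} ==> f t = 0"
 shows "AE x in lborel. (\<exists>A1. (A has_real_derivative A1) (at x)) --> (\<exists>v. ((%eps. PV eps f x) \<longlongrightarrow> v) (at_right 0))"
proof -
 have fi: "integrable lborel f" using L1_of_L2(1)[OF f, of "-R" "2 * R" 1] fs R by auto
 obtain C where C: "C > 0" and Cb: "!!R f lam. R > 0 ==> lam > 0 ==> L2R f ==> \<forall>t. t \<notin> {-R..<R} --> f t = 0 ==>
   \<exists>U\<in>sets borel. emeasure lborel U <= ennreal (C * sq f / lam^2) \<and> (\<forall>x. x \<notin> U --> (\<forall>eps>0. norm (PV eps f x) <= lam))"
  using PV_maximal by blast
 let ?P = "%k x. (\<exists>A1. (A has_real_derivative A1) (at x)) -->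
  (\<exists>d>0. \<forall>eps eps'. 0 < eps --> eps < d --> 0 < eps' --> eps' < d --> norm (PV eps f x - PV eps' f x) <= 1 / real (Suc k))"
 have step: "AE x in lborel. ?P k x" for k :: nat
 proof -
  \<comment> \<open>two errors of size \<open>2 lam\<close> make up the Cauchy bound \<open>1 / (k + 1)\<close>\<close>
  define lam where "lam = 1 / (4 * real (Suc k))"
  have lam: "lam > 0" "4 * lam = 1 / real (Suc k)" unfolding lam_def by (auto simp: field_simps)
  have bi: "(%t. 1 / b t) \<in> borel_measurable borel" "!!t. norm (1 / b t) <= 1"
   using b_lower by (auto simp: norm_divide divide_le_eq)
  have bb: "(%t. b t) \<in> borel_measurable borel" "!!t. norm (b t) <= 1 + L" using b_upper by auto
  have l: "2 * R > 0" using R by simp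
  have ex: "\<exists>V\<in>sets borel. emeasure lborel V <= ennreal (C * (1 + L)^2 / lam^2 * inverse (real (Suc n))) \<and> (\<forall>x. x \<notin> V --> ?P k x)" for n :: nat
  proof -
   obtain N c where Nc: "sq (%t. 1 / b t * f t - stepf (-R) (2*R) N c t) <= inverse (real (Suc n))"
    using step_dense[OF L2R_mult_bounded(1)[OF f bi], of "-R" "2*R" "inverse (real (Suc n))"] fs l by auto
   let ?g = "%t. stepf (-R) (2*R) N c t * b t"
   let ?h = "%t. f t - ?g t"
   have sL: "L2R (stepf (-R) (2*R) N c)" by (rule stepf_L2R[OF l])
   have gL: "L2R ?g" using L2R_mult_bounded(1)[OF sL bb] by (simp add: mult.commute)
   have gs: "?g t = 0" if "t \<notin> {-R..<R}" for t using stepf_outside[OF l, of t "-R"] that by simp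
   have gi: "integrable lborel ?g" using L1_of_L2(1)[OF gL, of "-R" "2 * R" 1] gs R by auto
   have hL: "L2R ?h" by (rule L2R_diff[OF f gL])
   have hsq: "sq ?h <= (1 + L)^2 * inverse (real (Suc n))"
   proof -
    have "sq ?h = sq (%t. b t * (1 / b t * f t - stepf (-R) (2*R) N c t))"
    using b_nz by (simp add: right_diff_distrib mult.commute)
    also have "... <= (1 + L)^2 * sq (%t. 1 / b t * f t - stepf (-R) (2*R) N c t)"
    by (rule L2R_mult_bounded(2)[OF L2R_diff[OF L2R_mult_bounded(1)[OF f bi] sL] bb])
    also have "... <= (1 + L)^2 * inverse (real (Suc n))" using Nc by (intro mult_left_mono) auto
    finally show ?thesis .
   qed
   obtain U where U: "U \<in> sets borel" "emeasure lborel U <= ennreal (C * sq ?h / lam^2)" "!!x eps. x \<notin> U ==> eps > 0 ==> norm (PV eps ?h x) <= lam"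
    using Cb[OF R lam(1) hL] fs gs by auto
   \<comment> \<open>at the end points of the steps the truncated integrals may diverge\<close>
   let ?D = "range (gp (-R) (2*R) N)"
   have Dn: "?D \<in> null_sets lborel" by (rule countable_imp_null_set_lborel) auto
   show ?thesis
   proof (intro bexI[of _ "U \<union> ?D"] conjI allI impI)
    show "U \<union> ?D \<in> sets borel" using U Dn by auto
    have "emeasure lborel (U \<union> ?D) <= emeasure lborel U + emeasure lborel ?D"
    by (rule emeasure_subadditive) (use U Dn in auto)
    also have "... = emeasure lborel U" using Dn by (simp add: null_sets_def)
    also have "... <= ennreal (C * sq ?h / lam^2)" by (rule U)
    also have "... <= ennreal (C * (1 + L)^2 / lam^2 * inverse (real (Suc n)))"
    proof (rule ennreal_leI)
    have "C * sq ?h / lam^2 <= C * ((1 + L)^2 * inverse (real (Suc n))) / lam^2"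
    using hsq C by (intro divide_right_mono mult_left_mono) auto
    thus "C * sq ?h / lam^2 <= C * (1 + L)^2 / lam^2 * inverse (real (Suc n))" by (simp add: mult.assoc)
    qed
    finally show "emeasure lborel (U \<union> ?D) <= ennreal (C * (1 + L)^2 / lam^2 * inverse (real (Suc n)))" .
    fix x assume x: "x \<notin> U \<union> ?D" and "\<exists>A1. (A has_real_derivative A1) (at x)"
    then obtain A1 where A1: "(A has_real_derivative A1) (at x)" by blast
    obtain v where v: "((%eps. PV eps ?g x) \<longlongrightarrow> v) (at_right 0)"
    using PV_stepf[OF l A1, of "-R" N c] x by auto
    have "\<forall>\<^sub>F eps in at_right 0. dist (PV eps ?g x) v < lam" using tendstoD[OF v lam(1)] .
    then obtain d where d: "d > 0" "!!eps. 0 < eps ==> eps < d ==> norm (PV eps ?g x - v) < lam"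
    unfolding eventually_at_right_field dist_norm by auto
    show "\<exists>d>0. \<forall>eps eps'. 0 < eps --> eps < d --> 0 < eps' --> eps' < d --> norm (PV eps f x - PV eps' f x) <= 1 / real (Suc k)"
    proof (intro exI[of _ d] conjI d(1) allI impI)
    fix eps eps' assume eps: "0 < eps" "eps < d" "0 < eps'" "eps' < d"
    have dec: "norm (PV s f x - v) <= 2 * lam" if "0 < s" "s < d" for s
    proof -
    have "PV s f x - v = PV s ?h x + (PV s ?g x - v)" using PV_diff[OF fi gi that(1), of x] by simp
    hence "norm (PV s f x - v) <= norm (PV s ?h x) + norm (PV s ?g x - v)" by (simp only: norm_triangle_ineq)
    thus ?thesis using U(3)[of x s] x that d(2)[OF that] by auto
    qed
    have "norm (PV eps f x - PV eps' f x) <= norm (PV eps f x - v) + norm (PV eps' f x - v)"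
    using norm_triangle_ineq4[of "PV eps f x - v" "PV eps' f x - v"] by simp
    also have "... <= 4 * lam" using dec[OF eps(1,2)] dec[OF eps(3,4)] by simp
    finally show "norm (PV eps f x - PV eps' f x) <= 1 / real (Suc k)" using lam by simp
    qed
   qed
  qed
  hence "\<forall>n. \<exists>V. V \<in> sets borel \<and> emeasure lborel V <= ennreal (C * (1 + L)^2 / lam^2 * inverse (real (Suc n))) \<and> (\<forall>x. x \<notin> V --> ?P k x)"
   by blast
  from choice[OF this] obtain V where V: "!!n. V n \<in> sets borel" "!!n. emeasure lborel (V n) <= ennreal (C * (1 + L)^2 / lam^2 * inverse (real (Suc n)))" "!!n x. x \<notin> V n ==> ?P k x"
   by blast
  have "emeasure lborel (\<Inter>n. V n) <= 0"
  proof (rule LIMSEQ_le_const)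
   have "(%n. ennreal (C * (1 + L)^2 / lam^2 * inverse (real (Suc n)))) \<longlonglongrightarrow> ennreal (C * (1 + L)^2 / lam^2 * 0)"
    by (intro tendsto_ennrealI tendsto_intros LIMSEQ_inverse_real_of_nat)
   thus "(%n. ennreal (C * (1 + L)^2 / lam^2 * inverse (real (Suc n)))) \<longlonglongrightarrow> 0" by simp
   show "\<exists>N. \<forall>n\<ge>N. emeasure lborel (\<Inter>n. V n) <= ennreal (C * (1 + L)^2 / lam^2 * inverse (real (Suc n)))"
   proof (intro exI[of _ 0] allI impI)
    fix n
    have "emeasure lborel (\<Inter>n. V n) <= emeasure lborel (V n)" by (rule emeasure_mono) (use V(1) in auto)
    thus "emeasure lborel (\<Inter>n. V n) <= ennreal (C * (1 + L)^2 / lam^2 * inverse (real (Suc n)))" using V(2)[of n] by (rule order_trans)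
   qed
  qed
  hence "(\<Inter>n. V n) \<in> null_sets lborel" using V(1) by (auto simp: null_sets_def)
  hence "AE x in lborel. x \<notin> (\<Inter>n. V n)" by (rule AE_not_in)
  thus ?thesis by eventually_elim (use V(3) in blast)
 qed
 have "AE x in lborel. \<forall>k. ?P k x" using step by (subst AE_all_countable) blast
 thus ?thesis
 proof eventually_elim
  case (elim x)
  show ?case
  proof
   assume A1: "\<exists>A1. (A has_real_derivative A1) (at x)"
   show "\<exists>v. ((%eps. PV eps f x) \<longlongrightarrow> v) (at_right 0)"
    by (rule tendsto_at_right_of_cauchy) (use elim A1 in blast)
  qed
 qed
qed

end

section \<open>Measures dominated by length\<close>

text \<open>Cover the set by nonoverlapping closed intervals of almost the same total length.\<close>
lemma emeasure_le_of_intervals_bounded: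
 fixes M :: "real measure"
 assumes sM: "sets M = sets borel" and C: "C >= 0"
  and I: "!!s t. s <= t ==> emeasure M {s..t} <= ennreal (C * (t - s))"
  and E: "E \<in> sets borel" "E \<subseteq> {u..v}"
 shows "emeasure M E <= ennreal (C * measure lebesgue E)"
proof (rule ennreal_le_epsilon)
 fix e :: real assume e: "e > 0"
 have El: "E \<in> lmeasurable"
  by (rule bounded_set_imp_lmeasurable) (use E in "auto intro: bounded_subset[OF bounded_closed_interval]")
 define e' where "e' = e / (C + 1)"
 have e': "e' > 0" "C * e' <= e" unfolding e'_def using e C by (auto simp: field_simps)
 obtain D where D: "countable D" "!!K. K \<in> D ==> K \<subseteq> cbox u v \<and> K ~= {} \<and> (\<exists>c d. K = cbox c d)"
   "pairwise (%A B. interior A \<inter> interior B = {}) D" "E \<subseteq> \<Union>D" "\<Union>D \<in> lmeasurable"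
   "measure lebesgue (\<Union>D) <= measure lebesgue E + e'"
  using measurable_outer_intervals_bounded[OF El _ e'(1), of u v] E by (metis cbox_interval)
 have KM: "K \<in> sets M" if "K \<in> D" for K using D(2)[OF that] sM by auto
 have KL: "K \<in> lmeasurable" if "K \<in> D" for K using D(2)[OF that] by auto
 have KI: "emeasure M K <= ennreal (C * measure lebesgue K)" if KD: "K \<in> D" for K
 proof -
  obtain c d where K: "K = {c..d}" "K ~= {}" using D(2)[OF KD] by (auto simp: cbox_interval)
  hence "c <= d" by auto
  thus ?thesis using I[of c d] K by simp
 qed
 have fin: "emeasure M (\<Union>F) <= ennreal (C * (measure lebesgue E + e'))" if F: "finite F" "F \<subseteq> D" for F
 proof -
  have neg: "pairwise (%S T. negligible (S \<inter> T)) F"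
  proof (rule pairwiseI)
   fix S T assume ST: "S \<in> F" "T \<in> F" "S ~= T"
   hence "interior S \<inter> interior T = {}" using D(3) F(2) unfolding pairwise_def by blast
   moreover obtain a b where "S = cbox a b" using D(2) ST F(2) by blast
   moreover obtain c d where "T = cbox c d" using D(2) ST F(2) by blast
   ultimately have "S \<inter> T \<subseteq> {a,b,c,d}" by (auto simp: box_real cbox_interval interior_atLeastAtMost_real)
   thus "negligible (S \<inter> T)" by (rule negligible_subset[rotated]) (rule negligible_finite, simp)
  qed
  have "emeasure M (\<Union>F) <= (\<Sum>K\<in>F. emeasure M K)"
   using emeasure_subadditive_finite[of F "%K. K" M] F KM by auto
  also have "... <= (\<Sum>K\<in>F. ennreal (C * measure lebesgue K))" by (rule sum_mono) (use KI F in auto)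
  also have "... = ennreal (C * measure lebesgue (\<Union>F))"
   by (subst measure_negligible_finite_Union[OF F(1) _ neg]) (use F KL C in "auto simp: sum_distrib_left sum_ennreal")
  also have "... <= ennreal (C * (measure lebesgue E + e'))"
  proof (intro ennreal_leI mult_left_mono C order_trans[OF _ D(6)])
   show "measure lebesgue (\<Union>F) <= measure lebesgue (\<Union>D)"
    by (rule measure_mono_fmeasurable[OF _ _ D(5)]) (use F KL in "auto intro!: sets.finite_Union")
  qed
  finally show ?thesis .
 qed
 have "emeasure M E <= emeasure M (\<Union>D)"
  by (rule emeasure_mono[OF D(4)]) (use D(1) KM in "auto intro!: sets.countable_Union")
 also have "... <= ennreal (C * (measure lebesgue E + e'))"
 proof (cases "D = {}")
  case False
  let ?K = "from_nat_into D"
  have KD: "?K i \<in> D" for i by (rule from_nat_into[OF False])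
  have U: "\<Union>D = (\<Union>n. \<Union>i<n. ?K i)"
  proof -
   have "\<Union>D = (\<Union>i. ?K i)" using range_from_nat_into[OF False D(1)] by simp
   also have "... = (\<Union>n. \<Union>i<n. ?K i)" by (auto intro: lessI)
   finally show ?thesis .
  qed
  have lim: "(%n. emeasure M (\<Union>i<n. ?K i)) \<longlonglongrightarrow> emeasure M (\<Union>n. \<Union>i<n. ?K i)"
   by (rule Lim_emeasure_incseq) (use KD KM in "auto simp: incseq_def intro: order.strict_trans2")
  show ?thesis unfolding U
  proof (rule LIMSEQ_le_const2[OF lim], intro exI allI impI)
   fix n show "emeasure M (\<Union>i<n. ?K i) <= ennreal (C * (measure lebesgue E + e'))"
    by (rule fin) (use KD in auto)
  qed
 qed simp
 also have "... <= ennreal (C * measure lebesgue E + e)"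
  using e'(2) by (intro ennreal_leI) (simp add: algebra_simps)
 also have "... = ennreal (C * measure lebesgue E) + ennreal e"
  using C e by (intro ennreal_plus) auto
 finally show "emeasure M E <= ennreal (C * measure lebesgue E) + ennreal e" .
qed

text \<open>The bound on intervals extends to bounded Borel sets, which gives absolute continuity; where the Radon-Nikodym density exceeded
\<open>C\<close>, the same bound would be violated.\<close>
theorem bounded_density:
 fixes M :: "real measure"
 assumes sM: "sets M = sets borel" and C: "C >= 0"
  and I: "!!s t. s <= t ==> emeasure M {s..t} <= ennreal (C * (t - s))"
 shows "\<exists>rho\<in>borel_measurable borel. (\<forall>x. 0 <= rho x \<and> rho x <= C) \<and> M = density lborel (%x. ennreal (rho x))"
proof -
 have bd: "emeasure M E <= ennreal (C * measure lebesgue E)" if E: "E \<in> sets borel" "E \<subseteq> {u..v}" for E u v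
  by (rule emeasure_le_of_intervals_bounded[OF sM C _ E]) (rule I)
 have "absolutely_continuous lborel M"
  unfolding absolutely_continuous_def
 proof
  fix E :: "real set" assume "E \<in> null_sets lborel"
  hence E: "E \<in> sets borel" "emeasure lborel E = 0" by auto
  have "emeasure M (E \<inter> {- real n..real n}) = 0" for n
  proof -
   have "measure lebesgue (E \<inter> {- real n..real n}) = measure lborel (E \<inter> {- real n..real n})"
    using E by (intro measure_completion) auto
   also have "... = 0"
    using emeasure_mono[of "E \<inter> {- real n..real n}" E lborel] E unfolding measure_def by simp
   finally show ?thesis using bd[of "E \<inter> {- real n..real n}" "- real n" "real n"] E by simp
  qed
  hence "(\<Union>n. E \<inter> {- real n..real n}) \<in> null_sets M"
   using E sM by (intro null_sets_UN) auto
  moreover have "(\<Union>n. E \<inter> {- real n..real n}) = E"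
  proof -
   have "\<exists>n. x \<in> {- real n..real n}" for x :: real
    using real_arch_simple[of "\<bar>x\<bar>"] by (auto simp: abs_le_iff minus_le_iff)
   thus ?thesis by blast
  qed
  ultimately show "E \<in> null_sets M" by simp
 qed
 then obtain g where g: "g \<in> borel_measurable lborel" "density lborel g = M"
  using sigma_finite_measure.Radon_Nikodym[OF sigma_finite_lborel, of M] sM by auto
 have g' [measurable]: "g \<in> borel_measurable borel" using g by simp
 have le: "AE x in lborel. x \<in> {- real n..real n} --> g x <= ennreal C" for n
 proof (rule ccontr)
  let ?E = "{x. g x > ennreal C} \<inter> {- real n..real n}"
  have E: "?E \<in> sets borel" by measurable
  assume neg: "\<not> (AE x in lborel. x \<in> {- real n..real n} --> g x <= ennreal C)"
  have El: "emeasure lborel ?E = ennreal (measure lebesgue ?E)"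
  proof -
   have "emeasure lborel ?E <= emeasure lborel {- real n..real n}" by (rule emeasure_mono) auto
   also have "... < \<infinity>" by simp
   finally have "emeasure lborel ?E = ennreal (measure lborel ?E)" by (intro emeasure_eq_ennreal_measure) auto
   also have "measure lborel ?E = measure lebesgue ?E" using E by (intro measure_completion[symmetric]) simp
   finally show ?thesis .
  qed
  have i1: "(\<integral>\<^sup>+x. ennreal C * indicator ?E x \<partial>lborel) = ennreal (C * measure lebesgue ?E)"
   using E El C by (subst nn_integral_cmult_indicator) (auto simp: ennreal_mult)
  have "(\<integral>\<^sup>+x. ennreal C * indicator ?E x \<partial>lborel) < (\<integral>\<^sup>+x. g x * indicator ?E x \<partial>lborel)"
  proof (rule nn_integral_less)
   show "(%x. ennreal C * indicator ?E x) \<in> borel_measurable lborel" by measurable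
   show "(%x. g x * indicator ?E x) \<in> borel_measurable lborel" by measurable
   show "(\<integral>\<^sup>+x. ennreal C * indicator ?E x \<partial>lborel) ~= \<infinity>" unfolding i1 by simp
   show "AE x in lborel. ennreal C * indicator ?E x <= g x * indicator ?E x"
    by (auto simp: indicator_def)
   show "\<not> (AE x in lborel. g x * indicator ?E x <= ennreal C * indicator ?E x)"
   proof
    assume "AE x in lborel. g x * indicator ?E x <= ennreal C * indicator ?E x"
    hence "AE x in lborel. x \<in> {- real n..real n} --> g x <= ennreal C"
    by (rule AE_mp) (rule AE_I2, auto simp: indicator_def not_le split: if_splits)
    with neg show False ..
   qed
  qed
  also have "... = emeasure M ?E" unfolding g(2)[symmetric] using E by (subst emeasure_density) auto
  also have "... <= ennreal (C * measure lebesgue ?E)" by (rule bd[OF E, of "- real n" "real n"]) auto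
  finally show False unfolding i1 by simp
 qed
 have "AE x in lborel. \<forall>n. x \<in> {- real n..real n} --> g x <= ennreal C"
  unfolding AE_all_countable using le by blast
 hence ae: "AE x in lborel. g x = ennreal (enn2real (min (g x) (ennreal C)))"
 proof (rule AE_mp, intro AE_I2 impI)
  fix x assume *: "\<forall>n. x \<in> {- real n..real n} --> g x <= ennreal C"
  obtain n where "\<bar>x\<bar> <= real n" using real_arch_simple by blast
  hence "x \<in> {- real n..real n}" by auto
  hence "g x <= ennreal C" using * by blast
  thus "g x = ennreal (enn2real (min (g x) (ennreal C)))"
   by (metis ennreal_enn2real ennreal_less_top le_less_trans min.absorb1)
 qed
 let ?\<rho> = "%x. enn2real (min (g x) (ennreal C))"
 have m: "?\<rho> \<in> borel_measurable borel" by measurable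
 have b: "0 <= ?\<rho> x \<and> ?\<rho> x <= C" for x
  using enn2real_mono[of "min (g x) (ennreal C)" "ennreal C"] C by auto
 have "M = density lborel (%x. ennreal (?\<rho> x))"
  unfolding g(2)[symmetric] by (rule density_cong) (use g m ae in auto)
 thus ?thesis using m b by (intro bexI[of _ ?\<rho>]) auto
qed

text \<open>The function \<open>A x + L x\<close> is nondecreasing and has slopes at most \<open>2 L\<close>, so its Stieltjes measure has a density with values
in \<open>[0, 2 L]\<close>.\<close>
corollary lipschitz_derivative_density:
 assumes lip: "!!s t :: real. \<bar>A s - A t\<bar> <= L * \<bar>s - t\<bar>"
 shows "\<exists>a. lip_graph_deriv A L a"
proof -
 interpret lip_graph A L by standard (rule lip)
 let ?G = "%x. A x + L * x"
 have mono: "?G x <= ?G y" if "x <= y" for x y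
 proof -
  have "A x - A y <= L * (y - x)" using lip[of x y] that by auto
  thus ?thesis by (simp add: algebra_simps)
 qed
 have cA: "continuous_on UNIV A"
 proof (rule continuous_on_iff[THEN iffD2], intro ballI allI impI)
  fix x e :: real assume e: "e > 0"
  show "\<exists>d>0. \<forall>x'\<in>UNIV. dist x' x < d --> dist (A x') (A x) < e"
  proof (intro exI[of _ "e / (L + 1)"] conjI ballI impI)
   show "e / (L + 1) > 0" using e L_nonneg by simp
   fix y assume "dist y x < e / (L + 1)"
   hence "\<bar>y - x\<bar> * (L + 1) < e" using L_nonneg by (simp add: dist_real_def pos_less_divide_eq)
   hence "L * \<bar>y - x\<bar> < e" using mult_right_mono[of L "L + 1" "\<bar>y - x\<bar>"] unfolding mult.commute[of _ "L + 1"] by auto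
   thus "dist (A y) (A x) < e" using lip[of y x] by (simp add: dist_real_def)
  qed
 qed
 have cG: "continuous_on UNIV ?G" by (intro continuous_intros cA)
 have Icc: "emeasure (interval_measure ?G) {s..t} = ennreal (?G t - ?G s)" if "s <= t" for s t
  using emeasure_interval_measure_Icc[OF that mono cG] .
 have GC: "?G t - ?G s <= 2 * L * (t - s)" if "s <= t" for s t
  using lip[of t s] that by (simp add: algebra_simps)
 have "\<exists>rho\<in>borel_measurable borel. (\<forall>x. 0 <= rho x \<and> rho x <= 2 * L) \<and> interval_measure ?G = density lborel (%x. ennreal (rho x))"
 proof (rule bounded_density)
  show "emeasure (interval_measure ?G) {s..t} <= ennreal (2 * L * (t - s))" if "s <= t" for s t
   unfolding Icc[OF that] using GC[OF that] by (rule ennreal_leI)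
 qed (use L_nonneg in auto)
 then obtain rho where rho: "rho \<in> borel_measurable borel" "!!x. 0 <= rho x" "!!x. rho x <= 2 * L"
   "interval_measure ?G = density lborel (%x. ennreal (rho x))" by blast
 have "lip_graph_deriv A L (%x. rho x - L)"
 proof (unfold_locales)
  show "(%x. rho x - L) \<in> borel_measurable borel" using rho(1) by measurable
  show "\<bar>rho t - L\<bar> <= L" for t using rho(2,3)[of t] by (simp add: abs_le_iff)
  fix s t :: real assume st: "s <= t"
  have nn: "(\<integral>\<^sup>+x. ennreal (rho x * indicator {s..t} x) \<partial>lborel) = ennreal (?G t - ?G s)"
  proof -
   have "(\<integral>\<^sup>+x. ennreal (rho x * indicator {s..t} x) \<partial>lborel) = (\<integral>\<^sup>+x. ennreal (rho x) * indicator {s..t} x \<partial>lborel)"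
    by (rule nn_integral_cong) (auto simp: indicator_def)
   also have "... = emeasure (interval_measure ?G) {s..t}"
    unfolding rho(4) using rho(1) by (subst emeasure_density) auto
   finally show ?thesis using Icc[OF st] by simp
  qed
  have i: "integrable lborel (%x. rho x * indicator {s..t} x)"
   by (rule integrableI_nonneg) (use rho nn in auto)
  have v: "(LBINT x. rho x * indicator {s..t} x) = ?G t - ?G s"
   by (rule integral_eq_nn_integral[THEN trans]) (use rho nn mono[OF st] in auto)
  have iL: "integrable lborel (%x. L * indicator {s..t} x)"
   by (intro integrable_mult_right integrable_real_indicator) (auto simp: emeasure_lborel_Icc_eq)
  have "(LBINT x:{s..t}. rho x - L) = (LBINT x. rho x * indicator {s..t} x - L * indicator {s..t} x)"
   unfolding set_lebesgue_integral_def by (rule lint_cong) (auto simp: algebra_simps)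
  also have "... = (?G t - ?G s) - L * (t - s)"
   unfolding lint_diff[OF i iL] v using st by simp
  also have "... = A t - A s" by (simp add: algebra_simps)
  finally show "(LBINT x:{s..t}. rho x - L) = A t - A s" .
 qed
 thus ?thesis by blast
qed

section \<open>Boundary charts\<close>

lemma space_hausdorff1 [simp]: "space hausdorff1 = UNIV"
 unfolding hausdorff1_def by (simp add: space_measure_of_conv)

lemma sets_hausdorff1 [simp, measurable_cong]: "sets hausdorff1 = sets borel"
 unfolding hausdorff1_def by (simp add: sets_measure_of_conv) (metis sets.sigma_sets_eq space_borel)

lemma emeasure_hausdorff1_eq:
 "emeasure hausdorff1 A =
  (if A \<in> sets borel \<and> measure_space UNIV (sets borel) hausdorff1_outer then hausdorff1_outer A else 0)"
proof -
 have "sigma_sets UNIV (sets (borel :: (real^2) measure)) = sets borel"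
  by (metis sets.sigma_sets_eq space_borel)
 thus ?thesis unfolding hausdorff1_def by (simp add: emeasure_measure_of_conv)
qed

text \<open>Also true in the degenerate case in which the outer measure is not countably additive on the Borel sets, as the
measure is then 0 by definition. Upper bounds for the Hausdorff measure therefore need no case distinction.\<close>
lemma emeasure_hausdorff1_le: "emeasure hausdorff1 A <= hausdorff1_outer A"
 unfolding emeasure_hausdorff1_eq by simp

text \<open>Cut the parameter interval into \<open>n\<close> equal pieces; their images have diameter at most \<open>C (t - s) / n\<close>.\<close>
lemma hausdorff1_outer_lipschitz_arc:
 fixes Z :: "real => real^2"
 assumes Z: "!!s t. norm (Z s - Z t) <= C * \<bar>s - t\<bar>" and C: "C >= 0" and st: "s <= t"
 shows "hausdorff1_outer (Z ` {s..t}) <= ennreal (C * (t - s))"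
 unfolding hausdorff1_outer_def
proof (rule SUP_least)
 fix delta :: real assume "delta \<in> {0<..}"
 hence delta: "delta > 0" by simp
 obtain n :: nat where n: "C * (t - s) / delta < real n" "n > 0"
  using reals_Archimedean2[of "max 0 (C * (t - s) / delta)"] by (metis max_less_iff_conj of_nat_0_less_iff)
 define w where "w = (t - s) / real n"
 have w: "w >= 0" "C * w <= delta" "real n * w = t - s"
  unfolding w_def using n st delta by (auto simp: field_simps)
 define U where "U i = (if i < n then Z ` {s + real i * w..s + real (Suc i) * w} else {})" for i
 have nb: "norm (x - y) <= C * w" if xy: "x \<in> U i" "y \<in> U i" for x y i
 proof -
  obtain a b where ab: "x = Z a" "y = Z b" "a \<in> {s + real i * w..s + real (Suc i) * w}" "b \<in> {s + real i * w..s + real (Suc i) * w}"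
   using xy unfolding U_def by (auto split: if_splits)
  have "\<bar>a - b\<bar> <= w" using ab(3,4) by (auto simp: algebra_simps abs_le_iff)
  hence "C * \<bar>a - b\<bar> <= C * w" using C by (rule mult_left_mono)
  thus ?thesis using Z[of a b] ab by simp
 qed
 have dU: "diameter (U i) <= C * w" for i by (rule diameter_le) (use nb C w in auto)
 have bU: "bounded (U i)" for i
 proof (cases "U i = {}")
  case False
  then obtain x0 where "x0 \<in> U i" by blast
  thus ?thesis using nb[of x0 i] unfolding bounded_def dist_norm by blast
 qed simp
 have cover: "Z ` {s..t} \<subseteq> (\<Union>i. U i)"
 proof
  fix y assume "y \<in> Z ` {s..t}"
  then obtain a where a: "y = Z a" "s <= a" "a <= t" by auto
  show "y \<in> (\<Union>i. U i)"
  proof (cases "a = t")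
   case True
   have "U (n - 1) = Z ` {s + real (n - 1) * w..s + real n * w}" unfolding U_def using n by simp
   moreover have "t \<in> {s + real (n - 1) * w..s + real n * w}"
    using w mult_right_mono[of "real (n - 1)" "real n" w] by simp
   ultimately have "y \<in> U (n - 1)" using a True by auto
   thus ?thesis by blast
  next
   case False
   hence at: "a < t" using a by simp
   hence wp: "w > 0" unfolding w_def using n a by simp
   define i where "i = nat \<lfloor>(a - s) / w\<rfloor>"
   have q: "(a - s) / w >= 0" using a wp by simp
   have i1: "real i <= (a - s) / w" "(a - s) / w < real i + 1"
    unfolding i_def using q by (simp_all add: of_nat_nat)
   hence i2: "real i * w <= a - s" "a - s < (real i + 1) * w"
    using wp by (simp_all add: pos_le_divide_eq pos_divide_less_eq)
   have "i < n"
   proof (rule ccontr)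
    assume "\<not> i < n"
    hence "real n * w <= real i * w" using wp by (intro mult_right_mono) auto
    thus False using i2 w at by linarith
   qed
   hence "y \<in> U i" unfolding U_def a using i2 by (auto intro!: imageI simp: algebra_simps)
   thus ?thesis by blast
  qed
 qed
 have "(\<Sum>i. ennreal (diameter (U i))) = (\<Sum>i<n. ennreal (diameter (U i)))"
  by (rule suminf_finite) (auto simp: U_def)
 also have "... <= (\<Sum>i<n. ennreal (C * w))" by (intro sum_mono ennreal_leI dU)
 also have "... = ennreal (real n * (C * w))" using C w by (simp add: ennreal_of_nat_eq_real_of_nat ennreal_mult)
 also have "real n * (C * w) = C * (t - s)" using w(3) by (metis mult.left_commute)
 finally have sm: "(\<Sum>i. ennreal (diameter (U i))) <= ennreal (C * (t - s))" .
 have in_U: "U \<in> {U. Z ` {s..t} \<subseteq> (\<Union>i. U i) \<and> (\<forall>i. bounded (U i) \<and> diameter (U i) <= delta)}"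
  using cover bU order_trans[OF dU w(2)] by blast
 show "(INF U\<in>{U. Z ` {s..t} \<subseteq> (\<Union>i. U i) \<and> (\<forall>i. bounded (U i) \<and> diameter (U i) <= delta)}. \<Sum>i. ennreal (diameter (U i))) <= ennreal (C * (t - s))"
  by (rule INF_lower2[OF in_U]) (rule sm)
qed

lemma orthonormal_pair_expand:
 fixes e f x :: "real^2"
 assumes "norm e = 1" "norm f = 1" "e \<bullet> f = 0"
 shows "x = (x \<bullet> e) *\<^sub>R e + (x \<bullet> f) *\<^sub>R f"
proof -
 have ef: "e ~= f" using assms by (metis norm_eq_1 zero_neq_one)
 have po: "pairwise orthogonal {e, f}" using assms by (auto simp: pairwise_def orthogonal_def inner_commute)
 have nz: "0 \<notin> {e, f}" using assms by auto
 have "independent {e, f}" by (rule pairwise_orthogonal_independent[OF po nz])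
 moreover have "card {e, f} = DIM(real^2)" using ef by simp
 ultimately have sp: "span {e, f} = UNIV" by (metis card_eq_dim dim_UNIV finite.emptyI finite.insertI independent_card_le span_UNIV subset_UNIV top.extremum_unique card_ge_dim_independent)
 have "(\<Sum>v\<in>{e, f}. (v \<bullet> x) *\<^sub>R v) = x"
  using orthonormal_basis_expand[OF po, of x] assms sp by (auto simp: inner_commute)
 thus ?thesis using ef by (simp add: inner_commute)
qed

text \<open>The cylinder of a boundary point, with the radius \<open>r\<close> so small that the graph over \<open>|a| < r\<close> stays inside the
cylinder. The boundary in the cylinder is then the whole graph over this interval (\<open>frontier_nbh_iff\<close>, \<open>Z_in_patch\<close>).\<close>
locale boundary_chart = lip_graph gamma L for gamma :: "real => real" and L :: real +
 fixes B :: "(real^2) set" and p e f :: "real^2" and r h :: real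
 assumes B_open: "open B" and p_frontier: "p \<in> frontier B"
  and norm_e: "norm e = 1" and norm_f: "norm f = 1" and ef: "e \<bullet> f = 0"
  and r_pos: "r > 0" and h_pos: "h > 0" and Lr: "L * r < h"
  and graph: "!!a b. \<bar>a\<bar> < r ==> \<bar>b\<bar> < h ==> p + a *\<^sub>R e + b *\<^sub>R f \<in> B \<longleftrightarrow> b > gamma a"
begin

definition Z :: "real => real^2" where "Z t = p + t *\<^sub>R e + gamma t *\<^sub>R f"
definition nbh :: "(real^2) set" where "nbh = {y. \<bar>(y - p) \<bullet> e\<bar> < r \<and> \<bar>(y - p) \<bullet> f\<bar> < h}"
definition par :: "real^2 => real" where "par y = (y - p) \<bullet> e"

lemma ee: "e \<bullet> e = 1" "f \<bullet> f = 1" "f \<bullet> e = 0"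
 using norm_e norm_f ef by (auto simp: norm_eq_1 inner_commute)

lemma coords: "y = p + ((y - p) \<bullet> e) *\<^sub>R e + ((y - p) \<bullet> f) *\<^sub>R f"
 using orthonormal_pair_expand[OF norm_e norm_f ef, of "y - p"] by (simp add: algebra_simps)

lemma nbh_open: "open nbh"
 unfolding nbh_def by (intro open_Collect_conj open_Collect_less continuous_intros)

lemma p_nbh: "p \<in> nbh" unfolding nbh_def using r_pos h_pos by simp

lemma par_Z [simp]: "par (Z t) = t" unfolding par_def Z_def by (simp add: algebra_simps inner_add_left ee)
lemma Z_f: "(Z t - p) \<bullet> f = gamma t" unfolding Z_def by (simp add: algebra_simps inner_add_left ee ef)

lemma inner_frame: "(a *\<^sub>R e + b *\<^sub>R f) \<bullet> (a *\<^sub>R e + b *\<^sub>R f) = a^2 + b^2"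
 by (simp add: algebra_simps inner_add_left inner_add_right ee ef power2_eq_square)

lemma Z_diff: "Z x - Z t = (x - t) *\<^sub>R e + (gamma x - gamma t) *\<^sub>R f"
 unfolding Z_def by (simp add: algebra_simps)

lemma norm_Z_diff: "norm (Z x - Z t) = norm (z t - z x)"
proof -
 have "norm (Z x - Z t) = sqrt ((x - t)^2 + (gamma x - gamma t)^2)"
  unfolding norm_eq_sqrt_inner Z_diff inner_frame ..
 also have "... = norm (z t - z x)" unfolding z_def cmod_def by (simp add: power2_commute)
 finally show ?thesis .
qed

lemma Z_lip: "norm (Z s - Z t) <= (1 + L) * \<bar>s - t\<bar>"
proof -
 have "norm (Z s - Z t) <= norm ((s - t) *\<^sub>R e) + norm ((gamma s - gamma t) *\<^sub>R f)"
  unfolding Z_diff by (rule norm_triangle_ineq)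
 also have "... = \<bar>s - t\<bar> + \<bar>gamma s - gamma t\<bar>" using norm_e norm_f by simp
 finally show ?thesis using lip[of s t] by (simp add: algebra_simps)
qed

lemma Z_cont: "continuous_on UNIV Z"
proof -
 have "(1 + L)-lipschitz_on UNIV Z"
  using Z_lip L_nonneg by (intro lipschitz_onI) (auto simp: dist_norm dist_real_def)
 thus ?thesis by (rule lipschitz_on_continuous_on)
qed

lemma Z_meas [measurable]: "Z \<in> borel_measurable borel"
 using Z_cont by (rule borel_measurable_continuous_onI)

lemma par_meas [measurable]: "par \<in> borel_measurable borel"
 unfolding par_def by measurable

lemma nbh_meas [measurable]: "nbh \<in> sets borel" using nbh_open by simp

lemma frontier_meas [measurable]: "frontier B \<in> sets borel" by simp

lemma vertical_tendsto: "((%d. y + d *\<^sub>R f) \<longlongrightarrow> y) (at_right (0::real))"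
proof -
 have "((%d. y + d *\<^sub>R f) \<longlongrightarrow> y + 0 *\<^sub>R f) (at_right (0::real))" by (intro tendsto_intros)
 thus ?thesis by simp
qed

lemma nbh_char:
 assumes "y \<in> nbh"
 shows "y \<in> B \<longleftrightarrow> (y - p) \<bullet> f > gamma ((y - p) \<bullet> e)"
 using graph[of "(y - p) \<bullet> e" "(y - p) \<bullet> f"] assms coords[of y] unfolding nbh_def by auto

lemma below_not_frontier:
 assumes y: "y \<in> nbh" and lt: "(y - p) \<bullet> f < gamma ((y - p) \<bullet> e)"
 shows "y \<notin> closure B"
proof -
 let ?W = "nbh \<inter> {y. (y - p) \<bullet> f < gamma ((y - p) \<bullet> e)}"
 have c\<gamma>: "continuous_on UNIV gamma"
 proof -
  have "L-lipschitz_on UNIV gamma" using lip L_nonneg by (intro lipschitz_onI) (auto simp: dist_real_def)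
  thus ?thesis by (rule lipschitz_on_continuous_on)
 qed
 have "open ?W"
  by (intro open_Int nbh_open open_Collect_less continuous_intros continuous_on_compose2[OF c\<gamma>]) auto
 moreover have "?W \<inter> B = {}" using nbh_char by fastforce
 ultimately have "?W \<inter> closure B = {}" by (simp add: open_Int_closure_eq_empty)
 thus ?thesis using y lt by blast
qed

lemma frontier_nbh_iff:
 assumes y: "y \<in> nbh"
 shows "y \<in> frontier B \<longleftrightarrow> y = Z (par y)"
proof
 assume fr: "y \<in> frontier B"
 hence "y \<notin> B" "y \<in> closure B" using B_open by (auto simp: frontier_def interior_open)
 hence "\<not> (y - p) \<bullet> f > gamma ((y - p) \<bullet> e)" "\<not> (y - p) \<bullet> f < gamma ((y - p) \<bullet> e)"
  using nbh_char[OF y] below_not_frontier[OF y] by blast+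
 hence "(y - p) \<bullet> f = gamma (par y)" unfolding par_def by simp
 thus "y = Z (par y)" unfolding Z_def using coords[of y] by (simp add: par_def)
next
 assume yz: "y = Z (par y)"
 hence yf: "(y - p) \<bullet> f = gamma ((y - p) \<bullet> e)" using Z_f[of "par y"] by (simp add: par_def)
 hence nB: "y \<notin> B" using nbh_char[OF y] by simp
 have "\<forall>\<^sub>F d in at_right 0. y + d *\<^sub>R f \<in> nbh"
  by (rule topological_tendstoD[OF vertical_tendsto nbh_open y])
 moreover have "\<forall>\<^sub>F d in at_right (0::real). d > 0" by (simp add: eventually_at_right_less)
 ultimately have ev: "\<forall>\<^sub>F d in at_right 0. y + d *\<^sub>R f \<in> B"
 proof eventually_elim
  fix d :: real assume d: "y + d *\<^sub>R f \<in> nbh" "d > 0"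
  have "(y + d *\<^sub>R f - p) \<bullet> f = (y - p) \<bullet> f + d" "(y + d *\<^sub>R f - p) \<bullet> e = (y - p) \<bullet> e"
   by (simp_all add: algebra_simps inner_add_left inner_diff_left ee)
  thus "y + d *\<^sub>R f \<in> B" using nbh_char[OF d(1)] yf d(2) by simp
 qed
 have "y \<in> closure B"
 proof (rule Lim_in_closed_set[OF closed_closure _ _ vertical_tendsto])
  show "\<forall>\<^sub>F d in at_right 0. y + d *\<^sub>R f \<in> closure B"
   using ev by (rule eventually_mono) (use closure_subset in auto)
 qed simp
 thus "y \<in> frontier B" using nB B_open by (simp add: frontier_def interior_open)
qed

lemma \<gamma>0: "gamma 0 = 0"
proof -
 have "p = Z (par p)" using frontier_nbh_iff[OF p_nbh] p_frontier by simp
 hence "(p - p) \<bullet> f = gamma (par p)" using Z_f[of "par p"] by simp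
 thus ?thesis by (simp add: par_def)
qed

lemma \<gamma>_small: "\<bar>t\<bar> < r ==> \<bar>gamma t\<bar> < h"
 using lip[of t 0] \<gamma>0 Lr mult_left_mono[of "\<bar>t\<bar>" r L] L_nonneg by auto

lemma Z_in_patch: "Z t \<in> frontier B \<inter> nbh \<longleftrightarrow> \<bar>t\<bar> < r"
proof
 assume "Z t \<in> frontier B \<inter> nbh"
 hence "\<bar>par (Z t)\<bar> < r" unfolding nbh_def par_def by simp
 thus "\<bar>t\<bar> < r" by simp
next
 assume t: "\<bar>t\<bar> < r"
 hence n: "Z t \<in> nbh" unfolding nbh_def using \<gamma>_small[OF t] Z_f[of t] par_Z[of t] by (simp add: par_def)
 thus "Z t \<in> frontier B \<inter> nbh" using frontier_nbh_iff[OF n] by simp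
qed

abbreviation patch :: "(real^2) set" where "patch \<equiv> frontier B \<inter> nbh"

lemma patch_point: "y \<in> patch ==> y = Z (par y) \<and> \<bar>par y\<bar> < r"
 using frontier_nbh_iff[of y] Z_in_patch[of "par y"] by auto

lemma patch_meas [measurable]: "patch \<in> sets borel" by (intro sets.Int) simp_all

lemma Z_arc_measure:
 assumes "s <= t" shows "emeasure hausdorff1 (Z ` {s..t}) <= ennreal ((1 + L) * (t - s))"
 by (rule order_trans[OF emeasure_hausdorff1_le hausdorff1_outer_lipschitz_arc]) (use Z_lip L_nonneg assms in auto)

lemma Z_arc_sets: "Z ` {s..t} \<in> sets borel"
proof -
 have "compact (Z ` {s..t})" by (intro compact_continuous_image continuous_on_subset[OF Z_cont]) auto
 thus ?thesis by (intro borel_closed compact_imp_closed)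
qed

text \<open>Finiteness of the boundary measure, which follows, makes square integrable densities integrable.\<close>
lemma patch_finite: "emeasure hausdorff1 patch < \<infinity>"
proof -
 have "patch \<subseteq> Z ` {-r..r}" using patch_point by force
 hence "emeasure hausdorff1 patch <= emeasure hausdorff1 (Z ` {-r..r})"
  by (rule emeasure_mono) (use Z_arc_sets in auto)
 also have "... <= ennreal ((1 + L) * (r - - r))" by (rule Z_arc_measure) (use r_pos in auto)
 also have "... < \<infinity>" by simp
 finally show ?thesis .
qed

lemma par_restr: "par \<in> measurable (restrict_space hausdorff1 patch) borel"
 by (intro measurable_restrict_space1) (simp add: measurable_cong_sets[OF sets_hausdorff1 refl])

text \<open>The part of the patch over an interval is a Lipschitz arc, so its length is at most \<open>1 + L\<close> times that of the interval.\<close>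
lemma patch_density:
 "\<exists>rho\<in>borel_measurable borel. (\<forall>x. 0 <= rho x \<and> rho x <= 1 + L) \<and>
   distr (restrict_space hausdorff1 patch) borel par = density lborel (%x. ennreal (rho x))"
proof (rule bounded_density)
 show "emeasure (distr (restrict_space hausdorff1 patch) borel par) {s..t} <= ennreal ((1 + L) * (t - s))"
  if "s <= t" for s t
 proof -
  have "emeasure (distr (restrict_space hausdorff1 patch) borel par) {s..t}
    = emeasure (restrict_space hausdorff1 patch) (par -` {s..t} \<inter> patch)"
   using par_restr by (subst emeasure_distr) (auto simp: space_restrict_space)
  also have "... = emeasure hausdorff1 (par -` {s..t} \<inter> patch)"
   by (rule emeasure_restrict_space) auto
  also have "... <= emeasure hausdorff1 (Z ` {s..t})"
  proof (rule emeasure_mono)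
   show "par -` {s..t} \<inter> patch \<subseteq> Z ` {s..t}" using patch_point by fastforce
  qed (use Z_arc_sets in auto)
  also have "... <= ennreal ((1 + L) * (t - s))" by (rule Z_arc_measure[OF that])
  finally show ?thesis .
 qed
qed (use L_nonneg in auto)

text \<open>On the patch \<open>par\<close> is inverse to \<open>Z\<close>, so arc length integrals are integrals with respect to the image measure under \<open>par\<close>.\<close>
lemma patch_integral:
 fixes F :: "real^2 => 'a::{banach, second_countable_topology}"
 assumes rho: "rho \<in> borel_measurable borel" "!!x. 0 <= rho x"
   "distr (restrict_space hausdorff1 patch) borel par = density lborel (%x. ennreal (rho x))"
  and F [measurable]: "F \<in> borel_measurable borel"
 shows "(LINT y|hausdorff1. indicator patch y *\<^sub>R F y) = (LBINT t. rho t *\<^sub>R F (Z t))"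
  and "integrable hausdorff1 (%y. indicator patch y *\<^sub>R F y) \<longleftrightarrow> integrable lborel (%t. rho t *\<^sub>R F (Z t))"
proof -
 have FZ: "(%t. F (Z t)) \<in> borel_measurable borel" by measurable
 let ?R = "restrict_space hausdorff1 patch"
 have s: "patch \<inter> space hausdorff1 \<in> sets hausdorff1" by simp
 have c: "F y = F (Z (par y))" if "y \<in> space ?R" for y
  using that patch_point[of y] by (auto simp: space_restrict_space)
 have "(LINT y|hausdorff1. indicator patch y *\<^sub>R F y) = integral\<^sup>L ?R F"
  by (rule integral_restrict_space[OF s, symmetric])
 also have "... = integral\<^sup>L ?R (%y. F (Z (par y)))" by (rule lint_cong[OF refl c])
 also have "... = integral\<^sup>L (distr ?R borel par) (%t. F (Z t))" by (rule integral_distr[OF par_restr FZ, symmetric])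
 also have "... = (LBINT t. rho t *\<^sub>R F (Z t))"
  unfolding rho(3) by (rule integral_density) (use rho FZ in auto)
 finally show "(LINT y|hausdorff1. indicator patch y *\<^sub>R F y) = (LBINT t. rho t *\<^sub>R F (Z t))" .
 have "integrable hausdorff1 (%y. indicator patch y *\<^sub>R F y) \<longleftrightarrow> integrable ?R F"
  by (rule integrable_restrict_space[OF s, symmetric])
 also have "... \<longleftrightarrow> integrable ?R (%y. F (Z (par y)))" by (rule Bochner_Integration.integrable_cong[OF refl c])
 also have "... \<longleftrightarrow> integrable (distr ?R borel par) (%t. F (Z t))" by (rule integrable_distr_eq[OF par_restr FZ, symmetric])
 also have "... \<longleftrightarrow> integrable lborel (%t. rho t *\<^sub>R F (Z t))"
  unfolding rho(3) by (rule integrable_density) (use rho FZ in auto)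
 finally show "integrable hausdorff1 (%y. indicator patch y *\<^sub>R F y) \<longleftrightarrow> integrable lborel (%t. rho t *\<^sub>R F (Z t))" .
qed

text \<open>Near \<open>x\<close> the boundary stays in every double cone around the line orthogonal to \<open>n\<close>, since its points are limits both of
points of \<open>B\<close> and of points outside. A vertical line is excluded by the Lipschitz condition, so the line is the tangent of the graph.\<close>
lemma normal_differentiable:
 assumes x: "x \<in> patch" and n: "is_outward_normal B x n"
 shows "\<exists>D. (gamma has_real_derivative D) (at (par x))"
proof -
 let ?t = "par x"
 have nx: "norm n = 1" using n unfolding is_outward_normal_def by simp
 have tang: "\<exists>delta>0. \<forall>y\<in>frontier B. norm (y - x) < delta --> \<bar>(y - x) \<bullet> n\<bar> <= eps * norm (y - x)" if eps: "eps > 0" for eps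
 proof -
  obtain delta where delta: "delta > 0" "!!y. norm (y - x) < delta ==>
    ((y - x) \<bullet> n < - eps * norm (y - x) --> y \<in> B) \<and> ((y - x) \<bullet> n > eps * norm (y - x) --> y \<notin> B)"
   using n eps unfolding is_outward_normal_def by blast
  have "\<bar>(y - x) \<bullet> n\<bar> <= eps * norm (y - x)" if y: "y \<in> frontier B" "norm (y - x) < delta" for y
  proof -
   have nB: "y \<notin> B" "y \<in> closure B" using y B_open by (auto simp: frontier_def interior_open)
   have l: "\<not> (y - x) \<bullet> n < - eps * norm (y - x)" using delta(2)[OF y(2)] nB by blast
   let ?W = "{w. norm (w - x) < delta} \<inter> {w. eps * norm (w - x) < (w - x) \<bullet> n}"
   have "open ?W" by (intro open_Int open_Collect_less continuous_intros)
   moreover have "?W \<inter> B = {}" using delta(2) by blast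
   ultimately have "?W \<inter> closure B = {}" by (simp add: open_Int_closure_eq_empty)
   hence "\<not> (y - x) \<bullet> n > eps * norm (y - x)" using nB y by blast
   thus ?thesis using l by (simp add: abs_le_iff)
  qed
  thus ?thesis using delta(1) by blast
 qed
 define alpha beta where "alpha = e \<bullet> n" and "beta = f \<bullet> n"
 have xZ: "x = Z ?t" "\<bar>?t\<bar> < r" using patch_point[OF x] by auto
 have C: "1 + L > 0" using L_nonneg by simp
 have tang2: "\<forall>\<^sub>F tau in at 0. \<bar>alpha * tau + beta * (gamma (?t + tau) - gamma ?t)\<bar> <= eps * \<bar>tau\<bar>" if eps: "eps > 0" for eps
 proof -
  have e1: "eps / (1 + L) > 0" using eps C by simp
  obtain delta where delta: "delta > 0" "!!y. y \<in> frontier B ==> norm (y - x) < delta ==> \<bar>(y - x) \<bullet> n\<bar> <= eps / (1 + L) * norm (y - x)"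
   using tang[OF e1] by blast
  have d0: "min (delta / (1 + L)) (r - \<bar>?t\<bar>) > 0" using delta C xZ by simp
  show ?thesis unfolding eventually_at
  proof (intro exI[of _ "min (delta / (1 + L)) (r - \<bar>?t\<bar>)"] conjI ballI impI d0)
   fix tau :: real assume "tau ~= 0 \<and> dist tau 0 < min (delta / (1 + L)) (r - \<bar>?t\<bar>)"
   hence tau: "\<bar>tau\<bar> < delta / (1 + L)" "\<bar>tau\<bar> < r - \<bar>?t\<bar>" by auto
   hence "Z (?t + tau) \<in> frontier B" using Z_in_patch[of "?t + tau"] by auto
   moreover have nb: "norm (Z (?t + tau) - x) <= (1 + L) * \<bar>tau\<bar>" using Z_lip[of "?t + tau" ?t] xZ by simp
   moreover have "(1 + L) * \<bar>tau\<bar> < delta" using tau(1) C by (simp add: pos_less_divide_eq mult.commute)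
   ultimately have "\<bar>(Z (?t + tau) - x) \<bullet> n\<bar> <= eps / (1 + L) * norm (Z (?t + tau) - x)" by (intro delta(2)) auto
   also have "... <= eps / (1 + L) * ((1 + L) * \<bar>tau\<bar>)" using nb e1 by (intro mult_left_mono) auto
   also have "... = eps * \<bar>tau\<bar>" using C by simp
   also have "(Z (?t + tau) - x) \<bullet> n = alpha * tau + beta * (gamma (?t + tau) - gamma ?t)"
    using Z_diff[of "?t + tau" ?t] xZ by (simp add: inner_add_left alpha_def beta_def)
   finally show "\<bar>alpha * tau + beta * (gamma (?t + tau) - gamma ?t)\<bar> <= eps * \<bar>tau\<bar>" .
  qed
 qed
 have beta: "beta ~= 0"
 proof
  assume b0: "beta = 0"
  have "n = alpha *\<^sub>R e" using orthonormal_pair_expand[OF norm_e norm_f ef, of n] b0 by (simp add: alpha_def beta_def inner_commute)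
  hence a1: "\<bar>alpha\<bar> = 1" using nx norm_e by simp
  have "\<forall>\<^sub>F tau::real in at 0. tau = 0"
   using tang2[of "1/2"] b0 a1 by (simp add: abs_mult)
  moreover have "\<forall>\<^sub>F tau::real in at 0. tau ~= 0" by (simp add: eventually_neq_at_within)
  ultimately have "\<forall>\<^sub>F tau::real in at 0. False" by eventually_elim simp
  thus False by simp
 qed
 have "((%tau. (gamma (?t + tau) - gamma ?t) / tau) \<longlongrightarrow> - alpha / beta) (at 0)"
 proof (rule tendstoI)
  fix eps :: real assume eps: "eps > 0"
  have "eps * \<bar>beta\<bar> / 2 > 0" using eps beta by simp
  from tang2[OF this] have "\<forall>\<^sub>F tau in at 0. \<bar>alpha * tau + beta * (gamma (?t + tau) - gamma ?t)\<bar> <= eps * \<bar>beta\<bar> / 2 * \<bar>tau\<bar> \<and> tau ~= 0"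
   by (simp add: eventually_conj_iff eventually_neq_at_within)
  thus "\<forall>\<^sub>F tau in at 0. dist ((gamma (?t + tau) - gamma ?t) / tau) (- alpha / beta) < eps"
  proof (rule eventually_mono)
   fix tau assume tau: "\<bar>alpha * tau + beta * (gamma (?t + tau) - gamma ?t)\<bar> <= eps * \<bar>beta\<bar> / 2 * \<bar>tau\<bar> \<and> tau ~= 0"
   have "(gamma (?t + tau) - gamma ?t) / tau - (- alpha / beta) = (alpha * tau + beta * (gamma (?t + tau) - gamma ?t)) / (beta * tau)"
    using tau beta by (simp add: field_simps)
   hence "\<bar>(gamma (?t + tau) - gamma ?t) / tau - (- alpha / beta)\<bar> = \<bar>alpha * tau + beta * (gamma (?t + tau) - gamma ?t)\<bar> / (\<bar>beta\<bar> * \<bar>tau\<bar>)"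
    by (simp add: abs_mult)
   also have "... <= (eps * \<bar>beta\<bar> / 2 * \<bar>tau\<bar>) / (\<bar>beta\<bar> * \<bar>tau\<bar>)" using tau by (intro divide_right_mono) auto
   also have "... = eps / 2" using tau beta by simp
   finally show "dist ((gamma (?t + tau) - gamma ?t) / tau) (- alpha / beta) < eps" using eps by (simp add: dist_real_def)
  qed
 qed
 thus ?thesis unfolding DERIV_def by blast
qed

end

section \<open>Principal values on a Lipschitz boundary\<close>

lemma chart_exists:
 assumes B: "open B" and lb: "lipschitz_boundary B" and p: "p \<in> frontier B"
 shows "\<exists>gamma L e f r h. boundary_chart gamma L B p e f r h"
proof -
 obtain e f r h L gamma where *: "r > 0" "h > 0" "norm e = 1" "norm f = 1" "e \<bullet> f = 0"
   "L-lipschitz_on (UNIV :: real set) gamma"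
   "!!a b. \<bar>a\<bar> < r ==> \<bar>b\<bar> < h ==> p + a *\<^sub>R e + b *\<^sub>R f \<in> B \<longleftrightarrow> b > (gamma a :: real)"
  using lb p unfolding lipschitz_boundary_def by blast
 have L: "L >= 0" by (rule lipschitz_on_nonneg[OF *(6)])
 \<comment> \<open>keeps the graph inside the cylinder, as it passes through the centre\<close>
 define r' where "r' = min r (h / (L + 1))"
 have r': "r' > 0" "r' <= r" "r' <= h / (L + 1)" unfolding r'_def using * L by auto
 have "r' * (L + 1) <= h" using r'(3) L by (simp add: pos_le_divide_eq)
 hence Lr: "L * r' < h" using r'(1) by (simp add: algebra_simps)
 have "boundary_chart gamma L B p e f r' h"
 proof
  show "\<bar>gamma s - gamma t\<bar> <= L * \<bar>s - t\<bar>" for s t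
   using lipschitz_onD[OF *(6), of s t] by (simp add: dist_real_def)
  show "(p + a *\<^sub>R e + b *\<^sub>R f \<in> B) = (gamma a < b)" if "\<bar>a\<bar> < r'" "\<bar>b\<bar> < h" for a b
   by (rule *(7)) (use that r' in auto)
 qed (use * r' Lr B p in auto)
 thus ?thesis by blast
qed

context boundary_chart begin

text \<open>The components of \<open>(x - y) / |x - y|\<^sup>2\<close> are, up to sign, the real and imaginary parts of the Cauchy kernel. As the density is complex,
the real and imaginary parts of the kernel are separated by applying the principal value also to the conjugate density.\<close>
lemma patch_principal_value:
 fixes phi :: "real^2 => complex"
 assumes phi [measurable]: "phi \<in> borel_measurable borel"
  and \<phi>2: "integrable hausdorff1 (%y. (norm (phi y))^2)"
 shows "AE y in hausdorff1. y \<in> patch --> (\<exists>n. is_outward_normal B y n) -->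
  (\<forall>v. \<exists>l. ((%eps. LINT w|hausdorff1. indicator patch w *\<^sub>R
    (indicator {w. eps < norm (y - w)} w *\<^sub>R (((y - w) \<bullet> v / (norm (y - w))^2) *\<^sub>R phi w))) \<longlongrightarrow> l) (at_right 0))"
proof -
 obtain a where "lip_graph_deriv gamma L a" using lipschitz_derivative_density[of gamma L] lip by blast
 then interpret D: lip_graph_deriv gamma L a .
 obtain rho where rho: "rho \<in> borel_measurable borel" "!!x. 0 <= rho x" "!!x. rho x <= 1 + L"
   "distr (restrict_space hausdorff1 patch) borel par = density lborel (%x. ennreal (rho x))"
  using patch_density by blast
 note [measurable] = rho(1)
 note PI = patch_integral[OF rho(1,2,4)]
 define F where "F t = rho t *\<^sub>R (indicator patch (Z t) *\<^sub>R phi (Z t))" for t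
 define g where "g t = cnj (F t)" for t
 have pZ [measurable]: "(%t. indicator patch (Z t) :: real) \<in> borel_measurable borel"
  by (rule borel_measurable_indicator[OF patch_meas, THEN measurable_compose[OF Z_meas]])
 have \<phi>Z [measurable]: "(%t. phi (Z t)) \<in> borel_measurable borel" by measurable
 have fm [measurable]: "F \<in> borel_measurable borel" unfolding F_def by measurable
 have gm [measurable]: "g \<in> borel_measurable borel" unfolding g_def by (rule measurable_compose[OF fm]) (intro borel_measurable_continuous_onI continuous_intros)
 have f2: "integrable lborel (%t. (norm (F t))^2)"
 proof (rule integrable_dominated)
  have "integrable hausdorff1 (%y. indicator patch y *\<^sub>R (norm (phi y))^2)"
   by (rule integrable_mult_indicator[OF _ \<phi>2]) simp
  hence "integrable lborel (%t. rho t *\<^sub>R (norm (phi (Z t)))^2)"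
   by (subst (asm) PI(2)) measurable
  thus "integrable lborel (%t. (1 + L) * (rho t *\<^sub>R (norm (phi (Z t)))^2))" by (rule integrable_mult_right)
  show "AE t in lborel. norm ((norm (F t))^2) <= norm ((1 + L) * (rho t *\<^sub>R (norm (phi (Z t)))^2))"
  proof (rule AE_I2)
   fix t
   have "rho t * rho t * (norm (phi (Z t)))^2 <= (1 + L) * rho t * (norm (phi (Z t)))^2"
    using rho(2,3)[of t] by (intro mult_right_mono) auto
   thus "norm ((norm (F t))^2) <= norm ((1 + L) * (rho t *\<^sub>R (norm (phi (Z t)))^2))"
    unfolding F_def using rho(2)[of t] L_nonneg
    by (cases "Z t \<in> patch") (auto simp: abs_mult power_mult_distrib power2_eq_square mult_ac)
  qed
 qed measurable
 have L2F: "D.L2R F" and L2g: "D.L2R g" unfolding D.L2R_def using f2 fm gm by (auto simp: g_def)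
 have supp: "F t = 0" "g t = 0" if "t \<notin> {-r..<r}" for t
 proof -
  have "\<not> \<bar>t\<bar> < r" using that r_pos by auto
  hence "Z t \<notin> patch" using Z_in_patch by blast
  hence "indicator patch (Z t) = (0::real)" by (rule indicator_simps(2))
  thus "F t = 0" "g t = 0" unfolding g_def F_def by simp_all
 qed
 have fi: "integrable lborel F" "integrable lborel g"
  using D.L1_of_L2(1)[OF L2F, of "-r" "2 * r" 1] D.L1_of_L2(1)[OF L2g, of "-r" "2 * r" 1] supp r_pos by auto
 have "AE t in lborel. (\<exists>D. (gamma has_real_derivative D) (at t)) -->
   (\<exists>v. ((%eps. D.PV eps F t) \<longlongrightarrow> v) (at_right 0)) \<and> (\<exists>v. ((%eps. D.PV eps g t) \<longlongrightarrow> v) (at_right 0))"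
  (is "AE t in lborel. ?Q t")
 proof -
  have "AE t in lborel. (\<exists>D. (gamma has_real_derivative D) (at t)) --> (\<exists>v. ((%eps. D.PV eps F t) \<longlongrightarrow> v) (at_right 0))"
   by (rule D.PV_exists_ae[OF L2F r_pos]) (rule supp)
  moreover have "AE t in lborel. (\<exists>D. (gamma has_real_derivative D) (at t)) --> (\<exists>v. ((%eps. D.PV eps g t) \<longlongrightarrow> v) (at_right 0))"
   by (rule D.PV_exists_ae[OF L2g r_pos]) (rule supp)
  ultimately show ?thesis by eventually_elim blast
 qed
 hence "AE t in density lborel (%x. ennreal (rho x)). ?Q t"
  by (subst AE_density) auto
 hence "AE t in distr (restrict_space hausdorff1 patch) borel par. ?Q t" unfolding rho(4) .
 hence "AE y in restrict_space hausdorff1 patch. ?Q (par y)" by (rule AE_distrD[OF par_restr])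
 hence "AE y in hausdorff1. y \<in> patch --> ?Q (par y)" by (subst (asm) AE_restrict_space_iff) auto
 thus ?thesis
 proof (rule AE_mp, intro AE_I2 impI allI)
  fix y v assume q: "y \<in> patch --> ?Q (par y)" and y: "y \<in> patch" and n: "\<exists>n. is_outward_normal B y n"
  define x where "x = par y"
  have yZ: "y = Z x" unfolding x_def using patch_point[OF y] by simp
  have "\<exists>D. (gamma has_real_derivative D) (at (par y))" using n normal_differentiable[OF y] by blast
  then obtain v1 v2 where v: "((%eps. D.PV eps F x) \<longlongrightarrow> v1) (at_right 0)" "((%eps. D.PV eps g x) \<longlongrightarrow> v2) (at_right 0)"
   using q y unfolding x_def by blast
  define alpha where "alpha = e \<bullet> v"
  define beta where "beta = (f \<bullet> v)"
  \<comment> \<open>the kernel in direction \<open>v\<close> is twice the real part of \<open>c\<close> times the Cauchy kernel\<close>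
  define c where "c = Complex (- alpha / 2) (- beta / 2)"
  have vdot: "(Z x - Z t) \<bullet> v = alpha * (x - t) + beta * (gamma x - gamma t)" for t
   unfolding Z_diff alpha_def beta_def by (simp add: inner_add_left)
  have kap: "of_real ((Z x - Z t) \<bullet> v / (norm (Z x - Z t))^2) = c / (z t - z x) + cnj (c / (z t - z x))" for t
  proof -
   have "Re (c / (z t - z x)) = ((alpha * (x - t) + beta * (gamma x - gamma t)) / 2) / (norm (z t - z x))^2"
   proof -
    have n: "Re c * (t - x) + Im c * (gamma t - gamma x) = (alpha * (x - t) + beta * (gamma x - gamma t)) / 2"
    unfolding c_def by (simp add: field_simps)
    have "Re (c / (z t - z x)) = (Re c * (t - x) + Im c * (gamma t - gamma x)) / (norm (z t - z x))^2"
    unfolding Re_divide cmod_power2 z_def by simp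
    thus ?thesis unfolding n .
   qed
   moreover have "2 * (u / 2 / w) = u / w" for u w :: real by simp
   ultimately have "2 * Re (c / (z t - z x)) = (Z x - Z t) \<bullet> v / (norm (Z x - Z t))^2"
    unfolding vdot norm_Z_diff by metis
   thus ?thesis by (simp only: complex_add_cnj)
  qed
  let ?J = "%eps w. indicator {w. eps < norm (y - w)} w *\<^sub>R (((y - w) \<bullet> v / (norm (y - w))^2) *\<^sub>R phi w)"
  have eq: "(LINT w|hausdorff1. indicator patch w *\<^sub>R ?J eps w) = c * D.PV eps F x + cnj (c * D.PV eps g x)" if eps: "eps > 0" for eps
  proof -
   have Jm [measurable]: "?J eps \<in> borel_measurable borel" by measurable
   have JPm: "(%w. indicator patch w *\<^sub>R ?J eps w) \<in> borel_measurable borel"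
    by (intro borel_measurable_scaleR borel_measurable_indicator patch_meas Jm)
   have "(LINT w|hausdorff1. indicator patch w *\<^sub>R ?J eps w) = (LINT w|hausdorff1. indicator patch w *\<^sub>R (indicator patch w *\<^sub>R ?J eps w))"
    by (rule lint_cong) (auto simp: indicator_def)
   also have "... = (LBINT t. rho t *\<^sub>R (indicator patch (Z t) *\<^sub>R ?J eps (Z t)))" by (rule PI(1)[OF JPm])
   also have "... = (LBINT t. c * (indicator {t. eps < norm (z t - z x)} t *\<^sub>R (F t / (z t - z x)))
    + cnj (c * (indicator {t. eps < norm (z t - z x)} t *\<^sub>R (g t / (z t - z x)))))"
   proof (rule lint_cong[OF refl])
    fix t
    have I: "indicator {w. eps < norm (y - w)} (Z t) = (indicator {t. eps < norm (z t - z x)} t :: real)"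
    unfolding yZ by (simp add: indicator_def norm_Z_diff)
    have "rho t *\<^sub>R (indicator patch (Z t) *\<^sub>R ?J eps (Z t)) = indicator {t. eps < norm (z t - z x)} t *\<^sub>R (of_real ((Z x - Z t) \<bullet> v / (norm (Z x - Z t))^2) * F t)"
    unfolding I F_def unfolding yZ by (simp add: scaleR_conv_of_real mult_ac)
    also have "... = indicator {t. eps < norm (z t - z x)} t *\<^sub>R (c / (z t - z x) * F t + cnj (c / (z t - z x) * g t))"
    unfolding kap g_def by (simp add: distrib_right)
    finally show "rho t *\<^sub>R (indicator patch (Z t) *\<^sub>R ?J eps (Z t)) = c * (indicator {t. eps < norm (z t - z x)} t *\<^sub>R (F t / (z t - z x)))
    + cnj (c * (indicator {t. eps < norm (z t - z x)} t *\<^sub>R (g t / (z t - z x))))"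
    by (simp add: scaleR_add_right)
   qed
   also have "... = c * D.PV eps F x + cnj (c * D.PV eps g x)"
   proof -
    note i1 = integrable_mult_right[OF D.PV_integrable[OF fi(1) eps, of x], of c]
    note i2 = integrable_mult_right[OF D.PV_integrable[OF fi(2) eps, of x], of c]
    have i2': "integrable lborel (%t. cnj (c * (indicator {t. eps < norm (z t - z x)} t *\<^sub>R (g t / (z t - z x)))))"
    by (rule Bochner_Integration.integrable_cnj[OF i2])
    show ?thesis unfolding lint_add[OF i1 i2'] lint_cnj D.PV_def
    by (simp only: integral_mult_right_zero)
   qed
   finally show ?thesis .
  qed
  have "((%eps. c * D.PV eps F x + cnj (c * D.PV eps g x)) \<longlongrightarrow> c * v1 + cnj (c * v2)) (at_right 0)"
   by (intro tendsto_intros v)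
  hence "((%eps. LINT w|hausdorff1. indicator patch w *\<^sub>R ?J eps w) \<longlongrightarrow> c * v1 + cnj (c * v2)) (at_right 0)"
   by (rule Lim_transform_eventually) (use eventually_at_right_less[of "0::real"] in "rule eventually_mono, simp only: eq")
  thus "\<exists>l. ((%eps. LINT w|hausdorff1. indicator patch w *\<^sub>R ?J eps w) \<longlongrightarrow> l) (at_right 0)" by blast
 qed
qed

end

abbreviation chart_nbh :: "(real^2) set => (real^2) set => bool" where
 "chart_nbh B N \<equiv> \<exists>gamma L p e f r h. boundary_chart gamma L B p e f r h \<and> N = boundary_chart.nbh p e f r h"

lemma frontier_chart_data:
 assumes B: "open B" "bounded B" and lb: "lipschitz_boundary B"
 obtains \<N> where "finite \<N>" "frontier B \<subseteq> \<Union>\<N>" "!!N. N \<in> \<N> ==> chart_nbh B N"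
proof -
 let ?C = "{N. chart_nbh B N}"
 have c1: "compact (frontier B)" using B by (simp add: compact_frontier_bounded)
 have c2: "open N" if N: "N \<in> ?C" for N
 proof -
  obtain gamma L p e f r h where c: "boundary_chart gamma L B p e f r h" "N = boundary_chart.nbh p e f r h" using N by auto
  show ?thesis unfolding c(2) by (rule boundary_chart.nbh_open[OF c(1)])
 qed
 have c3: "frontier B \<subseteq> \<Union>?C"
 proof
  fix p assume "p \<in> frontier B"
  from chart_exists[OF B(1) lb this] obtain gamma L e f r h where c: "boundary_chart gamma L B p e f r h" by blast
  show "p \<in> \<Union>?C" using boundary_chart.p_nbh[OF c] c by blast
 qed
 obtain \<N> where "\<N> \<subseteq> ?C" "finite \<N>" "frontier B \<subseteq> \<Union>\<N>" by (rule compactE[OF c1 c3 c2]) auto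
 thus ?thesis by (intro that[of \<N>]) auto
qed

lemma frontier_finite_measure:
 assumes B: "open B" "bounded B" "lipschitz_boundary B"
 shows "emeasure hausdorff1 (frontier B) < \<infinity>" "finite_measure (boundary_measure B)"
proof -
 obtain \<N> where N: "finite \<N>" "frontier B \<subseteq> \<Union>\<N>" "!!N. N \<in> \<N> ==> chart_nbh B N"
  using frontier_chart_data[OF B] by blast
 have f: "frontier B \<inter> M \<in> sets borel \<and> emeasure hausdorff1 (frontier B \<inter> M) < \<infinity>" if MN: "M \<in> \<N>" for M
 proof -
  obtain gamma L p e f r h where c: "boundary_chart gamma L B p e f r h" "M = boundary_chart.nbh p e f r h" using N(3)[OF MN] by auto
  show ?thesis unfolding c(2) using boundary_chart.patch_finite[OF c(1)] boundary_chart.patch_meas[OF c(1)] by simp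
 qed
 have "emeasure hausdorff1 (frontier B) <= emeasure hausdorff1 (\<Union>M\<in>\<N>. frontier B \<inter> M)"
  proof (rule emeasure_mono)
  show "frontier B \<subseteq> (\<Union>M\<in>\<N>. frontier B \<inter> M)" using N(2) by blast
  show "(\<Union>M\<in>\<N>. frontier B \<inter> M) \<in> sets hausdorff1" by (rule sets.finite_UN[OF N(1)]) (use f in simp)
 qed
 also have "... <= (\<Sum>M\<in>\<N>. emeasure hausdorff1 (frontier B \<inter> M))"
  by (rule emeasure_subadditive_finite) (use N f in auto)
 also have "... < \<infinity>" using N f by simp
 finally show l: "emeasure hausdorff1 (frontier B) < \<infinity>" .
 show "finite_measure (boundary_measure B)"
 proof
  have "emeasure (boundary_measure B) (space (boundary_measure B)) = emeasure hausdorff1 (frontier B)"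
   unfolding boundary_measure_def by (subst emeasure_restrict_space) (auto simp: space_restrict_space)
  thus "emeasure (boundary_measure B) (space (boundary_measure B)) ~= \<infinity>" using l by simp
 qed
qed

lemma L2_integrable:
 fixes phi :: "'a => 'b::{banach, second_countable_topology}"
 assumes "finite_measure M" and phi: "L2 M phi"
 shows "integrable M phi"
proof (rule integrable_dominated)
 interpret finite_measure M by fact
 show "integrable M (%x. 1 + (norm (phi x))^2)"
  using phi unfolding L2_def by (intro Bochner_Integration.integrable_add) auto
 show "phi \<in> borel_measurable M" using phi unfolding L2_def by simp
 show "AE x in M. norm (phi x) <= norm (1 + (norm (phi x))^2)"
 proof (rule AE_I2)
  fix x
  have "0 <= (norm (phi x) - 1)^2 + (norm (phi x))^2 + 1" by (intro add_nonneg_nonneg) auto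
  hence "2 * norm (phi x) <= 2 * (1 + (norm (phi x))^2)" by (simp add: power2_eq_square algebra_simps)
  thus "norm (phi x) <= norm (1 + (norm (phi x))^2)" by simp
 qed
qed

lemma frontier_meas [measurable]: "frontier B \<in> sets borel" by simp

lemma boundary_integral:
 fixes F :: "real^2 => 'b::{banach, second_countable_topology}"
 shows "(LINT w|boundary_measure B. F w) = (LINT w|hausdorff1. indicator (frontier B) w *\<^sub>R F w)"
  and "integrable (boundary_measure B) F \<longleftrightarrow> integrable hausdorff1 (%w. indicator (frontier B) w *\<^sub>R F w)"
 unfolding boundary_measure_def by (auto intro!: integral_restrict_space integrable_restrict_space)

lemma boundary_AE: "(AE x in boundary_measure B. P x) \<longleftrightarrow> (AE x in hausdorff1. x \<in> frontier B --> P x)"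
 unfolding boundary_measure_def by (rule AE_restrict_space_iff) simp

lemma boundary_measurable:
 fixes F :: "real^2 => 'b::real_normed_vector"
 shows "F \<in> borel_measurable (boundary_measure B) \<longleftrightarrow> (%w. indicator (frontier B) w *\<^sub>R F w) \<in> borel_measurable borel"
proof -
 have "F \<in> borel_measurable (boundary_measure B) \<longleftrightarrow> (%w. indicator (frontier B) w *\<^sub>R F w) \<in> borel_measurable hausdorff1"
  unfolding boundary_measure_def by (rule borel_measurable_restrict_space_iff) simp
 thus ?thesis by (simp add: measurable_cong_sets[OF sets_hausdorff1 refl])
qed

text \<open>Near \<open>x\<close> the integral is one over a chart; the rest of the boundary has positive distance from \<open>x\<close> and its contribution does not
depend on \<open>eps\<close> once \<open>eps\<close> is small.\<close>
theorem frontier_principal_value: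
 fixes phi :: "real^2 => complex"
 assumes B: "open B" "bounded B" "lipschitz_boundary B" and phi: "L2 (boundary_measure B) phi"
 shows "AE x in boundary_measure B. (\<exists>n. is_outward_normal B x n) -->
  (\<forall>v. \<exists>l. ((%eps. LINT w|boundary_measure B. indicator {w. eps < norm (x - w)} w *\<^sub>R
    (((x - w) \<bullet> v / (norm (x - w))^2) *\<^sub>R phi w)) \<longlongrightarrow> l) (at_right 0))"
proof -
 define phi' where "phi' w = indicator (frontier B) w *\<^sub>R phi w" for w
 have m [measurable]: "phi' \<in> borel_measurable borel"
  using phi unfolding L2_def boundary_measurable phi'_def by simp
 have \<phi>2: "integrable hausdorff1 (%y. (norm (phi' y))^2)"
 proof -
  have "integrable hausdorff1 (%y. indicator (frontier B) y *\<^sub>R (norm (phi y))^2)"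
   using phi unfolding L2_def boundary_integral by simp
  moreover have "(%y. indicator (frontier B) y *\<^sub>R (norm (phi y))^2) = (%y. (norm (phi' y))^2)"
   unfolding phi'_def by (auto simp: indicator_def)
  ultimately show ?thesis by simp
 qed
 have \<phi>1: "integrable hausdorff1 phi'"
  using L2_integrable[OF frontier_finite_measure(2)[OF B] phi] unfolding boundary_integral phi'_def .
 define J where "J x v eps w = indicator {w. eps < norm (x - w)} w *\<^sub>R (((x - w) \<bullet> v / (norm (x - w))^2) *\<^sub>R phi' w)" for x v :: "real^2" and eps :: real and w
 have Jm [measurable]: "J x v eps \<in> borel_measurable borel" for x v eps unfolding J_def by measurable
 have Ji: "integrable hausdorff1 (J x v eps)" if eps: "eps > 0" for x v eps
 proof (rule integrable_dominated)
  show "integrable hausdorff1 (%w. (norm v / eps) *\<^sub>R phi' w)" using \<phi>1 by simp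
  show "J x v eps \<in> borel_measurable hausdorff1" by measurable
  show "AE w in hausdorff1. norm (J x v eps w) <= norm ((norm v / eps) *\<^sub>R phi' w)"
  proof (rule AE_I2)
   fix w
   show "norm (J x v eps w) <= norm ((norm v / eps) *\<^sub>R phi' w)"
   proof (cases "eps < norm (x - w)")
    case True
    have "\<bar>(x - w) \<bullet> v\<bar> <= norm (x - w) * norm v" by (rule Cauchy_Schwarz_ineq2)
    hence "\<bar>(x - w) \<bullet> v\<bar> / (norm (x - w))^2 <= norm (x - w) * norm v / (norm (x - w))^2" by (rule divide_right_mono) simp
    also have "... = norm v / norm (x - w)" using True eps by (simp add: power2_eq_square)
    also have "... <= norm v / eps" using True eps order.strict_trans[OF eps True] by (intro divide_left_mono mult_pos_pos) auto
    finally have "\<bar>(x - w) \<bullet> v\<bar> / (norm (x - w))^2 * norm (phi' w) <= norm v / eps * norm (phi' w)" by (rule mult_right_mono) simp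
    thus ?thesis unfolding J_def using True eps by simp
   qed (simp add: J_def)
  qed
 qed
 have J: "(LINT w|boundary_measure B. indicator {w. eps < norm (x - w)} w *\<^sub>R (((x - w) \<bullet> v / (norm (x - w))^2) *\<^sub>R phi w))
   = (LINT w|hausdorff1. J x v eps w)" for x v eps
  unfolding boundary_integral J_def phi'_def by (rule lint_cong) (auto simp: indicator_def)
 obtain \<N> where N: "finite \<N>" "frontier B \<subseteq> \<Union>\<N>" "!!N. N \<in> \<N> ==> chart_nbh B N"
  using frontier_chart_data[OF B] by blast
 have near: "open N \<and> (AE x in hausdorff1. x \<in> frontier B \<inter> N --> (\<exists>n. is_outward_normal B x n) -->
   (\<forall>v. \<exists>l. ((%eps. LINT w|hausdorff1. indicator (frontier B \<inter> N) w *\<^sub>R J x v eps w) \<longlongrightarrow> l) (at_right 0)))" if NN: "N \<in> \<N>" for N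
 proof -
  obtain gamma L p e f r h where c: "boundary_chart gamma L B p e f r h" "N = boundary_chart.nbh p e f r h" using N(3)[OF NN] by auto
  show ?thesis unfolding c(2) J_def using boundary_chart.patch_principal_value[OF c(1) m \<phi>2] boundary_chart.nbh_open[OF c(1)] by simp
 qed
 have "AE x in hausdorff1. \<forall>N\<in>\<N>. x \<in> frontier B \<inter> N --> (\<exists>n. is_outward_normal B x n) -->
   (\<forall>v. \<exists>l. ((%eps. LINT w|hausdorff1. indicator (frontier B \<inter> N) w *\<^sub>R J x v eps w) \<longlongrightarrow> l) (at_right 0))"
  by (rule AE_finite_allI[OF N(1)]) (use near in blast)
 thus ?thesis unfolding boundary_AE J
 proof (rule AE_mp, intro AE_I2 impI allI)
  fix x v
  assume *: "\<forall>N\<in>\<N>. x \<in> frontier B \<inter> N --> (\<exists>n. is_outward_normal B x n) -->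
   (\<forall>v. \<exists>l. ((%eps. LINT w|hausdorff1. indicator (frontier B \<inter> N) w *\<^sub>R J x v eps w) \<longlongrightarrow> l) (at_right 0))"
   and x: "x \<in> frontier B" and n: "\<exists>n. is_outward_normal B x n"
  obtain N' where N': "N' \<in> \<N>" "x \<in> N'" using N(2) x by blast
  hence oN: "open N'" using near by blast
  obtain l where l: "((%eps. LINT w|hausdorff1. indicator (frontier B \<inter> N') w *\<^sub>R J x v eps w) \<longlongrightarrow> l) (at_right 0)"
   using * N' x n by blast
  obtain d where d: "d > 0" "ball x d \<subseteq> N'" using oN N'(2) by (meson open_contains_ball)
  define l' where "l' = (LINT w|hausdorff1. indicator (frontier B - N') w *\<^sub>R J x v (d / 2) w)"
  have "((%eps. (LINT w|hausdorff1. indicator (frontier B \<inter> N') w *\<^sub>R J x v eps w) + l') \<longlongrightarrow> l + l') (at_right 0)"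
   by (intro tendsto_intros l)
  hence "((%eps. LINT w|hausdorff1. J x v eps w) \<longlongrightarrow> l + l') (at_right 0)"
  proof (rule Lim_transform_eventually, intro eventually_at_rightI[OF _ d(1)])
   fix eps assume eps: "eps \<in> {0<..<d}"
   have "norm (x - w) >= d" if "w \<notin> N'" for w using that d(2) by (force simp: dist_norm)
   hence far: "indicator (frontier B - N') w *\<^sub>R J x v (d / 2) w = indicator (frontier B - N') w *\<^sub>R J x v eps w" for w
    unfolding J_def using eps d(1) by (fastforce simp: indicator_def)
   have i1: "integrable hausdorff1 (%w. indicator (frontier B \<inter> N') w *\<^sub>R J x v eps w)"
    by (rule integrable_mult_indicator[OF _ Ji]) (use oN eps in auto)
   have i2: "integrable hausdorff1 (%w. indicator (frontier B - N') w *\<^sub>R J x v eps w)"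
    by (rule integrable_mult_indicator[OF _ Ji]) (use oN eps in auto)
   have "(LINT w|hausdorff1. J x v eps w) = (LINT w|hausdorff1. indicator (frontier B \<inter> N') w *\<^sub>R J x v eps w + indicator (frontier B - N') w *\<^sub>R J x v eps w)"
    by (rule lint_cong) (auto simp: indicator_def J_def phi'_def)
   thus "(LINT w|hausdorff1. indicator (frontier B \<inter> N') w *\<^sub>R J x v eps w) + l' = (LINT w|hausdorff1. J x v eps w)"
    unfolding lint_add[OF i1 i2] l'_def far by simp
  qed
  thus "\<exists>l. ((%eps. LINT w|hausdorff1. J x v eps w) \<longlongrightarrow> l) (at_right 0)" by blast
 qed
qed

section \<open>Bessel functions and the fundamental solution\<close>

text \<open>The series for the Bessel functions become such series in the variable \<open>t\<^sup>2\<close>. This isolates the factors \<open>t^m\<close> and \<open>ln t\<close>, the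
only ones that are not entire in \<open>t\<^sup>2\<close>.\<close>
locale entire_series =
 fixes c :: "nat => real"
 assumes c_bound: "!!j. \<bar>c j\<bar> <= 1 / fact j"
begin

definition ps :: "real => real" where "ps u = (\<Sum>j. c j * u ^ j)"
definition ps' :: "real => real" where "ps' u = (\<Sum>j. diffs c j * u ^ j)"

lemma ps_summable: "summable (%j. c j * u ^ j)"
proof (rule summable_comparison_test'[where N = 0])
 show "summable (%j. \<bar>u\<bar> ^ j /\<^sub>R fact j)" by (rule summable_exp_generic)
 fix j :: nat
 have "\<bar>c j\<bar> * \<bar>u\<bar> ^ j <= 1 / fact j * \<bar>u\<bar> ^ j" by (rule mult_right_mono[OF c_bound]) simp
 thus "norm (c j * u ^ j) <= \<bar>u\<bar> ^ j /\<^sub>R fact j" by (simp add: abs_mult power_abs divide_inverse mult.commute)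
qed

lemma ps_deriv: "(ps has_real_derivative ps' u) (at u)"
 unfolding ps_def ps'_def by (rule termdiffs_strong_converges_everywhere) (rule ps_summable)

lemma ps_continuous: "continuous_on UNIV ps"
 using DERIV_isCont[OF ps_deriv] by (simp add: continuous_on_eq_continuous_at)

lemma ps'_continuous: "continuous_on UNIV ps'"
proof -
 have "isCont ps' u" for u
  unfolding ps'_def by (rule isCont_powser_converges_everywhere) (rule termdiff_converges_all, rule ps_summable)
 thus ?thesis by (simp add: continuous_on_eq_continuous_at)
qed

lemma ps_measurable [measurable]: "ps \<in> borel_measurable borel" "ps' \<in> borel_measurable borel"
 by (rule borel_measurable_continuous_onI[OF ps_continuous], rule borel_measurable_continuous_onI[OF ps'_continuous])

lemma ps_bounded_on: "\<exists>C. \<forall>u\<in>{0..T}. \<bar>ps u\<bar> <= C \<and> \<bar>ps' u\<bar> <= C"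
proof -
 have "bounded (ps ` {0..T})" "bounded (ps' ` {0..T})"
  by (intro compact_imp_bounded compact_continuous_image continuous_on_subset[OF ps_continuous]
    continuous_on_subset[OF ps'_continuous]; simp)+
 then obtain C1 C2 where "!!u. u \<in> {0..T} ==> \<bar>ps u\<bar> <= C1" "!!u. u \<in> {0..T} ==> \<bar>ps' u\<bar> <= C2"
  unfolding bounded_iff by (auto simp del: atLeastAtMost_iff)
 thus ?thesis by (intro exI[of _ "max C1 C2"]) (fastforce simp: le_max_iff_disj)
qed

end

definition J_coeff :: "nat => nat => real" where
 "J_coeff n j = (-1) ^ j / (fact j * fact (j + n) * 4 ^ j)"
text \<open>The coefficients of \<open>(J\<^sub>0 - 1) / t\<^sup>2\<close>; the constant term of \<open>J\<^sub>0\<close> produces the singular part of the kernel.\<close>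
definition J0_tail_coeff :: "nat => real" where "J0_tail_coeff j = J_coeff 0 (Suc j)"
definition Y_coeff :: "nat => real" where
 "Y_coeff j = (-1) ^ j * harm (Suc j) / (4 ^ Suc j * (fact (Suc j))^2)"

lemma inverse_fact_bound: "1 / (fact j * q) <= 1 / fact j" if "(q::real) >= 1"
 using that by (intro divide_left_mono) (auto simp: mult_le_cancel_left1)

global_interpretation Jn: entire_series "J_coeff n" for n
proof
 fix j
 have "(1::real) <= fact (j + n) * 4 ^ j"
  using mult_mono[of "1::real" "fact (j + n)" 1 "4 ^ j"] by simp
 from inverse_fact_bound[OF this, of j]
 show "\<bar>J_coeff n j\<bar> <= 1 / fact j" unfolding J_coeff_def by (simp add: abs_mult mult.assoc)
qed

global_interpretation Jt: entire_series J0_tail_coeff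
proof
 fix j
 have "\<bar>J_coeff 0 (Suc j)\<bar> <= 1 / fact (Suc j)" by (rule Jn.c_bound)
 also have "... <= 1 / fact j" by (intro divide_left_mono fact_mono) auto
 finally show "\<bar>J0_tail_coeff j\<bar> <= 1 / fact j" unfolding J0_tail_coeff_def .
qed

global_interpretation Yq: entire_series Y_coeff
proof
 fix j
 have h: "harm (Suc j) <= (fact (Suc j) :: real)"
 proof -
  have "harm (Suc j) <= (\<Sum>k=1..Suc j. 1 :: real)" unfolding harm_def by (intro sum_mono) (auto simp: divide_simps)
  also have "... = real (Suc j)" by simp
  also have "... <= fact (Suc j)" by (metis fact_ge_self of_nat_fact of_nat_le_iff)
  finally show ?thesis .
 qed
 have h0: "harm (Suc j) >= (0::real)" by (rule harm_nonneg)
 have "\<bar>Y_coeff j\<bar> = harm (Suc j) / (4 ^ Suc j * (fact (Suc j))^2)"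
  unfolding Y_coeff_def using h0 by (simp add: abs_mult power_abs)
 also have "... <= fact (Suc j) / (4 ^ Suc j * (fact (Suc j))^2)" by (intro divide_right_mono h) auto
 also have "... = 1 / (fact (Suc j) * 4 ^ Suc j)" by (simp add: power2_eq_square)
 also have "... <= 1 / fact (Suc j)" by (rule inverse_fact_bound) (rule one_le_power, simp)
 also have "... <= 1 / fact j" by (intro divide_left_mono fact_mono) auto
 finally show "\<bar>Y_coeff j\<bar> <= 1 / fact j" .
qed

lemma bessel_J_eq:
 "bessel_J m t = (if m < 0 then (-1) ^ nat \<bar>m\<bar> else 1) * ((t / 2) ^ nat \<bar>m\<bar> * Jn.ps (nat \<bar>m\<bar>) (t^2))"
proof -
 let ?n = "nat \<bar>m\<bar>"
 have "(\<Sum>j. (-1) ^ j / (fact j * fact (j + ?n)) * (t / 2) ^ (2 * j + ?n)) = (\<Sum>j. (t / 2) ^ ?n * (J_coeff ?n j * (t^2) ^ j))"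
 proof (rule suminf_cong)
  fix j
  have "(t / 2) ^ (2 * j + ?n) = (t / 2) ^ ?n * ((t^2) ^ j / 4 ^ j)"
  proof -
   have "(t / 2) ^ (2 * j) = (t^2) ^ j / 4 ^ j" by (simp only: power_mult power_divide) simp
   thus ?thesis by (simp only: power_add mult.commute)
  qed
  thus "(-1) ^ j / (fact j * fact (j + ?n)) * (t / 2) ^ (2 * j + ?n) = (t / 2) ^ ?n * (J_coeff ?n j * (t^2) ^ j)"
   unfolding J_coeff_def by simp
 qed
 also have "... = (t / 2) ^ ?n * Jn.ps ?n (t^2)"
  unfolding Jn.ps_def by (rule suminf_mult) (rule Jn.ps_summable)
 finally show ?thesis unfolding bessel_J_def by simp
qed

lemma bessel_J0_eq: "bessel_J 0 t = Jn.ps 0 (t^2)" unfolding bessel_J_eq by simp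

lemma J0_tail: "Jn.ps 0 u = 1 + u * Jt.ps u"
proof -
 have "(\<Sum>j. J_coeff 0 j * u ^ j) = J_coeff 0 0 * u ^ 0 + (\<Sum>j. J_coeff 0 (Suc j) * u ^ Suc j)"
  using suminf_split_head[OF Jn.ps_summable[of 0 u]] by simp
 also have "(\<Sum>j. J_coeff 0 (Suc j) * u ^ Suc j) = (\<Sum>j. u * (J0_tail_coeff j * u ^ j))"
  by (rule suminf_cong) (simp add: J0_tail_coeff_def)
 also have "... = u * Jt.ps u" unfolding Jt.ps_def by (rule suminf_mult) (rule Jt.ps_summable)
 finally show ?thesis unfolding Jn.ps_def by (simp add: J_coeff_def)
qed

lemma bessel_Y0_eq:
 "bessel_Y0 t = 2 / pi * ((ln (t / 2) + euler_mascheroni) * Jn.ps 0 (t^2) + t^2 * Yq.ps (t^2))"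
proof -
 have "(\<Sum>j. (-1) ^ j * harm (Suc j) * (t / 2) ^ (2 * Suc j) / (fact (Suc j))^2) = (\<Sum>j. t^2 * (Y_coeff j * (t^2) ^ j))"
 proof (rule suminf_cong)
  fix j
  have "(t / 2) ^ (2 * Suc j) = t^2 * (t^2) ^ j / 4 ^ Suc j"
   by (simp only: power_mult power_divide) simp
  thus "(-1) ^ j * harm (Suc j) * (t / 2) ^ (2 * Suc j) / (fact (Suc j))^2 = t^2 * (Y_coeff j * (t^2) ^ j)"
   unfolding Y_coeff_def by simp
 qed
 also have "... = t^2 * Yq.ps (t^2)" unfolding Yq.ps_def by (rule suminf_mult) (rule Yq.ps_summable)
 finally show ?thesis unfolding bessel_Y0_def bessel_J0_eq by simp
qed

text \<open>The radial derivative of the fundamental solution at distance \<open>r\<close>, minus its singular part \<open>1 / (2 \<pi> r)\<close>.\<close>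
definition radial_rest :: "real => real => complex" where
 "radial_rest k r =
   of_real (k / (2 * pi) * (k * r * Jt.ps ((k * r)^2)
    + (ln (k * r / 2) + euler_mascheroni) * (2 * (k * r) * Jn.ps' 0 ((k * r)^2))
    + (2 * (k * r) * Yq.ps ((k * r)^2) + (k * r)^2 * (2 * (k * r) * Yq.ps' ((k * r)^2)))))
   - \<i> * of_real (k / 4 * (2 * (k * r) * Jn.ps' 0 ((k * r)^2)))"

lemma radial_rest_measurable [measurable]: "radial_rest k \<in> borel_measurable borel"
 unfolding radial_rest_def by measurable

lemma t_ln_bound: "\<bar>t * ln (t / 2)\<bar> <= 2 + t^2" if t: "t > 0" for t :: real
proof (cases "t >= 2")
 case True
 have "0 <= ln (t / 2)" "ln (t / 2) <= t / 2 - 1" using True ln_le_minus_one[of "t / 2"] by auto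
 hence "0 <= t * ln (t / 2)" "t * ln (t / 2) <= t * t" using t by (auto intro!: mult_left_mono)
 thus ?thesis by (simp add: power2_eq_square)
next
 case False
 have "ln (2 / t) <= 2 / t - 1" using t by (intro ln_le_minus_one) auto
 moreover have "ln (2 / t) = - ln (t / 2)" using t by (simp add: ln_div)
 ultimately have "t * (- ln (t / 2)) <= t * (2 / t)" using t by (intro mult_left_mono) auto
 moreover have "ln (t / 2) <= 0" using t False by (simp add: ln_le_zero_iff)
 hence "t * ln (t / 2) <= 0" using t by (simp add: mult_nonneg_nonpos)
 ultimately have "\<bar>t * ln (t / 2)\<bar> <= 2" using t by simp
 thus ?thesis using zero_le_power2[of t] by linarith
qed

text \<open>The only unbounded factor is the logarithm, and it is multiplied by \<open>r\<close>.\<close>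
lemma radial_rest_bounded:
 assumes k: "k > 0" and R: "R > 0"
 shows "\<exists>C. \<forall>r. 0 < r --> r <= R --> norm (radial_rest k r) <= C"
proof -
 define T where "T = k * R"
 have T: "T > 0" unfolding T_def using k R by simp
 obtain C1 where C1: "!!u. u \<in> {0..T^2} ==> \<bar>Jt.ps u\<bar> <= C1 \<and> \<bar>Jt.ps' u\<bar> <= C1" using Jt.ps_bounded_on by blast
 obtain C2 where C2: "!!u. u \<in> {0..T^2} ==> \<bar>Jn.ps 0 u\<bar> <= C2 \<and> \<bar>Jn.ps' 0 u\<bar> <= C2" using Jn.ps_bounded_on by blast
 obtain C3 where C3: "!!u. u \<in> {0..T^2} ==> \<bar>Yq.ps u\<bar> <= C3 \<and> \<bar>Yq.ps' u\<bar> <= C3" using Yq.ps_bounded_on by blast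
 define c where "c = k / (2 * pi)"
 have c: "c > 0" unfolding c_def using k by simp
 let ?C = "c * (T * C1 + (2 * (2 + T^2) * C2 + \<bar>euler_mascheroni\<bar> * (2 * T * C2)) + (2 * T * C3 + T^2 * (2 * T * C3))) + k / 4 * (2 * T * C2)"
 show ?thesis
 proof (intro exI[of _ ?C] allI impI)
  fix r :: real assume r: "0 < r" "r <= R"
  define t where "t = k * r"
  have t: "0 < t" "t <= T" unfolding t_def T_def using r k by auto
  have t2: "t^2 \<in> {0..T^2}" using t by (auto intro!: power_mono)
  note b = C1[OF t2] C2[OF t2] C3[OF t2]
  have a: "\<bar>t * x\<bar> <= T * D" if "\<bar>x\<bar> <= D" for x D
   unfolding abs_mult using t that by (intro mult_mono) auto
  have b1: "\<bar>t * Jt.ps (t^2)\<bar> <= T * C1" using a b by blast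
  have b2': "\<bar>t * Jn.ps' 0 (t^2)\<bar> <= T * C2" using a b by blast
  have b3: "\<bar>t * Yq.ps (t^2)\<bar> <= T * C3" "\<bar>t * Yq.ps' (t^2)\<bar> <= T * C3" using a b by blast+
  have b2: "\<bar>ln (t / 2) * (2 * t * Jn.ps' 0 (t^2))\<bar> <= 2 * (2 + T^2) * C2"
  proof -
   have "\<bar>t * ln (t / 2)\<bar> <= 2 + T^2" using t_ln_bound[OF t(1)] t2 by auto
   hence "\<bar>t * ln (t / 2)\<bar> * \<bar>Jn.ps' 0 (t^2)\<bar> <= (2 + T^2) * C2" using b by (intro mult_mono) auto
   moreover have "\<bar>ln (t / 2) * (2 * t * Jn.ps' 0 (t^2))\<bar> = 2 * (\<bar>t * ln (t / 2)\<bar> * \<bar>Jn.ps' 0 (t^2)\<bar>)"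
    by (simp add: abs_mult)
   ultimately show ?thesis unfolding mult.assoc[of 2] by simp
  qed
  have b4: "\<bar>euler_mascheroni * (2 * t * Jn.ps' 0 (t^2))\<bar> <= \<bar>euler_mascheroni\<bar> * (2 * T * C2)"
   unfolding abs_mult[of euler_mascheroni] using b2' by (intro mult_left_mono) (auto simp: abs_mult)
  have b5: "\<bar>2 * t * Yq.ps (t^2)\<bar> <= 2 * T * C3" using b3(1) by (simp add: abs_mult)
  have b6: "\<bar>t^2 * (2 * t * Yq.ps' (t^2))\<bar> <= T^2 * (2 * T * C3)"
   unfolding abs_mult[of "t^2"] using b3(2) t2 by (intro mult_mono) (auto simp: abs_mult)
  let ?X = "t * Jt.ps (t^2) + (ln (t / 2) + euler_mascheroni) * (2 * t * Jn.ps' 0 (t^2)) + (2 * t * Yq.ps (t^2) + t^2 * (2 * t * Yq.ps' (t^2)))"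
  have X: "\<bar>?X\<bar> <= T * C1 + (2 * (2 + T^2) * C2 + \<bar>euler_mascheroni\<bar> * (2 * T * C2)) + (2 * T * C3 + T^2 * (2 * T * C3))"
   unfolding distrib_right using b1 b2 b4 b5 b6
   by (intro order_trans[OF abs_triangle_ineq] add_mono) auto
  have "norm (radial_rest k r) <= norm (complex_of_real (c * ?X)) + norm (\<i> * of_real (k / 4 * (2 * t * Jn.ps' 0 (t^2))))"
   unfolding radial_rest_def t_def[symmetric] c_def[symmetric] by (rule norm_triangle_ineq4)
  also have "... = c * \<bar>?X\<bar> + k / 4 * \<bar>2 * t * Jn.ps' 0 (t^2)\<bar>"
   unfolding norm_mult norm_of_real using c k by (simp add: abs_mult)
  also have "... <= ?C"
   using X b2' c k by (intro add_mono mult_left_mono) (auto simp: abs_mult)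
  finally show "norm (radial_rest k r) <= ?C" .
 qed
qed

lemma fund_sol_radial:
 assumes k: "k > 0" and r: "r > 0"
 shows "((%r. - (\<i> / 4) * hankel1_0 (k * r)) has_vector_derivative (of_real (1 / (2 * pi * r)) + radial_rest k r)) (at r)"
proof -
 let ?t = "k * r"
 have t: "?t > 0" using k r by simp
 have J: "((%r. Jn.ps 0 ((k * r)^2)) has_real_derivative Jn.ps' 0 (?t^2) * (2 * ?t * k)) (at r)"
  by (rule DERIV_chain2[where f = "Jn.ps 0" and g = "%r. (k * r)^2"], rule Jn.ps_deriv) (auto intro!: derivative_eq_intros)
 have Y: "((%r. Yq.ps ((k * r)^2)) has_real_derivative Yq.ps' (?t^2) * (2 * ?t * k)) (at r)"
  by (rule DERIV_chain2[where f = "Yq.ps" and g = "%r. (k * r)^2"], rule Yq.ps_deriv) (auto intro!: derivative_eq_intros)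
 have L: "((%r. ln (k * r / 2)) has_real_derivative 1 / r) (at r)"
  by (rule derivative_eq_intros refl | use t r k in simp)+
 have Y0: "((%r. bessel_Y0 (k * r)) has_real_derivative
   2 / pi * (1 / r * Jn.ps 0 (?t^2) + (ln (?t / 2) + euler_mascheroni) * (Jn.ps' 0 (?t^2) * (2 * ?t * k))
    + (2 * ?t * k * Yq.ps (?t^2) + ?t^2 * (Yq.ps' (?t^2) * (2 * ?t * k))))) (at r)"
  unfolding bessel_Y0_eq by (rule derivative_eq_intros J Y L refl | simp)+
 have J0: "((%r. bessel_J 0 (k * r)) has_real_derivative Jn.ps' 0 (?t^2) * (2 * ?t * k)) (at r)"
  unfolding bessel_J0_eq by (rule J)
 have e: "- (\<i> / 4) * hankel1_0 (k * q) = of_real (bessel_Y0 (k * q) / 4) - \<i> * of_real (bessel_J 0 (k * q) / 4)" for q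
  unfolding hankel1_0_def by (simp add: complex_eq_iff)
 have d: "((%r. complex_of_real (bessel_Y0 (k * r) / 4) - \<i> * of_real (bessel_J 0 (k * r) / 4)) has_vector_derivative
   of_real (2 / pi * (1 / r * Jn.ps 0 (?t^2) + (ln (?t / 2) + euler_mascheroni) * (Jn.ps' 0 (?t^2) * (2 * ?t * k))
    + (2 * ?t * k * Yq.ps (?t^2) + ?t^2 * (Yq.ps' (?t^2) * (2 * ?t * k)))) / 4)
   - \<i> * of_real (Jn.ps' 0 (?t^2) * (2 * ?t * k) / 4)) (at r)"
  by (intro has_vector_derivative_diff has_vector_derivative_mult_right has_vector_derivative_of_real DERIV_cdivide Y0 J0)
 have eqn: "2 / pi * (1 / r * Jn.ps 0 (?t^2) + (ln (?t / 2) + euler_mascheroni) * (Jn.ps' 0 (?t^2) * (2 * ?t * k))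
    + (2 * ?t * k * Yq.ps (?t^2) + ?t^2 * (Yq.ps' (?t^2) * (2 * ?t * k)))) / 4
   = 1 / (2 * pi * r) + k / (2 * pi) * (?t * Jt.ps (?t^2) + (ln (?t / 2) + euler_mascheroni) * (2 * ?t * Jn.ps' 0 (?t^2))
    + (2 * ?t * Yq.ps (?t^2) + ?t^2 * (2 * ?t * Yq.ps' (?t^2))))"
 proof -
  have "1 / r * Jn.ps 0 (?t^2) = 1 / r + k * (?t * Jt.ps (?t^2))"
   unfolding J0_tail[of "?t^2"] using r by (simp add: field_simps power2_eq_square)
  thus ?thesis by (simp add: algebra_simps divide_simps)
 qed
 have eqn2: "Jn.ps' 0 (?t^2) * (2 * ?t * k) / 4 = k / 4 * (2 * ?t * Jn.ps' 0 (?t^2))" by simp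
 show ?thesis using d unfolding e radial_rest_def eqn eqn2 of_real_add[of "1 / (2 * pi * r)"] add_diff_eq .
qed

lemma fund_sol_has_derivative:
 assumes k: "k > 0" and x: "x ~= 0"
 shows "(fund_sol k has_derivative
   (%v. ((x \<bullet> v) / norm x) *\<^sub>R (of_real (1 / (2 * pi * norm x)) + radial_rest k (norm x)))) (at x)"
proof -
 have n: "(norm has_derivative (%v. sgn x \<bullet> v)) (at x)" using has_derivative_norm[OF x] by (simp add: inner_commute)
 have r: "((%r. - (\<i> / 4) * hankel1_0 (k * r)) has_derivative (%h. h *\<^sub>R (of_real (1 / (2 * pi * norm x)) + radial_rest k (norm x)))) (at (norm x))"
  using fund_sol_radial[OF k, of "norm x"] x unfolding has_vector_derivative_def by simp
 have "(fund_sol k has_derivative (%v. (sgn x \<bullet> v) *\<^sub>R (of_real (1 / (2 * pi * norm x)) + radial_rest k (norm x)))) (at x)"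
  using has_derivative_compose[OF n r] unfolding fund_sol_def[abs_def] .
 moreover have "sgn x \<bullet> v = (x \<bullet> v) / norm x" for v unfolding sgn_div_norm by (simp add: divide_inverse mult.commute)
 ultimately show ?thesis by simp
qed

text \<open>The angular factor combines with \<open>|x|^m\<close> to a power of \<open>x\<^sub>1 \<plusminus> \<i> x\<^sub>2\<close>. This shows smoothness also across the branch cut of the polar
angle, where the defining formula is not visibly smooth.\<close>
lemma cyl_wave_eq:
 "cyl_wave m k x = of_real ((if m < 0 then (-1) ^ nat \<bar>m\<bar> else 1) * (k / 2) ^ nat \<bar>m\<bar> * Jn.ps (nat \<bar>m\<bar>) (k^2 * (x \<bullet> x)))
   * (of_real (x $ 1) + (if m < 0 then - \<i> else \<i>) * of_real (x $ 2)) ^ nat \<bar>m\<bar>"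
proof -
 let ?n = "nat \<bar>m\<bar>" and ?z = "Complex (x $ 1) (x $ 2)"
 have nz: "norm x = norm ?z" by (simp add: norm_vec_def L2_set_def sum_2 cmod_def)
 have pol: "of_real (norm x) * cis (polar_angle x) = ?z"
  unfolding nz polar_angle_def using rcis_cmod_Arg[of ?z] by (simp add: rcis_def)
 have cp: "of_real (norm x) ^ ?n * cis (of_int m * polar_angle x) = (of_real (x $ 1) + (if m < 0 then - \<i> else \<i>) * of_real (x $ 2)) ^ ?n"
 proof (cases "m < 0")
  case True
  hence "cis (of_int m * polar_angle x) = cnj (cis (polar_angle x)) ^ ?n"
  proof -
   have rn: "of_int m = - real ?n" using True by simp
   have "cis (of_int m * polar_angle x) = cis (real ?n * (- polar_angle x))"
    unfolding rn by (simp only: mult_minus_left mult_minus_right)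
   thus ?thesis unfolding cis_cnj Complex.DeMoivre .
  qed
  hence "of_real (norm x) ^ ?n * cis (of_int m * polar_angle x) = cnj (of_real (norm x) * cis (polar_angle x)) ^ ?n"
   by (simp add: power_mult_distrib)
  also have "cnj (of_real (norm x) * cis (polar_angle x)) = of_real (x $ 1) + - \<i> * of_real (x $ 2)"
   unfolding pol by (simp add: complex_eq_iff)
  finally show ?thesis using True by simp
 next
  case False
  hence "cis (of_int m * polar_angle x) = cis (polar_angle x) ^ ?n"
  proof -
   have "of_int m = real ?n" using False by simp
   thus ?thesis unfolding Complex.DeMoivre by (simp only:)
  qed
  hence "of_real (norm x) ^ ?n * cis (of_int m * polar_angle x) = (of_real (norm x) * cis (polar_angle x)) ^ ?n"
   by (simp add: power_mult_distrib)
  also have "of_real (norm x) * cis (polar_angle x) = of_real (x $ 1) + \<i> * of_real (x $ 2)"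
   unfolding pol by (simp add: complex_eq_iff)
  finally show ?thesis using False by simp
 qed
 have "(k * norm x)^2 = k^2 * (x \<bullet> x)" by (simp add: power_mult_distrib power2_norm_eq_inner)
 hence "bessel_J m (k * norm x) = (if m < 0 then (-1) ^ ?n else 1) * (k / 2) ^ ?n * Jn.ps ?n (k^2 * (x \<bullet> x)) * norm x ^ ?n"
  unfolding bessel_J_eq by (simp only: power_mult_distrib power_divide times_divide_eq_left times_divide_eq_right mult.assoc mult.commute mult.left_commute)
 thus ?thesis unfolding cyl_wave_def cp[symmetric] by simp
qed

lemma cyl_wave_differentiable: "cyl_wave m k differentiable (at x)"
proof -
 let ?n = "nat \<bar>m\<bar>"
 have P: "(%x::real^2. Jn.ps ?n (k^2 * (x \<bullet> x))) differentiable (at x)"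
 proof -
  have "(%x::real^2. k^2 * (x \<bullet> x)) differentiable (at x)"
   unfolding differentiable_def by (intro exI) (rule derivative_intros)+
  moreover have "Jn.ps ?n differentiable (at u)" for u
   using Jn.ps_deriv[of ?n u] unfolding has_field_derivative_def differentiable_def by blast
  ultimately show ?thesis by (rule differentiable_compose[where f = "Jn.ps ?n", rotated]) 
 qed
 then obtain P' where P': "((%x::real^2. Jn.ps ?n (k^2 * (x \<bullet> x))) has_derivative P') (at x)" unfolding differentiable_def by blast
 have c: "((%x::real^2. x $ i) has_derivative (%v. v $ i)) (at x)" for i
  by (rule bounded_linear_imp_has_derivative[OF bounded_linear_vec_nth])
 show ?thesis
  unfolding cyl_wave_eq[abs_def] differentiable_def
  by (intro exI) (rule derivative_intros has_derivative_of_real has_derivative_power P' c)+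
qed

section \<open>The limit in the Neumann-Poincare operator\<close>

lemma normal_deriv_fund_sol:
 assumes k: "k > 0" and xy: "x ~= y"
 shows "normal_deriv B (%z. fund_sol k (z - y)) x =
  (((x - y) \<bullet> outward_normal B x) / norm (x - y)) *\<^sub>R (of_real (1 / (2 * pi * norm (x - y))) + radial_rest k (norm (x - y)))"
proof -
 have t: "((%z. z - y) has_derivative (%v. v)) (at x)" by (auto intro!: derivative_eq_intros)
 have xy': "x - y ~= 0" using xy by simp
 show ?thesis unfolding normal_deriv_def
  frechet_derivative_at[OF has_derivative_compose[OF t fund_sol_has_derivative[OF k xy']], symmetric] ..
qed

lemma bounded_mult_integrable:
 fixes phi g :: "'a => complex"
 assumes phi: "integrable M phi" and g: "g \<in> borel_measurable M" and b: "!!w. w \<in> space M ==> norm (g w) <= C"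
 shows "integrable M (%w. g w * phi w)"
proof (rule integrable_dominated)
 show "integrable M (%w. of_real C * phi w)" using phi by simp
 show "(%w. g w * phi w) \<in> borel_measurable M"
  using g borel_measurable_integrable[OF phi] by (rule borel_measurable_times)
 show "AE w in M. norm (g w * phi w) <= norm (of_real C * phi w)"
 proof (rule AE_I2)
  fix w assume "w \<in> space M"
  from b[OF this] show "norm (g w * phi w) <= norm (of_real C * phi w)"
   unfolding norm_mult by (intro mult_right_mono) auto
 qed
qed

lemma boundary_measurable_of_borel:
 "g \<in> borel_measurable borel ==> g \<in> borel_measurable (boundary_measure B)"
 unfolding boundary_measure_def by (intro measurable_restrict_space1) (simp add: measurable_cong_sets[OF sets_hausdorff1 refl])

lemma space_boundary_measure [simp]: "space (boundary_measure B) = frontier B"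
 unfolding boundary_measure_def by (simp add: space_restrict_space)

lemma inner_over_norm_bound: "\<bar>((x - w) \<bullet> v) / norm (x - w)\<bar> <= norm v"
proof (cases "x = w")
 case False
 have "\<bar>(x - w) \<bullet> v\<bar> <= norm (x - w) * norm v" by (rule Cauchy_Schwarz_ineq2)
 thus ?thesis using False by (simp add: pos_divide_le_eq mult.commute)
qed simp

text \<open>Without an outward normal at \<open>x\<close> the normal vector is 0 by convention and the integrals vanish. Otherwise the singular part of the
kernel is covered by \<open>frontier_principal_value\<close>, and the bounded part converges by dominated convergence.\<close>
theorem neumann_poincare_limit_exists:
 fixes phi :: "real^2 => complex"
 assumes B: "open B" "bounded B" "lipschitz_boundary B" and k: "k > 0" and phi: "L2 (boundary_measure B) phi"
 shows "AE x in boundary_measure B. \<exists>l. ((%eps. LINT y|boundary_measure B.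
    indicator {y. norm (x - y) > eps} y *\<^sub>R (normal_deriv B (%z. fund_sol k (z - y)) x * phi y)) \<longlongrightarrow> l) (at_right 0)"
 using frontier_principal_value[OF B phi]
proof (rule AE_mp, intro AE_I2 impI)
 let ?M = "boundary_measure B"
 have \<phi>1: "integrable ?M phi" by (rule L2_integrable[OF frontier_finite_measure(2)[OF B] phi])
 fix x assume x: "x \<in> space ?M" and pv: "(\<exists>n. is_outward_normal B x n) -->
  (\<forall>v. \<exists>l. ((%eps. LINT w|?M. indicator {w. eps < norm (x - w)} w *\<^sub>R
    (((x - w) \<bullet> v / (norm (x - w))^2) *\<^sub>R phi w)) \<longlongrightarrow> l) (at_right 0))"
 define v where "v = outward_normal B x"
 obtain l1 where l1: "((%eps. LINT w|?M. indicator {w. eps < norm (x - w)} w *\<^sub>R (((x - w) \<bullet> v / (norm (x - w))^2) *\<^sub>R phi w)) \<longlongrightarrow> l1) (at_right 0)"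
 proof (cases "\<exists>n. is_outward_normal B x n")
  case True
  thus thesis using pv that by blast
 next
  case False
  hence "v = 0" unfolding v_def outward_normal_def by (rule if_not_P)
  thus thesis by (intro that[of 0]) simp
 qed
 define K where "K w = (((x - w) \<bullet> v) / norm (x - w)) *\<^sub>R radial_rest k (norm (x - w))" for w
 have Km [measurable]: "K \<in> borel_measurable borel" unfolding K_def by measurable
 obtain R where R: "R > 0" "!!w. w \<in> frontier B ==> norm (x - w) <= R"
 proof -
  have "bounded (frontier B)" using compact_frontier_bounded[OF B(2)] by (rule compact_imp_bounded)
  then obtain e where e: "!!w. w \<in> frontier B ==> dist x w <= e" unfolding bounded_any_center[of _ x] by blast
  show thesis by (rule that[of "max e 1"]) (use e in "auto simp: dist_norm le_max_iff_disj")
 qed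
 obtain C where C: "!!r. 0 < r ==> r <= R ==> norm (radial_rest k r) <= C" using radial_rest_bounded[OF k R(1)] by blast
 have C0: "C >= 0" using C[of R] R(1) norm_ge_zero order_trans by blast
 have Kb: "norm (K w) <= norm v * C" if w: "w \<in> frontier B" for w
 proof (cases "w = x")
  case False
  hence "norm (radial_rest k (norm (x - w))) <= C" using R(2)[OF w] by (intro C) auto
  thus ?thesis unfolding K_def norm_scaleR using C0 inner_over_norm_bound[of x w v]
   by (intro mult_mono) auto
 qed (use C0 in "simp add: K_def")
 let ?I = "%eps w. indicator {w. eps < norm (x - w)} w :: real"
 have Im [measurable]: "?I eps \<in> borel_measurable borel" for eps by measurable
 define s where "s u w = (?I (inverse u) w *\<^sub>R K w) * phi w" for u w
 have "((%u. LINT w|?M. s u w) \<longlongrightarrow> (LINT w|?M. K w * phi w)) at_top"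
 proof (rule integral_dominated_convergence_at_top)
  have \<phi>m: "phi \<in> borel_measurable ?M" using \<phi>1 by simp
  show "(%w. K w * phi w) \<in> borel_measurable ?M"
   by (rule borel_measurable_times[OF boundary_measurable_of_borel[OF Km] \<phi>m])
  show "s u \<in> borel_measurable ?M" for u
   unfolding s_def by (rule borel_measurable_times[OF boundary_measurable_of_borel \<phi>m]) measurable
  show "integrable ?M (%w. norm v * C * norm (phi w))" using \<phi>1 by simp
  show "AE w in ?M. ((%u. s u w) \<longlongrightarrow> K w * phi w) at_top"
  proof (rule AE_I2)
   fix w
   show "((%u. s u w) \<longlongrightarrow> K w * phi w) at_top"
   proof (cases "w = x")
    case True
    thus ?thesis unfolding s_def K_def by simp
   next
    case False
    hence p: "norm (x - w) > 0" by simp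
    have "\<forall>\<^sub>F u in at_top. inverse u < norm (x - w)"
    by (rule order_tendstoD(2)[OF tendsto_inverse_0_at_top[OF filterlim_ident] p])
    hence "\<forall>\<^sub>F u in at_top. K w * phi w = s u w"
    by (rule eventually_mono) (simp add: s_def)
    thus ?thesis by (rule Lim_transform_eventually[OF tendsto_const])
   qed
  qed
  show "\<forall>\<^sub>F u in at_top. AE w in ?M. norm (s u w) <= norm v * C * norm (phi w)"
  proof (rule always_eventually, rule allI, rule AE_I2)
   fix u w assume "w \<in> space ?M"
   hence "norm (K w) <= norm v * C" using Kb by simp
   moreover have "norm (?I (inverse u) w *\<^sub>R K w) <= norm (K w)" by (simp add: indicator_def)
   ultimately show "norm (s u w) <= norm v * C * norm (phi w)"
    unfolding s_def norm_mult by (intro mult_right_mono) auto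
  qed
 qed
 hence l2: "((%eps. LINT w|?M. (?I eps w *\<^sub>R K w) * phi w) \<longlongrightarrow> (LINT w|?M. K w * phi w)) (at_right 0)"
  unfolding s_def filterlim_at_right_to_top .
 let ?L = "(1 / (2 * pi)) *\<^sub>R l1 + (LINT w|?M. K w * phi w)"
 have lim: "((%eps. (1 / (2 * pi)) *\<^sub>R (LINT w|?M. ?I eps w *\<^sub>R (((x - w) \<bullet> v / (norm (x - w))^2) *\<^sub>R phi w))
   + (LINT w|?M. (?I eps w *\<^sub>R K w) * phi w)) \<longlongrightarrow> ?L) (at_right 0)"
  by (intro tendsto_intros l1 l2)
 have eq: "(1 / (2 * pi)) *\<^sub>R (LINT w|?M. ?I eps w *\<^sub>R (((x - w) \<bullet> v / (norm (x - w))^2) *\<^sub>R phi w))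
   + (LINT w|?M. (?I eps w *\<^sub>R K w) * phi w)
   = (LINT y|?M. ?I eps y *\<^sub>R (normal_deriv B (%z. fund_sol k (z - y)) x * phi y))" if eps: "eps > 0" for eps
 proof -
  have i1: "integrable ?M (%w. (?I eps w *\<^sub>R of_real ((x - w) \<bullet> v / (norm (x - w))^2)) * phi w)"
  proof (rule bounded_mult_integrable[OF \<phi>1])
   show "(%w. ?I eps w *\<^sub>R complex_of_real ((x - w) \<bullet> v / (norm (x - w))^2)) \<in> borel_measurable ?M"
    by (rule boundary_measurable_of_borel) measurable
   fix w
   show "norm (?I eps w *\<^sub>R complex_of_real ((x - w) \<bullet> v / (norm (x - w))^2)) <= norm v / eps"
   proof (cases "eps < norm (x - w)")
    case True
    have "\<bar>(x - w) \<bullet> v / (norm (x - w))^2\<bar> = \<bar>((x - w) \<bullet> v) / norm (x - w)\<bar> / norm (x - w)" by (simp add: power2_eq_square)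
    also have "... <= norm v / norm (x - w)" by (intro divide_right_mono inner_over_norm_bound) simp
    also have "... <= norm v / eps" using True eps order.strict_trans[OF eps True] by (intro divide_left_mono mult_pos_pos) auto
    finally show ?thesis using True by (simp del: of_real_divide of_real_power)
   qed (use eps in simp)
  qed
  have i1': "integrable ?M (%w. ?I eps w *\<^sub>R (((x - w) \<bullet> v / (norm (x - w))^2) *\<^sub>R phi w))"
   using i1 by (simp add: scaleR_conv_of_real mult.assoc)
  have i2: "integrable ?M (%w. (?I eps w *\<^sub>R K w) * phi w)"
  proof (rule bounded_mult_integrable[OF \<phi>1])
   show "(%w. ?I eps w *\<^sub>R K w) \<in> borel_measurable ?M" by (rule boundary_measurable_of_borel) measurable
   fix w assume "w \<in> space ?M"
   hence "norm (K w) <= norm v * C" using Kb by simp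
   moreover have "norm (?I eps w *\<^sub>R K w) <= norm (K w)" by (simp add: indicator_def)
   ultimately show "norm (?I eps w *\<^sub>R K w) <= norm v * C" by simp
  qed
  have "(1 / (2 * pi)) *\<^sub>R (LINT w|?M. ?I eps w *\<^sub>R (((x - w) \<bullet> v / (norm (x - w))^2) *\<^sub>R phi w))
   + (LINT w|?M. (?I eps w *\<^sub>R K w) * phi w)
   = (LINT w|?M. (1 / (2 * pi)) *\<^sub>R (?I eps w *\<^sub>R (((x - w) \<bullet> v / (norm (x - w))^2) *\<^sub>R phi w)) + (?I eps w *\<^sub>R K w) * phi w)"
   unfolding lint_add[OF integrable_scaleR_right[OF i1'] i2] integral_scaleR_right ..
  also have "... = (LINT y|?M. ?I eps y *\<^sub>R (normal_deriv B (%z. fund_sol k (z - y)) x * phi y))"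
  proof (rule lint_cong[OF refl])
   fix w
   show "(1 / (2 * pi)) *\<^sub>R (?I eps w *\<^sub>R (((x - w) \<bullet> v / (norm (x - w))^2) *\<^sub>R phi w)) + (?I eps w *\<^sub>R K w) * phi w
    = ?I eps w *\<^sub>R (normal_deriv B (%z. fund_sol k (z - w)) x * phi w)"
   proof (cases "eps < norm (x - w)")
    case True
    hence xw: "x ~= w" using eps by auto
    have "(1 / (2 * pi)) *\<^sub>R (((x - w) \<bullet> v / (norm (x - w))^2) *\<^sub>R phi w)
    = (((x - w) \<bullet> v) / norm (x - w)) *\<^sub>R (of_real (1 / (2 * pi * norm (x - w))) * phi w)"
    by (simp add: scaleR_conv_of_real power2_eq_square)
    thus ?thesis using True unfolding normal_deriv_fund_sol[OF k xw] v_def[symmetric] K_def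
    by (simp add: scaleR_add_right distrib_right del: of_real_divide of_real_mult)
   qed simp
  qed
  finally show ?thesis .
 qed
 have "((%eps. LINT y|?M. ?I eps y *\<^sub>R (normal_deriv B (%z. fund_sol k (z - y)) x * phi y)) \<longlongrightarrow> ?L) (at_right 0)"
  by (rule Lim_transform_eventually[OF lim], rule eventually_mono[OF eventually_at_right_less[of "0::real"]], rule eq)
 thus "\<exists>l. ((%eps. LINT y|?M. ?I eps y *\<^sub>R (normal_deriv B (%z. fund_sol k (z - y)) x * phi y)) \<longlongrightarrow> l) (at_right 0)" by blast
qed

section \<open>Scaling of measures\<close>

text \<open>A bimeasurable bijection under which one measure is a constant multiple of the image of the other. Since nonmeasurable
functions have integral 0 on both sides, the change of variables below holds for arbitrary functions.\<close>
locale measure_scaling =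
 fixes M M' :: "'a measure" and T T' :: "'a => 'a" and c :: real
 assumes T [measurable]: "T \<in> measurable M M'" and T' [measurable]: "T' \<in> measurable M' M"
  and T'T: "!!x. x \<in> space M ==> T' (T x) = x" and TT': "!!y. y \<in> space M' ==> T (T' y) = y"
  and c: "c > 0"
  and em: "!!A. A \<in> sets M' ==> emeasure M' A = ennreal c * emeasure M (T -` A \<inter> space M)"
begin

lemma measurable_iff:
 fixes F :: "'a => 'b::topological_space"
 shows "F \<in> borel_measurable M' \<longleftrightarrow> (%x. F (T x)) \<in> borel_measurable M"
proof
 assume F: "(%x. F (T x)) \<in> borel_measurable M"
 have "(%y. F (T (T' y))) \<in> borel_measurable M'" by (rule measurable_compose[OF T' F])
 thus "F \<in> borel_measurable M'" by (rule measurable_cong[THEN iffD1, rotated]) (simp add: TT')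
qed (rule measurable_compose[OF T])

lemma density_eq: "M' = density (distr M M' T) (%_. ennreal c)"
proof (rule measure_eqI)
 fix A assume A: "A \<in> sets M'"
 thus "emeasure M' A = emeasure (density (distr M M' T) (%_. ennreal c)) A"
  by (subst emeasure_density) (auto simp: em emeasure_distr[OF T] nn_integral_cmult_indicator)
qed simp

lemma
 fixes F :: "'a => 'b::{banach, second_countable_topology}"
 shows integrable_iff: "integrable M' F \<longleftrightarrow> integrable M (%x. F (T x))"
  and integral_eq: "(LINT y|M'. F y) = c *\<^sub>R (LINT x|M. F (T x))"
proof -
 have *: "(integrable M' F \<longleftrightarrow> integrable M (%x. F (T x))) \<and> (LINT y|M'. F y) = c *\<^sub>R (LINT x|M. F (T x))"
 proof (cases "F \<in> borel_measurable M'")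
  case True
  hence Fd: "F \<in> borel_measurable (distr M M' T)" by simp
  have "integrable M' F \<longleftrightarrow> integrable (distr M M' T) (%y. c *\<^sub>R F y)"
   by (subst density_eq, rule integrable_density) (use Fd c in auto)
  also have "... \<longleftrightarrow> integrable M (%x. F (T x))"
  proof -
   have "integrable (distr M M' T) (%y. c *\<^sub>R F y) \<longleftrightarrow> integrable M (%x. c *\<^sub>R F (T x))"
    by (rule integrable_distr_eq[OF T]) (use True in auto)
   also have "... \<longleftrightarrow> integrable M (%x. F (T x))"
    using c integrable_scaleR_right[of "inverse c" M "%x. c *\<^sub>R F (T x)"] by auto
   finally show ?thesis .
  qed
  finally have i: "integrable M' F \<longleftrightarrow> integrable M (%x. F (T x))" .
  have "(LINT y|M'. F y) = (LINT y|distr M M' T. c *\<^sub>R F y)"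
   by (subst density_eq, rule integral_density) (use Fd c in auto)
  also have "... = (LINT x|M. c *\<^sub>R F (T x))" by (rule integral_distr[OF T]) (use True in auto)
  finally show ?thesis using i by simp
 next
  case False
  hence n: "\<not> integrable M' F" "\<not> integrable M (%x. F (T x))"
   unfolding measurable_iff by (auto dest: borel_measurable_integrable simp: measurable_iff)
  thus ?thesis by (simp add: not_integrable_integral_eq)
 qed
 show "integrable M' F \<longleftrightarrow> integrable M (%x. F (T x))" using * ..
 show "(LINT y|M'. F y) = c *\<^sub>R (LINT x|M. F (T x))" using * ..
qed

lemma AE_iff: "(AE y in M'. P y) \<longleftrightarrow> (AE x in M. P (T x))"
proof
 assume "AE y in M'. P y"
 hence "AE y in density (distr M M' T) (%_. ennreal c). P y" 
  using arg_cong[OF density_eq, of "%M. AE y in M. P y"] by (rule iffD1[rotated])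
 hence "AE y in distr M M' T. P y" by (subst (asm) AE_density) (use c in auto)
 thus "AE x in M. P (T x)" by (rule AE_distrD[OF T])
next
 assume "AE x in M. P (T x)"
 then obtain N where N: "{x \<in> space M. \<not> P (T x)} \<subseteq> N" "N \<in> sets M" "emeasure M N = 0" by (rule AE_E)
 let ?N = "T' -` N \<inter> space M'"
 have s: "?N \<in> sets M'" by (rule measurable_sets[OF T' N(2)])
 have "T -` ?N \<inter> space M = N"
  using sets.sets_into_space[OF N(2)] T'T measurable_space[OF T] by auto
 hence "emeasure M' ?N = 0" using em[OF s] N(3) by simp
 moreover have "{y \<in> space M'. \<not> P y} \<subseteq> ?N"
 proof
  fix y assume "y \<in> {y \<in> space M'. \<not> P y}"
  hence y: "y \<in> space M'" "\<not> P y" by auto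
  hence "T' y \<in> space M" "\<not> P (T (T' y))" using measurable_space[OF T' y(1)] TT'[OF y(1)] by auto
  thus "y \<in> ?N" using N(1) y(1) by blast
 qed
 ultimately show "AE y in M'. P y" using AE_I[OF _ _ s] by blast
qed

lemma L2_iff:
 fixes F :: "'a => 'b::{real_normed_vector, second_countable_topology}"
 shows "L2 M' F \<longleftrightarrow> L2 M (%x. F (T x))"
 unfolding L2_def measurable_iff integrable_iff ..

lemma L2_norm_eq: "L2_norm M' F = sqrt c * L2_norm M (%x. F (T x))"
 unfolding L2_norm_def integral_eq by (simp add: real_sqrt_mult)

end

lemma L2_scaleR:
 fixes F :: "'a => 'b::{real_normed_vector, second_countable_topology}"
 assumes "L2 M F" shows "L2 M (%x. a *\<^sub>R F x)"
 using assms unfolding L2_def by (auto simp: power_mult_distrib)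

lemma L2_norm_scaleR: "L2_norm M (%x. a *\<^sub>R F x) = \<bar>a\<bar> * L2_norm M F"
 unfolding L2_norm_def by (simp add: power_mult_distrib real_sqrt_mult)

locale dilation =
 fixes s :: real
 assumes s: "s > 0"
begin

abbreviation S :: "real^2 => real^2" where "S x \<equiv> s *\<^sub>R x"
abbreviation S' :: "real^2 => real^2" where "S' x \<equiv> inverse s *\<^sub>R x"

lemma inverse_dilation: "dilation (inverse s)" by standard (use s in simp)

lemma SS': "S (S' x) = x" "S' (S x) = x" "s * inverse s = 1" "inverse s * s = 1" using s by auto

lemma inj_S: "inj S" using s by (auto intro: injI)

lemma mem_image_S: "y \<in> S ` A \<longleftrightarrow> S' y \<in> A"
proof
 assume "S' y \<in> A"
 hence "S (S' y) \<in> S ` A" by (rule imageI)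
 thus "y \<in> S ` A" unfolding SS'(1) .
qed (auto simp: SS')
lemma S_mem [simp]: "S x \<in> S ` A \<longleftrightarrow> x \<in> A" unfolding mem_image_S SS' ..

lemma image_S_vimage: "S ` A = S' -` A" using mem_image_S by blast

lemma image_S'_vimage: "S' ` A = S -` A"
proof -
 have "x \<in> S' ` A" if "S x \<in> A" for x using imageI[OF that, of S'] unfolding SS' .
 thus ?thesis by (auto simp: SS')
qed

lemma image_S_S': "S' ` S ` A = A" by (auto simp: image_image SS')

lemma S_borel [measurable]: "S \<in> borel_measurable borel" "S' \<in> borel_measurable borel" by measurable

lemma image_S_borel: "A \<in> sets borel ==> S ` A \<in> sets borel"
 unfolding image_S_vimage using measurable_sets[OF S_borel(2), of A] by simp

text \<open>Covers are mapped to covers, with the mesh \<open>delta / s\<close> becoming \<open>delta\<close>. The converse inequality is the same statement for \<open>1 / s\<close>.\<close>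
lemma hausdorff1_outer_le: "hausdorff1_outer (S ` A) <= ennreal s * hausdorff1_outer A"
 unfolding hausdorff1_outer_def[of "S ` A"]
proof (rule SUP_least)
 fix delta :: real assume "delta \<in> {0<..}"
 hence delta: "delta / s \<in> {0<..}" using s by simp
 let ?C = "%A delta. {U :: nat => (real^2) set. A \<subseteq> (\<Union>i. U i) \<and> (\<forall>i. bounded (U i) \<and> diameter (U i) <= delta)}"
 let ?X = "INF U\<in>?C (S ` A) delta. \<Sum>i. ennreal (diameter (U i))"
 have "ennreal (inverse s) * ?X <= (INF U\<in>?C A (delta / s). \<Sum>i. ennreal (diameter (U i)))"
 proof (rule INF_greatest)
  fix U assume U: "U \<in> ?C A (delta / s)"
  have d: "diameter (S ` U i) <= s * diameter (U i)" for i
  proof (rule diameter_le)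
   show "S ` U i ~= {} \<or> 0 <= s * diameter (U i)" using s U by (simp add: diameter_ge_0)
   fix x y assume "x \<in> S ` U i" "y \<in> S ` U i"
   then obtain a b where ab: "x = S a" "y = S b" "a \<in> U i" "b \<in> U i" by auto
   have "dist a b <= diameter (U i)" using U ab by (intro diameter_bounded_bound) auto
   hence "s * norm (a - b) <= s * diameter (U i)" using s by (simp add: dist_norm)
   thus "norm (x - y) <= s * diameter (U i)"
    unfolding ab using s by (metis abs_of_pos norm_scaleR scaleR_diff_right)
  qed
  have "S ` A \<subseteq> (\<Union>i. S ` U i)" using U by blast
  moreover have "bounded (S ` U i) \<and> diameter (S ` U i) <= delta" for i
  proof
   show "bounded (S ` U i)" using U by (auto intro: bounded_scaling)
   have "s * diameter (U i) <= s * (delta / s)" using U s by (intro mult_left_mono) auto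
   thus "diameter (S ` U i) <= delta" using d[of i] s by simp
  qed
  ultimately have "(%i. S ` U i) \<in> ?C (S ` A) delta" by blast
  hence "?X <= (\<Sum>i. ennreal (diameter (S ` U i)))" by (rule INF_lower)
  also have "... <= (\<Sum>i. ennreal s * ennreal (diameter (U i)))"
   using s d by (intro suminf_le summableI) (simp add: ennreal_mult'[symmetric] ennreal_leI)
  also have "... = ennreal s * (\<Sum>i. ennreal (diameter (U i)))" by simp
  finally have "ennreal (inverse s) * ?X <= ennreal (inverse s) * (ennreal s * (\<Sum>i. ennreal (diameter (U i))))"
   by (rule mult_left_mono) simp
  also have "... = (\<Sum>i. ennreal (diameter (U i)))"
   using s by (simp add: mult.assoc[symmetric] ennreal_mult'[symmetric])
  finally show "ennreal (inverse s) * ?X <= (\<Sum>i. ennreal (diameter (U i)))" .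
 qed
 also have "... <= hausdorff1_outer A" unfolding hausdorff1_outer_def by (rule SUP_upper[OF delta])
 finally have "ennreal s * (ennreal (inverse s) * ?X) <= ennreal s * hausdorff1_outer A" by (rule mult_left_mono) simp
 moreover have "ennreal s * (ennreal (inverse s) * ?X) = ?X"
  using s by (simp add: mult.assoc[symmetric] ennreal_mult'[symmetric])
 ultimately show "?X <= ennreal s * hausdorff1_outer A" by simp
qed

end

context dilation begin

lemma hausdorff1_outer_dilation: "hausdorff1_outer (S ` A) = ennreal s * hausdorff1_outer A"
proof (rule antisym[OF hausdorff1_outer_le])
 interpret inv: dilation "inverse s" by (rule inverse_dilation)
 have "hausdorff1_outer A <= ennreal (inverse s) * hausdorff1_outer (S ` A)"
  using inv.hausdorff1_outer_le[of "S ` A"] unfolding image_S_S' .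
 hence "ennreal s * hausdorff1_outer A <= ennreal s * (ennreal (inverse s) * hausdorff1_outer (S ` A))"
  by (rule mult_left_mono) simp
 also have "... = hausdorff1_outer (S ` A)"
  using s by (simp add: mult.assoc[symmetric] ennreal_mult'[symmetric])
 finally show "ennreal s * hausdorff1_outer A <= hausdorff1_outer (S ` A)" .
qed

lemma emeasure_hausdorff1_dilation:
 assumes "A \<in> sets borel" shows "emeasure hausdorff1 (S ` A) = ennreal s * emeasure hausdorff1 A"
 unfolding emeasure_hausdorff1_eq using assms image_S_borel[OF assms] hausdorff1_outer_dilation by simp

lemma linear_S: "linear S" by simp

lemma frontier_S: "frontier (S ` B) = S ` frontier B"
proof -
 have "interior (S ` B) = S ` interior B" by (rule interior_injective_linear_image[OF linear_S inj_S])
 thus ?thesis unfolding frontier_def closure_scaleR[symmetric] by (simp add: image_set_diff[OF inj_S])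
qed

lemma boundary_scaling: "measure_scaling (boundary_measure B) (boundary_measure (S ` B)) S S' s"
proof
 show "S \<in> boundary_measure B \<rightarrow>\<^sub>M boundary_measure (S ` B)"
  unfolding boundary_measure_def frontier_S
  by (rule measurable_restrict_space3) (auto simp: measurable_cong_sets[OF sets_hausdorff1 sets_hausdorff1])
 show "S' \<in> boundary_measure (S ` B) \<rightarrow>\<^sub>M boundary_measure B"
  unfolding boundary_measure_def frontier_S
  by (rule measurable_restrict_space3) (auto simp: measurable_cong_sets[OF sets_hausdorff1 sets_hausdorff1] SS')
 fix A assume "A \<in> sets (boundary_measure (S ` B))"
 hence A: "A \<in> sets borel" "A \<subseteq> S ` frontier B"
  unfolding boundary_measure_def frontier_S by (auto simp: sets_restrict_space image_S_borel)
 let ?A = "S -` A \<inter> space (boundary_measure B)"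
 have sA: "?A = S' ` A"
 proof -
  have "space (boundary_measure B) = frontier B" unfolding boundary_measure_def by (simp add: space_restrict_space)
  moreover have "S -` A \<subseteq> frontier B" using A(2) S_mem by blast
  ultimately show ?thesis unfolding image_S'_vimage by blast
 qed
 interpret inv: dilation "inverse s" by (rule inverse_dilation)
 have A': "S' ` A \<in> sets borel" by (rule inv.image_S_borel[OF A(1)])
 have "emeasure (boundary_measure (S ` B)) A = emeasure hausdorff1 A"
  unfolding boundary_measure_def frontier_S by (rule emeasure_restrict_space) (use A image_S_borel in auto)
 also have "... = emeasure hausdorff1 (S ` S' ` A)" by (simp add: image_image SS')
 also have "... = ennreal s * emeasure hausdorff1 (S' ` A)"
  by (rule emeasure_hausdorff1_dilation[OF A'])
 also have "emeasure hausdorff1 (S' ` A) = emeasure (boundary_measure B) (S' ` A)"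
  unfolding boundary_measure_def by (rule emeasure_restrict_space[symmetric]) (use A(2) SS' in auto)
 finally show "emeasure (boundary_measure (S ` B)) A = ennreal s * emeasure (boundary_measure B) ?A" unfolding sA .
qed (use s SS' in auto)

lemma lebesgue_scaling:
 assumes B: "B \<in> sets lebesgue"
 shows "measure_scaling (lebesgue_on B) (lebesgue_on (S ` B)) S S' (s^2)"
proof
 interpret inv: dilation "inverse s" by (rule inverse_dilation)
 have sB: "S ` B \<in> sets lebesgue"
  unfolding image_S_vimage using measurable_sets[OF lebesgue_measurable_scaling B, of "inverse s"] by simp
 show "S \<in> lebesgue_on B \<rightarrow>\<^sub>M lebesgue_on (S ` B)"
  by (rule measurable_restrict_space3) (auto intro: lebesgue_measurable_scaling)
 show "S' \<in> lebesgue_on (S ` B) \<rightarrow>\<^sub>M lebesgue_on B"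
  by (rule measurable_restrict_space3) (auto intro: lebesgue_measurable_scaling simp: SS')
 fix A assume A: "A \<in> sets (lebesgue_on (S ` B))"
 hence A': "A \<in> sets lebesgue" "A \<subseteq> S ` B" using sB by (auto simp: sets_restrict_space)
 let ?A = "S -` A \<inter> space (lebesgue_on B)"
 have sA: "?A = S' ` A"
 proof -
  have "space (lebesgue_on B) = B" by (simp add: space_restrict_space)
  moreover have "S -` A \<subseteq> B" using A'(2) S_mem by blast
  ultimately show ?thesis unfolding image_S'_vimage by blast
 qed
 have "emeasure (lebesgue_on (S ` B)) A = emeasure lebesgue A"
  by (rule emeasure_restrict_space) (use A' sB in auto)
 also have "... = emeasure lebesgue ((%x. s *\<^sub>R x + 0) ` S' ` A)" by (simp add: image_image SS')
 also have "... = ennreal (s^2) * emeasure lebesgue (S' ` A)"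
  using emeasure_lebesgue_affine[of s 0 "S' ` A"] s by simp
 also have "emeasure lebesgue (S' ` A) = emeasure (lebesgue_on B) (S' ` A)"
  by (rule emeasure_restrict_space[symmetric]) (use A'(2) B SS' in auto)
 finally show "emeasure (lebesgue_on (S ` B)) A = ennreal (s^2) * emeasure (lebesgue_on B) ?A" unfolding sA .
qed (use s SS' in auto)

end

section \<open>Scaling of the transmission problem\<close>

lemma C_infinity_differentiable: "C_infinity f ==> f differentiable (at x)"
proof -
 assume "C_infinity f"
 hence "C_n (Suc 0) f" unfolding C_infinity_def by blast
 thus ?thesis by simp
qed

context dilation begin

lemma has_derivative_dilate:
 assumes "(f has_derivative f') (at (S x))"
 shows "((%x. f (S x)) has_derivative (%h. f' (S h))) (at x)"
proof -
 have "(S has_derivative S) (at x)" by (auto intro!: derivative_eq_intros)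
 thus ?thesis using assms by (rule has_derivative_compose)
qed

lemma differentiable_dilate: "f differentiable (at (S x)) ==> (%x. f (S x)) differentiable (at x)"
 unfolding differentiable_def using has_derivative_dilate by blast

lemma frechet_dilate:
 fixes f :: "real^2 => 'b::real_normed_vector"
 assumes "f differentiable (at (S x))"
 shows "frechet_derivative (%x. f (S x)) (at x) h = s *\<^sub>R frechet_derivative f (at (S x)) h"
proof -
 have d: "(f has_derivative frechet_derivative f (at (S x))) (at (S x))"
  using assms by (simp add: frechet_derivative_works)
 have "frechet_derivative (%x. f (S x)) (at x) h = frechet_derivative f (at (S x)) (S h)"
  using fun_cong[OF frechet_derivative_at[OF has_derivative_dilate[OF d]], of h] by (rule sym)
 also have "... = s *\<^sub>R frechet_derivative f (at (S x)) h"
  by (rule linear_cmul[OF has_derivative_linear[OF d]])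
 finally show ?thesis .
qed

text \<open>The constant factor \<open>a\<close> makes the induction work: every derivative contributes a factor \<open>s\<close>.\<close>
lemma C_n_dilate: "C_n n f ==> C_n n (%x. a *\<^sub>R f (S x))"
proof (induction n arbitrary: f a)
 case 0
 hence "continuous_on UNIV f" by simp
 hence "continuous_on UNIV (%x. f (S x))" by (rule continuous_on_compose2) (auto intro!: continuous_intros)
 thus ?case by (simp add: continuous_on_scaleR)
next
 case (Suc n)
 hence d: "f differentiable (at y)" for y by simp
 have d': "(%x. f (S x)) differentiable (at x)" for x by (rule differentiable_dilate[OF d])
 have d'': "(%x. a *\<^sub>R f (S x)) differentiable (at x)" for x
  by (rule differentiable_scaleR[OF differentiable_const d'])
 have fd: "frechet_derivative (%x. a *\<^sub>R f (S x)) (at x) v = (a * s) *\<^sub>R frechet_derivative f (at (S x)) v" for x v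
 proof -
  have "((%x. f (S x)) has_derivative frechet_derivative (%x. f (S x)) (at x)) (at x)"
   using d' by (simp add: frechet_derivative_works)
  from fun_cong[OF frechet_derivative_at[OF has_derivative_scaleR_right[OF this, of a]], of v]
  have "frechet_derivative (%x. a *\<^sub>R f (S x)) (at x) v = a *\<^sub>R frechet_derivative (%x. f (S x)) (at x) v"
   by (rule sym)
  thus ?thesis unfolding frechet_dilate[OF d] by simp
 qed
 have "C_n n (%x. frechet_derivative f (at x) v)" for v using Suc.prems by simp
 from Suc.IH[OF this] show ?case using d'' by (simp add: fd)
qed

lemma C_infinity_dilate: "C_infinity f ==> C_infinity (%x. f (S x))"
 unfolding C_infinity_def using C_n_dilate[of _ f 1] by simp

lemma test_function_dilate:
 assumes "test_function (S ` B) v" shows "test_function B (%x. v (S x))"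
proof -
 have "{x. v (S x) ~= 0} = S' ` {y. v y ~= 0}" unfolding image_S'_vimage by auto
 hence sp: "supp (%x. v (S x)) = S' ` supp v" unfolding supp_def by (simp add: closure_scaleR)
 have "compact (S' ` supp v)" using assms unfolding test_function_def by (intro compact_scaling) auto
 moreover have "S' ` supp v \<subseteq> B"
  using assms image_mono[of "supp v" "S ` B" S'] unfolding test_function_def image_S_S' by blast
 ultimately show ?thesis using assms unfolding test_function_def sp by (auto intro: C_infinity_dilate)
qed

lemma grad_dilate:
 assumes "f differentiable (at (S x))"
 shows "grad (%x. f (S x)) x = s *\<^sub>R grad f (S x)"
 unfolding grad_def vec_eq_iff by (simp add: frechet_dilate[OF assms])

text \<open>Test functions on \<open>B\<close> are transported to \<open>s B\<close>; area contributes \<open>s\<^sup>2\<close> on both sides and the gradient of the test function \<open>1 / s\<close>.\<close>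
lemma weak_gradient_dilate:
 assumes B: "B \<in> sets lebesgue" and wk: "weak_gradient (S ` B) w G"
 shows "weak_gradient B (%x. w (S x)) (%x. s *\<^sub>R G (S x))"
 unfolding weak_gradient_def
proof (intro allI impI)
 fix v :: "real^2 => complex" and j :: 2
 assume v: "test_function B v"
 interpret inv: dilation "inverse s" by (rule inverse_dilation)
 interpret M: measure_scaling "lebesgue_on B" "lebesgue_on (S ` B)" S S' "s^2" by (rule lebesgue_scaling[OF B])
 let ?v = "%y. v (S' y)"
 have "test_function (S ` B) ?v" by (rule inv.test_function_dilate) (simp add: image_S_S' v)
 hence e: "(LINT y|lebesgue_on (S ` B). w y * grad ?v y $ j) = - (LINT y|lebesgue_on (S ` B). G y $ j * ?v y)"
  using wk unfolding weak_gradient_def by blast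
 have dv: "v differentiable (at y)" for y using v unfolding test_function_def by (auto intro: C_infinity_differentiable)
 have g: "grad ?v (S x) = inverse s *\<^sub>R grad v x" for x
  using inv.grad_dilate[of v "S x", OF dv] by (simp add: SS')
 let ?I = "LINT x|lebesgue_on B. w (S x) * grad v x $ j" and ?J = "LINT x|lebesgue_on B. G (S x) $ j * v x"
 have "(LINT y|lebesgue_on (S ` B). w y * grad ?v y $ j) = s^2 *\<^sub>R (LINT x|lebesgue_on B. inverse s *\<^sub>R (w (S x) * grad v x $ j))"
  unfolding M.integral_eq g by (simp only: vector_scaleR_component mult_scaleR_right)
 moreover have "(LINT y|lebesgue_on (S ` B). G y $ j * ?v y) = s^2 *\<^sub>R ?J"
  unfolding M.integral_eq by (simp only: SS')
 ultimately have "s^2 *\<^sub>R (inverse s *\<^sub>R ?I) = s^2 *\<^sub>R (- ?J)"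
  using e by (simp only: integral_scaleR_right scaleR_minus_right)
 hence "inverse s *\<^sub>R ?I = - ?J" by (rule scaleR_left_imp_eq[rotated]) (use s in simp)
 from arg_cong[OF this, of "(*\<^sub>R) s"] have "?I = - (s *\<^sub>R ?J)"
  unfolding scaleR_scaleR SS' scaleR_one scaleR_minus_right .
 moreover have "(LINT x|lebesgue_on B. (s *\<^sub>R G (S x)) $ j * v x) = s *\<^sub>R ?J"
  by (simp only: vector_scaleR_component mult_scaleR_left integral_scaleR_right)
 ultimately show "?I = - (LINT x|lebesgue_on B. (s *\<^sub>R G (S x)) $ j * v x)" by (simp only:)
qed

lemma H1_dilate:
 assumes B: "B \<in> sets lebesgue" and h: "H1 (S ` B) w G"
 shows "H1 B (%x. w (S x)) (%x. s *\<^sub>R G (S x))"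
proof -
 interpret M: measure_scaling "lebesgue_on B" "lebesgue_on (S ` B)" S S' "s^2" by (rule lebesgue_scaling[OF B])
 show ?thesis using h weak_gradient_dilate[OF B] L2_scaleR[of "lebesgue_on B" "%x. G (S x)" s]
  unfolding H1_def M.L2_iff by blast
qed

lemma H1_limit_dilate:
 assumes B: "B \<in> sets lebesgue" and d: "!!j x. v j differentiable (at x)" and l: "H1_limit (S ` B) v w G"
 shows "H1_limit B (%j x. v j (S x)) (%x. w (S x)) (%x. s *\<^sub>R G (S x))"
proof -
 interpret M: measure_scaling "lebesgue_on B" "lebesgue_on (S ` B)" S S' "s^2" by (rule lebesgue_scaling[OF B])
 have n: "L2_norm (lebesgue_on B) (%x. F (S x)) = inverse s * L2_norm (lebesgue_on (S ` B)) F" for F :: "real^2 => 'c::{real_normed_vector, second_countable_topology}"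
  unfolding M.L2_norm_eq using s by simp
 have n1: "L2_norm (lebesgue_on B) (%x. v j (S x) - w (S x)) = inverse s * L2_norm (lebesgue_on (S ` B)) (%x. v j x - w x)" for j
  by (rule n)
 have n2: "L2_norm (lebesgue_on B) (%x. grad (%x. v j (S x)) x - s *\<^sub>R G (S x)) = s * (inverse s * L2_norm (lebesgue_on (S ` B)) (%x. grad (v j) x - G x))" for j
 proof -
  have "(%x. grad (%x. v j (S x)) x - s *\<^sub>R G (S x)) = (%x. s *\<^sub>R (grad (v j) (S x) - G (S x)))"
   unfolding grad_dilate[OF d] by (simp add: scaleR_diff_right)
  thus ?thesis using L2_norm_scaleR[of "lebesgue_on B" s "%x. grad (v j) (S x) - G (S x)"] n[of "%x. grad (v j) x - G x"] s by simp
 qed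
 show ?thesis using l unfolding H1_limit_def n1 n2 by (auto intro!: tendsto_mult_right_zero)
qed

lemma sobolev_trace_dilate:
 assumes B: "B \<in> sets lebesgue" and t: "sobolev_trace (S ` B) w G u"
 shows "sobolev_trace B (%x. w (S x)) (%x. s *\<^sub>R G (S x)) (%x. u (S x))"
proof -
 interpret N: measure_scaling "boundary_measure B" "boundary_measure (S ` B)" S S' s by (rule boundary_scaling)
 obtain v where v: "!!j. C_infinity (v j)" "H1_limit (S ` B) v w G"
   "(%j. L2_norm (boundary_measure (S ` B)) (%x. v j x - u x)) \<longlonglongrightarrow> 0"
  using t unfolding sobolev_trace_def by blast
 have n: "L2_norm (boundary_measure B) (%x. v j (S x) - u (S x)) = inverse (sqrt s) * L2_norm (boundary_measure (S ` B)) (%x. v j x - u x)" for j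
  unfolding N.L2_norm_eq using s by simp
 have "(%j. L2_norm (boundary_measure B) (%x. v j (S x) - u (S x))) \<longlonglongrightarrow> 0"
  unfolding n by (rule tendsto_mult_right_zero[OF v(3)])
 moreover have "H1_limit B (%j x. v j (S x)) (%x. w (S x)) (%x. s *\<^sub>R G (S x))"
  by (rule H1_limit_dilate[OF B C_infinity_differentiable[OF v(1)] v(2)])
 moreover have "C_infinity (%x. v j (S x))" for j by (rule C_infinity_dilate[OF v(1)])
 ultimately show ?thesis using t H1_dilate[OF B] unfolding sobolev_trace_def N.L2_iff
  by (intro conjI exI[of _ "%j x. v j (S x)"]) auto
qed

text \<open>The factor \<open>s\<^sup>2\<close> from the area is taken up by the two gradients in the first term and by the spectral parameter in the
second.\<close>
lemma energy_form_dilate: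
 assumes B: "B \<in> sets lebesgue"
 shows "energy_form (S ` B) a b lam w G v H =
  energy_form B (%x. a (S x)) (%x. b (S x)) (s^2 * lam) (%x. w (S x)) (%x. s *\<^sub>R G (S x)) (%x. v (S x)) (%x. s *\<^sub>R H (S x))"
proof -
 interpret M: measure_scaling "lebesgue_on B" "lebesgue_on (S ` B)" S S' "s^2" by (rule lebesgue_scaling[OF B])
 have p: "(\<Sum>j\<in>UNIV. (s *\<^sub>R G x) $ j * cnj ((s *\<^sub>R H x) $ j)) = s^2 *\<^sub>R (\<Sum>j\<in>UNIV. G x $ j * cnj (H x $ j))" for x
  unfolding scaleR_sum_right
  by (rule sum.cong) (simp_all only: vector_scaleR_component complex_cnj_scaleR mult_scaleR_left mult_scaleR_right scaleR_scaleR power2_eq_square)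
 show ?thesis
  unfolding energy_form_def M.integral_eq p integral_scaleR_right[symmetric]
  by (rule lint_cong) (simp_all add: scaleR_diff_right mult_ac)
qed

lemma neumann_solution_dilate:
 assumes B: "B \<in> sets lebesgue" and n: "neumann_solution (S ` B) \<sigma> \<mu> lam g w G"
 shows "neumann_solution B (%x. \<sigma> (S x)) (%x. \<mu> (S x)) (s^2 * lam) (%x. s *\<^sub>R g (S x)) (%x. w (S x)) (%x. s *\<^sub>R G (S x))"
 unfolding neumann_solution_def
proof (intro conjI allI impI)
 show "H1 B (%x. w (S x)) (%x. s *\<^sub>R G (S x))" using n H1_dilate[OF B] unfolding neumann_solution_def by blast
 fix v H u assume t: "sobolev_trace B v H u"
 interpret inv: dilation "inverse s" by (rule inverse_dilation)
 interpret N: measure_scaling "boundary_measure B" "boundary_measure (S ` B)" S S' s by (rule boundary_scaling)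
 interpret M: measure_scaling "lebesgue_on B" "lebesgue_on (S ` B)" S S' "s^2" by (rule lebesgue_scaling[OF B])
 have SB: "S ` B \<in> sets lebesgue"
  unfolding image_S_vimage using measurable_sets[OF lebesgue_measurable_scaling B, of "inverse s"] by simp
 have "sobolev_trace (S ` B) (%y. v (S' y)) (%y. inverse s *\<^sub>R H (S' y)) (%y. u (S' y))"
  by (rule inv.sobolev_trace_dilate[OF SB]) (simp add: image_S_S' t)
 hence "energy_form (S ` B) (%x. 1 / \<sigma> x) \<mu> lam w G (%y. v (S' y)) (%y. inverse s *\<^sub>R H (S' y))
   = (LINT y|boundary_measure (S ` B). g y * cnj (u (S' y)))"
  using n unfolding neumann_solution_def by blast
 thus "energy_form B (%x. 1 / \<sigma> (S x)) (%x. \<mu> (S x)) (s^2 * lam) (%x. w (S x)) (%x. s *\<^sub>R G (S x)) v H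
   = (LINT x|boundary_measure B. s *\<^sub>R g (S x) * cnj (u x))"
  unfolding energy_form_dilate[OF B] N.integral_eq using s
  by (simp add: SS' mult_scaleR_left)
qed

lemma NtD_dilate:
 assumes B: "B \<in> sets lebesgue" and n: "NtD (S ` B) \<sigma> \<mu> k g u"
 shows "NtD B (%x. \<sigma> (S x)) (%x. \<mu> (S x)) (s * k) (%x. s *\<^sub>R g (S x)) (%x. u (S x))"
proof -
 interpret N: measure_scaling "boundary_measure B" "boundary_measure (S ` B)" S S' s by (rule boundary_scaling)
 obtain w G where "neumann_solution (S ` B) \<sigma> \<mu> (k^2) g w G" "sobolev_trace (S ` B) w G u" "L2 (boundary_measure (S ` B)) g"
  using n unfolding NtD_def by blast
 thus ?thesis
  using neumann_solution_dilate[OF B, of \<sigma> \<mu> "k^2" g w G] sobolev_trace_dilate[OF B, of w G u]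
   L2_scaleR[of "boundary_measure B" "%x. g (S x)" s]
  unfolding NtD_def N.L2_iff power_mult_distrib by blast
qed

lemma is_outward_normal_dilate:
 assumes n: "is_outward_normal B x n" shows "is_outward_normal (S ` B) (S x) n"
 unfolding is_outward_normal_def
proof (intro conjI allI impI)
 show "norm n = 1" using n unfolding is_outward_normal_def by simp
 fix eps :: real assume "eps > 0"
 then obtain delta where delta: "delta > 0" "!!y. norm (y - x) < delta ==>
   ((y - x) \<bullet> n < - eps * norm (y - x) --> y \<in> B) \<and> ((y - x) \<bullet> n > eps * norm (y - x) --> y \<notin> B)"
  using n unfolding is_outward_normal_def by blast
 show "\<exists>delta>0. \<forall>y. norm (y - S x) < delta -->
   ((y - S x) \<bullet> n < - eps * norm (y - S x) --> y \<in> S ` B) \<and> (eps * norm (y - S x) < (y - S x) \<bullet> n --> y \<notin> S ` B)"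
 proof (intro exI[of _ "s * delta"] conjI[of "s * delta > 0"] allI impI)
  show "s * delta > 0" using s delta by simp
  fix y assume y: "norm (y - S x) < s * delta"
  have ds: "y - S x = s *\<^sub>R (S' y - x)" using s by (simp add: scaleR_diff_right)
  have ns: "norm (y - S x) = s * norm (S' y - x)" unfolding ds using s by simp
  have ins: "(y - S x) \<bullet> n = s * ((S' y - x) \<bullet> n)" unfolding ds by simp
  have "norm (S' y - x) < delta" using y s unfolding ns by simp
  from delta(2)[OF this]
  have "((y - S x) \<bullet> n < - eps * norm (y - S x) --> S' y \<in> B) \<and> (eps * norm (y - S x) < (y - S x) \<bullet> n --> S' y \<notin> B)"
   unfolding ns ins using s mult_less_cancel_left_pos[OF s] by (metis mult.left_commute)
  thus "((y - S x) \<bullet> n < - eps * norm (y - S x) --> y \<in> S ` B) \<and> (eps * norm (y - S x) < (y - S x) \<bullet> n --> y \<notin> S ` B)"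
   unfolding mem_image_S .
 qed
qed

lemma outward_normal_dilate: "outward_normal (S ` B) (S x) = outward_normal B x"
proof -
 interpret inv: dilation "inverse s" by (rule inverse_dilation)
 have "is_outward_normal (S ` B) (S x) = is_outward_normal B x"
 proof
  fix n show "is_outward_normal (S ` B) (S x) n \<longleftrightarrow> is_outward_normal B x n"
  using is_outward_normal_dilate[of B x n] inv.is_outward_normal_dilate[of "S ` B" "S x" n]
  unfolding image_S_S' SS' by blast
 qed
 thus ?thesis unfolding outward_normal_def by (simp only:)
qed

lemma normal_deriv_dilate:
 assumes "u differentiable (at (S x))"
 shows "normal_deriv B (%x. u (S x)) x = s *\<^sub>R normal_deriv (S ` B) u (S x)"
 unfolding normal_deriv_def outward_normal_dilate by (rule frechet_dilate[OF assms])

lemma lipschitz_boundary_dilate: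
 assumes "lipschitz_boundary B" shows "lipschitz_boundary (S ` B)"
 unfolding lipschitz_boundary_def
proof
 fix p' assume "p' \<in> frontier (S ` B)"
 then obtain p where p: "p' = S p" "p \<in> frontier B" unfolding frontier_S by blast
 obtain e f r h L gamma where *: "r > 0" "h > 0" "norm e = 1" "norm f = 1" "e \<bullet> f = 0"
   "L-lipschitz_on (UNIV :: real set) gamma"
   "!!a b. \<bar>a\<bar> < r ==> \<bar>b\<bar> < h ==> p + a *\<^sub>R e + b *\<^sub>R f \<in> B \<longleftrightarrow> b > (gamma a :: real)"
  using assms p(2) unfolding lipschitz_boundary_def by blast
 let ?\<gamma> = "%a. s * gamma (a / s)"
 have l: "L-lipschitz_on UNIV ?\<gamma>"
 proof (rule lipschitz_onI)
  fix x y :: real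
  have "dist (gamma (x / s)) (gamma (y / s)) <= L * dist (x / s) (y / s)" by (rule lipschitz_onD[OF *(6)]) auto
  hence "s * \<bar>gamma (x / s) - gamma (y / s)\<bar> <= s * (L * \<bar>x / s - y / s\<bar>)"
   using s by (intro mult_left_mono) (auto simp: dist_real_def)
  also have "... = L * \<bar>x - y\<bar>" using s by (simp add: diff_divide_distrib[symmetric])
  also have "s * \<bar>gamma (x / s) - gamma (y / s)\<bar> = \<bar>?\<gamma> x - ?\<gamma> y\<bar>" using s by (simp add: right_diff_distrib[symmetric] abs_mult)
  finally show "dist (?\<gamma> x) (?\<gamma> y) <= L * dist x y" by (simp add: dist_real_def)
 qed (rule lipschitz_on_nonneg[OF *(6)])
 have g: "p' + a *\<^sub>R e + b *\<^sub>R f \<in> S ` B \<longleftrightarrow> b > ?\<gamma> a" if ab: "\<bar>a\<bar> < s * r \<and> \<bar>b\<bar> < s * h" for a b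
 proof -
  have "p' + a *\<^sub>R e + b *\<^sub>R f = S (p + (a / s) *\<^sub>R e + (b / s) *\<^sub>R f)"
   using s p by (simp add: scaleR_add_right)
  hence "p' + a *\<^sub>R e + b *\<^sub>R f \<in> S ` B \<longleftrightarrow> p + (a / s) *\<^sub>R e + (b / s) *\<^sub>R f \<in> B" by (simp only: S_mem)
  also have "... \<longleftrightarrow> b / s > gamma (a / s)" by (rule *(7)) (use ab s in "auto simp: pos_divide_less_eq mult.commute")
  also have "... \<longleftrightarrow> b > ?\<gamma> a" using s by (simp add: pos_less_divide_eq mult.commute)
  finally show ?thesis .
 qed
 have "s * r > 0" "s * h > 0" using s * by auto
 thus "\<exists>e f. \<exists>r>0. \<exists>h>0. \<exists>L gamma. norm e = 1 \<and> norm f = 1 \<and> e \<bullet> f = 0 \<and> L-lipschitz_on (UNIV :: real set) gamma \<and>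
    (\<forall>a b. \<bar>a\<bar> < r \<and> \<bar>b\<bar> < h --> (p' + a *\<^sub>R e + b *\<^sub>R f \<in> S ` B \<longleftrightarrow> b > (gamma a :: real)))"
  using *(3,4,5) l g by blast
qed

lemma norm_S_diff: "norm (S x - S y) = s * norm (x - y)"
 unfolding scaleR_diff_right[symmetric] using s by simp

lemma fund_sol_dilate: "fund_sol k (S x - S y) = fund_sol (s * k) (x - y)"
 unfolding fund_sol_def norm_S_diff by (simp add: mult_ac)

lemma cyl_wave_dilate: "cyl_wave m k (S x) = cyl_wave m (s * k) x"
proof -
 have "Complex (S x $ 1) (S x $ 2) = of_real s * Complex (x $ 1) (x $ 2)" by (simp add: complex_eq_iff)
 hence "polar_angle (S x) = polar_angle x"
  unfolding polar_angle_def using s by (simp only: Arg_times_of_real)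
 thus ?thesis unfolding cyl_wave_def using s by (simp add: mult_ac)
qed

lemma single_layer_dilate: "single_layer (S ` B) k phi (S x) = single_layer B (s * k) (%x. s *\<^sub>R phi (S x)) x"
proof -
 interpret N: measure_scaling "boundary_measure B" "boundary_measure (S ` B)" S S' s by (rule boundary_scaling)
 show ?thesis unfolding single_layer_def N.integral_eq fund_sol_dilate
  by (simp only: mult_scaleR_right integral_scaleR_right)
qed

text \<open>The truncated integrals for \<open>s B\<close> at \<open>eps\<close> are \<open>1 / s\<close> times those for \<open>B\<close> at \<open>eps / s\<close>. This passes to the limit because the limit is known to
exist.\<close>
lemma neumann_poincare_dilate:
 assumes B: "open B" "bounded B" "lipschitz_boundary B" and k: "k > 0" and phi: "L2 (boundary_measure (S ` B)) phi"
 shows "AE x in boundary_measure B.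
  s *\<^sub>R neumann_poincare_adj (S ` B) k phi (S x) = neumann_poincare_adj B (s * k) (%x. s *\<^sub>R phi (S x)) x"
proof -
 interpret N: measure_scaling "boundary_measure B" "boundary_measure (S ` B)" S S' s by (rule boundary_scaling)
 let ?\<phi> = "%x. s *\<^sub>R phi (S x)"
 let ?I = "%x eps. indicator {y. norm (x - y) > eps} :: real^2 => real"
 have phi': "L2 (boundary_measure B) ?\<phi>" using phi unfolding N.L2_iff by (rule L2_scaleR)
 have sk: "s * k > 0" using s k by simp
 show ?thesis using neumann_poincare_limit_exists[OF B sk phi']
 proof (rule AE_mp, intro AE_I2 impI)
  fix x
  define t where "t eps = (LINT y|boundary_measure B. ?I x eps y *\<^sub>R (normal_deriv B (%z. fund_sol (s * k) (z - y)) x * ?\<phi> y))" for eps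
  define t' where "t' eps = (LINT y|boundary_measure (S ` B). ?I (S x) eps y *\<^sub>R (normal_deriv (S ` B) (%z. fund_sol k (z - y)) (S x) * phi y))" for eps
  assume "\<exists>l. ((%eps. LINT y|boundary_measure B. ?I x eps y *\<^sub>R (normal_deriv B (%z. fund_sol (s * k) (z - y)) x * ?\<phi> y)) \<longlongrightarrow> l) (at_right 0)"
  then obtain l where l: "(t \<longlongrightarrow> l) (at_right 0)" unfolding t_def by blast
  have eq: "inverse s *\<^sub>R t (eps / s) = t' eps" if eps: "eps > 0" for eps
  proof -
   have "?I (S x) eps (S w) *\<^sub>R (normal_deriv (S ` B) (%z. fund_sol k (z - S w)) (S x) * phi (S w))
    = inverse s *\<^sub>R (inverse s *\<^sub>R (?I x (eps / s) w *\<^sub>R (normal_deriv B (%z. fund_sol (s * k) (z - w)) x * ?\<phi> w)))" (is "?F w = ?G w") for w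
   proof (cases "eps / s < norm (x - w)")
    case True
    hence "eps < norm (S x - S w)" unfolding norm_S_diff using s by (simp add: pos_divide_less_eq mult.commute)
    moreover have xw: "S x - S w ~= 0"
    using True eps s by (auto simp: field_simps)
    have t1: "((%z. z - S w) has_derivative (%v. v)) (at (S x))" by (auto intro!: derivative_eq_intros)
    have "(%z. fund_sol k (z - S w)) differentiable (at (S x))"
    unfolding differentiable_def using has_derivative_compose[OF t1 fund_sol_has_derivative[OF k xw]] by blast
    from normal_deriv_dilate[OF this, of B]
    have "normal_deriv B (%z. fund_sol (s * k) (z - w)) x = s *\<^sub>R normal_deriv (S ` B) (%z. fund_sol k (z - S w)) (S x)"
    unfolding fund_sol_dilate .
    moreover have "inverse s * (inverse s * (s * s)) = 1" using s by (simp add: field_simps)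
    ultimately show ?thesis using True by simp
   next
    case False
    hence "\<not> eps < norm (S x - S w)" unfolding norm_S_diff using s by (simp add: pos_divide_less_eq mult.commute)
    thus ?thesis using False by simp
   qed
   hence "?F = ?G" by blast
   hence "t' eps = s *\<^sub>R (LINT w|boundary_measure B. ?G w)" unfolding t'_def N.integral_eq by (simp only:)
   also have "(LINT w|boundary_measure B. ?G w) = inverse s *\<^sub>R (inverse s *\<^sub>R t (eps / s))"
    unfolding t_def integral_scaleR_right ..
   finally show ?thesis by (simp only: scaleR_scaleR mult.assoc[symmetric] SS' mult_1_left)
  qed
  have f: "filterlim (%eps. eps / s) (at_right 0) (at_right 0)"
   unfolding filterlim_at
  proof
   show "\<forall>\<^sub>F eps in at_right 0. eps / s \<in> {0<..} \<and> eps / s ~= 0"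
    using s by (intro eventually_mono[OF eventually_at_right_less[of "0::real"]]) auto
   have "((%eps. eps / s) \<longlongrightarrow> 0 / s) (at_right 0)" by (intro tendsto_intros) (use s in auto)
   thus "((%eps. eps / s) \<longlongrightarrow> 0) (at_right 0)" by simp
  qed
  have "((%eps. inverse s *\<^sub>R t (eps / s)) \<longlongrightarrow> inverse s *\<^sub>R l) (at_right 0)"
   by (intro tendsto_intros filterlim_compose[OF l f])
  hence "(t' \<longlongrightarrow> inverse s *\<^sub>R l) (at_right 0)"
   by (rule Lim_transform_eventually) (rule eventually_mono[OF eventually_at_right_less[of "0::real"]], rule eq)
  hence "neumann_poincare_adj (S ` B) k phi (S x) = inverse s *\<^sub>R l"
   unfolding neumann_poincare_adj_def t'_def[symmetric] by (intro tendsto_Lim) auto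
  moreover have "neumann_poincare_adj B (s * k) ?\<phi> x = l"
   unfolding neumann_poincare_adj_def t_def[symmetric] by (intro tendsto_Lim l) auto
  ultimately show "s *\<^sub>R neumann_poincare_adj (S ` B) k phi (S x) = neumann_poincare_adj B (s * k) ?\<phi> x"
   using s by simp
 qed
qed

text \<open>The first component is invariant and the second one, a normal derivative, is multiplied by \<open>s\<close>.\<close>
lemma transmission_op_dilate:
 assumes B: "open B" "bounded B" "lipschitz_boundary B" and k: "k > 0"
  and t: "transmission_op (S ` B) \<sigma> \<mu> k phi psi f g"
 shows "transmission_op B (%x. \<sigma> (S x)) (%x. \<mu> (S x)) (s * k) (%x. s *\<^sub>R phi (S x)) (%x. s *\<^sub>R psi (S x)) (%x. f (S x)) (%x. s *\<^sub>R g (S x))"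
proof -
 interpret N: measure_scaling "boundary_measure B" "boundary_measure (S ` B)" S S' s by (rule boundary_scaling)
 have Bl: "B \<in> sets lebesgue" using B(1) by (simp add: borel_open)
 obtain u where u: "NtD (S ` B) \<sigma> \<mu> k psi u"
   "AE x in boundary_measure (S ` B). f x = - single_layer (S ` B) k phi x + u x"
  and L: "L2 (boundary_measure (S ` B)) phi" "L2 (boundary_measure (S ` B)) psi"
  and G: "AE x in boundary_measure (S ` B). g x = - (phi x / 2 + neumann_poincare_adj (S ` B) k phi x) + psi x"
  using t unfolding transmission_op_def by blast
 have "AE x in boundary_measure B. s *\<^sub>R g (S x) = - ((s *\<^sub>R phi (S x)) / 2 + neumann_poincare_adj B (s * k) (%x. s *\<^sub>R phi (S x)) x) + s *\<^sub>R psi (S x)"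
  using G[unfolded N.AE_iff] neumann_poincare_dilate[OF B k L(1)]
 proof eventually_elim
  fix x assume a: "g (S x) = - (phi (S x) / 2 + neumann_poincare_adj (S ` B) k phi (S x)) + psi (S x)"
   and b: "s *\<^sub>R neumann_poincare_adj (S ` B) k phi (S x) = neumann_poincare_adj B (s * k) (%x. s *\<^sub>R phi (S x)) x"
  show "s *\<^sub>R g (S x) = - ((s *\<^sub>R phi (S x)) / 2 + neumann_poincare_adj B (s * k) (%x. s *\<^sub>R phi (S x)) x) + s *\<^sub>R psi (S x)"
   unfolding a b[symmetric] by (simp add: scaleR_conv_of_real algebra_simps)
 qed
 moreover have "AE x in boundary_measure B. f (S x) = - single_layer B (s * k) (%x. s *\<^sub>R phi (S x)) x + u (S x)"
  using u(2) unfolding N.AE_iff single_layer_dilate .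
 moreover have "NtD B (%x. \<sigma> (S x)) (%x. \<mu> (S x)) (s * k) (%x. s *\<^sub>R psi (S x)) (%x. u (S x))"
  by (rule NtD_dilate[OF Bl u(1)])
 moreover have "L2 (boundary_measure B) (%x. s *\<^sub>R phi (S x))" "L2 (boundary_measure B) (%x. s *\<^sub>R psi (S x))"
  using L unfolding N.L2_iff by (auto intro: L2_scaleR)
 ultimately show ?thesis unfolding transmission_op_def by blast
qed

text \<open>The factor \<open>s\<close> in the density compensates the factor from arc length, so the pairing with the wave is unchanged.\<close>
lemma scattering_pairing_dilate:
 assumes B: "open B" "bounded B" "lipschitz_boundary B" and k: "k > 0"
  and t: "\<exists>phi psi. scattering_densities (S ` B) \<sigma> \<mu> k m phi psi \<and> c = (LINT y|boundary_measure (S ` B). cnj (cyl_wave n k y) * phi y)"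
 shows "\<exists>phi psi. scattering_densities B (%x. \<sigma> (S x)) (%x. \<mu> (S x)) (s * k) m phi psi \<and> c = (LINT y|boundary_measure B. cnj (cyl_wave n (s * k) y) * phi y)"
proof -
 interpret N: measure_scaling "boundary_measure B" "boundary_measure (S ` B)" S S' s by (rule boundary_scaling)
 obtain phi psi where d: "transmission_op (S ` B) \<sigma> \<mu> k phi psi (cyl_wave m k) (normal_deriv (S ` B) (cyl_wave m k))"
  and c: "c = (LINT y|boundary_measure (S ` B). cnj (cyl_wave n k y) * phi y)"
  using t unfolding scattering_densities_def by blast
 have nd: "s *\<^sub>R normal_deriv (S ` B) (cyl_wave m k) (S x) = normal_deriv B (cyl_wave m (s * k)) x" for x
  using normal_deriv_dilate[OF cyl_wave_differentiable, of B m k x] unfolding cyl_wave_dilate by simp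
 have "scattering_densities B (%x. \<sigma> (S x)) (%x. \<mu> (S x)) (s * k) m (%x. s *\<^sub>R phi (S x)) (%x. s *\<^sub>R psi (S x))"
  using transmission_op_dilate[OF B k d] unfolding cyl_wave_dilate nd scattering_densities_def .
 moreover have "c = (LINT y|boundary_measure B. cnj (cyl_wave n (s * k) y) * (s *\<^sub>R phi (S y)))"
  unfolding c N.integral_eq cyl_wave_dilate by (simp only: mult_scaleR_right integral_scaleR_right)
 ultimately show ?thesis by blast
qed

end

text \<open>Both coefficients describe the number \<open>c\<close> that belongs to some pair of densities. \<open>scattering_pairing_dilate\<close>, applied to the
dilations by \<open>s\<close> and by \<open>1 / s\<close>, shows that the same numbers \<open>c\<close> occur on both sides.\<close>
theorem proposition4p3:
  fixes \<omega> s lam1 lam2 lam3 lam4 :: real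
    and \<sigma> \<mu> :: "real^2 \<Rightarrow> real"
    and B :: "(real^2) set"
    and n m :: int
  assumes "\<omega> > 0" and "s > 0"
    and "\<And>x. \<sigma> x > 0" and "\<And>x. \<mu> x > 0"
    and "(\<lambda>x. 1 / \<sigma> x) \<in> borel_measurable lebesgue" and "\<mu> \<in> borel_measurable lebesgue"
    and "0 < lam1" and "\<And>x. lam1 \<le> 1 / \<sigma> x" and "\<And>x. 1 / \<sigma> x \<le> lam2"
    and "0 < lam3" and "\<And>x. lam3 \<le> \<mu> x" and "\<And>x. \<mu> x \<le> lam4"
    and "compact (supp (\<lambda>x. 1 / \<sigma> x - 1))" and "compact (supp (\<lambda>x. \<mu> x - 1))"
    and "open B" and "connected B" and "bounded B" and "lipschitz_boundary B" and "0 \<in> B"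
    and "supp (\<lambda>x. 1 / \<sigma> x - 1) \<subseteq> B" and "supp (\<lambda>x. \<mu> x - 1) \<subseteq> B"
    and "\<not> neumann_eigenvalue ((\<lambda>x. s *\<^sub>R x) ` B)
            (\<lambda>x. \<sigma> (inverse s *\<^sub>R x)) (\<lambda>x. \<mu> (inverse s *\<^sub>R x)) (\<omega>\<^sup>2)"
    and "\<not> dirichlet_eigenvalue ((\<lambda>x. s *\<^sub>R x) ` B) (\<omega>\<^sup>2)"
  shows "scattering_coeff n m ((\<lambda>x. s *\<^sub>R x) ` B)
            (\<lambda>x. \<sigma> (inverse s *\<^sub>R x)) (\<lambda>x. \<mu> (inverse s *\<^sub>R x)) \<omega>
         = scattering_coeff n m B \<sigma> \<mu> (s * \<omega>)"
proof -
 interpret dilation s by standard (rule \<open>s > 0\<close>)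
 interpret inv: dilation "inverse s" by (rule inverse_dilation)
 have B: "open B" "bounded B" "lipschitz_boundary B" by fact+
 have B': "open (S ` B)" "bounded (S ` B)" "lipschitz_boundary (S ` B)"
  using open_scaling[of s B] s B by (auto intro: bounded_scaling lipschitz_boundary_dilate)
 have "(\<exists>phi psi. scattering_densities (S ` B) (\<lambda>x. \<sigma> (S' x)) (\<lambda>x. \<mu> (S' x)) \<omega> m phi psi \<and> c = (LINT y|boundary_measure (S ` B). cnj (cyl_wave n \<omega> y) * phi y))
   \<longleftrightarrow> (\<exists>phi psi. scattering_densities B \<sigma> \<mu> (s * \<omega>) m phi psi \<and> c = (LINT y|boundary_measure B. cnj (cyl_wave n (s * \<omega>) y) * phi y))" for c
 proof
  assume "\<exists>phi psi. scattering_densities (S ` B) (\<lambda>x. \<sigma> (S' x)) (\<lambda>x. \<mu> (S' x)) \<omega> m phi psi \<and> c = (LINT y|boundary_measure (S ` B). cnj (cyl_wave n \<omega> y) * phi y)"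
  from scattering_pairing_dilate[OF B \<open>\<omega> > 0\<close> this]
  show "\<exists>phi psi. scattering_densities B \<sigma> \<mu> (s * \<omega>) m phi psi \<and> c = (LINT y|boundary_measure B. cnj (cyl_wave n (s * \<omega>) y) * phi y)"
   unfolding SS' .
 next
  assume *: "\<exists>phi psi. scattering_densities B \<sigma> \<mu> (s * \<omega>) m phi psi \<and> c = (LINT y|boundary_measure B. cnj (cyl_wave n (s * \<omega>) y) * phi y)"
  have so: "s * \<omega> > 0" using s \<open>\<omega> > 0\<close> by simp
  have e: "inverse s * (s * \<omega>) = \<omega>" using s by simp
  show "\<exists>phi psi. scattering_densities (S ` B) (\<lambda>x. \<sigma> (S' x)) (\<lambda>x. \<mu> (S' x)) \<omega> m phi psi \<and> c = (LINT y|boundary_measure (S ` B). cnj (cyl_wave n \<omega> y) * phi y)"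
   using inv.scattering_pairing_dilate[OF B' so, of \<sigma> \<mu> m c n] * unfolding image_S_S' e by blast
 qed
 then show ?thesis unfolding scattering_coeff_def by simp
qed

end
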